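(* The systems $\mathbf{BIM}$ and $\mathbf{EL}$ have a common conservative extension obtained by definitional extensions; in this sense they are essentially equivalent.
   Context: All systems are based on two-sorted intuitionistic predicate logic with number variables and function variables (one-place number-theoretic functions); number equality primitive, $u=v:\equiv\forall x\,u(x)=v(x)$. $\mathbf{BIM}$ (Basic Intuitionistic Mathematics, W. Veldman): constants $0$, constant-zero function, identity, successor $S$, pairing $J$ onto $\mathbb{N}$ with projections $K,L$; no $\lambda$-abstraction; with $\alpha(m,n)$ for $\alpha(J(m,n))$, axioms: equality axioms, induction for all formulas, axioms on the constants, closure of functions under composition, pairing ($\forall\alpha\forall\beta\exists\gamma\forall n\,\gamma(n)=J(\alpha(n),\beta(n))$), primitive recursion ($\forall\alpha\forall\beta\exists\gamma\forall m\forall n[\gamma(m,0)=\alpha(m)\,\&\,\gamma(m,S(n))=\beta(m,n,\gamma(m,n))]$), and unbounded search $\forall\alpha[\forall m\exists n\,\alpha(m,n)=0\to\exists\gamma\forall m[\alpha(m,\gamma(m))=0\,\&\,\forall n<\gamma(m)\,\alpha(m,n)\neq0]]$. $\mathbf{HA_1}$: $0$, a constant for each primitive recursive description, application, $\lambda$-abstraction, recursor $\mathrm{rec}$; axioms $x=x$, $A(x)\,\&\,x=y\to A(y)$, induction, $\neg S(0)=0$, defining equations, $\lambda$-conversion, $\mathrm{rec}(t,u,0)=t$, $\mathrm{rec}(t,u,S(s))=u(\langle\mathrm{rec}(t,u,s),s\rangle)$ with $\langle a,b\rangle=2^a3^b$. $\mathbf{EL}=\mathbf{HA_1}+\mathrm{QF\text{-}AC_{00}}$,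 where $\mathrm{QF\text{-}AC_{00}}$: $\forall x\exists y\,A(x,y)\to\exists\alpha\forall x\,A(x,\alpha(x))$ for quantifier-free $A$ not containing $\alpha$. Conservative extension: theorems of the extension in the smaller language are exactly those of the smaller system. Definitional extension $S_2$ of $S_1$: there is an effective translation $E\mapsto E'$ with $E'\equiv E$ on the language of $S_1$, $S_2\vdash E'\leftrightarrow E$, $\Gamma\vdash_{S_2}E\Rightarrow\Gamma'\vdash_{S_1}E'$, $'$ commuting with logical operations.
   Formalization: With J only a bijection onto ℕ, no common extension conservative over BIM is definitional over EL; so that claim is proved after adding to BIM equations making J the Cantor pairing. For plain BIM: a common conservative extension, definitional over BIM. *)

theory Defs
  imports Main
begin

section \<open>Primitive recursive descriptions\<close>

text \<open>
  Kleene's schemata: successor; constant functions of n arguments; projections (counting the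
  arguments from 0); composition (the first component is the number of arguments of the
  composite); recursion without parameters, \<open>f(0) = q\<close>, \<open>f(y') = h(y, f(y))\<close>; and recursion with
  parameters, \<open>f(0, xs) = g(xs)\<close>, \<open>f(y', xs) = h(y, f(y, xs), xs)\<close>.
\<close>

datatype prd =
    Succ
  | Const nat nat
  | Proj nat nat
  | Comp nat prd "prd list"
  | Rec0 nat prd
  | RecP prd prd

inductive describes :: "prd \<Rightarrow> nat \<Rightarrow> bool" \<comment> \<open>\<open>describes d n\<close>: d is a description of an n-place function\<close> where
  "describes Succ 1"
| "0 < n \<Longrightarrow> describes (Const n q) n"
| "i < n \<Longrightarrow> describes (Proj n i) n"
| "0 < n \<Longrightarrow> describes g (length hs) \<Longrightarrow> (\<And>h. h \<in> set hs \<Longrightarrow> describes h n)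
     \<Longrightarrow> describes (Comp n g hs) n"
| "describes h 2 \<Longrightarrow> describes (Rec0 q h) 1"
| "describes g n \<Longrightarrow> describes h (n + 2) \<Longrightarrow> describes (RecP g h) (n + 1)"

definition pr_add :: prd where
  "pr_add = RecP (Proj 1 0) (Comp 3 Succ [Proj 3 1])"

definition pr_mult :: prd where
  "pr_mult = RecP (Const 1 0) (Comp 3 pr_add [Proj 3 1, Proj 3 2])"

definition pr_power :: "nat \<Rightarrow> prd" where  \<comment> \<open>\<open>pr_power q\<close> describes the map \<open>n \<mapsto> q ^ n\<close>\<close>
  "pr_power q = Rec0 1 (Comp 2 pr_mult [Const 2 q, Proj 2 1])"

definition pr_pair :: prd where  \<comment> \<open>\<open>(a, b) \<mapsto> 2 ^ a * 3 ^ b\<close>\<close>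
  "pr_pair = Comp 2 pr_mult [Comp 2 (pr_power 2) [Proj 2 0], Comp 2 (pr_power 3) [Proj 2 1]]"


section \<open>Two-sorted terms and formulas\<close>

text \<open>
  One syntax contains the languages of all systems considered.  Zero and successor are shared
  by BIM and EL; the successor constant is \<open>PR Succ\<close>.  The constants \<open>ZeroFn\<close>, \<open>Ident\<close>, \<open>PairJ\<close>,
  \<open>ProjK\<close>, \<open>ProjL\<close> are those of BIM.

  Variables are de Bruijn indices, with separate index spaces for the two sorts: \<open>Lam\<close>, \<open>AllN\<close>
  and \<open>ExN\<close> bind the number index 0, \<open>AllF\<close> and \<open>ExF\<close> bind the function index 0.

  A one-place constant c occurs only as the functor \<open>FC c\<close>, so that its value at t is
  \<open>App (FC c) t\<close>; constants of any other number of places are applied by \<open>Fn\<close>.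

  Equality of functors u = v is not primitive: it abbreviates the pointwise equality
  \<open>\<forall>x. u(x) = v(x)\<close>, so there are no atomic formulas other than number equations and falsity.
\<close>

datatype fsym = Zero | ZeroFn | Ident | PairJ | ProjK | ProjL | PR prd

inductive has_arity :: "fsym \<Rightarrow> nat \<Rightarrow> bool" where
  "has_arity Zero 0"
| "has_arity ZeroFn 1"
| "has_arity Ident 1"
| "has_arity PairJ 2"
| "has_arity ProjK 1"
| "has_arity ProjL 1"
| "describes d n \<Longrightarrow> has_arity (PR d) n"

datatype trm =
    Var nat
  | Fn fsym "trm list"
  | App fnl trm
  | Rec trm fnl trm
and fnl =
    FVar nat
  | FC fsym
  | Lam trm

datatype fm =
    Eq trm trm
  | Bot
  | And fm fm
  | Or fm fm
  | Imp fm fm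
  | AllN fm
  | ExN fm
  | AllF fm
  | ExF fm

abbreviation Neg :: "fm \<Rightarrow> fm" where "Neg A \<equiv> Imp A Bot"
abbreviation Iff :: "fm \<Rightarrow> fm \<Rightarrow> fm" where "Iff A B \<equiv> And (Imp A B) (Imp B A)"

abbreviation zero :: trm where "zero \<equiv> Fn Zero []"
abbreviation suc :: "trm \<Rightarrow> trm" where "suc t \<equiv> App (FC (PR Succ)) t"
abbreviation pairJ :: "trm \<Rightarrow> trm \<Rightarrow> trm" where "pairJ s t \<equiv> Fn PairJ [s, t]"
abbreviation projK :: "trm \<Rightarrow> trm" where "projK t \<equiv> App (FC ProjK) t"
abbreviation projL :: "trm \<Rightarrow> trm" where "projL t \<equiv> App (FC ProjL) t"

primrec numeral_trm :: "nat \<Rightarrow> trm" where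
  "numeral_trm 0 = zero"
| "numeral_trm (Suc n) = suc (numeral_trm n)"

definition apply_const :: "fsym \<Rightarrow> trm list \<Rightarrow> trm" where
  "apply_const c ts = (case ts of [t] \<Rightarrow> App (FC c) t | _ \<Rightarrow> Fn c ts)"

fun quantifier_free :: "fm \<Rightarrow> bool" where
  "quantifier_free (Eq s t) = True"
| "quantifier_free Bot = True"
| "quantifier_free (And A B) = (quantifier_free A \<and> quantifier_free B)"
| "quantifier_free (Or A B) = (quantifier_free A \<and> quantifier_free B)"
| "quantifier_free (Imp A B) = (quantifier_free A \<and> quantifier_free B)"
| "quantifier_free _ = False"


section \<open>Renaming and substitution\<close>

text \<open>
  Simultaneous: the first argument acts on number variables, the second on function variables.
\<close>

definition up_ren :: "(nat \<Rightarrow> nat) \<Rightarrow> nat \<Rightarrow> nat" where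
  "up_ren r n = (case n of 0 \<Rightarrow> 0 | Suc m \<Rightarrow> Suc (r m))"

primrec ren_trm :: "(nat \<Rightarrow> nat) \<Rightarrow> (nat \<Rightarrow> nat) \<Rightarrow> trm \<Rightarrow> trm"
    and ren_fnl :: "(nat \<Rightarrow> nat) \<Rightarrow> (nat \<Rightarrow> nat) \<Rightarrow> fnl \<Rightarrow> fnl" where
  "ren_trm r q (Var n) = Var (r n)"
| "ren_trm r q (Fn c ts) = Fn c (map (ren_trm r q) ts)"
| "ren_trm r q (App u t) = App (ren_fnl r q u) (ren_trm r q t)"
| "ren_trm r q (Rec t u s) = Rec (ren_trm r q t) (ren_fnl r q u) (ren_trm r q s)"
| "ren_fnl r q (FVar n) = FVar (q n)"
| "ren_fnl r q (FC c) = FC c"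
| "ren_fnl r q (Lam t) = Lam (ren_trm (up_ren r) q t)"

definition up_trm :: "(nat \<Rightarrow> trm) \<Rightarrow> nat \<Rightarrow> trm" where
  "up_trm \<sigma> n = (case n of 0 \<Rightarrow> Var 0 | Suc m \<Rightarrow> ren_trm Suc id (\<sigma> m))"

definition up_fnl :: "(nat \<Rightarrow> fnl) \<Rightarrow> nat \<Rightarrow> fnl" where
  "up_fnl \<tau> n = (case n of 0 \<Rightarrow> FVar 0 | Suc m \<Rightarrow> ren_fnl id Suc (\<tau> m))"

primrec sub_trm :: "(nat \<Rightarrow> trm) \<Rightarrow> (nat \<Rightarrow> fnl) \<Rightarrow> trm \<Rightarrow> trm"
    and sub_fnl :: "(nat \<Rightarrow> trm) \<Rightarrow> (nat \<Rightarrow> fnl) \<Rightarrow> fnl \<Rightarrow> fnl" where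
  "sub_trm \<sigma> \<tau> (Var n) = \<sigma> n"
| "sub_trm \<sigma> \<tau> (Fn c ts) = Fn c (map (sub_trm \<sigma> \<tau>) ts)"
| "sub_trm \<sigma> \<tau> (App u t) = App (sub_fnl \<sigma> \<tau> u) (sub_trm \<sigma> \<tau> t)"
| "sub_trm \<sigma> \<tau> (Rec t u s) = Rec (sub_trm \<sigma> \<tau> t) (sub_fnl \<sigma> \<tau> u) (sub_trm \<sigma> \<tau> s)"
| "sub_fnl \<sigma> \<tau> (FVar n) = \<tau> n"
| "sub_fnl \<sigma> \<tau> (FC c) = FC c"
| "sub_fnl \<sigma> \<tau> (Lam t) = Lam (sub_trm (up_trm \<sigma>) (\<lambda>n. ren_fnl Suc id (\<tau> n)) t)"

primrec sub_fm :: "(nat \<Rightarrow> trm) \<Rightarrow> (nat \<Rightarrow> fnl) \<Rightarrow> fm \<Rightarrow> fm" where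
  "sub_fm \<sigma> \<tau> (Eq s t) = Eq (sub_trm \<sigma> \<tau> s) (sub_trm \<sigma> \<tau> t)"
| "sub_fm \<sigma> \<tau> Bot = Bot"
| "sub_fm \<sigma> \<tau> (And A B) = And (sub_fm \<sigma> \<tau> A) (sub_fm \<sigma> \<tau> B)"
| "sub_fm \<sigma> \<tau> (Or A B) = Or (sub_fm \<sigma> \<tau> A) (sub_fm \<sigma> \<tau> B)"
| "sub_fm \<sigma> \<tau> (Imp A B) = Imp (sub_fm \<sigma> \<tau> A) (sub_fm \<sigma> \<tau> B)"
| "sub_fm \<sigma> \<tau> (AllN A) = AllN (sub_fm (up_trm \<sigma>) (\<lambda>n. ren_fnl Suc id (\<tau> n)) A)"
| "sub_fm \<sigma> \<tau> (ExN A) = ExN (sub_fm (up_trm \<sigma>) (\<lambda>n. ren_fnl Suc id (\<tau> n)) A)"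
| "sub_fm \<sigma> \<tau> (AllF A) = AllF (sub_fm (\<lambda>n. ren_trm id Suc (\<sigma> n)) (up_fnl \<tau>) A)"
| "sub_fm \<sigma> \<tau> (ExF A) = ExF (sub_fm (\<lambda>n. ren_trm id Suc (\<sigma> n)) (up_fnl \<tau>) A)"

abbreviation liftN :: "fm \<Rightarrow> fm" where
  "liftN \<equiv> sub_fm (\<lambda>n. Var (Suc n)) FVar"

abbreviation liftF :: "fm \<Rightarrow> fm" where
  "liftF \<equiv> sub_fm Var (\<lambda>n. FVar (Suc n))"

text \<open>Instantiation of the index 0, removing it from the context.\<close>

definition inst_trm :: "trm \<Rightarrow> trm \<Rightarrow> trm" where
  "inst_trm s = sub_trm (\<lambda>n. case n of 0 \<Rightarrow> s | Suc m \<Rightarrow> Var m) FVar"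

definition instN :: "trm \<Rightarrow> fm \<Rightarrow> fm" where
  "instN s = sub_fm (\<lambda>n. case n of 0 \<Rightarrow> s | Suc m \<Rightarrow> Var m) FVar"

definition instF :: "fnl \<Rightarrow> fm \<Rightarrow> fm" where
  "instF u = sub_fm Var (\<lambda>n. case n of 0 \<Rightarrow> u | Suc m \<Rightarrow> FVar m)"


section \<open>Languages, systems, derivability\<close>

text \<open>
  Variables, application and the logical symbols belong to every language; a language is given
  by its constants and by whether it has lambda-abstraction and the recursor.
\<close>

datatype lsym = Sym fsym | LamSym | RecSym

type_synonym language = "lsym set"

inductive_set terms :: "language \<Rightarrow> trm set" and functors :: "language \<Rightarrow> fnl set"
  for L :: language where
  "Var n \<in> terms L"
| "Sym c \<in> L \<Longrightarrow> has_arity c (length ts) \<Longrightarrow> length ts \<noteq> 1 \<Longrightarrow> (\<And>t. t \<in> set ts \<Longrightarrow> t \<in> terms L)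
     \<Longrightarrow> Fn c ts \<in> terms L"
| "u \<in> functors L \<Longrightarrow> t \<in> terms L \<Longrightarrow> App u t \<in> terms L"
| "RecSym \<in> L \<Longrightarrow> t \<in> terms L \<Longrightarrow> u \<in> functors L \<Longrightarrow> s \<in> terms L \<Longrightarrow> Rec t u s \<in> terms L"
| "FVar n \<in> functors L"
| "Sym c \<in> L \<Longrightarrow> has_arity c 1 \<Longrightarrow> FC c \<in> functors L"
| "LamSym \<in> L \<Longrightarrow> t \<in> terms L \<Longrightarrow> Lam t \<in> functors L"

inductive_set formulas :: "language \<Rightarrow> fm set" for L :: language where
  "s \<in> terms L \<Longrightarrow> t \<in> terms L \<Longrightarrow> Eq s t \<in> formulas L"
| "Bot \<in> formulas L"
| "A \<in> formulas L \<Longrightarrow> B \<in> formulas L \<Longrightarrow> And A B \<in> formulas L"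
| "A \<in> formulas L \<Longrightarrow> B \<in> formulas L \<Longrightarrow> Or A B \<in> formulas L"
| "A \<in> formulas L \<Longrightarrow> B \<in> formulas L \<Longrightarrow> Imp A B \<in> formulas L"
| "A \<in> formulas L \<Longrightarrow> AllN A \<in> formulas L"
| "A \<in> formulas L \<Longrightarrow> ExN A \<in> formulas L"
| "A \<in> formulas L \<Longrightarrow> AllF A \<in> formulas L"
| "A \<in> formulas L \<Longrightarrow> ExF A \<in> formulas L"

record fsystem =
  lang :: language
  axs :: "fm set"

abbreviation fmls :: "fsystem \<Rightarrow> fm set" where "fmls S \<equiv> formulas (lang S)"

text \<open>
  Intuitionistic natural deduction.  All terms, functors and formulas of a derivation in S belong
  to the language of S.  The free variables of the hypotheses are held constant, whereas
  axioms, which are not shifted by the quantifier introductions, hold for all values of theirs.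
\<close>

inductive deriv :: "fsystem \<Rightarrow> fm set \<Rightarrow> fm \<Rightarrow> bool" for S :: fsystem where
  Axiom: "A \<in> axs S \<Longrightarrow> A \<in> fmls S \<Longrightarrow> deriv S \<Gamma> A"
| Hyp: "A \<in> \<Gamma> \<Longrightarrow> A \<in> fmls S \<Longrightarrow> deriv S \<Gamma> A"
| BotE: "deriv S \<Gamma> Bot \<Longrightarrow> A \<in> fmls S \<Longrightarrow> deriv S \<Gamma> A"
| AndI: "deriv S \<Gamma> A \<Longrightarrow> deriv S \<Gamma> B \<Longrightarrow> deriv S \<Gamma> (And A B)"
| AndE1: "deriv S \<Gamma> (And A B) \<Longrightarrow> deriv S \<Gamma> A"
| AndE2: "deriv S \<Gamma> (And A B) \<Longrightarrow> deriv S \<Gamma> B"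
| OrI1: "deriv S \<Gamma> A \<Longrightarrow> B \<in> fmls S \<Longrightarrow> deriv S \<Gamma> (Or A B)"
| OrI2: "deriv S \<Gamma> B \<Longrightarrow> A \<in> fmls S \<Longrightarrow> deriv S \<Gamma> (Or A B)"
| OrE: "deriv S \<Gamma> (Or A B) \<Longrightarrow> deriv S (insert A \<Gamma>) C \<Longrightarrow> deriv S (insert B \<Gamma>) C \<Longrightarrow> deriv S \<Gamma> C"
| ImpI: "deriv S (insert A \<Gamma>) B \<Longrightarrow> A \<in> fmls S \<Longrightarrow> deriv S \<Gamma> (Imp A B)"
| ImpE: "deriv S \<Gamma> (Imp A B) \<Longrightarrow> deriv S \<Gamma> A \<Longrightarrow> deriv S \<Gamma> B"
| AllNI: "deriv S (liftN ` \<Gamma>) A \<Longrightarrow> deriv S \<Gamma> (AllN A)"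
| AllNE: "deriv S \<Gamma> (AllN A) \<Longrightarrow> t \<in> terms (lang S) \<Longrightarrow> deriv S \<Gamma> (instN t A)"
| ExNI: "deriv S \<Gamma> (instN t A) \<Longrightarrow> t \<in> terms (lang S) \<Longrightarrow> A \<in> fmls S \<Longrightarrow> deriv S \<Gamma> (ExN A)"
| ExNE: "deriv S \<Gamma> (ExN A) \<Longrightarrow> deriv S (insert A (liftN ` \<Gamma>)) (liftN C) \<Longrightarrow> C \<in> fmls S
     \<Longrightarrow> deriv S \<Gamma> C"
| AllFI: "deriv S (liftF ` \<Gamma>) A \<Longrightarrow> deriv S \<Gamma> (AllF A)"
| AllFE: "deriv S \<Gamma> (AllF A) \<Longrightarrow> u \<in> functors (lang S) \<Longrightarrow> deriv S \<Gamma> (instF u A)"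
| ExFI: "deriv S \<Gamma> (instF u A) \<Longrightarrow> u \<in> functors (lang S) \<Longrightarrow> A \<in> fmls S \<Longrightarrow> deriv S \<Gamma> (ExF A)"
| ExFE: "deriv S \<Gamma> (ExF A) \<Longrightarrow> deriv S (insert A (liftF ` \<Gamma>)) (liftF C) \<Longrightarrow> C \<in> fmls S
     \<Longrightarrow> deriv S \<Gamma> C"

definition add_axioms :: "fsystem \<Rightarrow> fm set \<Rightarrow> fsystem"  (infixl "\<oplus>\<^sub>a" 65) where
  "S \<oplus>\<^sub>a X = S\<lparr>axs := axs S \<union> X\<rparr>"


section \<open>Effective operations on formulas\<close>

text \<open>
  Expressions are coded by binary trees.  The computable total functions on trees are generated,
  as on the natural numbers, from initial functions by composition, primitive recursion (along
  the two immediate subtrees) and minimization of regular functions.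
\<close>

datatype tree = Leaf | Branch tree tree

primrec left :: "tree \<Rightarrow> tree" where
  "left Leaf = Leaf"
| "left (Branch a b) = a"

primrec right :: "tree \<Rightarrow> tree" where
  "right Leaf = Leaf"
| "right (Branch a b) = b"

primrec num_tree :: "nat \<Rightarrow> tree" where
  "num_tree 0 = Leaf"
| "num_tree (Suc n) = Branch Leaf (num_tree n)"

primrec list_tree :: "tree list \<Rightarrow> tree" where
  "list_tree [] = Leaf"
| "list_tree (a # as) = Branch a (list_tree as)"

primrec recurse :: "(tree \<Rightarrow> tree) \<Rightarrow> (tree \<Rightarrow> tree) \<Rightarrow> tree \<Rightarrow> tree \<Rightarrow> tree" where
  "recurse f g p Leaf = f p"
| "recurse f g p (Branch a b) = g (list_tree [a, b, recurse f g p a, recurse f g p b, p])"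

inductive computable :: "(tree \<Rightarrow> tree) \<Rightarrow> bool" where
  "computable (\<lambda>x. x)"
| "computable (\<lambda>x. Leaf)"
| "computable left"
| "computable right"
| "computable f \<Longrightarrow> computable g \<Longrightarrow> computable (\<lambda>x. Branch (f x) (g x))"
| "computable f \<Longrightarrow> computable g \<Longrightarrow> computable (\<lambda>x. f (g x))"
| "computable f \<Longrightarrow> computable g \<Longrightarrow> computable (\<lambda>x. recurse f g (right x) (left x))"
| "computable f \<Longrightarrow> (\<And>x. \<exists>n. f (Branch x (num_tree n)) = Leaf)
     \<Longrightarrow> computable (\<lambda>x. num_tree (LEAST n. f (Branch x (num_tree n)) = Leaf))"

definition node :: "nat \<Rightarrow> tree list \<Rightarrow> tree" where
  "node k as = Branch (num_tree k) (list_tree as)"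

primrec code_prd :: "prd \<Rightarrow> tree" where
  "code_prd Succ = node 0 []"
| "code_prd (Const n q) = node 1 [num_tree n, num_tree q]"
| "code_prd (Proj n i) = node 2 [num_tree n, num_tree i]"
| "code_prd (Comp n g hs) = node 3 [num_tree n, code_prd g, list_tree (map code_prd hs)]"
| "code_prd (Rec0 q h) = node 4 [num_tree q, code_prd h]"
| "code_prd (RecP g h) = node 5 [code_prd g, code_prd h]"

primrec code_fsym :: "fsym \<Rightarrow> tree" where
  "code_fsym Zero = node 0 []"
| "code_fsym ZeroFn = node 1 []"
| "code_fsym Ident = node 2 []"
| "code_fsym PairJ = node 3 []"
| "code_fsym ProjK = node 4 []"
| "code_fsym ProjL = node 5 []"
| "code_fsym (PR d) = node 6 [code_prd d]"

primrec code_trm :: "trm \<Rightarrow> tree" and code_fnl :: "fnl \<Rightarrow> tree" where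
  "code_trm (Var n) = node 0 [num_tree n]"
| "code_trm (Fn c ts) = node 1 [code_fsym c, list_tree (map code_trm ts)]"
| "code_trm (App u t) = node 2 [code_fnl u, code_trm t]"
| "code_trm (Rec t u s) = node 3 [code_trm t, code_fnl u, code_trm s]"
| "code_fnl (FVar n) = node 4 [num_tree n]"
| "code_fnl (FC c) = node 5 [code_fsym c]"
| "code_fnl (Lam t) = node 6 [code_trm t]"

primrec code_fm :: "fm \<Rightarrow> tree" where
  "code_fm (Eq s t) = node 0 [code_trm s, code_trm t]"
| "code_fm Bot = node 1 []"
| "code_fm (And A B) = node 2 [code_fm A, code_fm B]"
| "code_fm (Or A B) = node 3 [code_fm A, code_fm B]"
| "code_fm (Imp A B) = node 4 [code_fm A, code_fm B]"
| "code_fm (AllN A) = node 5 [code_fm A]"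
| "code_fm (ExN A) = node 6 [code_fm A]"
| "code_fm (AllF A) = node 7 [code_fm A]"
| "code_fm (ExF A) = node 8 [code_fm A]"

definition effective_on :: "fm set \<Rightarrow> (fm \<Rightarrow> fm) \<Rightarrow> bool" where
  "effective_on X tr \<longleftrightarrow> (\<exists>f. computable f \<and> (\<forall>E\<in>X. code_fm (tr E) = f (code_fm E)))"


section \<open>Conservative and definitional extensions\<close>

definition extension :: "fsystem \<Rightarrow> fsystem \<Rightarrow> bool" where
  "extension S2 S1 \<longleftrightarrow> lang S1 \<subseteq> lang S2 \<and> (\<forall>E\<in>fmls S1. deriv S1 {} E \<longrightarrow> deriv S2 {} E)"

definition conservative_extension :: "fsystem \<Rightarrow> fsystem \<Rightarrow> bool" where
  "conservative_extension S2 S1 \<longleftrightarrow>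
     lang S1 \<subseteq> lang S2 \<and> (\<forall>E\<in>fmls S1. deriv S2 {} E \<longleftrightarrow> deriv S1 {} E)"

definition commutes_with_logic :: "fm set \<Rightarrow> (fm \<Rightarrow> fm) \<Rightarrow> bool" where
  "commutes_with_logic X tr \<longleftrightarrow>
     tr Bot = Bot \<and>
     (\<forall>A\<in>X. \<forall>B\<in>X. tr (And A B) = And (tr A) (tr B) \<and>
                     tr (Or A B) = Or (tr A) (tr B) \<and>
                     tr (Imp A B) = Imp (tr A) (tr B)) \<and>
     (\<forall>A\<in>X. tr (AllN A) = AllN (tr A) \<and> tr (ExN A) = ExN (tr A) \<and>
             tr (AllF A) = AllF (tr A) \<and> tr (ExF A) = ExF (tr A))"

definition definitional_extension :: "fsystem \<Rightarrow> fsystem \<Rightarrow> bool" where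
  "definitional_extension S2 S1 \<longleftrightarrow>
     extension S2 S1 \<and>
     (\<exists>tr. tr ` fmls S2 \<subseteq> fmls S1 \<and>
           effective_on (fmls S2) tr \<and>
           (\<forall>E\<in>fmls S1. tr E = E) \<and>
           (\<forall>E\<in>fmls S2. deriv S2 {} (Iff (tr E) E)) \<and>
           (\<forall>\<Gamma> E. \<Gamma> \<subseteq> fmls S2 \<longrightarrow> E \<in> fmls S2 \<longrightarrow> deriv S2 \<Gamma> E \<longrightarrow> deriv S1 (tr ` \<Gamma>) (tr E)) \<and>
           commutes_with_logic (fmls S2) tr)"


section \<open>Axioms common to BIM and EL\<close>

text \<open>
  In \<open>A(x) \<and> x = y \<longrightarrow> A(y)\<close> the formula A is given with a distinguished index 0, for which the
  variables \<open>Var i\<close> and \<open>Var j\<close> are substituted.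
\<close>

definition equality_axioms :: "language \<Rightarrow> fm set" where
  "equality_axioms L =
     {Eq (Var 0) (Var 0)} \<union>
     {Imp (And (instN (Var i) A) (Eq (Var i) (Var j))) (instN (Var j) A) | A i j. A \<in> formulas L}"

text \<open>\<open>A(0) \<and> \<forall>x (A(x) \<longrightarrow> A(S(x))) \<longrightarrow> \<forall>x A(x)\<close>\<close>

definition induction_axioms :: "language \<Rightarrow> fm set" where
  "induction_axioms L =
     {Imp (And (instN zero A)
               (AllN (Imp A (sub_fm (\<lambda>n. case n of 0 \<Rightarrow> suc (Var 0) | Suc m \<Rightarrow> Var (Suc m)) FVar A))))
          (AllN A) | A. A \<in> formulas L}"


section \<open>Basic Intuitionistic Mathematics\<close>

definition bim_language :: language where
  "bim_language = Sym ` {Zero, ZeroFn, Ident, PR Succ, PairJ, ProjK, ProjL}"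

text \<open>
  BIM has no constant for addition; \<open>s < t\<close> is \<open>\<exists>k. s + S(k) = t\<close>, where + is the function
  \<open>\<delta>\<close> with \<open>\<delta>(m, 0) = m\<close> and \<open>\<delta>(m, S(n)) = S(\<delta>(m, n))\<close> given by primitive recursion.
\<close>

definition less_fm :: "trm \<Rightarrow> trm \<Rightarrow> fm" where
  "less_fm s t =
     ExF (And (AllN (And (Eq (App (FVar 0) (pairJ (Var 0) zero)) (Var 0))
                         (AllN (Eq (App (FVar 0) (pairJ (Var 1) (suc (Var 0))))
                                   (suc (App (FVar 0) (pairJ (Var 1) (Var 0))))))))
              (ExN (Eq (App (FVar 0) (pairJ (ren_trm Suc Suc s) (suc (Var 0))))
                       (ren_trm Suc Suc t))))"

definition bim_constant_axioms :: "fm set" where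
  "bim_constant_axioms =
     {Eq (App (FC ZeroFn) (Var 0)) zero,
      Eq (App (FC Ident) (Var 0)) (Var 0),
      Neg (Eq (suc (Var 0)) zero),
      Imp (Eq (suc (Var 0)) (suc (Var 1))) (Eq (Var 0) (Var 1)),
      Eq (projK (pairJ (Var 0) (Var 1))) (Var 0),
      Eq (projL (pairJ (Var 0) (Var 1))) (Var 1),
      Eq (pairJ (projK (Var 0)) (projL (Var 0))) (Var 0)}"

text \<open>\<open>\<forall>\<alpha> \<forall>\<beta> \<exists>\<gamma> \<forall>n. \<gamma>(n) = \<alpha>(\<beta>(n))\<close>\<close>

definition bim_composition :: fm where
  "bim_composition =
     AllF (AllF (ExF (AllN (Eq (App (FVar 0) (Var 0)) (App (FVar 2) (App (FVar 1) (Var 0)))))))"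

text \<open>\<open>\<forall>\<alpha> \<forall>\<beta> \<exists>\<gamma> \<forall>n. \<gamma>(n) = J(\<alpha>(n), \<beta>(n))\<close>\<close>

definition bim_pairing :: fm where
  "bim_pairing =
     AllF (AllF (ExF (AllN (Eq (App (FVar 0) (Var 0))
                               (pairJ (App (FVar 2) (Var 0)) (App (FVar 1) (Var 0)))))))"

text \<open>
  \<open>\<forall>\<alpha> \<forall>\<beta> \<exists>\<gamma> \<forall>m \<forall>n. \<gamma>(m, 0) = \<alpha>(m) \<and> \<gamma>(m, S(n)) = \<beta>(m, n, \<gamma>(m, n))\<close>, where
  \<open>\<alpha>(m, n)\<close> is \<open>\<alpha>(J(m, n))\<close> and \<open>\<alpha>(m, n, p)\<close> is \<open>\<alpha>(J(J(m, n), p))\<close>.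
\<close>

definition bim_primitive_recursion :: fm where
  "bim_primitive_recursion =
     AllF (AllF (ExF (AllN (AllN
       (And (Eq (App (FVar 0) (pairJ (Var 1) zero)) (App (FVar 2) (Var 1)))
            (Eq (App (FVar 0) (pairJ (Var 1) (suc (Var 0))))
                (App (FVar 1) (pairJ (pairJ (Var 1) (Var 0))
                                     (App (FVar 0) (pairJ (Var 1) (Var 0)))))))))))"

text \<open>
  \<open>\<forall>\<alpha>. \<forall>m \<exists>n. \<alpha>(m, n) = 0 \<longrightarrow> \<exists>\<gamma> \<forall>m. \<alpha>(m, \<gamma>(m)) = 0 \<and> (\<forall>n. n < \<gamma>(m) \<longrightarrow> \<alpha>(m, n) \<noteq> 0)\<close>
\<close>

definition bim_unbounded_search :: fm where
  "bim_unbounded_search =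
     AllF (Imp (AllN (ExN (Eq (App (FVar 0) (pairJ (Var 1) (Var 0))) zero)))
       (ExF (AllN
         (And (Eq (App (FVar 1) (pairJ (Var 0) (App (FVar 0) (Var 0)))) zero)
              (AllN (Imp (less_fm (Var 0) (App (FVar 0) (Var 1)))
                         (Neg (Eq (App (FVar 1) (pairJ (Var 1) (Var 0))) zero))))))))"

definition BIM :: fsystem where
  "BIM = \<lparr>lang = bim_language,
          axs = equality_axioms bim_language \<union> induction_axioms bim_language \<union>
                bim_constant_axioms \<union>
                {bim_composition, bim_pairing, bim_primitive_recursion, bim_unbounded_search}\<rparr>"

text \<open>
  The axioms of BIM say that J is a bijection with inverse (K, L), but do not fix its values: not
  even \<open>J(0, 0) = 0\<close> is decided.  The following recursion equations identify J as the Cantor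
  pairing, which runs through the diagonals \<open>m + n = 0, 1, 2, \<dots>\<close> in turn, each in the order of
  increasing m; given the axioms of BIM, they determine J, K and L completely.  A definitional
  extension of EL with J in its language decides every equation \<open>J(m, n) = p\<close> between numerals,
  hence is conservative over a theory of J only if that theory decides them too.
\<close>

definition cantor_pairing_axioms :: "fm set" where
  "cantor_pairing_axioms =
     {Eq (pairJ zero zero) zero,
      Eq (pairJ zero (suc (Var 0))) (suc (pairJ (Var 0) zero)),
      Eq (pairJ (suc (Var 0)) (Var 1)) (suc (pairJ (Var 0) (suc (Var 1))))}"


section \<open>Intuitionistic arithmetic with function variables and elementary analysis\<close>

definition ha1_language :: language where
  "ha1_language = insert (Sym Zero) {Sym (PR d) | d n. describes d n} \<union> {LamSym, RecSym}"

text \<open>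
  The arguments of an n-place function are the variables with indices below n; in the schemata
  of recursion the recursion variable is \<open>Var 0\<close>.
\<close>

inductive_set defining_equations :: "fm set" where
  "describes (Const n q) n \<Longrightarrow>
     Eq (apply_const (PR (Const n q)) (map Var [0..<n])) (numeral_trm q) \<in> defining_equations"
| "describes (Proj n i) n \<Longrightarrow>
     Eq (apply_const (PR (Proj n i)) (map Var [0..<n])) (Var i) \<in> defining_equations"
| "describes (Comp n g hs) n \<Longrightarrow>
     Eq (apply_const (PR (Comp n g hs)) (map Var [0..<n]))
        (apply_const (PR g) (map (\<lambda>h. apply_const (PR h) (map Var [0..<n])) hs))
       \<in> defining_equations"
| "describes (Rec0 q h) 1 \<Longrightarrow>
     Eq (apply_const (PR (Rec0 q h)) [zero]) (numeral_trm q) \<in> defining_equations"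
| "describes (Rec0 q h) 1 \<Longrightarrow>
     Eq (apply_const (PR (Rec0 q h)) [suc (Var 0)])
        (apply_const (PR h) [Var 0, apply_const (PR (Rec0 q h)) [Var 0]]) \<in> defining_equations"
| "describes (RecP g h) (n + 1) \<Longrightarrow>
     Eq (apply_const (PR (RecP g h)) (zero # map Var [1..<n + 1]))
        (apply_const (PR g) (map Var [1..<n + 1])) \<in> defining_equations"
| "describes (RecP g h) (n + 1) \<Longrightarrow>
     Eq (apply_const (PR (RecP g h)) (suc (Var 0) # map Var [1..<n + 1]))
        (apply_const (PR h)
           (Var 0 # apply_const (PR (RecP g h)) (map Var [0..<n + 1]) # map Var [1..<n + 1]))
       \<in> defining_equations"

definition lambda_axioms :: "language \<Rightarrow> fm set" where
  "lambda_axioms L = {Eq (App (Lam t) s) (inst_trm s t) | t s. t \<in> terms L \<and> s \<in> terms L}"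

definition recursor_axioms :: "language \<Rightarrow> fm set" where
  "recursor_axioms L =
     {Eq (Rec t u zero) t | t u. t \<in> terms L \<and> u \<in> functors L} \<union>
     {Eq (Rec t u (suc s)) (App u (apply_const (PR pr_pair) [Rec t u s, s])) | t u s.
        t \<in> terms L \<and> u \<in> functors L \<and> s \<in> terms L}"

definition HA1 :: fsystem where
  "HA1 = \<lparr>lang = ha1_language,
          axs = equality_axioms ha1_language \<union> induction_axioms ha1_language \<union>
                {Neg (Eq (suc zero) zero)} \<union> defining_equations \<union>
                lambda_axioms ha1_language \<union> recursor_axioms ha1_language\<rparr>"

text \<open>
  \<open>\<forall>x \<exists>y A(x, y) \<longrightarrow> \<exists>\<alpha> \<forall>x A(x, \<alpha>(x))\<close>: in A the index 1 stands for x and 0 for y.  The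
  shift of the function indices keeps the bound \<open>\<alpha>\<close> from occurring in A.
\<close>

definition qf_ac00 :: "language \<Rightarrow> fm set" where
  "qf_ac00 L =
     {Imp (AllN (ExN A))
          (ExF (AllN (sub_fm (\<lambda>n. case n of 0 \<Rightarrow> App (FVar 0) (Var 0) | Suc m \<Rightarrow> Var m)
                             (\<lambda>k. FVar (Suc k)) A))) | A.
        A \<in> formulas L \<and> quantifier_free A}"

definition EL :: fsystem where
  "EL = HA1 \<oplus>\<^sub>a qf_ac00 ha1_language"

end

theory Submission
 imports Defs "HOL-Library.Infinite_Set" "HOL-Library.Countable"
begin

abbreviation (input) iff_ascii (infixr "<->" 25) where "A <-> B \<equiv> A \<longleftrightarrow> B"

text \<open>
 The common extension has the symbols and the axioms of BIM and of HA1 together.  Derivability is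
 reduced to truth in a canonical Kripke model whose worlds are saturated theories with infinitely
 many unused variables as fresh constants; the terms of a world, modulo the equations true in it,
 form an algebra in which the axioms can be applied like ordinary arithmetic.

 Over BIM, an equation between terms that are not terms of BIM is replaced by the assertion that
 certain functions, which satisfy the defining equations of the subterms and exist by primitive
 recursion, agree on a code of the values of the variables.  QF-AC00 follows from unbounded search,
 since a quantifier-free formula is equivalent to an equation of a term with 0.

 Over EL, the constants J, K, L are replaced by descriptions of the Cantor pairing and of its
 inverses.  Composition, pairing and primitive recursion then follow from abstraction and the
 recursor, and unbounded search from QF-AC00 by bounded minimization.  The recursion equations of the
 Cantor pairing make the replacement provably equivalent, because they determine J by induction.
\<close>

section \<open>Substitution\<close>

text \<open>Three obstacles shape the proof. One is that BIM has no abstraction: its functors are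
  variables and constants, so a term with \<open>Lam\<close> or \<open>Rec\<close> can only be
  described by a graph. Binders turn number variables into arguments, and a graph may depend on
  function variables; hence the values of all number variables are packed into one number, those of
  all function variables into one function, and the recursion of BIM has to supply these codes.
  Another is that BIM does not settle the values of J, whereas a translation into EL must choose
  some; therefore the Cantor equations are treated as a parameter \<open>C\<close>, so that the same
  system serves with and without them. The third is that the recursor hands its functor the single
  number \<open>2 ^ a * 3 ^ b\<close>: to reach the recursion of BIM one must recover
  \<open>a\<close>, and for this a piece of arithmetic has to be built from the defining equations.
  Worlds help with all three: saturation yields genuine case distinctions, and an induction axiom
  becomes a rule about the elements of a world.\<close>

lemma up_ren_simps [simp]: "up_ren r 0 = 0" "up_ren r (Suc n) = Suc (r n)"
 by (simp_all add: up_ren_def)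

lemma up_trm_simps [simp]: "up_trm sg 0 = Var 0" "up_trm sg (Suc n) = ren_trm Suc id (sg n)"
 by (simp_all add: up_trm_def)

lemma up_fnl_simps [simp]: "up_fnl ta 0 = FVar 0" "up_fnl ta (Suc n) = ren_fnl id Suc (ta n)"
 by (simp_all add: up_fnl_def)

text \<open>Lifting a substitution under a binder renames its values. Therefore the laws of
  composition come in this order: the binder case of \<open>ren_sub\<close> needs
  \<open>ren_ren\<close>, and that of \<open>sub_sub\<close> needs \<open>sub_ren\<close> and
  \<open>ren_sub\<close>.\<close>

lemma sub_ren: "sub_trm sg ta (ren_trm r q t) = sub_trm (sg \<circ> r) (ta \<circ> q) t"
 and sub_ren_fnl: "sub_fnl sg ta (ren_fnl r q u) = sub_fnl (sg \<circ> r) (ta \<circ> q) u"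
proof (induction t and u arbitrary: sg ta r q and sg ta r q)
 case (Lam t)
 have "up_trm sg \<circ> up_ren r = up_trm (sg \<circ> r)"
  by (rule ext) (simp add: up_trm_def up_ren_def split: nat.split)
 thus ?case using Lam by (simp add: comp_def)
qed auto

lemma ren_ren: "ren_trm r q (ren_trm r' q' t) = ren_trm (r \<circ> r') (q \<circ> q') t"
 and ren_ren_fnl: "ren_fnl r q (ren_fnl r' q' u) = ren_fnl (r \<circ> r') (q \<circ> q') u"
proof (induction t and u arbitrary: r q r' q' and r q r' q')
 case (Lam t)
 have "up_ren r \<circ> up_ren r' = up_ren (r \<circ> r')"
  by (rule ext) (simp add: up_ren_def split: nat.split)
 thus ?case using Lam by (simp add: comp_def)
qed auto

lemma ren_sub: "ren_trm r q (sub_trm sg ta t) = sub_trm (ren_trm r q \<circ> sg) (ren_fnl r q \<circ> ta) t"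
 and ren_sub_fnl: "ren_fnl r q (sub_fnl sg ta u) = sub_fnl (ren_trm r q \<circ> sg) (ren_fnl r q \<circ> ta) u"
proof (induction t and u arbitrary: r q sg ta and r q sg ta)
 case (Lam t)
 have 1: "ren_trm (up_ren r) q \<circ> up_trm sg = up_trm (ren_trm r q \<circ> sg)"
  by (rule ext) (simp add: up_trm_def ren_ren comp_def split: nat.split)
 have 2: "ren_fnl (up_ren r) q (ren_fnl Suc id u) = ren_fnl Suc id (ren_fnl r q u)" for u
  by (simp add: ren_ren_fnl comp_def)
 show ?case using Lam 1 2 by (simp add: comp_def)
qed auto

lemma sub_sub: "sub_trm sg ta (sub_trm sg' ta' t) = sub_trm (sub_trm sg ta \<circ> sg') (sub_fnl sg ta \<circ> ta') t"
 and sub_sub_fnl: "sub_fnl sg ta (sub_fnl sg' ta' u) = sub_fnl (sub_trm sg ta \<circ> sg') (sub_fnl sg ta \<circ> ta') u"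
proof (induction t and u arbitrary: sg ta sg' ta' and sg ta sg' ta')
 case (Lam t)
 have 1: "sub_trm (up_trm sg) (%n. ren_fnl Suc id (ta n)) \<circ> up_trm sg' = up_trm (sub_trm sg ta \<circ> sg')"
  by (rule ext) (simp add: up_trm_def sub_ren ren_sub comp_def split: nat.split)
 have 2: "sub_fnl (up_trm sg) (%n. ren_fnl Suc id (ta n)) (ren_fnl Suc id u)
   = ren_fnl Suc id (sub_fnl sg ta u)" for u
  by (simp add: sub_ren_fnl ren_sub_fnl comp_def)
 show ?case using Lam 1 2 by (simp add: comp_def)
qed auto

lemma up_trm_Var [simp]: "up_trm Var = Var"
 by (rule ext) (simp add: up_trm_def split: nat.split)

lemma up_fnl_FVar [simp]: "up_fnl FVar = FVar"
 by (rule ext) (simp add: up_fnl_def split: nat.split)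

lemma sub_id [simp]: "sub_trm Var FVar t = t"
 and sub_id_fnl [simp]: "sub_fnl Var FVar u = u"
 by (induction t and u) (auto simp: map_idI)

lemma ren_is_sub: "ren_trm r q t = sub_trm (Var \<circ> r) (FVar \<circ> q) t"
 and ren_is_sub_fnl: "ren_fnl r q u = sub_fnl (Var \<circ> r) (FVar \<circ> q) u"
proof (induction t and u arbitrary: r q and r q)
 case (Lam t)
 have "up_trm (Var \<circ> r) = Var \<circ> up_ren r"
  by (rule ext) (simp add: up_trm_def up_ren_def split: nat.split)
 thus ?case using Lam by (simp add: comp_def)
qed auto

lemma sub_fm_sub_fm:
 "sub_fm sg ta (sub_fm sg' ta' A) = sub_fm (%n. sub_trm sg ta (sg' n)) (%n. sub_fnl sg ta (ta' n)) A"
proof (induction A arbitrary: sg ta sg' ta')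
 case (Eq s t)
 thus ?case by (simp add: sub_sub comp_def)
next
 case (AllN A)
 have 1: "(%n. sub_trm (up_trm sg) (%n. ren_fnl Suc id (ta n)) (up_trm sg' n)) = up_trm (%n. sub_trm sg ta (sg' n))"
  by (rule ext) (simp add: up_trm_def sub_ren ren_sub comp_def split: nat.split)
 show ?case using AllN 1 by (simp add: sub_ren_fnl ren_sub_fnl comp_def)
next
 case (ExN A)
 have 1: "(%n. sub_trm (up_trm sg) (%n. ren_fnl Suc id (ta n)) (up_trm sg' n)) = up_trm (%n. sub_trm sg ta (sg' n))"
  by (rule ext) (simp add: up_trm_def sub_ren ren_sub comp_def split: nat.split)
 show ?case using ExN 1 by (simp add: sub_ren_fnl ren_sub_fnl comp_def)
next
 case (AllF A)
 have 1: "(%n. sub_fnl (%n. ren_trm id Suc (sg n)) (up_fnl ta) (up_fnl ta' n)) = up_fnl (%n. sub_fnl sg ta (ta' n))"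
  by (rule ext) (simp add: up_fnl_def sub_ren_fnl ren_sub_fnl comp_def split: nat.split)
 show ?case using AllF 1 by (simp add: sub_ren ren_sub comp_def)
next
 case (ExF A)
 have 1: "(%n. sub_fnl (%n. ren_trm id Suc (sg n)) (up_fnl ta) (up_fnl ta' n)) = up_fnl (%n. sub_fnl sg ta (ta' n))"
  by (rule ext) (simp add: up_fnl_def sub_ren_fnl ren_sub_fnl comp_def split: nat.split)
 show ?case using ExF 1 by (simp add: sub_ren ren_sub comp_def)
qed auto

lemma sub_fm_id [simp]: "sub_fm Var FVar A = A"
 by (induction A) auto

lemma sub_fm_cong: "(\<And>n. sg n = sg' n) ==> (\<And>n. ta n = ta' n) ==> A = B ==> sub_fm sg ta A = sub_fm sg' ta' B"
 by (metis ext)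

abbreviation consn :: "'a => (nat => 'a) => nat => 'a"  (infixr "##" 70) where
 "consn a f \<equiv> case_nat a f"

text \<open>The lifted substitution keeps the index 0, which the instantiation then fills; together
  they put \<open>s\<close> in front of the environment. The truth clauses for quantifiers rest on
  this form.\<close>

lemma instN_sub: "instN s (sub_fm (up_trm sg) (%n. ren_fnl Suc id (ta n)) A) = sub_fm (s ## sg) ta A"
 unfolding instN_def sub_fm_sub_fm
 by (rule sub_fm_cong) (auto simp: sub_ren sub_ren_fnl comp_def up_trm_def split: nat.split)

lemma instF_sub: "instF u (sub_fm (%n. ren_trm id Suc (sg n)) (up_fnl ta) A) = sub_fm sg (u ## ta) A"
 unfolding instF_def sub_fm_sub_fm
 by (rule sub_fm_cong) (auto simp: sub_ren sub_ren_fnl comp_def up_fnl_def split: nat.split)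

lemma sub_instN: "sub_fm sg ta (instN s A) = sub_fm (sub_trm sg ta s ## sg) ta A"
 unfolding instN_def sub_fm_sub_fm
 by (rule sub_fm_cong) (auto split: nat.split)

lemma sub_instF: "sub_fm sg ta (instF u A) = sub_fm sg (sub_fnl sg ta u ## ta) A"
 unfolding instF_def sub_fm_sub_fm
 by (rule sub_fm_cong) (auto split: nat.split)

lemma sub_liftN: "sub_fm sg ta (liftN A) = sub_fm (%n. sg (Suc n)) ta A"
 by (simp add: sub_fm_sub_fm)

lemma sub_liftF: "sub_fm sg ta (liftF A) = sub_fm sg (%n. ta (Suc n)) A"
 by (simp add: sub_fm_sub_fm)

lemma liftN_sub: "liftN (sub_fm sg ta A) = sub_fm (%n. ren_trm Suc id (sg n)) (%n. ren_fnl Suc id (ta n)) A"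
 by (simp add: sub_fm_sub_fm ren_is_sub ren_is_sub_fnl comp_def)

lemma liftF_sub: "liftF (sub_fm sg ta A) = sub_fm (%n. ren_trm id Suc (sg n)) (%n. ren_fnl id Suc (ta n)) A"
 by (simp add: sub_fm_sub_fm ren_is_sub ren_is_sub_fnl comp_def)

section \<open>Formulas whose free variables lie in given sets\<close>

primrec over_trm :: "nat set => nat set => trm => bool"
  and over_fnl :: "nat set => nat set => fnl => bool" where
 "over_trm X Y (Var n) = (n \<in> X)"
| "over_trm X Y (Fn c ts) = (\<forall>b \<in> set (map (over_trm X Y) ts). b)"
| "over_trm X Y (App u t) = (over_fnl X Y u \<and> over_trm X Y t)"
| "over_trm X Y (Rec t u s) = (over_trm X Y t \<and> over_fnl X Y u \<and> over_trm X Y s)"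
| "over_fnl X Y (FVar n) = (n \<in> Y)"
| "over_fnl X Y (FC c) = True"
| "over_fnl X Y (Lam t) = over_trm (insert 0 (Suc ` X)) Y t"

primrec over_fm :: "nat set => nat set => fm => bool" where
 "over_fm X Y (Eq s t) = (over_trm X Y s \<and> over_trm X Y t)"
| "over_fm X Y Bot = True"
| "over_fm X Y (And A B) = (over_fm X Y A \<and> over_fm X Y B)"
| "over_fm X Y (Or A B) = (over_fm X Y A \<and> over_fm X Y B)"
| "over_fm X Y (Imp A B) = (over_fm X Y A \<and> over_fm X Y B)"
| "over_fm X Y (AllN A) = over_fm (insert 0 (Suc ` X)) Y A"
| "over_fm X Y (ExN A) = over_fm (insert 0 (Suc ` X)) Y A"
| "over_fm X Y (AllF A) = over_fm X (insert 0 (Suc ` Y)) A"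
| "over_fm X Y (ExF A) = over_fm X (insert 0 (Suc ` Y)) A"

lemma over_mono: "over_trm X Y t ==> X \<subseteq> X' ==> Y \<subseteq> Y' ==> over_trm X' Y' t"
 and over_mono_fnl: "over_fnl X Y u ==> X \<subseteq> X' ==> Y \<subseteq> Y' ==> over_fnl X' Y' u"
proof (induction t and u arbitrary: X X' and X X')
 case (Lam t)
 have "insert 0 (Suc ` X) \<subseteq> insert 0 (Suc ` X')" using Lam by auto
 thus ?case using Lam by simp
qed auto

lemma over_mono_fm: "over_fm X Y A ==> X \<subseteq> X' ==> Y \<subseteq> Y' ==> over_fm X' Y' A"
proof (induction A arbitrary: X X' Y Y')
 case (Eq s t) thus ?case using over_mono by auto
next
 case (AllN A)
 have "insert 0 (Suc ` X) \<subseteq> insert 0 (Suc ` X')" using AllN by auto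
 thus ?case using AllN by simp
next
 case (ExN A)
 have "insert 0 (Suc ` X) \<subseteq> insert 0 (Suc ` X')" using ExN by auto
 thus ?case using ExN by simp
next
 case (AllF A)
 have "insert 0 (Suc ` Y) \<subseteq> insert 0 (Suc ` Y')" using AllF by auto
 thus ?case using AllF by simp
next
 case (ExF A)
 have "insert 0 (Suc ` Y) \<subseteq> insert 0 (Suc ` Y')" using ExF by auto
 thus ?case using ExF by simp
qed auto

lemma sub_cong_over: "over_trm X Y t ==> (\<And>n. n \<in> X ==> sg n = sg' n) ==> (\<And>n. n \<in> Y ==> ta n = ta' n)
  ==> sub_trm sg ta t = sub_trm sg' ta' t"
 and sub_cong_over_fnl: "over_fnl X Y u ==> (\<And>n. n \<in> X ==> sg n = sg' n) ==> (\<And>n. n \<in> Y ==> ta n = ta' n)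
  ==> sub_fnl sg ta u = sub_fnl sg' ta' u"
proof (induction t and u arbitrary: X sg sg' ta ta' and X sg sg' ta ta')
 case (Lam t)
 show ?case using Lam.prems by simp (rule Lam.IH[where X = "insert 0 (Suc ` X)"]; auto)
next
 case (App u t)
 show ?case using App.prems by (auto intro!: App.IH(1)[of X] App.IH(2)[of X])
next
 case (Rec t u s)
 show ?case using Rec.prems by (auto intro!: Rec.IH(1)[of X] Rec.IH(2)[of X] Rec.IH(3)[of X])
next
 case (Fn c ts)
 show ?case using Fn.prems by (auto intro!: Fn.IH[of _ X])
qed auto

lemma sub_fm_cong_over: "over_fm X Y A ==> (\<And>n. n \<in> X ==> sg n = sg' n) ==> (\<And>n. n \<in> Y ==> ta n = ta' n)
  ==> sub_fm sg ta A = sub_fm sg' ta' A"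
proof (induction A arbitrary: X Y sg sg' ta ta')
 case (Eq s t) thus ?case by (auto intro!: sub_cong_over[of X Y])
next
 case (And A B) show ?case using And.prems by (auto intro!: And.IH(1)[of X Y] And.IH(2)[of X Y])
next
 case (Or A B) show ?case using Or.prems by (auto intro!: Or.IH(1)[of X Y] Or.IH(2)[of X Y])
next
 case (Imp A B) show ?case using Imp.prems by (auto intro!: Imp.IH(1)[of X Y] Imp.IH(2)[of X Y])
next
 case (AllN A) show ?case using AllN.prems by simp (rule AllN.IH[where X = "insert 0 (Suc ` X)" and Y = Y]; auto)
next
 case (ExN A) show ?case using ExN.prems by simp (rule ExN.IH[where X = "insert 0 (Suc ` X)" and Y = Y]; auto)
next
 case (AllF A) show ?case using AllF.prems by simp (rule AllF.IH[where X = X and Y = "insert 0 (Suc ` Y)"]; auto)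
next
 case (ExF A) show ?case using ExF.prems by simp (rule ExF.IH[where X = X and Y = "insert 0 (Suc ` Y)"]; auto)
qed auto

lemma over_sub: "over_trm X Y t ==> (\<And>n. n \<in> X ==> over_trm X' Y' (sg n)) ==> (\<And>n. n \<in> Y ==> over_fnl X' Y' (ta n))
  ==> over_trm X' Y' (sub_trm sg ta t)"
 and over_sub_fnl: "over_fnl X Y u ==> (\<And>n. n \<in> X ==> over_trm X' Y' (sg n)) ==> (\<And>n. n \<in> Y ==> over_fnl X' Y' (ta n))
  ==> over_fnl X' Y' (sub_fnl sg ta u)"
proof -
 have 1: "over_trm X Y t ==> (\<And>n. n \<in> X ==> r n \<in> X') ==> (\<And>n. n \<in> Y ==> q n \<in> Y') ==> over_trm X' Y' (ren_trm r q t)"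
  and 2: "over_fnl X Y u ==> (\<And>n. n \<in> X ==> r n \<in> X') ==> (\<And>n. n \<in> Y ==> q n \<in> Y') ==> over_fnl X' Y' (ren_fnl r q u)"
  for X X' Y Y' r q t u
 proof (induction t and u arbitrary: X X' r and X X' r)
  case (Lam t)
  show ?case using Lam.prems by simp (rule Lam.IH[where X = "insert 0 (Suc ` X)"]; auto)
 qed auto
 show "over_trm X Y t ==> (\<And>n. n \<in> X ==> over_trm X' Y' (sg n)) ==> (\<And>n. n \<in> Y ==> over_fnl X' Y' (ta n))
  ==> over_trm X' Y' (sub_trm sg ta t)"
 and "over_fnl X Y u ==> (\<And>n. n \<in> X ==> over_trm X' Y' (sg n)) ==> (\<And>n. n \<in> Y ==> over_fnl X' Y' (ta n))
  ==> over_fnl X' Y' (sub_fnl sg ta u)"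
 proof (induction t and u arbitrary: X X' sg ta and X X' sg ta)
  case (Lam t)
  have "over_fnl (insert 0 (Suc ` X')) Y' (ren_fnl Suc id (ta n))" if "n \<in> Y" for n
   by (rule 2[OF Lam.prems(3)[OF that]]) auto
  moreover have "over_trm (insert 0 (Suc ` X')) Y' (up_trm sg n)" if "n \<in> insert 0 (Suc ` X)" for n
   using that by (auto intro!: 1[OF Lam.prems(2)])
  ultimately show ?case using Lam.prems by simp (rule Lam.IH[where X = "insert 0 (Suc ` X)"]; auto)
 qed auto
qed

lemma over_ren: "over_trm X Y t ==> (\<And>n. n \<in> X ==> r n \<in> X') ==> (\<And>n. n \<in> Y ==> q n \<in> Y') ==> over_trm X' Y' (ren_trm r q t)"
 and over_ren_fnl: "over_fnl X Y u ==> (\<And>n. n \<in> X ==> r n \<in> X') ==> (\<And>n. n \<in> Y ==> q n \<in> Y') ==> over_fnl X' Y' (ren_fnl r q u)"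
 by (auto simp: ren_is_sub ren_is_sub_fnl intro: over_sub over_sub_fnl)

lemma over_sub_fm: "over_fm X Y A ==> (\<And>n. n \<in> X ==> over_trm X' Y' (sg n)) ==> (\<And>n. n \<in> Y ==> over_fnl X' Y' (ta n))
  ==> over_fm X' Y' (sub_fm sg ta A)"
proof (induction A arbitrary: X X' Y Y' sg ta)
 case (Eq s t) thus ?case by (auto elim!: over_sub)
next
 case (AllN A) show ?case using AllN.prems
  by simp (rule AllN.IH[where X = "insert 0 (Suc ` X)" and Y = Y]; auto intro!: over_ren[OF AllN.prems(2)] over_ren_fnl[OF AllN.prems(3)])
next
 case (ExN A) show ?case using ExN.prems
  by simp (rule ExN.IH[where X = "insert 0 (Suc ` X)" and Y = Y]; auto intro!: over_ren[OF ExN.prems(2)] over_ren_fnl[OF ExN.prems(3)])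
next
 case (AllF A) show ?case using AllF.prems
  by simp (rule AllF.IH[where X = X and Y = "insert 0 (Suc ` Y)"]; auto intro!: over_ren[OF AllF.prems(2)] over_ren_fnl[OF AllF.prems(3)])
next
 case (ExF A) show ?case using ExF.prems
  by simp (rule ExF.IH[where X = X and Y = "insert 0 (Suc ` Y)"]; auto intro!: over_ren[OF ExF.prems(2)] over_ren_fnl[OF ExF.prems(3)])
qed auto

lemma finite_preimage_Suc: "finite X ==> \<exists>X'. finite X' \<and> X \<subseteq> insert 0 (Suc ` X')"
proof (intro exI conjI subsetI)
 fix x assume "x \<in> X"
 thus "x \<in> insert 0 (Suc ` ((%n. n - 1) ` X))"
  by (cases x) (force simp: image_iff)+
qed auto

lemma finite_over: "\<exists>X Y. finite X \<and> finite Y \<and> over_trm X Y t"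
 and finite_over_fnl: "\<exists>X Y. finite X \<and> finite Y \<and> over_fnl X Y u"
proof (induction t and u)
 case (Var n) show ?case by (rule exI[of _ "{n}"], rule exI[of _ "{}"]) simp
next
 case (FVar n) show ?case by (rule exI[of _ "{}"], rule exI[of _ "{n}"]) simp
next
 case (FC n) show ?case by (rule exI[of _ "{}"], rule exI[of _ "{}"]) simp
next
 case (Fn c ts)
 have "\<exists>X Y. finite X \<and> finite Y \<and> (\<forall>t\<in>set ts. over_trm X Y t)"
  using Fn
 proof (induction ts)
  case (Cons t ts)
  obtain X' Y' where *: "finite X'" "finite Y'" "\<forall>t\<in>set ts. over_trm X' Y' t"
   using Cons.IH[OF Cons.prems[OF list.set_intros(2)]] by blast
  obtain X Y where XY: "finite X" "finite Y" "over_trm X Y t"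
   using Cons.prems[OF list.set_intros(1)] by blast
  have "over_trm (X \<union> X') (Y \<union> Y') t" by (rule over_mono[OF XY(3)]) (rule Un_upper1)+
  moreover have "\<forall>s\<in>set ts. over_trm (X \<union> X') (Y \<union> Y') s"
  proof
   fix s assume "s \<in> set ts"
   with *(3) have "over_trm X' Y' s" by (rule bspec)
   thus "over_trm (X \<union> X') (Y \<union> Y') s" by (rule over_mono) (rule Un_upper2)+
  qed
  ultimately have "\<forall>s\<in>set (t # ts). over_trm (X \<union> X') (Y \<union> Y') s"
   unfolding list.set ball_simps by (rule conjI)
  moreover have "finite (X \<union> X')" "finite (Y \<union> Y')" using * XY by auto
  ultimately show ?case by (intro exI conjI)
 qed auto
 thus ?case by simp
next
 case (App u t)
 then obtain X Y X' Y' where "finite X" "finite Y" "finite X'" "finite Y'" "over_fnl X Y u" "over_trm X' Y' t" by auto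
 thus ?case
  by - (rule exI[of _ "X \<union> X'"], rule exI[of _ "Y \<union> Y'"], auto elim!: over_mono over_mono_fnl)
next
 case (Rec t u s)
 then obtain X Y X' Y' X'' Y'' where "finite X" "finite Y" "finite X'" "finite Y'" "finite X''" "finite Y''"
  "over_fnl X Y u" "over_trm X' Y' t" "over_trm X'' Y'' s" by auto
 thus ?case
  by - (rule exI[of _ "X \<union> X' \<union> X''"], rule exI[of _ "Y \<union> Y' \<union> Y''"], auto elim!: over_mono over_mono_fnl)
next
 case (Lam t)
 then obtain X Y where "finite X" "finite Y" "over_trm X Y t" by auto
 moreover obtain X' where "finite X'" "X \<subseteq> insert 0 (Suc ` X')" using finite_preimage_Suc[OF \<open>finite X\<close>] by auto
 ultimately show ?case by - (rule exI[of _ X'], rule exI[of _ Y], auto elim!: over_mono)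
qed

lemma finite_over_fm: "\<exists>X Y. finite X \<and> finite Y \<and> over_fm X Y A"
proof (induction A)
 case (Eq s t)
 obtain X Y X' Y' where "finite X" "finite Y" "finite X'" "finite Y'" "over_trm X Y s" "over_trm X' Y' t"
  using finite_over by metis
 thus ?case
  by - (rule exI[of _ "X \<union> X'"], rule exI[of _ "Y \<union> Y'"], auto elim!: over_mono)
next
 case Bot show ?case by (rule exI[of _ "{}"], rule exI[of _ "{}"]) simp
next
 case (And A B)
 then obtain X Y X' Y' where "finite X" "finite Y" "finite X'" "finite Y'" "over_fm X Y A" "over_fm X' Y' B" by auto
 thus ?case
  by - (rule exI[of _ "X \<union> X'"], rule exI[of _ "Y \<union> Y'"], auto elim!: over_mono_fm)
next
 case (Or A B)
 then obtain X Y X' Y' where "finite X" "finite Y" "finite X'" "finite Y'" "over_fm X Y A" "over_fm X' Y' B" by auto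
 thus ?case
  by - (rule exI[of _ "X \<union> X'"], rule exI[of _ "Y \<union> Y'"], auto elim!: over_mono_fm)
next
 case (Imp A B)
 then obtain X Y X' Y' where "finite X" "finite Y" "finite X'" "finite Y'" "over_fm X Y A" "over_fm X' Y' B" by auto
 thus ?case
  by - (rule exI[of _ "X \<union> X'"], rule exI[of _ "Y \<union> Y'"], auto elim!: over_mono_fm)
next
 case (AllN A)
 then obtain X Y where "finite X" "finite Y" "over_fm X Y A" by auto
 moreover obtain X' where "finite X'" "X \<subseteq> insert 0 (Suc ` X')" using finite_preimage_Suc[OF \<open>finite X\<close>] by auto
 ultimately show ?case by - (rule exI[of _ X'], rule exI[of _ Y], auto elim!: over_mono_fm)
next
 case (ExN A)
 then obtain X Y where "finite X" "finite Y" "over_fm X Y A" by auto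
 moreover obtain X' where "finite X'" "X \<subseteq> insert 0 (Suc ` X')" using finite_preimage_Suc[OF \<open>finite X\<close>] by auto
 ultimately show ?case by - (rule exI[of _ X'], rule exI[of _ Y], auto elim!: over_mono_fm)
next
 case (AllF A)
 then obtain X Y where "finite X" "finite Y" "over_fm X Y A" by auto
 moreover obtain Y' where "finite Y'" "Y \<subseteq> insert 0 (Suc ` Y')" using finite_preimage_Suc[OF \<open>finite Y\<close>] by auto
 ultimately show ?case by - (rule exI[of _ X], rule exI[of _ Y'], auto elim!: over_mono_fm)
next
 case (ExF A)
 then obtain X Y where "finite X" "finite Y" "over_fm X Y A" by auto
 moreover obtain Y' where "finite Y'" "Y \<subseteq> insert 0 (Suc ` Y')" using finite_preimage_Suc[OF \<open>finite Y\<close>] by auto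
 ultimately show ?case by - (rule exI[of _ X], rule exI[of _ Y'], auto elim!: over_mono_fm)
qed

subsection \<open>Languages\<close>

inductive_simps terms_simps [simp]:
 "Var n \<in> terms L" "Fn c ts \<in> terms L" "App u t \<in> terms L" "Rec t u s \<in> terms L"
inductive_simps functors_simps [simp]:
 "FVar n \<in> functors L" "FC c \<in> functors L" "Lam t \<in> functors L"
inductive_simps formulas_simps [simp]:
 "Eq s t \<in> formulas L" "Bot \<in> formulas L" "And A B \<in> formulas L" "Or A B \<in> formulas L"
 "Imp A B \<in> formulas L" "AllN A \<in> formulas L" "ExN A \<in> formulas L" "AllF A \<in> formulas L"
 "ExF A \<in> formulas L"

lemma ren_terms: "ren_trm r q t \<in> terms L <-> t \<in> terms L"
 and ren_functors: "ren_fnl r q u \<in> functors L <-> u \<in> functors L"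
 by (induction t and u arbitrary: r q and r q) auto

lemma sub_terms: "t \<in> terms L ==> (\<And>n. sg n \<in> terms L) ==> (\<And>n. ta n \<in> functors L) ==> sub_trm sg ta t \<in> terms L"
 and sub_functors: "u \<in> functors L ==> (\<And>n. sg n \<in> terms L) ==> (\<And>n. ta n \<in> functors L) ==> sub_fnl sg ta u \<in> functors L"
proof (induction t and u arbitrary: sg ta and sg ta)
 case (Lam t)
 show ?case using Lam.prems
  by simp (rule Lam.IH; auto simp: up_trm_def ren_terms ren_functors split: nat.split)
qed auto

lemma sub_formulas: "A \<in> formulas L ==> (\<And>n. sg n \<in> terms L) ==> (\<And>n. ta n \<in> functors L) ==> sub_fm sg ta A \<in> formulas L"
proof (induction A arbitrary: sg ta)
 case (Eq s t) thus ?case by (auto intro: sub_terms)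
next
 case (AllN A) show ?case using AllN.prems
  by simp (rule AllN.IH; auto simp: up_trm_def ren_terms ren_functors split: nat.split)
next
 case (ExN A) show ?case using ExN.prems
  by simp (rule ExN.IH; auto simp: up_trm_def ren_terms ren_functors split: nat.split)
next
 case (AllF A) show ?case using AllF.prems
  by simp (rule AllF.IH; auto simp: up_fnl_def ren_terms ren_functors split: nat.split)
next
 case (ExF A) show ?case using ExF.prems
  by simp (rule ExF.IH; auto simp: up_fnl_def ren_terms ren_functors split: nat.split)
qed auto

text \<open>Symbols survive substitution. This is why the truth of an instance in a world certifies
  that the formula itself belongs to the language.\<close>

lemma unsub_terms: "sub_trm sg ta t \<in> terms L ==> t \<in> terms L"
 and unsub_functors: "sub_fnl sg ta u \<in> functors L ==> u \<in> functors L"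
 by (induction t and u arbitrary: sg ta and sg ta) auto

lemma unsub_formulas: "sub_fm sg ta A \<in> formulas L ==> A \<in> formulas L"
 by (induction A arbitrary: sg ta) (auto dest: unsub_terms)

lemma liftN_formulas [simp]: "liftN A \<in> formulas L <-> A \<in> formulas L"
 using unsub_formulas sub_formulas[of A L "%n. Var (Suc n)" FVar] by auto

lemma liftF_formulas [simp]: "liftF A \<in> formulas L <-> A \<in> formulas L"
 using unsub_formulas sub_formulas[of A L Var "%n. FVar (Suc n)"] by auto

lemma instN_formulas: "A \<in> formulas L ==> t \<in> terms L ==> instN t A \<in> formulas L"
 unfolding instN_def by (rule sub_formulas) (auto split: nat.split)

lemma instF_formulas: "A \<in> formulas L ==> u \<in> functors L ==> instF u A \<in> formulas L"
 unfolding instF_def by (rule sub_formulas) (auto split: nat.split)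

lemma terms_mono: "t \<in> terms L ==> L \<subseteq> L' ==> t \<in> terms L'"
 and functors_mono: "u \<in> functors L ==> L \<subseteq> L' ==> u \<in> functors L'"
 by (induction t and u) auto

lemma formulas_mono: "A \<in> formulas L ==> L \<subseteq> L' ==> A \<in> formulas L'"
 by (induction A) (auto intro: terms_mono)

section \<open>Properties of derivability\<close>

lemma deriv_formula: "deriv S Ga A ==> A \<in> fmls S"
 by (induction rule: deriv.induct) (auto intro: instN_formulas instF_formulas)

lemma weaken: "deriv S Ga A ==> Ga \<subseteq> De ==> deriv S De A"
proof (induction arbitrary: De rule: deriv.induct)
 case (OrE Ga A B C)
 show ?case
  by (rule deriv.OrE[OF OrE.IH(1)[OF OrE.prems] OrE.IH(2) OrE.IH(3)]) (use OrE.prems in auto)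
next
 case (ExNE Ga A C)
 show ?case
  by (rule deriv.ExNE[OF ExNE.IH(1)[OF ExNE.prems] ExNE.IH(2) ExNE.hyps(3)]) (use ExNE.prems in auto)
next
 case (ExFE Ga A C)
 show ?case
  by (rule deriv.ExFE[OF ExFE.IH(1)[OF ExFE.prems] ExFE.IH(2) ExFE.hyps(3)]) (use ExFE.prems in auto)
next
 case (ImpI A Ga B)
 show ?case
  by (rule deriv.ImpI[OF ImpI.IH ImpI.hyps(2)]) (use ImpI.prems in auto)
next
 case (AllNI Ga A)
 show ?case by (rule deriv.AllNI[OF AllNI.IH]) (use AllNI.prems in auto)
next
 case (AllFI Ga A)
 show ?case by (rule deriv.AllFI[OF AllFI.IH]) (use AllFI.prems in auto)
qed (blast intro: deriv.intros)+

lemma deriv_extend: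
 "deriv S Ga A ==> lang S \<subseteq> lang S' ==> (\<And>B. B \<in> axs S ==> B \<in> fmls S ==> deriv S' {} B) ==> deriv S' Ga A"
proof (induction rule: deriv.induct)
 case (Axiom A Ga)
 show ?case by (rule weaken[OF Axiom.prems(2)[OF Axiom.hyps]]) simp
next
 case (OrE Ga A B C)
 thus ?case by (blast intro: deriv.OrE)
next
 case (ExNE Ga A C)
 thus ?case by (blast intro: deriv.ExNE formulas_mono)
next
 case (ExFE Ga A C)
 thus ?case by (blast intro: deriv.ExFE formulas_mono)
qed (blast intro: deriv.intros formulas_mono terms_mono functors_mono)+

lemma cut: "deriv S Ga A ==> deriv S (insert A Ga) C ==> deriv S Ga C"
 by (meson deriv.ImpE deriv.ImpI deriv_formula)

text \<open>Derivations are finite. Below a quantifier rule the hypotheses that occur are lifts, and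
  a finite set of lifts is the image of a finite set of hypotheses.\<close>

lemma compact: "deriv S Ga A ==> \<exists>Ga'. finite Ga' \<and> Ga' \<subseteq> Ga \<and> deriv S Ga' A"
proof (induction rule: deriv.induct)
 case (Hyp A Ga)
 thus ?case by (intro exI[of _ "{A}"]) (auto intro: deriv.Hyp)
next
 case (Axiom A Ga)
 thus ?case by (intro exI[of _ "{}"]) (auto intro: deriv.Axiom)
next
 case (AndI Ga A B)
 then obtain G H where "finite G" "G \<subseteq> Ga" "deriv S G A" "finite H" "H \<subseteq> Ga" "deriv S H B" by auto
 thus ?case
  by (intro exI[of _ "G \<union> H"]) (auto intro!: deriv.AndI elim!: weaken)
next
 case (ImpE Ga A B)
 then obtain G H where "finite G" "G \<subseteq> Ga" "deriv S G (Imp A B)" "finite H" "H \<subseteq> Ga" "deriv S H A" by auto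
 thus ?case
  by (intro exI[of _ "G \<union> H"]) (auto intro!: deriv.ImpE[where A = A] elim!: weaken)
next
 case (OrE Ga A B C)
 then obtain G H K where *: "finite G" "G \<subseteq> Ga" "deriv S G (Or A B)" "finite H" "H \<subseteq> insert A Ga" "deriv S H C"
  "finite K" "K \<subseteq> insert B Ga" "deriv S K C" by auto
 let ?G = "G \<union> (H - {A}) \<union> (K - {B})"
 have "deriv S ?G C"
  by (rule deriv.OrE[of _ _ A B]; rule weaken, (rule *(3) *(6) *(9)), auto)
 thus ?case using * by (intro exI[of _ ?G]) auto
next
 case (ImpI A Ga B)
 then obtain H where *: "finite H" "H \<subseteq> insert A Ga" "deriv S H B" by auto
 have "deriv S (H - {A}) (Imp A B)"
  by (rule deriv.ImpI[OF _ ImpI.hyps(2)]; rule weaken, rule *(3), auto)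
 thus ?case using * by (intro exI[of _ "H - {A}"]) auto
next
 case (AllNI Ga A)
 then obtain G where "finite G" "G \<subseteq> Ga" "deriv S (liftN ` G) A" by (metis finite_subset_image)
 thus ?case by (intro exI[of _ G]) (auto intro: deriv.AllNI)
next
 case (AllFI Ga A)
 then obtain G where "finite G" "G \<subseteq> Ga" "deriv S (liftF ` G) A" by (metis finite_subset_image)
 thus ?case by (intro exI[of _ G]) (auto intro: deriv.AllFI)
next
 case (ExNE Ga A C)
 then obtain G H where *: "finite G" "G \<subseteq> Ga" "deriv S G (ExN A)" "finite H" "H \<subseteq> insert A (liftN ` Ga)" "deriv S H (liftN C)"
  by auto
 hence "finite (H - {A})" "H - {A} \<subseteq> liftN ` Ga" by auto
 then obtain K where K: "finite K" "K \<subseteq> Ga" "H - {A} = liftN ` K" by (metis finite_subset_image)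
 have "deriv S (G \<union> K) C"
  by (rule deriv.ExNE[OF _ _ ExNE.hyps(3)]; rule weaken, (rule * ), use K in auto)
 thus ?case using * K by (intro exI[of _ "G \<union> K"]) auto
next
 case (ExFE Ga A C)
 then obtain G H where *: "finite G" "G \<subseteq> Ga" "deriv S G (ExF A)" "finite H" "H \<subseteq> insert A (liftF ` Ga)" "deriv S H (liftF C)"
  by auto
 hence "finite (H - {A})" "H - {A} \<subseteq> liftF ` Ga" by auto
 then obtain K where K: "finite K" "K \<subseteq> Ga" "H - {A} = liftF ` K" by (metis finite_subset_image)
 have "deriv S (G \<union> K) C"
  by (rule deriv.ExFE[OF _ _ ExFE.hyps(3)]; rule weaken, (rule * ), use K in auto)
 thus ?case using * K by (intro exI[of _ "G \<union> K"]) auto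
qed (blast intro: deriv.intros)+

text \<open>Axioms hold for all values of their variables: generalize over all variables, then instantiate.\<close>

lemma deriv_empty_subN:
 assumes "\<And>n. sg n \<in> terms (lang S)"
 shows "deriv S {} ((AllN ^^ n) A) ==> deriv S {} (sub_fm (%i. if i < n then sg i else Var (i - n)) FVar A)"
 using assms
proof (induction n arbitrary: A sg)
 case (Suc n)
 have "deriv S {} ((AllN ^^ n) (AllN A))" using Suc.prems by (simp add: funpow_swap1)
 from Suc.IH[OF this, of "%i. sg (Suc i)"] Suc.prems
 have "deriv S {} (sub_fm (%i. if i < n then sg (Suc i) else Var (i - n)) FVar (AllN A))" by blast
 hence "deriv S {} (AllN (sub_fm (up_trm (%i. if i < n then sg (Suc i) else Var (i - n))) (%n. ren_fnl Suc id (FVar n)) A))"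
  by simp
 from deriv.AllNE[OF this, of "sg 0"] Suc.prems
 have "deriv S {} (sub_fm (sg 0 ## (%i. if i < n then sg (Suc i) else Var (i - n))) FVar A)"
  unfolding instN_sub by blast
 moreover have "(sg 0 ## (%i. if i < n then sg (Suc i) else Var (i - n))) = (%i. if i < Suc n then sg i else Var (i - Suc n))"
  by (rule ext) (auto split: nat.split)
 ultimately show ?case by simp
qed simp

lemma deriv_empty_subF:
 assumes "\<And>n. ta n \<in> functors (lang S)"
 shows "deriv S {} ((AllF ^^ n) A) ==> deriv S {} (sub_fm Var (%i. if i < n then ta i else FVar (i - n)) A)"
 using assms
proof (induction n arbitrary: A ta)
 case (Suc n)
 have "deriv S {} ((AllF ^^ n) (AllF A))" using Suc.prems by (simp add: funpow_swap1)
 from Suc.IH[OF this, of "%i. ta (Suc i)"] Suc.prems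
 have "deriv S {} (sub_fm Var (%i. if i < n then ta (Suc i) else FVar (i - n)) (AllF A))" by blast
 hence "deriv S {} (AllF (sub_fm (%n. ren_trm id Suc (Var n)) (up_fnl (%i. if i < n then ta (Suc i) else FVar (i - n))) A))"
  by simp
 from deriv.AllFE[OF this, of "ta 0"] Suc.prems
 have "deriv S {} (sub_fm Var (ta 0 ## (%i. if i < n then ta (Suc i) else FVar (i - n))) A)"
  unfolding instF_sub by blast
 moreover have "(ta 0 ## (%i. if i < n then ta (Suc i) else FVar (i - n))) = (%i. if i < Suc n then ta i else FVar (i - Suc n))"
  by (rule ext) (auto split: nat.split)
 ultimately show ?case by simp
qed simp

lemma deriv_empty_sub:
 assumes A: "deriv S {} A" and sg: "\<And>n. sg n \<in> terms (lang S)" and ta: "\<And>n. ta n \<in> functors (lang S)"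
 shows "deriv S {} (sub_fm sg ta A)"
proof -
 obtain X Y where XY: "finite X" "finite Y" "over_fm X Y A" using finite_over_fm by blast
 obtain m where m: "X \<subseteq> {..<m}" using XY finite_nat_bounded by blast
 obtain n where n: "Y \<subseteq> {..<n}" using XY finite_nat_bounded by blast
 have allF: "deriv S {} ((AllF ^^ k) B)" if "deriv S {} B" for k B
  by (induction k) (auto intro: deriv.AllFI that)
 have allN: "deriv S {} ((AllN ^^ k) B)" if "deriv S {} B" for k B
  by (induction k) (auto intro: deriv.AllNI that)
 have main: "deriv S {} (sub_fm sg ta A)"
 proof -
  let ?B = "(AllN ^^ m) A"
  have "deriv S {} ?B" by (rule allN[OF A])
  \<comment> \<open>The function variables are instantiated below the \<open>m\<close> number
    quantifiers, so the functors are shifted by \<open>m\<close>. The later instantiation of the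
    number variables undoes the shift, sending \<open>x + m\<close> to \<open>x\<close>.\<close>
  have shape: "sub_fm Var ta' ((AllN ^^ j) A') = (AllN ^^ j) (sub_fm Var (%i. ren_fnl (%x. x + j) id (ta' i)) A')" for j A' ta'
  proof (induction j arbitrary: A' ta')
   case 0
   have "ren_fnl (%x. x) id u = u" for u by (simp add: ren_is_sub_fnl comp_def)
   thus ?case by (simp add: id_def)
  next
   case (Suc j)
   have "(%i. ren_fnl (%x. x + j) id (ren_fnl Suc id (ta' i))) = (%i. ren_fnl (%x. x + Suc j) id (ta' i))"
    by (simp add: ren_ren_fnl comp_def id_def)
   thus ?case by (simp add: Suc.IH id_def)
  qed
  have fin: "over_fm {} Y ?B"
  proof -
   have "over_fm {i. i + j < m} Y ((AllN ^^ j) A)" if "j \<le> m" for j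
    using that
   proof (induction j)
    case 0 thus ?case using over_mono_fm[OF XY(3), of "{i. i < m}" Y] m by auto
   next
    case (Suc j)
    have "{i. i + j < m} \<subseteq> insert 0 (Suc ` {i. i + Suc j < m})"
    proof
     fix x assume "x \<in> {i. i + j < m}"
     thus "x \<in> insert 0 (Suc ` {i. i + Suc j < m})" by (cases x) auto
    qed
    thus ?case using Suc by (auto elim!: over_mono_fm)
   qed
   from this[of m] show ?thesis by simp
  qed
  have "deriv S {} (sub_fm Var (%i. if i < n then ta i else FVar (i - n)) ?B)"
   by (rule deriv_empty_subF[OF ta allF[OF allN[OF A]]])
  also have "sub_fm Var (%i. if i < n then ta i else FVar (i - n)) ?B = sub_fm Var ta ?B"
   by (rule sub_fm_cong_over[OF fin]) (use n in auto)
  finally have "deriv S {} ((AllN ^^ m) (sub_fm Var (%i. ren_fnl (%x. x + m) id (ta i)) A))" unfolding shape .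
  from deriv_empty_subN[OF sg this]
  have "deriv S {} (sub_fm (%i. if i < m then sg i else Var (i - m)) FVar (sub_fm Var (%i. ren_fnl (%x. x + m) id (ta i)) A))" .
  also have "sub_fm (%i. if i < m then sg i else Var (i - m)) FVar (sub_fm Var (%i. ren_fnl (%x. x + m) id (ta i)) A) = sub_fm sg ta A"
   unfolding sub_fm_sub_fm
   by (rule sub_fm_cong_over[OF XY(3)]) (use m in "auto simp: sub_ren_fnl comp_def")
  finally show ?thesis .
 qed
 thus ?thesis .
qed

text \<open>A set of axioms need not be closed under substitution, so the axiom case goes through
  the empty context, where variables can be generalized. In the other cases substitution commutes
  with the rule.\<close>

lemma deriv_sub:
 "deriv S Ga A ==> (\<And>n. sg n \<in> terms (lang S)) ==> (\<And>n. ta n \<in> functors (lang S))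
  ==> deriv S (sub_fm sg ta ` Ga) (sub_fm sg ta A)"
proof (induction arbitrary: sg ta rule: deriv.induct)
 case (Axiom A Ga)
 have "deriv S {} (sub_fm sg ta A)"
  by (rule deriv_empty_sub[OF deriv.Axiom[OF Axiom.hyps]]) (use Axiom.prems in auto)
 thus ?case by (rule weaken) simp
next
 case (Hyp A Ga)
 thus ?case by (auto intro!: deriv.Hyp sub_formulas)
next
 case (BotE Ga A)
 thus ?case by (metis deriv.BotE sub_formulas sub_fm.simps(2))
next
 case (OrI1 Ga A B)
 thus ?case by (auto intro!: deriv.OrI1 sub_formulas)
next
 case (OrI2 Ga B A)
 thus ?case by (auto intro!: deriv.OrI2 sub_formulas)
next
 case (OrE Ga A B C)
 have "deriv S (sub_fm sg ta ` Ga) (Or (sub_fm sg ta A) (sub_fm sg ta B))" using OrE by simp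
 moreover have "deriv S (insert (sub_fm sg ta A) (sub_fm sg ta ` Ga)) (sub_fm sg ta C)"
  using OrE.IH(2)[of sg ta, OF OrE.prems] by simp
 moreover have "deriv S (insert (sub_fm sg ta B) (sub_fm sg ta ` Ga)) (sub_fm sg ta C)"
  using OrE.IH(3)[of sg ta, OF OrE.prems] by simp
 ultimately show ?case by (rule deriv.OrE)
next
 case (ImpI A Ga B)
 show ?case using ImpI.IH[of sg ta, OF ImpI.prems] ImpI.hyps ImpI.prems
  by (auto intro!: deriv.ImpI sub_formulas)
next
 case (ImpE Ga A B)
 show ?case using ImpE.IH(1)[of sg ta, OF ImpE.prems] ImpE.IH(2)[of sg ta, OF ImpE.prems] by (auto intro: deriv.ImpE)
next
 case (AllNI Ga A)
 have eq: "sub_fm (up_trm sg) (%n. ren_fnl Suc id (ta n)) (liftN B) = liftN (sub_fm sg ta B)" for B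
  unfolding liftN_sub sub_liftN by simp
 have "deriv S (sub_fm (up_trm sg) (%n. ren_fnl Suc id (ta n)) ` liftN ` Ga) (sub_fm (up_trm sg) (%n. ren_fnl Suc id (ta n)) A)"
  by (rule AllNI.IH) (auto simp: up_trm_def ren_terms ren_functors AllNI.prems split: nat.split)
 thus ?case by (auto simp: image_image eq intro: deriv.AllNI)
next
 case (AllFI Ga A)
 have eq: "sub_fm (%n. ren_trm id Suc (sg n)) (up_fnl ta) (liftF B) = liftF (sub_fm sg ta B)" for B
  unfolding liftF_sub sub_liftF by simp
 have "deriv S (sub_fm (%n. ren_trm id Suc (sg n)) (up_fnl ta) ` liftF ` Ga) (sub_fm (%n. ren_trm id Suc (sg n)) (up_fnl ta) A)"
  by (rule AllFI.IH) (auto simp: up_fnl_def ren_terms ren_functors AllFI.prems split: nat.split)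
 thus ?case by (auto simp: image_image eq intro: deriv.AllFI)
next
 case (AllNE Ga A t)
 have "deriv S (sub_fm sg ta ` Ga) (instN (sub_trm sg ta t) (sub_fm (up_trm sg) (%n. ren_fnl Suc id (ta n)) A))"
  using AllNE.IH[of sg ta, OF AllNE.prems] AllNE.hyps AllNE.prems by (intro deriv.AllNE) (auto intro: sub_terms)
 thus ?case unfolding instN_sub sub_instN .
next
 case (AllFE Ga A u)
 have "deriv S (sub_fm sg ta ` Ga) (instF (sub_fnl sg ta u) (sub_fm (%n. ren_trm id Suc (sg n)) (up_fnl ta) A))"
  using AllFE.IH[of sg ta, OF AllFE.prems] AllFE.hyps AllFE.prems by (intro deriv.AllFE) (auto intro: sub_functors)
 thus ?case unfolding instF_sub sub_instF .
next
 case (ExNI Ga t A)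
 have "deriv S (sub_fm sg ta ` Ga) (instN (sub_trm sg ta t) (sub_fm (up_trm sg) (%n. ren_fnl Suc id (ta n)) A))"
  unfolding instN_sub using ExNI.IH[of sg ta, OF ExNI.prems] unfolding sub_instN .
 moreover have "sub_fm (up_trm sg) (%n. ren_fnl Suc id (ta n)) A \<in> fmls S"
  by (rule sub_formulas[OF ExNI.hyps(3)]) (auto simp: up_trm_def ren_terms ren_functors ExNI.prems split: nat.split)
 ultimately show ?case
  using ExNI.hyps ExNI.prems by (auto intro!: deriv.ExNI[where t = "sub_trm sg ta t"] sub_terms)
next
 case (ExFI Ga u A)
 have "deriv S (sub_fm sg ta ` Ga) (instF (sub_fnl sg ta u) (sub_fm (%n. ren_trm id Suc (sg n)) (up_fnl ta) A))"
  unfolding instF_sub using ExFI.IH[of sg ta, OF ExFI.prems] unfolding sub_instF .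
 moreover have "sub_fm (%n. ren_trm id Suc (sg n)) (up_fnl ta) A \<in> fmls S"
  by (rule sub_formulas[OF ExFI.hyps(3)]) (auto simp: up_fnl_def ren_terms ren_functors ExFI.prems split: nat.split)
 ultimately show ?case
  using ExFI.hyps ExFI.prems by (auto intro!: deriv.ExFI[where u = "sub_fnl sg ta u"] sub_functors)
next
 case (ExNE Ga A C)
 have eq: "sub_fm (up_trm sg) (%n. ren_fnl Suc id (ta n)) (liftN B) = liftN (sub_fm sg ta B)" for B
  unfolding liftN_sub sub_liftN by simp
 have "deriv S (sub_fm (up_trm sg) (%n. ren_fnl Suc id (ta n)) ` insert A (liftN ` Ga))
   (sub_fm (up_trm sg) (%n. ren_fnl Suc id (ta n)) (liftN C))"
  by (rule ExNE.IH(2)) (auto simp: up_trm_def ren_terms ren_functors ExNE.prems split: nat.split)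
 hence "deriv S (insert (sub_fm (up_trm sg) (%n. ren_fnl Suc id (ta n)) A) (liftN ` sub_fm sg ta ` Ga)) (liftN (sub_fm sg ta C))"
  by (auto simp: image_image eq)
 moreover have "deriv S (sub_fm sg ta ` Ga) (ExN (sub_fm (up_trm sg) (%n. ren_fnl Suc id (ta n)) A))"
  using ExNE.IH(1)[of sg ta, OF ExNE.prems] by simp
 ultimately show ?case using ExNE.hyps ExNE.prems by (metis deriv.ExNE sub_formulas)
next
 case (ExFE Ga A C)
 have eq: "sub_fm (%n. ren_trm id Suc (sg n)) (up_fnl ta) (liftF B) = liftF (sub_fm sg ta B)" for B
  unfolding liftF_sub sub_liftF by simp
 have "deriv S (sub_fm (%n. ren_trm id Suc (sg n)) (up_fnl ta) ` insert A (liftF ` Ga))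
   (sub_fm (%n. ren_trm id Suc (sg n)) (up_fnl ta) (liftF C))"
  by (rule ExFE.IH(2)) (auto simp: up_fnl_def ren_terms ren_functors ExFE.prems split: nat.split)
 hence "deriv S (insert (sub_fm (%n. ren_trm id Suc (sg n)) (up_fnl ta) A) (liftF ` sub_fm sg ta ` Ga)) (liftF (sub_fm sg ta C))"
  by (auto simp: image_image eq)
 moreover have "deriv S (sub_fm sg ta ` Ga) (ExF (sub_fm (%n. ren_trm id Suc (sg n)) (up_fnl ta) A))"
  using ExFE.IH(1)[of sg ta, OF ExFE.prems] by simp
 ultimately show ?case using ExFE.hyps ExFE.prems by (metis deriv.ExFE sub_formulas)
qed (auto intro: deriv.intros)

section \<open>Quantifier rules with a named fresh variable\<close>

definition shiftN :: "nat => nat => trm" where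
 "shiftN k i = (if i = k then Var 0 else Var (Suc i))"

definition shiftF :: "nat => nat => fnl" where
 "shiftF k i = (if i = k then FVar 0 else FVar (Suc i))"

lemma shiftN_liftN: "over_fm (- {k}) UNIV B ==> sub_fm (shiftN k) FVar B = liftN B"
 by (rule sub_fm_cong_over) (auto simp: shiftN_def)

lemma shiftF_liftF: "over_fm UNIV (- {k}) B ==> sub_fm Var (shiftF k) B = liftF B"
 by (rule sub_fm_cong_over) (auto simp: shiftF_def)

lemma shiftN_instN: "over_fm (- {k}) UNIV (ExN A) ==> sub_fm (shiftN k) FVar (instN (Var k) A) = A"
proof -
 assume "over_fm (- {k}) UNIV (ExN A)"
 hence "sub_fm (Var 0 ## shiftN k) FVar A = sub_fm Var FVar A"
  by (intro sub_fm_cong_over[where X = "insert 0 (Suc ` (- {k}))" and Y = UNIV])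
   (auto simp: shiftN_def split: if_splits)
 thus ?thesis by (simp add: sub_instN shiftN_def)
qed

lemma shiftF_instF: "over_fm UNIV (- {k}) (ExF A) ==> sub_fm Var (shiftF k) (instF (FVar k) A) = A"
proof -
 assume "over_fm UNIV (- {k}) (ExF A)"
 hence "sub_fm Var (FVar 0 ## shiftF k) A = sub_fm Var FVar A"
  by (intro sub_fm_cong_over[where Y = "insert 0 (Suc ` (- {k}))" and X = UNIV])
   (auto simp: shiftF_def split: if_splits)
 thus ?thesis by (simp add: sub_instF shiftF_def)
qed

text \<open>Renaming by \<open>shiftN k\<close> turns the named variable \<open>k\<close> into the
  bound index 0. Where \<open>k\<close> does not occur this renaming is just the lift, so the de
  Bruijn rule applies to the hypotheses as it stands.\<close>

lemma fresh_AllN: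
 assumes "deriv S Ga (instN (Var k) A)" "\<And>B. B \<in> Ga ==> over_fm (- {k}) UNIV B" "over_fm (- {k}) UNIV (AllN A)"
 shows "deriv S Ga (AllN A)"
proof (rule deriv.AllNI)
 have "deriv S (sub_fm (shiftN k) FVar ` Ga) (sub_fm (shiftN k) FVar (instN (Var k) A))"
  by (rule deriv_sub[OF assms(1)]) (auto simp: shiftN_def)
 thus "deriv S (liftN ` Ga) A"
  using assms(2,3) by (simp add: shiftN_liftN shiftN_instN cong: image_cong)
qed

lemma fresh_AllF:
 assumes "deriv S Ga (instF (FVar k) A)" "\<And>B. B \<in> Ga ==> over_fm UNIV (- {k}) B" "over_fm UNIV (- {k}) (AllF A)"
 shows "deriv S Ga (AllF A)"
proof (rule deriv.AllFI)
 have "deriv S (sub_fm Var (shiftF k) ` Ga) (sub_fm Var (shiftF k) (instF (FVar k) A))"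
  by (rule deriv_sub[OF assms(1)]) (auto simp: shiftF_def)
 thus "deriv S (liftF ` Ga) A"
  using assms(2,3) by (simp add: shiftF_liftF shiftF_instF cong: image_cong)
qed

lemma fresh_ExN:
 assumes "deriv S (insert (instN (Var k) A) Ga) C" "\<And>B. B \<in> Ga ==> over_fm (- {k}) UNIV B"
  "over_fm (- {k}) UNIV C" "ExN A \<in> Ga" "ExN A \<in> fmls S"
 shows "deriv S Ga C"
proof (rule deriv.ExNE)
 have "deriv S (sub_fm (shiftN k) FVar ` insert (instN (Var k) A) Ga) (sub_fm (shiftN k) FVar C)"
  by (rule deriv_sub[OF assms(1)]) (auto simp: shiftN_def)
 thus "deriv S (insert A (liftN ` Ga)) (liftN C)"
  using assms(2,3) shiftN_instN[OF assms(2)[OF assms(4)]] by (simp add: shiftN_liftN cong: image_cong)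
qed (use assms deriv_formula deriv.Hyp in auto)

lemma fresh_ExF:
 assumes "deriv S (insert (instF (FVar k) A) Ga) C" "\<And>B. B \<in> Ga ==> over_fm UNIV (- {k}) B"
  "over_fm UNIV (- {k}) C" "ExF A \<in> Ga" "ExF A \<in> fmls S"
 shows "deriv S Ga C"
proof (rule deriv.ExFE)
 have "deriv S (sub_fm Var (shiftF k) ` insert (instF (FVar k) A) Ga) (sub_fm Var (shiftF k) C)"
  by (rule deriv_sub[OF assms(1)]) (auto simp: shiftF_def)
 thus "deriv S (insert A (liftF ` Ga)) (liftF C)"
  using assms(2,3) shiftF_instF[OF assms(2)[OF assms(4)]] by (simp add: shiftF_liftF cong: image_cong)
qed (use assms deriv_formula deriv.Hyp in auto)

instance prd :: countable by countable_datatype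
instance fsym :: countable by countable_datatype
instance trm :: countable by countable_datatype
instance fm :: countable by countable_datatype

section \<open>The canonical Kripke model\<close>

text \<open>
 A world consists of a saturated theory and of the set of the indices of both sorts that may
 occur in it; infinitely many indices stay unused and serve as fresh constants of later worlds.
\<close>

datatype world = World (tru: "fm set") (ids: "nat set")

definition Fm :: "fsystem => nat set => fm set" where
 "Fm S X = {A \<in> fmls S. over_fm X X A}"

definition T :: "fsystem => world => trm set" where
 "T S w = {t \<in> terms (lang S). over_trm (ids w) (ids w) t}"

definition F :: "fsystem => world => fnl set" where
 "F S w = {u \<in> functors (lang S). over_fnl (ids w) (ids w) u}"

definition wrld :: "fsystem => world => bool" where
 "wrld S w <-> infinite (- ids w) \<and> tru w \<subseteq> Fm S (ids w) \<and>
  (\<forall>A \<in> Fm S (ids w). deriv S (tru w) A --> A \<in> tru w) \<and> Bot \<notin> tru w \<and>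
  (\<forall>A B. Or A B \<in> tru w --> A \<in> tru w \<or> B \<in> tru w) \<and>
  (\<forall>A. ExN A \<in> tru w --> (\<exists>t \<in> T S w. instN t A \<in> tru w)) \<and>
  (\<forall>A. ExF A \<in> tru w --> (\<exists>u \<in> F S w. instF u A \<in> tru w))"

definition wle :: "world => world => bool"  (infix "<<" 50) where
 "w << w' <-> tru w \<subseteq> tru w' \<and> ids w \<subseteq> ids w'"

lemma wle_refl [simp]: "w << w" by (simp add: wle_def)
lemma wle_trans [trans]: "w << w' ==> w' << w'' ==> w << w''" by (auto simp: wle_def)

lemma Fm_mono: "X \<subseteq> X' ==> Fm S X \<subseteq> Fm S X'"
 by (auto simp: Fm_def intro: over_mono_fm)

lemma T_mono: "w << w' ==> t \<in> T S w ==> t \<in> T S w'"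
 by (auto simp: T_def wle_def intro: over_mono)

lemma F_mono: "w << w' ==> u \<in> F S w ==> u \<in> F S w'"
 by (auto simp: F_def wle_def intro: over_mono_fnl)

lemma finite_support: "finite G ==> \<exists>U. finite U \<and> (\<forall>B\<in>G. over_fm U U B)"
proof (induction rule: finite_induct)
 case (insert A G)
 then obtain U where U: "finite U" "\<forall>B\<in>G. over_fm U U B" by auto
 obtain X Y where XY: "finite X" "finite Y" "over_fm X Y A" using finite_over_fm by blast
 have "\<forall>B \<in> insert A G. over_fm (U \<union> X \<union> Y) (U \<union> X \<union> Y) B"
  using U(2) XY(3) by (auto elim!: over_mono_fm)
 moreover have "finite (U \<union> X \<union> Y)" using U XY by simp
 ultimately show ?case by (intro exI conjI)
qed auto

text \<open>Only finitely many formulas have been added to \<open>Ga\<close>, so some index of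
  \<open>X' - X\<close> occurs in none of them, nor in \<open>Ga\<close>. Such a fresh variable can
  witness an existential formula without making \<open>C\<close> derivable.\<close>

lemma henkin_step:
 assumes Ga: "Ga \<subseteq> Fm S X" and X: "X \<subseteq> X'" "infinite (X' - X)" and C: "C \<in> fmls S"
  and G: "G \<subseteq> Fm S X'" "finite (G - Ga)" "\<not> deriv S G C" and ph: "ph \<in> Fm S X'" "\<not> deriv S (insert ph G) C"
 shows "\<exists>G'. G' \<subseteq> Fm S X' \<and> finite (G' - Ga) \<and> \<not> deriv S G' C \<and> insert ph G \<subseteq> G' \<and>
  (\<forall>A. ph = ExN A --> (\<exists>k\<in>X'. instN (Var k) A \<in> G')) \<and> (\<forall>A. ph = ExF A --> (\<exists>k\<in>X'. instF (FVar k) A \<in> G'))"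
proof -
 have "finite (insert C (insert ph (G - Ga)))" using G by simp
 from finite_support[OF this] obtain U where U: "finite U" "\<forall>B\<in>insert C (insert ph (G - Ga)). over_fm U U B" by blast
 have "infinite (X' - X - U)" using X U by simp
 then obtain k where k: "k \<in> X'" "k \<notin> X" "k \<notin> U" by (metis DiffE finite.emptyI subsetI subset_empty)
 have ov: "over_fm (- {k}) (- {k}) B" if "B \<in> insert C (insert ph G)" for B
 proof (cases "B \<in> Ga")
  case True thus ?thesis using Ga k by (auto simp: Fm_def elim!: over_mono_fm)
 next
  case False thus ?thesis using U k that by (auto elim!: over_mono_fm)
 qed
 have ov1: "over_fm (- {k}) UNIV B" "over_fm UNIV (- {k}) B" if "B \<in> insert C (insert ph G)" for B
  using ov[OF that] by (auto elim!: over_mono_fm)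
 have fin: "finite (insert B (insert ph G) - Ga)" for B
  by (rule finite_subset[of _ "insert B (insert ph (G - Ga))"]) (use G in auto)
 have fin': "finite (insert ph G - Ga)"
  by (rule finite_subset[of _ "insert ph (G - Ga)"]) (use G in auto)
 consider A where "ph = ExN A" | A where "ph = ExF A" | "\<forall>A. ph \<noteq> ExN A" "\<forall>A. ph \<noteq> ExF A" by blast
 thus ?thesis
 proof cases
  case 1
  have "instN (Var k) A \<in> Fm S X'"
   using ph(1) k 1 by (auto simp: Fm_def instN_def split: nat.split intro!: sub_formulas elim!: over_sub_fm)
  moreover have "\<not> deriv S (insert (instN (Var k) A) (insert ph G)) C"
   using fresh_ExN[of S k A "insert ph G" C] ov1 ph 1 by (auto simp: Fm_def)
  ultimately show ?thesis
   using 1 k ph G fin by (intro exI[of _ "insert (instN (Var k) A) (insert ph G)"]) auto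
 next
  case 2
  have "instF (FVar k) A \<in> Fm S X'"
   using ph(1) k 2 by (auto simp: Fm_def instF_def split: nat.split intro!: sub_formulas elim!: over_sub_fm)
  moreover have "\<not> deriv S (insert (instF (FVar k) A) (insert ph G)) C"
   using fresh_ExF[of S k A "insert ph G" C] ov1 ph 2 by (auto simp: Fm_def)
  ultimately show ?thesis
   using 2 k ph G fin by (intro exI[of _ "insert (instF (FVar k) A) (insert ph G)"]) auto
 next
  case 3
  thus ?thesis using ph G fin' by (intro exI[of _ "insert ph G"]) auto
 qed
qed

text \<open>Lindenbaum construction. The spare indices are split into two infinite sets: one
  supplies the witnesses of the new world, the other stays spare for later worlds. A formula left
  out of the limit derives \<open>C\<close> together with it; so if both disjuncts were left out,
  the disjunction would derive \<open>C\<close>.\<close>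

lemma extension:
 assumes Ga: "Ga \<subseteq> Fm S X" and X: "infinite (- X)" and C: "C \<in> Fm S X" and nd: "\<not> deriv S Ga C"
 shows "\<exists>w. wrld S w \<and> Ga \<subseteq> tru w \<and> X \<subset> ids w \<and> C \<notin> tru w"
proof -
 obtain Z V where "Z \<subseteq> - X" "V \<subseteq> - X" "infinite Z" "infinite V" "Z \<inter> V = {}"
  using infinite_split[OF X] by metis
 moreover from this have "V \<subseteq> - X - Z" by auto
 ultimately have Z: "Z \<subseteq> - X" "infinite Z" "infinite (- X - Z)" by (auto dest: finite_subset)
 define X' where "X' = X \<union> Z"
 have XX: "X \<subseteq> X'" "infinite (X' - X)" "infinite (- X')"
 proof -
  have "X' - X = Z" "- X' = - X - Z" using Z by (auto simp: X'_def)
  thus "infinite (X' - X)" "infinite (- X')" using Z by simp_all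
 qed (simp add: X'_def)
 have C': "C \<in> fmls S" using C by (simp add: Fm_def)
 \<comment> \<open>Finiteness of \<open>G - Ga\<close> keeps a fresh witness available at every
   stage.\<close>
 define good where "good G <-> G \<subseteq> Fm S X' \<and> finite (G - Ga) \<and> \<not> deriv S G C" for G
 define R where "R ph G G' <-> good G' \<and> G \<subseteq> G' \<and> (ph \<in> Fm S X' --> \<not> deriv S (insert ph G) C --> ph \<in> G' \<and>
  (\<forall>A. ph = ExN A --> (\<exists>k\<in>X'. instN (Var k) A \<in> G')) \<and> (\<forall>A. ph = ExF A --> (\<exists>k\<in>X'. instF (FVar k) A \<in> G')))" for ph G G'
 have step: "\<exists>G'. R ph G G'" if "good G" for ph G
 proof (cases "ph \<in> Fm S X' \<and> \<not> deriv S (insert ph G) C")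
  case True
  with that have "G \<subseteq> Fm S X'" "finite (G - Ga)" "\<not> deriv S G C" "ph \<in> Fm S X'" "\<not> deriv S (insert ph G) C"
   by (auto simp: good_def)
  from henkin_step[OF Ga XX(1,2) C' this] obtain G' where G': "G' \<subseteq> Fm S X'" "finite (G' - Ga)"
   "\<not> deriv S G' C" "insert ph G \<subseteq> G'" "\<forall>A. ph = ExN A --> (\<exists>k\<in>X'. instN (Var k) A \<in> G')"
   "\<forall>A. ph = ExF A --> (\<exists>k\<in>X'. instF (FVar k) A \<in> G')" by (elim exE conjE)
  have "R ph G G'" unfolding R_def good_def by (intro conjI impI) (use G' in simp_all)
  thus ?thesis by (rule exI)
 next
  case False thus ?thesis using that by (auto simp: R_def)
 qed
 define nxt where "nxt ph G = (SOME G'. R ph G G')" for ph G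
 have nxt: "R ph G (nxt ph G)" if "good G" for ph G unfolding nxt_def using step[OF that] by (rule someI_ex)
 define st where "st = rec_nat Ga (%n G. nxt (from_nat n) G)"
 have st0: "st 0 = Ga" and stS: "st (Suc n) = nxt (from_nat n) (st n)" for n by (simp_all add: st_def)
 have good: "good (st n)" for n
 proof (induction n)
  case 0 thus ?case using Ga nd Fm_mono[OF XX(1)] by (auto simp: st0 good_def)
 next
  case (Suc n) thus ?case using nxt stS by (auto simp: R_def)
 qed
 have R: "R (from_nat n) (st n) (st (Suc n))" for n using nxt[OF good] stS by simp
 have mono: "st m \<subseteq> st n" if "m \<le> n" for m n
  by (rule lift_Suc_mono_le[OF _ that]) (use R in "auto simp: R_def")
 define De where "De = (\<Union>n. st n)"
 have fin: "\<exists>n. H \<subseteq> st n" if "finite H" "H \<subseteq> De" for H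
  using that
 proof (induction rule: finite_induct)
  case (insert x H)
  then obtain n m where "H \<subseteq> st n" "x \<in> st m" by (auto simp: De_def)
  hence "insert x H \<subseteq> st (max m n)" using mono[of m "max m n"] mono[of n "max m n"] by auto
  thus ?case by (rule exI)
 qed auto
 have ndC: "\<not> deriv S De C"
 proof
  assume "deriv S De C"
  from compact[OF this] obtain H where H: "finite H" "H \<subseteq> De" "deriv S H C" by (elim exE conjE)
  from fin[OF H(1,2)] obtain n where "H \<subseteq> st n" ..
  with weaken[OF H(3)] good[of n] show False unfolding good_def by simp
 qed
 have De: "De \<subseteq> Fm S X'" using good by (auto simp: De_def good_def)
 \<comment> \<open>Each formula is considered at the stage that is its code, and it is rejected
   there only because it would make \<open>C\<close> derivable.\<close>
 have dec: "deriv S (insert ph (st n)) C" if "ph \<in> Fm S X'" "ph \<notin> De" "from_nat n = ph" for ph n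
 proof (rule ccontr)
  assume "\<not> ?thesis"
  hence "ph \<in> st (Suc n)" using R[of n] that by (auto simp: R_def)
  thus False using that by (auto simp: De_def)
 qed
 have dec': "deriv S (insert ph De) C" if "ph \<in> Fm S X'" "ph \<notin> De" for ph
  by (rule weaken[OF dec[OF that from_nat_to_nat]]) (auto simp: De_def)
 have closed: "A \<in> De" if "A \<in> Fm S X'" "deriv S De A" for A
  using dec'[OF that(1)] cut[OF that(2)] ndC by blast
 have wit: "ph \<in> De ==> (\<forall>A. ph = ExN A --> (\<exists>k\<in>X'. instN (Var k) A \<in> De)) \<and> (\<forall>A. ph = ExF A --> (\<exists>k\<in>X'. instF (FVar k) A \<in> De))" for ph
 proof -
  assume "ph \<in> De"
  let ?n = "to_nat ph"
  have "ph \<in> Fm S X'" using \<open>ph \<in> De\<close> De by auto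
  moreover have "\<not> deriv S (insert ph (st ?n)) C"
   using ndC weaken[of S "insert ph (st ?n)" C De] \<open>ph \<in> De\<close> by (auto simp: De_def)
  ultimately show ?thesis using R[of ?n] by (auto simp: R_def De_def) blast+
 qed
 have w: "wrld S (World De X')"
  unfolding wrld_def world.sel
 proof (intro conjI allI ballI impI)
  show "Bot \<notin> De"
  proof
   assume "Bot \<in> De"
   hence "deriv S De Bot" by (auto intro: deriv.Hyp)
   thus False using ndC deriv.BotE C' by blast
  qed
  fix A B assume AB: "Or A B \<in> De"
  show "A \<in> De \<or> B \<in> De"
  proof (rule ccontr)
   assume n: "\<not> ?thesis"
   have "Or A B \<in> Fm S X'" using AB De by auto
   hence "A \<in> Fm S X'" "B \<in> Fm S X'" by (auto simp: Fm_def)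
   hence "deriv S (insert A De) C" "deriv S (insert B De) C" using n dec' by auto
   moreover have "deriv S De (Or A B)" using AB \<open>Or A B \<in> Fm S X'\<close> by (auto intro: deriv.Hyp simp: Fm_def)
   ultimately show False using ndC deriv.OrE by blast
  qed
 next
  fix A assume "ExN A \<in> De"
  then obtain k where "k \<in> X'" "instN (Var k) A \<in> De" using wit by blast
  thus "\<exists>t\<in>T S (World De X'). instN t A \<in> De" by (intro bexI[of _ "Var k"]) (auto simp: T_def)
 next
  fix A assume "ExF A \<in> De"
  then obtain k where "k \<in> X'" "instF (FVar k) A \<in> De" using wit by blast
  thus "\<exists>t\<in>F S (World De X'). instF t A \<in> De" by (intro bexI[of _ "FVar k"]) (auto simp: F_def)
 qed (use XX De closed in auto)
 moreover have "C \<notin> De" using ndC C' deriv.Hyp by blast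
 moreover have "Ga \<subseteq> De" using st0 by (auto simp: De_def)
 moreover have "X \<subset> X'" using XX Z by (auto simp: X'_def infinite_imp_nonempty)
 ultimately show ?thesis by (intro exI[of _ "(World De X')"]) auto
qed

section \<open>Truth in a world and completeness\<close>

definition env :: "fsystem => world => (nat => trm) => (nat => fnl) => bool" where
 "env S w rh th <-> (\<forall>n. rh n \<in> T S w) \<and> (\<forall>n. th n \<in> F S w)"

lemma env_mono: "env S w rh th ==> w << w' ==> env S w' rh th"
 by (auto simp: env_def T_mono F_mono)

lemma env_consN: "env S w rh th ==> t \<in> T S w ==> env S w (t ## rh) th"
 by (auto simp: env_def split: nat.split)

lemma env_consF: "env S w rh th ==> u \<in> F S w ==> env S w rh (u ## th)"
 by (auto simp: env_def split: nat.split)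

lemma insert_0_range_Suc: "insert 0 (range Suc) = UNIV"
 by (metis UNIV_eq_I insertCI nat.exhaust rangeI)

lemma over_UNIV [simp]: "over_trm UNIV UNIV t"
 and over_UNIV_fnl [simp]: "over_fnl UNIV UNIV u"
 by (induction t and u) (auto simp: insert_0_range_Suc)

lemma over_UNIV_fm [simp]: "over_fm UNIV UNIV A"
 by (induction A) (auto simp: insert_0_range_Suc)

lemma sub_T: "env S w rh th ==> t \<in> terms (lang S) ==> sub_trm rh th t \<in> T S w"
 by (auto simp: T_def F_def env_def intro!: sub_terms over_sub[of UNIV UNIV])

lemma sub_F: "env S w rh th ==> u \<in> functors (lang S) ==> sub_fnl rh th u \<in> F S w"
 by (auto simp: T_def F_def env_def intro!: sub_functors over_sub_fnl[of UNIV UNIV])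

lemma sub_Fm: "env S w rh th ==> A \<in> fmls S ==> sub_fm rh th A \<in> Fm S (ids w)"
 by (auto simp: T_def F_def Fm_def env_def intro!: sub_formulas over_sub_fm[of UNIV UNIV])

text \<open>Truth is membership of the instance in the theory of the world. The Kripke clauses are
  thus not a definition but theorems, which together form the truth lemma.\<close>

definition sat :: "world => (nat => trm) => (nat => fnl) => fm => bool" where
 "sat w rh th A <-> sub_fm rh th A \<in> tru w"

lemma sat_formula: "wrld S w ==> sat w rh th A ==> A \<in> fmls S"
 unfolding sat_def wrld_def Fm_def using unsub_formulas by blast

lemma sat_mono: "sat w rh th A ==> w << w' ==> sat w' rh th A"
 by (auto simp: sat_def wle_def)

lemma closed: "wrld S w ==> A \<in> Fm S (ids w) ==> deriv S (tru w) A ==> A \<in> tru w"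
 by (simp add: wrld_def)

lemma in_world_deriv: "wrld S w ==> A \<in> tru w ==> deriv S (tru w) A"
 by (auto simp: wrld_def Fm_def intro: deriv.Hyp)

lemma in_world_Fm: "wrld S w ==> A \<in> tru w ==> A \<in> Fm S (ids w)"
 by (auto simp: wrld_def)

lemma sat_Bot [simp]: "wrld S w ==> \<not> sat w rh th Bot"
 by (simp add: sat_def wrld_def)

lemma sat_And: 
 assumes "wrld S w"
 shows "sat w rh th (And A B) <-> sat w rh th A \<and> sat w rh th B"
proof -
 have "And A B \<in> tru w <-> A \<in> tru w \<and> B \<in> tru w" for A B
 proof
  assume *: "And A B \<in> tru w"
  hence "A \<in> Fm S (ids w)" "B \<in> Fm S (ids w)" using in_world_Fm[OF assms] by (fastforce simp: Fm_def)+
  thus "A \<in> tru w \<and> B \<in> tru w"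
   using closed[OF assms] deriv.AndE1 deriv.AndE2 in_world_deriv[OF assms *] by blast
 next
  assume *: "A \<in> tru w \<and> B \<in> tru w"
  hence "And A B \<in> Fm S (ids w)" using in_world_Fm[OF assms] by (fastforce simp: Fm_def)
  thus "And A B \<in> tru w"
   using closed[OF assms] deriv.AndI in_world_deriv[OF assms] * by blast
 qed
 thus ?thesis by (simp add: sat_def)
qed

lemma sat_Or:
 assumes "wrld S w" "env S w rh th" "A \<in> fmls S" "B \<in> fmls S"
 shows "sat w rh th (Or A B) <-> sat w rh th A \<or> sat w rh th B"
proof
 assume "sat w rh th (Or A B)"
 thus "sat w rh th A \<or> sat w rh th B" using assms(1) by (simp add: sat_def wrld_def)
next
 have "sub_fm rh th (Or A B) \<in> Fm S (ids w)" by (rule sub_Fm) (use assms in auto)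
 moreover have "sub_fm rh th A \<in> fmls S" "sub_fm rh th B \<in> fmls S"
  using sub_Fm[OF assms(2)] assms(3,4) by (auto simp: Fm_def)
 moreover assume "sat w rh th A \<or> sat w rh th B"
 ultimately show "sat w rh th (Or A B)" unfolding sat_def
  using deriv.OrI1 deriv.OrI2 closed[OF assms(1)] in_world_deriv[OF assms(1)] by (metis sub_fm.simps(4))
qed

text \<open>If \<open>B\<close> did not follow from the theory together with \<open>A\<close>, a
  later world could contain \<open>A\<close> and omit \<open>B\<close>.\<close>

lemma sat_Imp:
 assumes "wrld S w" "env S w rh th" "A \<in> fmls S" "B \<in> fmls S"
 shows "sat w rh th (Imp A B) <-> (\<forall>w'. wrld S w' --> w << w' --> sat w' rh th A --> sat w' rh th B)"
proof (intro iffI allI impI)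
 fix w' assume "sat w rh th (Imp A B)" "wrld S w'" "w << w'" "sat w' rh th A"
 moreover from this have "sat w' rh th (Imp A B)" using sat_mono by blast
 moreover have "sub_fm rh th B \<in> Fm S (ids w')" by (rule sub_Fm[OF env_mono[OF assms(2) \<open>w << w'\<close>] assms(4)])
 ultimately show "sat w' rh th B" unfolding sat_def
  using deriv.ImpE closed in_world_deriv by (metis sub_fm.simps(5))
next
 assume *: "\<forall>w'. wrld S w' --> w << w' --> sat w' rh th A --> sat w' rh th B"
 let ?A = "sub_fm rh th A" and ?B = "sub_fm rh th B"
 have A: "?A \<in> Fm S (ids w)" and B: "?B \<in> Fm S (ids w)" and AB: "Imp ?A ?B \<in> Fm S (ids w)"
  using sub_Fm[OF assms(2) assms(3)] sub_Fm[OF assms(2) assms(4)] by (auto simp: Fm_def)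
 have "deriv S (insert ?A (tru w)) ?B"
 proof (rule ccontr)
  assume "\<not> ?thesis"
  moreover have "insert ?A (tru w) \<subseteq> Fm S (ids w)" "infinite (- ids w)" using assms(1) A by (auto simp: wrld_def)
  ultimately obtain w' where w': "wrld S w'" "insert ?A (tru w) \<subseteq> tru w'" "ids w \<subset> ids w'" "?B \<notin> tru w'"
   using extension[OF _ _ B, of "insert ?A (tru w)"] by blast
  hence "w << w'" "sat w' rh th A" by (auto simp: sat_def wle_def)
  with * w'(1,4) show False unfolding sat_def by blast
 qed
 thus "sat w rh th (Imp A B)"
  using A AB by (auto simp: sat_def Fm_def intro!: closed[OF assms(1)] deriv.ImpI)
qed

text \<open>The instance at a spare variable \<open>k\<close> must be derivable, for otherwise a
  later world that owns \<open>k\<close> would omit it. As \<open>k\<close> occurs nowhere in the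
  theory, \<open>fresh_AllN\<close> generalizes it.\<close>

lemma sat_AllN:
 assumes "wrld S w" "env S w rh th" "A \<in> fmls S"
 shows "sat w rh th (AllN A) <-> (\<forall>w'. wrld S w' --> w << w' --> (\<forall>t\<in>T S w'. sat w' (t ## rh) th A))"
proof (intro iffI allI impI ballI)
 fix w' t assume "sat w rh th (AllN A)" and w': "wrld S w'" "w << w'" and t: "t \<in> T S w'"
 hence "sub_fm rh th (AllN A) \<in> tru w'" using sat_mono sat_def by blast
 from deriv.AllNE[OF in_world_deriv[OF w'(1) this[simplified]], of t] t
 have "deriv S (tru w') (sub_fm (t ## rh) th A)" unfolding instN_sub by (auto simp: T_def)
 thus "sat w' (t ## rh) th A" unfolding sat_def
  by (rule closed[OF w'(1), rotated]) (rule sub_Fm[OF env_consN[OF env_mono[OF assms(2) w'(2)] t] assms(3)])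
next
 assume *: "\<forall>w'. wrld S w' --> w << w' --> (\<forall>t\<in>T S w'. sat w' (t ## rh) th A)"
 let ?A = "sub_fm (up_trm rh) (%n. ren_fnl Suc id (th n)) A"
 have AA: "sub_fm rh th (AllN A) \<in> Fm S (ids w)" by (rule sub_Fm[OF assms(2)]) (use assms in auto)
 hence A: "AllN ?A \<in> Fm S (ids w)" by simp
 have inf: "infinite (- ids w)" using assms(1) by (simp add: wrld_def)
 then obtain k where k: "k \<notin> ids w" by (metis ComplD ex_in_conv finite.emptyI)
 have "deriv S (tru w) (instN (Var k) ?A)"
 proof (rule ccontr)
  assume n: "\<not> ?thesis"
  have 1: "tru w \<subseteq> Fm S (insert k (ids w))" using assms(1) Fm_mono[of "ids w" "insert k (ids w)"] by (auto simp: wrld_def)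
  have 2: "infinite (- insert k (ids w))" using inf by (simp add: Compl_insert)
  have "instN (Var k) ?A \<in> Fm S (insert k (ids w))"
   using A by (auto simp: Fm_def instN_def split: nat.split intro!: sub_formulas elim!: over_sub_fm)
  from extension[OF 1 2 this n] obtain w' where w': "wrld S w'" "tru w \<subseteq> tru w'" "insert k (ids w) \<subset> ids w'"
   "instN (Var k) ?A \<notin> tru w'" by blast
  hence "Var k \<in> T S w'" "w << w'" by (auto simp: T_def wle_def)
  with * w'(1) have "sat w' (Var k ## rh) th A" by blast
  thus False using w'(4) unfolding instN_sub sat_def by simp
 qed
 hence "deriv S (tru w) (AllN ?A)"
 proof (rule fresh_AllN)
  show "over_fm (- {k}) UNIV B" if "B \<in> tru w" for B
   using in_world_Fm[OF assms(1) that] k by (auto simp: Fm_def elim!: over_mono_fm)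
  show "over_fm (- {k}) UNIV (AllN ?A)"
   by (rule over_mono_fm[of "ids w" "ids w"]) (use A k in "auto simp: Fm_def")
 qed
 thus "sat w rh th (AllN A)" using closed[OF assms(1) A] by (simp add: sat_def)
qed

lemma sat_AllF:
 assumes "wrld S w" "env S w rh th" "A \<in> fmls S"
 shows "sat w rh th (AllF A) <-> (\<forall>w'. wrld S w' --> w << w' --> (\<forall>t\<in>F S w'. sat w' rh (t ## th) A))"
proof (intro iffI allI impI ballI)
 fix w' t assume "sat w rh th (AllF A)" and w': "wrld S w'" "w << w'" and t: "t \<in> F S w'"
 hence "sub_fm rh th (AllF A) \<in> tru w'" using sat_mono sat_def by blast
 from deriv.AllFE[OF in_world_deriv[OF w'(1) this[simplified]], of t] t
 have "deriv S (tru w') (sub_fm rh (t ## th) A)" unfolding instF_sub by (auto simp: F_def)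
 thus "sat w' rh (t ## th) A" unfolding sat_def
  by (rule closed[OF w'(1), rotated]) (rule sub_Fm[OF env_consF[OF env_mono[OF assms(2) w'(2)] t] assms(3)])
next
 assume *: "\<forall>w'. wrld S w' --> w << w' --> (\<forall>t\<in>F S w'. sat w' rh (t ## th) A)"
 let ?A = "sub_fm (%n. ren_trm id Suc (rh n)) (up_fnl th) A"
 have AA: "sub_fm rh th (AllF A) \<in> Fm S (ids w)" by (rule sub_Fm[OF assms(2)]) (use assms in auto)
 hence A: "AllF ?A \<in> Fm S (ids w)" by simp
 have inf: "infinite (- ids w)" using assms(1) by (simp add: wrld_def)
 then obtain k where k: "k \<notin> ids w" by (metis ComplD ex_in_conv finite.emptyI)
 have "deriv S (tru w) (instF (FVar k) ?A)"
 proof (rule ccontr)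
  assume n: "\<not> ?thesis"
  have 1: "tru w \<subseteq> Fm S (insert k (ids w))" using assms(1) Fm_mono[of "ids w" "insert k (ids w)"] by (auto simp: wrld_def)
  have 2: "infinite (- insert k (ids w))" using inf by (simp add: Compl_insert)
  have "instF (FVar k) ?A \<in> Fm S (insert k (ids w))"
   using A by (auto simp: Fm_def instF_def split: nat.split intro!: sub_formulas elim!: over_sub_fm)
  from extension[OF 1 2 this n] obtain w' where w': "wrld S w'" "tru w \<subseteq> tru w'" "insert k (ids w) \<subset> ids w'"
   "instF (FVar k) ?A \<notin> tru w'" by blast
  hence "FVar k \<in> F S w'" "w << w'" by (auto simp: F_def wle_def)
  with * w'(1) have "sat w' rh (FVar k ## th) A" by blast
  thus False using w'(4) unfolding instF_sub sat_def by simp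
 qed
 hence "deriv S (tru w) (AllF ?A)"
 proof (rule fresh_AllF)
  show "over_fm UNIV (- {k}) B" if "B \<in> tru w" for B
   using in_world_Fm[OF assms(1) that] k by (auto simp: Fm_def elim!: over_mono_fm)
  show "over_fm UNIV (- {k}) (AllF ?A)"
   by (rule over_mono_fm[of "ids w" "ids w"]) (use A k in "auto simp: Fm_def")
 qed
 thus "sat w rh th (AllF A)" using closed[OF assms(1) A] by (simp add: sat_def)
qed

lemma sat_ExN:
 assumes "wrld S w" "env S w rh th" "A \<in> fmls S"
 shows "sat w rh th (ExN A) <-> (\<exists>t\<in>T S w. sat w (t ## rh) th A)"
proof
 assume "sat w rh th (ExN A)"
 hence "ExN (sub_fm (up_trm rh) (%n. ren_fnl Suc id (th n)) A) \<in> tru w" by (simp add: sat_def)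
 with assms(1) obtain t where "t \<in> T S w" "instN t (sub_fm (up_trm rh) (%n. ren_fnl Suc id (th n)) A) \<in> tru w"
  unfolding wrld_def by blast
 thus "\<exists>t\<in>T S w. sat w (t ## rh) th A" unfolding sat_def instN_sub by blast
next
 assume "\<exists>t\<in>T S w. sat w (t ## rh) th A"
 then obtain t where t: "t \<in> T S w" "instN t (sub_fm (up_trm rh) (%n. ren_fnl Suc id (th n)) A) \<in> tru w"
  unfolding sat_def instN_sub by blast
 have *: "sub_fm rh th (ExN A) \<in> Fm S (ids w)" by (rule sub_Fm[OF assms(2)]) (use assms in auto)
 show "sat w rh th (ExN A)" unfolding sat_def
  by (rule closed[OF assms(1) *]) (use * t in_world_deriv[OF assms(1) t(2)] in "auto simp: Fm_def T_def intro: deriv.ExNI")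
qed

lemma sat_ExF:
 assumes "wrld S w" "env S w rh th" "A \<in> fmls S"
 shows "sat w rh th (ExF A) <-> (\<exists>t\<in>F S w. sat w rh (t ## th) A)"
proof
 assume "sat w rh th (ExF A)"
 hence "ExF (sub_fm (%n. ren_trm id Suc (rh n)) (up_fnl th) A) \<in> tru w" by (simp add: sat_def)
 with assms(1) obtain t where "t \<in> F S w" "instF t (sub_fm (%n. ren_trm id Suc (rh n)) (up_fnl th) A) \<in> tru w"
  unfolding wrld_def by blast
 thus "\<exists>t\<in>F S w. sat w rh (t ## th) A" unfolding sat_def instF_sub by blast
next
 assume "\<exists>t\<in>F S w. sat w rh (t ## th) A"
 then obtain t where t: "t \<in> F S w" "instF t (sub_fm (%n. ren_trm id Suc (rh n)) (up_fnl th) A) \<in> tru w"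
  unfolding sat_def instF_sub by blast
 have *: "sub_fm rh th (ExF A) \<in> Fm S (ids w)" by (rule sub_Fm[OF assms(2)]) (use assms in auto)
 show "sat w rh th (ExF A)" unfolding sat_def
  by (rule closed[OF assms(1) *]) (use * t in_world_deriv[OF assms(1) t(2)] in "auto simp: Fm_def F_def intro: deriv.ExFI")
qed

lemma sat_theorem:
 assumes "wrld S w" "env S w rh th" "deriv S {} A"
 shows "sat w rh th A"
proof -
 have "deriv S {} (sub_fm rh th A)"
  by (rule deriv_empty_sub[OF assms(3)]) (use assms(2) in "auto simp: env_def T_def F_def")
 thus ?thesis unfolding sat_def
  using closed[OF assms(1) sub_Fm[OF assms(2) deriv_formula[OF assms(3)]]] weaken by blast
qed

lemma sat_sub: "sat w rh th (sub_fm sg ta A) <-> sat w (%n. sub_trm rh th (sg n)) (%n. sub_fnl rh th (ta n)) A"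
 by (simp add: sat_def sub_fm_sub_fm)

text \<open>Finitely many formulas leave infinitely many indices spare, as a world requires; from
  these formulas \<open>extension\<close> builds a countermodel.\<close>

lemma completeness:
 assumes Ga: "Ga \<subseteq> fmls S" "finite Ga" and A: "A \<in> fmls S"
  and val: "\<And>w rh th. wrld S w ==> env S w rh th ==> (\<And>B. B \<in> Ga ==> sat w rh th B) ==> sat w rh th A"
 shows "deriv S Ga A"
proof (rule ccontr)
 assume n: "\<not> ?thesis"
 obtain U where U: "finite U" "\<forall>B\<in>insert A Ga. over_fm U U B" using finite_support[of "insert A Ga"] Ga by auto
 have 1: "Ga \<subseteq> Fm S U" "A \<in> Fm S U" using U Ga A by (auto simp: Fm_def)
 have 2: "infinite (- U)" using U by simp
 from extension[OF 1(1) 2 1(2) n] obtain w where w: "wrld S w" "Ga \<subseteq> tru w" "U \<subset> ids w" "A \<notin> tru w" by blast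
 then obtain k where k: "k \<in> ids w" by blast
 \<comment> \<open>An environment may only use indices of the world. The others are sent to some
   \<open>k\<close> of the world, which exists because \<open>U\<close> is a proper subset; the
   formulas in question are not affected.\<close>
 define rh where "rh i = Var (if i \<in> ids w then i else k)" for i
 define th where "th i = FVar (if i \<in> ids w then i else k)" for i
 have env: "env S w rh th" using k by (auto simp: env_def rh_def th_def T_def F_def)
 have eq: "sub_fm rh th B = B" if "B \<in> insert A Ga" for B
 proof -
  have "sub_fm rh th B = sub_fm Var FVar B"
   by (rule sub_fm_cong_over[of U U]) (use U w that in "auto simp: rh_def th_def")
  thus ?thesis by simp
 qed
 have "sat w rh th A"
  by (rule val[OF w(1) env]) (use eq w in "auto simp: sat_def")
 thus False using eq w by (simp add: sat_def)
qed

section \<open>Equality and induction in the worlds\<close>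

lemma sat_AllN_D:
 "sat w rh th (AllN A) ==> wrld S w ==> env S w rh th ==> wrld S w' ==> w << w' ==> t \<in> T S w' ==> sat w' (t ## rh) th A"
 using sat_AllN sat_formula by (metis formulas_simps(6))

lemma sat_AllF_D:
 "sat w rh th (AllF A) ==> wrld S w ==> env S w rh th ==> wrld S w' ==> w << w' ==> u \<in> F S w' ==> sat w' rh (u ## th) A"
 using sat_AllF sat_formula by (metis formulas_simps(8))

lemma sat_ExF_D:
 "sat w rh th (ExF A) ==> wrld S w ==> env S w rh th ==> \<exists>u\<in>F S w. sat w rh (u ## th) A"
 using sat_ExF sat_formula by (metis formulas_simps(9))

lemma sat_Imp_D:
 "sat w rh th (Imp A B) ==> wrld S w ==> env S w rh th ==> wrld S w' ==> w << w' ==> sat w' rh th A ==> sat w' rh th B"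
 using sat_Imp sat_formula by (metis formulas_simps(5))

inductive_simps has_arity_simps [simp]:
 "has_arity Zero n" "has_arity ZeroFn n" "has_arity Ident n" "has_arity PairJ n" "has_arity ProjK n"
 "has_arity ProjL n" "has_arity (PR d) n"

inductive_simps describes_Succ [simp]: "describes Succ n"

locale eqind =
 fixes Sy :: fsystem
 assumes zero_succ: "Sym Zero \<in> lang Sy" "Sym (PR Succ) \<in> lang Sy"
  and equality: "equality_axioms (lang Sy) \<subseteq> axs Sy"
  and induction: "induction_axioms (lang Sy) \<subseteq> axs Sy"
begin

abbreviation "W \<equiv> wrld Sy"
abbreviation "Ter \<equiv> terms (lang Sy)"
abbreviation "Fun \<equiv> functors (lang Sy)"
abbreviation "Tm \<equiv> T Sy"
abbreviation "Fu \<equiv> F Sy"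
abbreviation "en \<equiv> env Sy"

lemma T_App [simp]: "App u t \<in> Tm w <-> u \<in> Fu w \<and> t \<in> Tm w"
 by (auto simp: T_def F_def)

lemma zero_T [simp]: "zero \<in> Tm w" using zero_succ by (simp add: T_def)

lemma Succ_F [simp]: "FC (PR Succ) \<in> Fu w" using zero_succ by (simp add: F_def)

lemma zero_terms [simp]: "zero \<in> Ter" using zero_succ by simp

lemma Succ_functors [simp]: "has_arity (PR Succ) 1" "Sym (PR Succ) \<in> lang Sy" using zero_succ by auto

lemma axiom_sat: "A \<in> axs Sy ==> A \<in> fmls Sy ==> W w ==> en w rh th ==> sat w rh th A"
 by (rule sat_theorem) (auto intro: deriv.Axiom)

definition eqw :: "world => trm => trm => bool" where "eqw w s t <-> Eq s t \<in> tru w"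

lemma sat_Eq_eqw: "sat w rh th (Eq s t) <-> eqw w (sub_trm rh th s) (sub_trm rh th t)"
 by (simp add: sat_def eqw_def)

lemma eqw_T: "W w ==> eqw w s t ==> s \<in> Tm w \<and> t \<in> Tm w"
 using in_world_Fm[of Sy w "Eq s t"] by (auto simp: eqw_def Fm_def T_def)

lemma eqw_mono: "eqw w s t ==> w << w' ==> eqw w' s t" by (auto simp: eqw_def wle_def)

lemma const_env: "t \<in> Tm w ==> u \<in> Fu w ==> en w (%_. t) (%_. u)" by (simp add: env_def)

lemma eqw_refl: assumes "W w" "t \<in> Tm w" shows "eqw w t t"
proof -
 have "sat w (%_. t) (%_. FC (PR Succ)) (Eq (Var 0) (Var 0))"
  by (rule axiom_sat) (use assms equality in "auto simp: equality_axioms_def intro: const_env")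
 thus ?thesis by (simp add: sat_Eq_eqw)
qed

lemma eq_subst:
 assumes w: "W w" and e: "en w rh th" and st: "eqw w s t" and A: "sat w (s ## rh) th A"
 shows "sat w (t ## rh) th A"
proof -
 have T: "s \<in> Tm w" "t \<in> Tm w" using eqw_T[OF w st] by auto
 \<comment> \<open>The parameter \<open>n + 1\<close> of \<open>A\<close> becomes
   \<open>n + 3\<close>, hence \<open>n + 2\<close> once the index 0 has been instantiated, which is
   behind the two slots for \<open>s\<close> and \<open>t\<close>.\<close>
 let ?A = "sub_fm (Var 0 ## (%n. Var (n + 3))) FVar A"
 have A': "?A \<in> fmls Sy" using sat_formula[OF w A] by (rule sub_formulas) (auto split: nat.split)
 let ?ax = "Imp (And (instN (Var 0) ?A) (Eq (Var 0) (Var 1))) (instN (Var 1) ?A)"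
 have e': "en w (s ## t ## rh) th" using e T by (intro env_consN)
 have "?ax \<in> fmls Sy" using A' by (auto intro: instN_formulas)
 moreover have "?ax \<in> axs Sy" using equality A' by (auto simp: equality_axioms_def)
 ultimately have AX: "sat w (s ## t ## rh) th ?ax" using axiom_sat w e' by blast
 have I: "sat w (s ## t ## rh) th (instN (Var i) ?A) <-> sat w ((s ## t ## rh) i ## rh) th A" for i
  unfolding instN_def sat_sub sub_fm_sub_fm
  by (rule arg_cong2[where f = "%x y. sat w x y A"]) (auto split: nat.split)
 show ?thesis
  using sat_Imp_D[OF AX w e' w wle_refl] I[of 0] I[of 1] A st by (simp add: sat_And[OF w] sat_Eq_eqw)
qed

lemma eqw_sym: assumes "W w" "eqw w s t" shows "eqw w t s"
proof -
 have T: "s \<in> Tm w" using eqw_T[OF assms] by auto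
 have "sat w (s ## (%_. s)) (%_. FC (PR Succ)) (Eq (Var 0) (Var 1))"
  using eqw_refl[OF assms(1) T] by (simp add: sat_Eq_eqw)
 from eq_subst[OF assms(1) const_env[OF T] assms(2) this] show ?thesis by (simp add: sat_Eq_eqw)
qed

lemma eqw_trans: assumes "W w" "eqw w s t" "eqw w t r" shows "eqw w s r"
proof -
 have T: "s \<in> Tm w" using eqw_T[OF assms(1,2)] by auto
 have "sat w (t ## (%_. s)) (%_. FC (PR Succ)) (Eq (Var 1) (Var 0))"
  using assms by (simp add: sat_Eq_eqw)
 from eq_subst[OF assms(1) const_env[OF T] assms(3) this] show ?thesis by (simp add: sat_Eq_eqw)
qed

text \<open>Terms equal in a world have the same normal form there, so that the worlds become algebras.\<close>

definition nf :: "world => trm => trm" where "nf w t = (SOME r. eqw w t r)"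

definition N :: "world => trm set" where "N w = nf w ` Tm w"

definition ap :: "world => fnl => trm => trm" where "ap w u t = nf w (App u t)"

lemma eqw_nf: "W w ==> t \<in> Tm w ==> eqw w t (nf w t)"
 unfolding nf_def by (rule someI[of "eqw w t"]) (rule eqw_refl)

lemma nf_T [simp]: "W w ==> t \<in> Tm w ==> nf w t \<in> Tm w"
 using eqw_nf eqw_T by blast

lemma eqw_iff_nf: assumes "W w" "s \<in> Tm w" "t \<in> Tm w" shows "eqw w s t <-> nf w s = nf w t"
proof
 assume "eqw w s t"
 hence "eqw w s r <-> eqw w t r" for r using assms(1) eqw_sym eqw_trans by meson
 thus "nf w s = nf w t" by (simp add: nf_def)
next
 assume "nf w s = nf w t"
 thus "eqw w s t" using eqw_nf assms eqw_sym eqw_trans by metis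
qed

lemma nf_N [simp]: "t \<in> Tm w ==> nf w t \<in> N w" by (simp add: N_def)

lemma N_T: "W w ==> a \<in> N w ==> a \<in> Tm w" by (auto simp: N_def)

lemma nf_idem: "W w ==> a \<in> N w ==> nf w a = a"
 unfolding N_def using eqw_nf eqw_iff_nf nf_T by (metis imageE)

lemma nf_nf: "W w ==> t \<in> Tm w ==> nf w (nf w t) = nf w t"
 by (simp add: nf_idem)

text \<open>A later world may identify more terms, so a normal form need not stay normal. Values
  pass to a later world by being normalized again.\<close>

lemma nf_up: "W w ==> W w' ==> w << w' ==> t \<in> Tm w ==> nf w' (nf w t) = nf w' t"
 using eqw_iff_nf[of w' t "nf w t"] eqw_mono[OF eqw_nf, of w t w'] T_mono nf_T by metis

lemma sat_nf: "W w ==> en w rh th ==> t \<in> Tm w ==> sat w (nf w t ## rh) th A <-> sat w (t ## rh) th A"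
 using eq_subst eqw_nf eqw_sym by blast

lemma sat_Eq: "W w ==> en w rh th ==> s \<in> Ter ==> t \<in> Ter ==>
  sat w rh th (Eq s t) <-> nf w (sub_trm rh th s) = nf w (sub_trm rh th t)"
 by (simp add: sat_Eq_eqw eqw_iff_nf sub_T)

lemma nf_cong1: assumes "W w" "en w rh th" "t \<in> Tm w" "s \<in> Ter"
 shows "nf w (sub_trm (nf w t ## rh) th s) = nf w (sub_trm (t ## rh) th s)"
proof -
 let ?s = "sub_trm (t ## rh) th s"
 have s: "?s \<in> Tm w" using assms by (intro sub_T env_consN)
 have e: "en w (?s ## rh) th" using assms s by (intro env_consN)
 \<comment> \<open>An extra slot stores the value \<open>?s\<close>, so that replacing
   \<open>t\<close> by its normal form changes one side of the equation only.\<close>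
 have "sat w (t ## ?s ## rh) th (Eq (Var 1) (sub_trm (Var 0 ## (%n. Var (n + 2))) FVar s))"
  using eqw_refl[OF assms(1) s] by (simp add: sat_Eq_eqw sub_sub comp_def nat.case_distrib cong: nat.case_cong)
 hence "sat w (nf w t ## ?s ## rh) th (Eq (Var 1) (sub_trm (Var 0 ## (%n. Var (n + 2))) FVar s))"
  using sat_nf[OF assms(1) e assms(3)] by simp
 hence "eqw w ?s (sub_trm (nf w t ## rh) th s)"
  by (simp add: sat_Eq_eqw sub_sub comp_def nat.case_distrib cong: nat.case_cong)
 thus ?thesis using eqw_T[OF assms(1)] eqw_iff_nf[OF assms(1)] by metis
qed

lemma nf_App: assumes "W w" "u \<in> Fu w" "t \<in> Tm w"
 shows "nf w (App u t) = ap w u (nf w t)"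
proof -
 have "en w (%_. t) (%_. u)" using assms by (simp add: env_def)
 from nf_cong1[OF assms(1) this assms(3), of "App (FVar 0) (Var 0)"] show ?thesis by (simp add: ap_def)
qed

lemma ap_N [simp]: "W w ==> u \<in> Fu w ==> a \<in> N w ==> ap w u a \<in> N w"
 by (simp add: ap_def N_T)

lemma env_T: "en w rh th ==> rh n \<in> Tm w" and env_F: "en w rh th ==> th n \<in> Fu w"
 by (auto simp: env_def)

text \<open>Equal terms satisfy the same formulas, so the quantifiers need only range over normal
  forms. From here on the elements of a world are the members of \<open>N w\<close>.\<close>

lemma sat_AllN':
 assumes "W w" "en w rh th" "A \<in> fmls Sy"
 shows "sat w rh th (AllN A) <-> (\<forall>w'. W w' --> w << w' --> (\<forall>a\<in>N w'. sat w' (a ## rh) th A))"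
 unfolding sat_AllN[OF assms]
 using sat_nf[OF _ env_mono[OF assms(2)]] N_T nf_N nf_idem by metis

lemma sat_ExN':
 assumes "W w" "en w rh th" "A \<in> fmls Sy"
 shows "sat w rh th (ExN A) <-> (\<exists>a\<in>N w. sat w (a ## rh) th A)"
 unfolding sat_ExN[OF assms]
 using sat_nf[OF assms(1,2)] N_T[OF assms(1)] nf_N nf_idem[OF assms(1)] by metis

lemma sat_AllEq:
 assumes "W w" "en w rh th" "s \<in> Ter" "t \<in> Ter"
 shows "sat w rh th (AllN (Eq s t)) <->
  (\<forall>w'. W w' --> w << w' --> (\<forall>a\<in>N w'. nf w' (sub_trm (a ## rh) th s) = nf w' (sub_trm (a ## rh) th t)))"
proof -
 have *: "sat w' (a ## rh) th (Eq s t) <-> nf w' (sub_trm (a ## rh) th s) = nf w' (sub_trm (a ## rh) th t)"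
  if "W w'" "w << w'" "a \<in> N w'" for w' a
  by (rule sat_Eq) (use that assms N_T in "auto intro: env_consN env_mono")
 show ?thesis
  by (subst sat_AllN') (use assms * in auto)
qed

abbreviation "zw w \<equiv> nf w zero"
abbreviation "Sw w \<equiv> ap w (FC (PR Succ))"

text \<open>The induction axiom has an implication below a quantifier; therefore the step is
  required in all later worlds. An element reached there is normalized again before the step is
  applied.\<close>

lemma induct_sat:
 assumes w: "W w" and e: "en w rh th" and A: "A \<in> fmls Sy"
  and 0: "sat w (zw w ## rh) th A"
  and Suc: "\<And>w' a. W w' ==> w << w' ==> a \<in> N w' ==> sat w' (a ## rh) th A ==> sat w' (Sw w' a ## rh) th A"
  and w': "W w'" "w << w'" and a: "a \<in> N w'"
 shows "sat w' (a ## rh) th A"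
proof -
 let ?B = "sub_fm (%n. case n of 0 => suc (Var 0) | Suc m => Var (Suc m)) FVar A"
 let ?ax = "Imp (And (instN zero A) (AllN (Imp A ?B))) (AllN A)"
 have B: "?B \<in> fmls Sy" by (rule sub_formulas[OF A]) (auto split: nat.split)
 hence ax: "?ax \<in> fmls Sy" using A instN_formulas[OF A zero_terms] by simp
 have "?ax \<in> axs Sy" using A induction by (auto simp: induction_axioms_def)
 from axiom_sat[OF this ax w e] have 1: "sat w rh th ?ax" .
 have B': "sat w' (a ## rh) th ?B <-> sat w' (suc a ## rh) th A" for w' a
  unfolding sat_sub by (rule arg_cong2[where f = "%x y. sat w' x y A"]) (auto split: nat.split)
 have "sat w rh th (instN zero A)"
  using 0 sat_nf[OF w e zero_T] by (simp add: sat_def sub_instN)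
 moreover have "sat w rh th (AllN (Imp A ?B))"
 proof (subst sat_AllN'[OF w e], safe)
  fix w1 a assume 1: "W w1" "w << w1" "a \<in> N w1"
  have e1: "en w1 (a ## rh) th" using 1 e N_T env_mono env_consN by metis
  show "sat w1 (a ## rh) th (Imp A ?B)"
  proof (subst sat_Imp[OF 1(1) e1 A B], safe)
   fix w2 assume 2: "W w2" "w1 << w2" and s: "sat w2 (a ## rh) th A"
   have e2: "en w2 rh th" and le: "w << w2" using e 1 2 env_mono wle_trans by blast+
   have aT: "a \<in> Tm w2" using 1 2 N_T T_mono by blast
   have "sat w2 (nf w2 a ## rh) th A" using s sat_nf[OF 2(1) e2 aT] by simp
   from Suc[OF 2(1) le _ this] have "sat w2 (Sw w2 (nf w2 a) ## rh) th A" using aT by simp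
   moreover have "Sw w2 (nf w2 a) = nf w2 (suc a)" using aT nf_App[OF 2(1)] by simp
   ultimately have "sat w2 (suc a ## rh) th A" using sat_nf[OF 2(1) e2, of "suc a"] aT by simp
   thus "sat w2 (a ## rh) th ?B" using B' by simp
  qed
 qed (use A B in simp)
 ultimately have "sat w rh th (AllN A)"
  using sat_Imp_D[OF 1 w e w wle_refl] by (simp add: sat_And[OF w])
 thus ?thesis using sat_AllN'[OF w e A] w' a by blast
qed

text \<open>Induction proves a disjunction, and saturation splits it: although the logic is
  intuitionistic, every element of a world is zero or a successor, and algebraic arguments may
  distinguish these cases.\<close>

lemma zero_or_suc: assumes "W w" "a \<in> N w" shows "a = zw w \<or> (\<exists>b\<in>N w. a = Sw w b)"
proof -
 let ?u = "%_::nat. FC (PR Succ)" and ?r = "%_::nat. zero"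
 let ?A = "Or (Eq (Var 0) zero) (ExN (Eq (Var 1) (suc (Var 0))))"
 have e: "en w' (b ## ?r) ?u" if "W w'" "b \<in> N w'" for w' b
  using that N_T by (auto simp: env_def split: nat.split)
 have *: "sat w' (b ## ?r) ?u ?A <-> b = zw w' \<or> (\<exists>c\<in>N w'. b = Sw w' c)" if "W w'" "b \<in> N w'" for w' b
 proof -
  have "sat w' (c ## b ## ?r) ?u (Eq (Var 1) (suc (Var 0))) <-> b = Sw w' c" if c: "c \<in> N w'" for c
   by (subst sat_Eq) (use \<open>W w'\<close> \<open>b \<in> N w'\<close> c e N_T in "auto simp: env_def nf_idem nf_App split: nat.split")
  thus ?thesis using that e[OF that]
   by (simp add: sat_Or sat_ExN' sat_Eq nf_idem zero_succ)
 qed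
 have "sat w (a ## ?r) ?u ?A"
 proof (rule induct_sat[of w])
  fix w' b assume "W w'" "b \<in> N w'"
  thus "sat w' (Sw w' b ## ?r) ?u ?A" by (subst * ) auto
 next
  show "sat w (zw w ## ?r) ?u ?A" using assms by (subst * ) auto
 qed (use assms zero_succ in "auto simp: env_def")
 thus ?thesis using *[OF assms] by blast
qed

end

section \<open>The worlds of a theory that contains BIM\<close>

locale bimc = eqind +
 assumes bim_lang: "bim_language \<subseteq> lang Sy"
  and bim_const: "bim_constant_axioms \<subseteq> axs Sy"
begin

lemma bim_syms [simp]:
 "Sym Zero \<in> lang Sy" "Sym ZeroFn \<in> lang Sy" "Sym Ident \<in> lang Sy" "Sym PairJ \<in> lang Sy"
 "Sym ProjK \<in> lang Sy" "Sym ProjL \<in> lang Sy"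
 using bim_lang by (auto simp: bim_language_def)

lemma bim_F [simp]: "FC ZeroFn \<in> Fu w" "FC Ident \<in> Fu w" "FC ProjK \<in> Fu w" "FC ProjL \<in> Fu w"
 by (simp_all add: F_def)

lemma pairJ_T [simp]: "pairJ s t \<in> Tm w <-> s \<in> Tm w \<and> t \<in> Tm w"
 by (auto simp: T_def)

definition Jw :: "world => trm => trm => trm" where "Jw w a b = nf w (pairJ a b)"
abbreviation "Kw w \<equiv> ap w (FC ProjK)"
abbreviation "Lw w \<equiv> ap w (FC ProjL)"

lemma nf_pairJ: assumes "W w" "s \<in> Tm w" "t \<in> Tm w"
 shows "nf w (pairJ s t) = Jw w (nf w s) (nf w t)"
proof -
 let ?u = "%_::nat. FC ZeroFn"
 have e: "en w (%_. r) ?u" if "r \<in> Tm w" for r using that by (simp add: env_def)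
 have "nf w (pairJ (nf w s) t) = nf w (pairJ s t)"
  using nf_cong1[OF assms(1) e[OF assms(3)] assms(2), of "pairJ (Var 0) (Var 1)"] by simp
 moreover have "nf w (pairJ (nf w s) (nf w t)) = nf w (pairJ (nf w s) t)"
  using nf_cong1[OF assms(1) e assms(3), of "nf w s" "pairJ (Var 1) (Var 0)"] assms by simp
 ultimately show ?thesis by (simp add: Jw_def)
qed

lemma Jw_N [simp]: "W w ==> a \<in> N w ==> b \<in> N w ==> Jw w a b \<in> N w"
 by (simp add: Jw_def N_T)

lemma bim_const_eqs:
 assumes "W w" "a \<in> N w" "b \<in> N w"
 shows "ap w (FC ZeroFn) a = zw w" "ap w (FC Ident) a = a"
  "Kw w (Jw w a b) = a" "Lw w (Jw w a b) = b" "Jw w (Kw w a) (Lw w a) = a"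
  "Sw w a \<noteq> zw w" "Sw w a = Sw w b <-> a = b"
proof -
 define rh where "rh n = (if n = (0::nat) then a else b)" for n
 let ?u = "%_::nat. FC ZeroFn"
 have e: "en w rh ?u" using assms N_T by (simp add: env_def rh_def)
 have ax: "sat w rh ?u A" if "A \<in> bim_constant_axioms" for A
  by (rule axiom_sat) (use that bim_const assms e in "auto simp: bim_constant_axioms_def")
 note [simp] = nf_App nf_pairJ sat_Eq assms N_T rh_def nf_idem e ap_N Jw_N
 have 1: "sat w rh ?u (Eq (App (FC ZeroFn) (Var 0)) zero)" "sat w rh ?u (Eq (App (FC Ident) (Var 0)) (Var 0))"
  "sat w rh ?u (Eq (projK (pairJ (Var 0) (Var 1))) (Var 0))" "sat w rh ?u (Eq (projL (pairJ (Var 0) (Var 1))) (Var 1))"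
  "sat w rh ?u (Eq (pairJ (projK (Var 0)) (projL (Var 0))) (Var 0))"
  "sat w rh ?u (Neg (Eq (suc (Var 0)) zero))" "sat w rh ?u (Imp (Eq (suc (Var 0)) (suc (Var 1))) (Eq (Var 0) (Var 1)))"
  by (rule ax, simp add: bim_constant_axioms_def)+
 show "ap w (FC ZeroFn) a = zw w" "ap w (FC Ident) a = a"
  "Kw w (Jw w a b) = a" "Lw w (Jw w a b) = b" "Jw w (Kw w a) (Lw w a) = a"
  using 1(1-5) by simp_all
 show "Sw w a \<noteq> zw w"
  using sat_Imp_D[OF 1(6) assms(1) e assms(1) wle_refl] sat_Bot[OF assms(1)] by auto
 show "Sw w a = Sw w b <-> a = b"
  using sat_Imp_D[OF 1(7) assms(1) e assms(1) wle_refl] by auto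
qed

text \<open>Pointwise equality of functors holds in a Kripke model only if it holds in all later
  worlds, so a functor is compared with a family of maps, one for each later world.\<close>

definition agree :: "world => fnl => (world => trm => trm) => bool" where
 "agree w ga ph <-> (\<forall>w'. W w' --> w << w' --> (\<forall>a\<in>N w'. ap w' ga a = ph w' a))"

lemma agreeD: "agree w ga ph ==> W w' ==> w << w' ==> a \<in> N w' ==> ap w' ga a = ph w' a"
 by (simp add: agree_def)

lemma agree_mono: "agree w ga ph ==> w << w' ==> agree w' ga ph"
 unfolding agree_def using wle_trans by blast

lemma agree_cong: "agree w ga ph ==> (\<And>w' a. W w' ==> w << w' ==> a \<in> N w' ==> ph w' a = ps w' a) ==> agree w ga ps"
 unfolding agree_def by simp

end

text \<open>Unbounded search is kept apart, because EL obtains it only with the help of the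
  functions whose existence is derived here.\<close>

locale bim0 = bimc +
 assumes bim_ax: "{bim_composition, bim_pairing, bim_primitive_recursion} \<subseteq> axs Sy"
begin

lemma closure_comp:
 assumes w: "W w" and "al \<in> Fu w" "be \<in> Fu w"
 shows "\<exists>ga\<in>Fu w. agree w ga (%w' a. ap w' al (ap w' be a))"
proof -
 let ?u = "%_::nat. FC ZeroFn" and ?r = "%_::nat. zero"
 have e: "en w ?r ?u" "en w ?r (al ## ?u)" "en w ?r (be ## al ## ?u)" using assms by (auto simp: env_def split: nat.split)
 have "sat w ?r ?u bim_composition"
  by (rule axiom_sat) (use bim_ax w e in "auto simp: bim_composition_def")
 from sat_AllF_D[OF this[unfolded bim_composition_def] w e(1) w wle_refl assms(2)]
 have "sat w ?r (al ## ?u) (AllF (ExF (AllN (Eq (App (FVar 0) (Var 0)) (App (FVar 2) (App (FVar 1) (Var 0)))))))" .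
 from sat_ExF_D[OF sat_AllF_D[OF this w e(2) w wle_refl assms(3)] w e(3)] obtain ga where
  ga: "ga \<in> Fu w" "sat w ?r (ga ## be ## al ## ?u) (AllN (Eq (App (FVar 0) (Var 0)) (App (FVar 2) (App (FVar 1) (Var 0)))))" by blast
 have "en w ?r (ga ## be ## al ## ?u)" using e(3) ga(1) by (rule env_consF)
 from sat_AllEq[OF w this] ga(2) have *: "\<forall>w'. W w' --> w << w' --> (\<forall>a\<in>N w'. nf w' (App ga a) = nf w' (App al (App be a)))"
  by (simp add: numeral_2_eq_2)
 have "agree w ga (%w' a. ap w' al (ap w' be a))" unfolding agree_def
 proof (intro allI impI ballI)
  fix w' a assume w': "W w'" "w << w'" "a \<in> N w'"
  have "al \<in> Fu w'" "be \<in> Fu w'" "ga \<in> Fu w'" using assms ga w' F_mono by blast+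
  moreover have "nf w' (App ga a) = nf w' (App al (App be a))" using * w' by blast
  ultimately show "ap w' ga a = ap w' al (ap w' be a)" using w' by (simp add: nf_App N_T nf_idem)
 qed
 thus ?thesis using ga by blast
qed

lemma closure_pair:
 assumes w: "W w" and "al \<in> Fu w" "be \<in> Fu w"
 shows "\<exists>ga\<in>Fu w. agree w ga (%w' a. Jw w' (ap w' al a) (ap w' be a))"
proof -
 let ?u = "%_::nat. FC ZeroFn" and ?r = "%_::nat. zero"
 have e: "en w ?r ?u" "en w ?r (al ## ?u)" "en w ?r (be ## al ## ?u)" using assms by (auto simp: env_def split: nat.split)
 have "sat w ?r ?u bim_pairing"
  by (rule axiom_sat) (use bim_ax w e in "auto simp: bim_pairing_def")
 from sat_AllF_D[OF sat_AllF_D[OF this[unfolded bim_pairing_def] w e(1) w wle_refl assms(2)] w e(2) w wle_refl assms(3)]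
 obtain ga where
  ga: "ga \<in> Fu w" "sat w ?r (ga ## be ## al ## ?u) (AllN (Eq (App (FVar 0) (Var 0)) (pairJ (App (FVar 2) (Var 0)) (App (FVar 1) (Var 0)))))"
  using sat_ExF_D[OF _ w e(3)] by blast
 have "en w ?r (ga ## be ## al ## ?u)" using e(3) ga(1) by (rule env_consF)
 from sat_AllEq[OF w this] ga(2) have *: "\<forall>w'. W w' --> w << w' --> (\<forall>a\<in>N w'. nf w' (App ga a) = nf w' (pairJ (App al a) (App be a)))"
  by (simp add: numeral_2_eq_2)
 have "agree w ga (%w' a. Jw w' (ap w' al a) (ap w' be a))" unfolding agree_def
 proof (intro allI impI ballI)
  fix w' a assume w': "W w'" "w << w'" "a \<in> N w'"
  have "al \<in> Fu w'" "be \<in> Fu w'" "ga \<in> Fu w'" using assms ga w' F_mono by blast+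
  moreover have "nf w' (App ga a) = nf w' (pairJ (App al a) (App be a))" using * w' by blast
  ultimately show "ap w' ga a = Jw w' (ap w' al a) (ap w' be a)" using w' by (simp add: nf_App nf_pairJ N_T nf_idem)
 qed
 thus ?thesis using ga by blast
qed

lemma closure_primrec:
 assumes w: "W w" and "al \<in> Fu w" "be \<in> Fu w"
 shows "\<exists>ga\<in>Fu w. \<forall>w'. W w' --> w << w' --> (\<forall>a\<in>N w'. ap w' ga (Jw w' a (zw w')) = ap w' al a \<and>
  (\<forall>b\<in>N w'. ap w' ga (Jw w' a (Sw w' b)) = ap w' be (Jw w' (Jw w' a b) (ap w' ga (Jw w' a b)))))"
proof -
 let ?u = "%_::nat. FC ZeroFn" and ?r = "%_::nat. zero"
 have e: "en w ?r ?u" "en w ?r (al ## ?u)" "en w ?r (be ## al ## ?u)" using assms by (auto simp: env_def split: nat.split)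
 have "sat w ?r ?u bim_primitive_recursion"
  by (rule axiom_sat) (use bim_ax w e in "auto simp: bim_primitive_recursion_def")
 from sat_AllF_D[OF sat_AllF_D[OF this[unfolded bim_primitive_recursion_def] w e(1) w wle_refl assms(2)] w e(2) w wle_refl assms(3)]
 obtain ga where
  ga: "ga \<in> Fu w" "sat w ?r (ga ## be ## al ## ?u) (AllN (AllN (And (Eq (App (FVar 0) (pairJ (Var 1) zero)) (App (FVar 2) (Var 1)))
      (Eq (App (FVar 0) (pairJ (Var 1) (suc (Var 0))))
        (App (FVar 1) (pairJ (pairJ (Var 1) (Var 0))
                  (App (FVar 0) (pairJ (Var 1) (Var 0)))))))))"
  using sat_ExF_D[OF _ w e(3)] by blast
 have e': "en w ?r (ga ## be ## al ## ?u)" using e(3) ga(1) by (rule env_consF)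
 have main: "ap w' ga (Jw w' a (zw w')) = ap w' al a \<and> ap w' ga (Jw w' a (Sw w' b)) = ap w' be (Jw w' (Jw w' a b) (ap w' ga (Jw w' a b)))"
  if w': "W w'" "w << w'" and ab: "a \<in> N w'" "b \<in> N w'" for w' a b
 proof -
  have F: "al \<in> Fu w'" "be \<in> Fu w'" "ga \<in> Fu w'" using assms ga w' F_mono by blast+
  note TT = N_T[OF w'(1) ab(1)] N_T[OF w'(1) ab(2)]
  have e1: "en w' (a ## ?r) (ga ## be ## al ## ?u)" using e' w' TT env_mono env_consN by blast
  have e2: "en w' (b ## a ## ?r) (ga ## be ## al ## ?u)" using e1 TT env_consN by blast
  from sat_AllN_D[OF sat_AllN_D[OF ga(2) w e' w' TT(1)] w'(1) e1 w'(1) wle_refl TT(2)]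
  show ?thesis
   using w' F ab TT e2
   by (simp add: sat_And[OF w'(1)] sat_Eq nf_App nf_pairJ nf_idem numeral_2_eq_2)
 qed
 show ?thesis
 proof (intro bexI[OF _ ga(1)] allI impI ballI conjI)
  fix w' a assume "W w'" "w << w'" "a \<in> N w'"
  thus "ap w' ga (Jw w' a (zw w')) = ap w' al a" using main[of w' a a] by simp
 qed (use main in blast)
qed

text \<open>The only constant function with a name in BIM is zero. The others come from it by
  composition with the successor, by induction on the value inside the theory.\<close>

lemma closure_const:
 assumes w: "W w" and a: "t \<in> Tm w"
 shows "\<exists>ga\<in>Fu w. agree w ga (%w' a. nf w' t)"
proof -
 let ?u = "%_::nat. FC ZeroFn" and ?r = "%_::nat. zero"
 let ?A = "ExF (AllN (Eq (App (FVar 0) (Var 0)) (Var 1)))"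
 have A: "?A \<in> fmls Sy" by simp
 have e: "en w' (b ## ?r) ?u" if "W w'" "b \<in> N w'" for w' b
  using that N_T by (auto simp: env_def split: nat.split)
 have *: "sat w' (b ## ?r) ?u ?A <-> (\<exists>ga\<in>Fu w'. agree w' ga (%w'' a. nf w'' b))" if "W w'" "b \<in> N w'" for w' b
 proof -
  have "sat w' (b ## ?r) (ga ## ?u) (AllN (Eq (App (FVar 0) (Var 0)) (Var 1))) <-> agree w' ga (%w'' a. nf w'' b)"
   if ga: "ga \<in> Fu w'" for ga
  proof -
   have e1: "en w' (b ## ?r) (ga ## ?u)" using e[OF \<open>W w'\<close> \<open>b \<in> N w'\<close>] ga by (rule env_consF)
   have "nf w'' (App ga a) = ap w'' ga a" if "W w''" "w' << w''" "a \<in> N w''" for w'' a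
    by (simp add: ap_def)
   thus ?thesis unfolding agree_def by (subst sat_AllEq[OF \<open>W w'\<close> e1]) auto
  qed
  thus ?thesis using sat_ExF[OF that(1) e[OF that], of "AllN (Eq (App (FVar 0) (Var 0)) (Var 1))"] by simp
 qed
 have "sat w (nf w t ## ?r) ?u ?A"
 proof (rule induct_sat[of w])
  have "agree w (FC ZeroFn) (%w'' a. nf w'' (zw w))"
   unfolding agree_def using w nf_up bim_const_eqs(1) by auto
  thus "sat w (zw w ## ?r) ?u ?A" by (subst *[OF w]) auto
 next
  fix w' b assume w': "W w'" "w << w'" "b \<in> N w'" "sat w' (b ## ?r) ?u ?A"
  then obtain ga where ga: "ga \<in> Fu w'" "agree w' ga (%w'' a. nf w'' b)" using * by blast
  from closure_comp[OF w'(1) Succ_F ga(1)] obtain de where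
   de: "de \<in> Fu w'" "agree w' de (%w'' a. Sw w'' (ap w'' ga a))" by blast
  have "agree w' de (%w'' a. nf w'' (Sw w' b))"
  proof (rule agree_cong[OF de(2)])
   fix w'' a assume w'': "W w''" "w' << w''" "a \<in> N w''"
   have bT: "b \<in> Tm w'" using w' N_T by blast
   have "nf w'' (Sw w' b) = nf w'' (suc b)" unfolding ap_def
    by (rule nf_up) (use w' w'' bT in auto)
   thus "Sw w'' (ap w'' ga a) = nf w'' (Sw w' b)"
    using agreeD[OF ga(2) w''] nf_App[OF w''(1) Succ_F T_mono[OF w''(2) bT]] by simp
  qed
  thus "sat w' (Sw w' b ## ?r) ?u ?A" using de w' by (subst *) auto
 qed (use w a in "auto simp: env_def")
 then obtain ga where ga: "ga \<in> Fu w" "agree w ga (%w' a'. nf w' (nf w t))" using * a w by auto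
 have "agree w ga (%w' a. nf w' t)"
  by (rule agree_cong[OF ga(2)]) (use nf_up w a in auto)
 thus ?thesis using ga(1) by blast
qed

end

locale bim = bim0 +
 assumes bim_search: "bim_unbounded_search \<in> axs Sy"
begin

lemma closure_search:
 assumes w: "W w" and al: "al \<in> Fu w"
  and ex: "\<And>w' a. W w' ==> w << w' ==> a \<in> N w' ==> \<exists>b\<in>N w'. ap w' al (Jw w' a b) = zw w'"
 shows "\<exists>ga\<in>Fu w. \<forall>w'. W w' --> w << w' --> (\<forall>a\<in>N w'. ap w' al (Jw w' a (ap w' ga a)) = zw w')"
proof -
 let ?u = "%_::nat. FC ZeroFn" and ?r = "%_::nat. zero"
 have e: "en w ?r ?u" "en w ?r (al ## ?u)" using assms by (auto simp: env_def split: nat.split)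
 have fm: "bim_unbounded_search \<in> fmls Sy" by (simp add: bim_unbounded_search_def less_fm_def)
 have "sat w ?r ?u bim_unbounded_search"
  by (rule axiom_sat) (use bim_search w e fm in auto)
 from sat_AllF_D[OF this[unfolded bim_unbounded_search_def] w e(1) w wle_refl al]
 have 1: "sat w ?r (al ## ?u) (Imp (AllN (ExN (Eq (App (FVar 0) (pairJ (Var 1) (Var 0))) zero)))
   (ExF (AllN
    (And (Eq (App (FVar 1) (pairJ (Var 0) (App (FVar 0) (Var 0)))) zero)
       (AllN (Imp (less_fm (Var 0) (App (FVar 0) (Var 1)))
            (Neg (Eq (App (FVar 1) (pairJ (Var 1) (Var 0))) zero))))))))" .
 have FM: "ExN (Eq (App (FVar 0) (pairJ (Var 1) (Var 0))) zero) \<in> fmls Sy" by simp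
 have "sat w ?r (al ## ?u) (AllN (ExN (Eq (App (FVar 0) (pairJ (Var 1) (Var 0))) zero)))"
 unfolding sat_AllN'[OF w e(2) FM]
 proof (intro allI impI ballI)
  fix w' a assume w': "W w'" "w << w'" and a: "a \<in> N w'"
  have F: "al \<in> Fu w'" using al w' F_mono by blast
  have e1: "en w' (a ## ?r) (al ## ?u)" using e w' a N_T env_mono env_consN by metis
  from ex[OF w' a] obtain b where b: "b \<in> N w'" "ap w' al (Jw w' a b) = zw w'" by blast
  have e2: "en w' (b ## a ## ?r) (al ## ?u)" using e1 b w' N_T env_consN by metis
  show "sat w' (a ## ?r) (al ## ?u) (ExN (Eq (App (FVar 0) (pairJ (Var 1) (Var 0))) zero))"
   by (subst sat_ExN'[OF w'(1) e1]) (use b w' a e2 F in "auto simp: sat_Eq nf_App nf_pairJ nf_idem N_T intro!: bexI[of _ b]")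
 qed
 from sat_ExF_D[OF sat_Imp_D[OF 1 w e(2) w wle_refl this] w e(2)] obtain ga where ga: "ga \<in> Fu w"
  "sat w ?r (ga ## al ## ?u) (AllN
    (And (Eq (App (FVar 1) (pairJ (Var 0) (App (FVar 0) (Var 0)))) zero)
       (AllN (Imp (less_fm (Var 0) (App (FVar 0) (Var 1)))
            (Neg (Eq (App (FVar 1) (pairJ (Var 1) (Var 0))) zero))))))" by blast
 have e': "en w ?r (ga ## al ## ?u)" using e(2) ga(1) by (rule env_consF)
 have "ap w' al (Jw w' a (ap w' ga a)) = zw w'" if w': "W w'" "w << w'" and a: "a \<in> N w'" for w' a
 proof -
  have F: "al \<in> Fu w'" "ga \<in> Fu w'" using al ga w' F_mono by blast+
  have e1: "en w' (a ## ?r) (ga ## al ## ?u)" using e' w' a N_T env_mono env_consN by metis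
  from sat_AllN_D[OF ga(2) w e' w' N_T[OF w'(1) a]]
  have "sat w' (a ## ?r) (ga ## al ## ?u) (Eq (App (FVar 1) (pairJ (Var 0) (App (FVar 0) (Var 0)))) zero)"
   by (simp add: sat_And[OF w'(1)])
  thus ?thesis using w' F a e1 by (simp add: sat_Eq nf_App nf_pairJ nf_idem N_T)
 qed
 thus ?thesis using ga by blast
qed

end

section \<open>Graphs of terms as formulas of BIM\<close>

text \<open>
 In each of the following formulas the function index 0 stands for the function \<open>de\<close> being
 defined and the index 1 for a function \<open>Ph\<close> that codes the values of all function variables by
 \<open>Ph(J(n, x)) = al\<^sub>n(x)\<close>.  The sequence of arguments of a constant, as well as the sequence of the
 values of all number variables, is coded by \<open>J(x\<^sub>0, J(x\<^sub>1, ...))\<close>.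

 \<open>call X R\<close> provides \<open>X\<close> with a copy of \<open>Ph\<close> at the index 1, which makes it unnecessary
 to rename the variables of \<open>X\<close>; in \<open>R\<close>, the function defined by \<open>X\<close> has the index 0.
\<close>

definition basic :: "trm => fm" where
 "basic E = AllN (Eq (App (FVar 0) (Var 0)) E)"

definition call :: "fm => fm => fm" where
 "call X R = ExF (ExF (And (AllN (Eq (App (FVar 1) (Var 0)) (App (FVar 3) (Var 0)))) (And X R)))"

text \<open>After two calls the functions defined by \<open>Y\<close> and \<open>X\<close> have the
  indices 0 and 2, and the function being defined has moved to 4.\<close>

definition comp2 :: "fm => fm => trm => fm" where
 "comp2 X Y E = call X (call Y (AllN (Eq (App (FVar 4) (Var 0)) E)))"

text \<open>The step receives \<open>J(y, J(r, x))\<close> with the previous value \<open>r\<close>.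
  This is the coded argument sequence of \<open>h\<close> in the schema of recursion with
  parameters.\<close>

definition rec2 :: "fm => fm => fm" where
 "rec2 X Y = call X (call Y (AllN (And
  (Eq (App (FVar 4) (pairJ zero (Var 0))) (App (FVar 2) (Var 0)))
  (AllN (Eq (App (FVar 4) (pairJ (suc (Var 0)) (Var 1)))
       (App (FVar 0) (pairJ (Var 0) (pairJ (App (FVar 4) (pairJ (Var 0) (Var 1))) (Var 1)))))))))"

abbreviation E_comp :: trm where "E_comp \<equiv> App (FVar 2) (App (FVar 0) (Var 0))"
abbreviation E_app :: trm where "E_app \<equiv> App (FVar 2) (pairJ (App (FVar 0) (Var 0)) (Var 0))"
abbreviation E_pair :: trm where "E_pair \<equiv> pairJ (App (FVar 2) (Var 0)) (App (FVar 0) (Var 0))"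
text \<open>From \<open>J(m, J(r, e))\<close>, which \<open>rec2\<close> supplies to its step, this
  forms the argument of the functor of a recursor: the code of \<open>(r, m)\<close> as a power
  product, paired with the environment \<open>e\<close>.\<close>

abbreviation E_step :: trm where
 "E_step \<equiv> App (FVar 2) (pairJ
  (App (FVar 0) (pairJ (projK (projL (Var 0))) (pairJ (projK (Var 0)) zero))) (projL (projL (Var 0))))"

primrec Lpow :: "nat => trm => trm" where
 "Lpow 0 t = t"
| "Lpow (Suc n) t = projL (Lpow n t)"

primrec tuple_fm :: "fm list => fm" where
 "tuple_fm [] = basic zero"
| "tuple_fm (X # Xs) = comp2 X (tuple_fm Xs) E_pair"

primrec prd_fm :: "prd => fm" where
 "prd_fm Succ = basic (suc (projK (Var 0)))"
| "prd_fm (Const n q) = basic (numeral_trm q)"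
| "prd_fm (Proj n i) = basic (projK (Lpow i (Var 0)))"
| "prd_fm (Comp n g hs) = comp2 (prd_fm g) (tuple_fm (map prd_fm hs)) E_comp"
| "prd_fm (Rec0 q h) = rec2 (basic (numeral_trm q)) (prd_fm h)"
| "prd_fm (RecP g h) = rec2 (prd_fm g) (prd_fm h)"

primrec fsym_fm :: "fsym => fm" where
 "fsym_fm Zero = basic zero"
| "fsym_fm ZeroFn = basic zero"
| "fsym_fm Ident = basic (projK (Var 0))"
| "fsym_fm PairJ = basic (pairJ (projK (Var 0)) (projK (projL (Var 0))))"
| "fsym_fm ProjK = basic (projK (projK (Var 0)))"
| "fsym_fm ProjL = basic (projL (projK (Var 0)))"
| "fsym_fm (PR d) = prd_fm d"

text \<open>The function for a term takes the code \<open>e\<close> of an environment, and the one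
  for a functor takes \<open>J(a, e)\<close>. Since this codes the environment with \<open>a\<close>
  put in front, abstraction leaves the formula unchanged.\<close>

primrec trm_fm :: "trm => fm" and fnl_fm :: "fnl => fm" where
 "trm_fm (Var n) = basic (projK (Lpow n (Var 0)))"
| "trm_fm (Fn c ts) = comp2 (fsym_fm c) (tuple_fm (map trm_fm ts)) E_comp"
| "trm_fm (App u t) = comp2 (fnl_fm u) (trm_fm t) E_app"
| "trm_fm (Rec t u s) = comp2 (rec2 (trm_fm t) (comp2 (fnl_fm u) (prd_fm pr_pair) E_step)) (trm_fm s) E_app"
| "fnl_fm (FVar n) = basic (App (FVar 1) (pairJ (numeral_trm n) (projK (Var 0))))"
| "fnl_fm (FC c) = comp2 (fsym_fm c) (basic (pairJ (projK (Var 0)) zero)) E_comp"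
| "fnl_fm (Lam t) = trm_fm t"

lemma bim_language_mem [simp]:
 "Sym Zero \<in> bim_language" "Sym ZeroFn \<in> bim_language" "Sym Ident \<in> bim_language" "Sym PairJ \<in> bim_language"
 "Sym ProjK \<in> bim_language" "Sym ProjL \<in> bim_language" "Sym (PR Succ) \<in> bim_language"
 by (auto simp: bim_language_def)

lemma numeral_trm_terms [simp]: "numeral_trm n \<in> terms bim_language" by (induction n) auto
lemma Lpow_terms [simp]: "Lpow n t \<in> terms bim_language <-> t \<in> terms bim_language" by (induction n) auto
lemma sub_numeral [simp]: "sub_trm sg ta (numeral_trm n) = numeral_trm n" by (induction n) auto
lemma sub_Lpow [simp]: "sub_trm sg ta (Lpow n t) = Lpow n (sub_trm sg ta t)" by (induction n) auto

lemma basic_formula [simp]: "basic E \<in> formulas bim_language <-> E \<in> terms bim_language" by (simp add: basic_def)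
lemma call_formula [simp]: "call X R \<in> formulas bim_language <-> X \<in> formulas bim_language \<and> R \<in> formulas bim_language"
 by (simp add: call_def)
lemma comp2_formula [simp]: "comp2 X Y E \<in> formulas bim_language <->
  X \<in> formulas bim_language \<and> Y \<in> formulas bim_language \<and> E \<in> terms bim_language"
 by (simp add: comp2_def)
lemma rec2_formula [simp]: "rec2 X Y \<in> formulas bim_language <-> X \<in> formulas bim_language \<and> Y \<in> formulas bim_language"
 by (auto simp: rec2_def)

context bim0
begin

subsection \<open>Representable families of functions\<close>

lemma nf_N_T [simp]: "W w ==> a \<in> N w ==> a \<in> Tm w" by (rule N_T)

lemma N_up [simp]: "W w ==> W w' ==> w << w' ==> a \<in> N w ==> nf w' a \<in> N w'"
 using N_T T_mono nf_N by blast

lemma nf_nf_up [simp]: "W w ==> W w' ==> w << w' ==> t \<in> Tm w ==> nf w' (nf w t) = nf w' t"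
 by (rule nf_up)

lemma ap_up: assumes "W w" "W w'" "w << w'" "u \<in> Fu w" "a \<in> N w"
 shows "nf w' (ap w u a) = ap w' u (nf w' a)"
proof -
 have "a \<in> Tm w" using assms by simp
 hence "a \<in> Tm w'" "u \<in> Fu w'" using assms T_mono F_mono by blast+
 thus ?thesis unfolding ap_def
  using assms nf_nf_up[of w w' "App u a"] nf_App[of w' u a] by (simp add: ap_def)
qed

lemma Jw_up: assumes "W w" "W w'" "w << w'" "a \<in> N w" "b \<in> N w"
 shows "nf w' (Jw w a b) = Jw w' (nf w' a) (nf w' b)"
proof -
 have "a \<in> Tm w" "b \<in> Tm w" using assms by simp_all
 hence "a \<in> Tm w'" "b \<in> Tm w'" using assms T_mono by blast+
 thus ?thesis unfolding Jw_def
  using assms nf_nf_up[of w w' "pairJ a b"] nf_pairJ[of w' a b] by (simp add: Jw_def)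
qed

lemma numeral_T [simp]: "numeral_trm n \<in> Tm w" by (induction n) auto
lemma Lpow_T [simp]: "Lpow n t \<in> Tm w <-> t \<in> Tm w" by (induction n) auto
lemma Lpow_N [simp]: "W w ==> a \<in> N w ==> (Lw w ^^ n) a \<in> N w" by (induction n) auto
lemma nf_Lpow: "W w ==> t \<in> Tm w ==> nf w (Lpow n t) = (Lw w ^^ n) (nf w t)"
 by (induction n) (simp_all add: nf_App)

text \<open>The closure properties of this predicate replace the missing abstraction: a family built
  from representable ones is shown to be representable by following its construction.\<close>

definition rp :: "world => (world => trm => trm) => bool" where
 "rp w ph <-> (\<exists>ga\<in>Fu w. agree w ga ph)"

lemma rpI: "ga \<in> Fu w ==> agree w ga ph ==> rp w ph" by (auto simp: rp_def)

lemma rp_N: "W w ==> rp w ph ==> W w' ==> w << w' ==> a \<in> N w' ==> ph w' a \<in> N w'"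
proof -
 assume w: "W w" "rp w ph" "W w'" "w << w'" "a \<in> N w'"
 then obtain ga where ga: "ga \<in> Fu w" "agree w ga ph" by (auto simp: rp_def)
 have "ap w' ga a \<in> N w'" by (rule ap_N[OF w(3) F_mono[OF w(4) ga(1)] w(5)])
 thus "ph w' a \<in> N w'" using agreeD[OF ga(2) w(3-5)] by simp
qed

lemma rp_cong: "rp w ph ==> (\<And>w' a. W w' ==> w << w' ==> a \<in> N w' ==> ph w' a = ps w' a) ==> rp w ps"
 unfolding rp_def by (blast intro: agree_cong)

lemma rp_fun: "ga \<in> Fu w ==> rp w (%w' a. ap w' ga a)"
 by (auto simp: rp_def agree_def)

lemma rp_id: "W w ==> rp w (%w' a. a)"
 by (rule rpI[of "FC Ident"]) (auto simp: agree_def bim_const_eqs)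

lemma rp_comp: assumes "W w" "rp w ph" "rp w ps" shows "rp w (%w' a. ph w' (ps w' a))"
proof -
 obtain al be where *: "al \<in> Fu w" "agree w al ph" "be \<in> Fu w" "agree w be ps" using assms by (auto simp: rp_def)
 obtain ga where ga: "ga \<in> Fu w" "agree w ga (%w' a. ap w' al (ap w' be a))"
  using closure_comp[OF assms(1) *(1,3)] by blast
 have "agree w ga (%w' a. ph w' (ps w' a))"
 proof (rule agree_cong[OF ga(2)])
  fix w' a assume w': "W w'" "w << w'" "a \<in> N w'"
  have "ap w' be a \<in> N w'" using w' * F_mono by simp
  thus "ap w' al (ap w' be a) = ph w' (ps w' a)" using agreeD[OF *(2)] agreeD[OF *(4)] w' by simp
 qed
 thus ?thesis using ga(1) rpI by blast
qed

lemma rp_ap: "W w ==> ga \<in> Fu w ==> rp w ps ==> rp w (%w' a. ap w' ga (ps w' a))"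
 by (rule rp_comp[OF _ rp_fun])

lemma rp_pair: assumes "W w" "rp w ph" "rp w ps" shows "rp w (%w' a. Jw w' (ph w' a) (ps w' a))"
proof -
 obtain al be where *: "al \<in> Fu w" "agree w al ph" "be \<in> Fu w" "agree w be ps" using assms by (auto simp: rp_def)
 obtain ga where ga: "ga \<in> Fu w" "agree w ga (%w' a. Jw w' (ap w' al a) (ap w' be a))"
  using closure_pair[OF assms(1) *(1,3)] by blast
 have "agree w ga (%w' a. Jw w' (ph w' a) (ps w' a))"
  by (rule agree_cong[OF ga(2)]) (use agreeD[OF *(2)] agreeD[OF *(4)] in simp)
 thus ?thesis using ga(1) rpI by blast
qed

lemma rp_const: "W w ==> t \<in> Tm w ==> rp w (%w' a. nf w' t)"
 unfolding rp_def by (rule closure_const)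

lemma rp_zero: "W w ==> rp w (%w' a. zw w')"
 by (rule rp_const) auto

lemma rp_Lpow: "W w ==> rp w ph ==> rp w (%w' a. (Lw w' ^^ n) (ph w' a))"
 by (induction n) (auto intro: rp_ap)

lemmas rp_intros = rp_zero rp_pair rp_id rp_Lpow rp_ap

definition rec_spec :: "world => fnl => fnl => fnl => bool" where
 "rec_spec w rh al be <-> (\<forall>w'. W w' --> w << w' --> (\<forall>x\<in>N w'. ap w' rh (Jw w' (zw w') x) = ap w' al x \<and>
  (\<forall>y\<in>N w'. ap w' rh (Jw w' (Sw w' y) x) = ap w' be (Jw w' y (Jw w' (ap w' rh (Jw w' y x)) x)))))"

text \<open>The axiom of BIM puts the parameter in front and passes \<open>J(J(x, y), r)\<close> to
  the step. Here \<open>be'\<close> rearranges the arguments of the step, and \<open>rh\<close>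
  swaps those of the result.\<close>

lemma closure_rec: assumes w: "W w" and al: "al \<in> Fu w" and be: "be \<in> Fu w"
 shows "\<exists>rh\<in>Fu w. rec_spec w rh al be"
proof -
 have "rp w (%w' z. ap w' be (Jw w' (Lw w' (Kw w' z)) (Jw w' (Lw w' z) (Kw w' (Kw w' z)))))"
  by (intro rp_intros w be bim_F)
 then obtain be' where be': "be' \<in> Fu w"
  "agree w be' (%w' z. ap w' be (Jw w' (Lw w' (Kw w' z)) (Jw w' (Lw w' z) (Kw w' (Kw w' z)))))" by (auto simp: rp_def)
 obtain ga where ga: "ga \<in> Fu w" "\<forall>w'. W w' --> w << w' --> (\<forall>a\<in>N w'. ap w' ga (Jw w' a (zw w')) = ap w' al a \<and>
  (\<forall>b\<in>N w'. ap w' ga (Jw w' a (Sw w' b)) = ap w' be' (Jw w' (Jw w' a b) (ap w' ga (Jw w' a b)))))"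
  using closure_primrec[OF w al be'(1)] by blast
 have "rp w (%w' z. ap w' ga (Jw w' (Lw w' z) (Kw w' z)))"
  by (intro rp_intros w ga bim_F)
 then obtain rh where rh: "rh \<in> Fu w" "agree w rh (%w' z. ap w' ga (Jw w' (Lw w' z) (Kw w' z)))" by (auto simp: rp_def)
 have "rec_spec w rh al be" unfolding rec_spec_def
 proof (intro allI impI ballI conjI)
  fix w' x assume w': "W w'" "w << w'" and x: "x \<in> N w'"
  note F = F_mono[OF w'(2) al] F_mono[OF w'(2) be] F_mono[OF w'(2) ga(1)] F_mono[OF w'(2) be'(1)]
  have r: "ap w' rh (Jw w' y x) = ap w' ga (Jw w' x y)" if "y \<in> N w'" for y
   using agreeD[OF rh(2) w', of "Jw w' y x"] w' x that by (simp add: bim_const_eqs)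
  show "ap w' rh (Jw w' (zw w') x) = ap w' al x"
   using r[of "zw w'"] ga(2) w' x by simp
  fix y assume y: "y \<in> N w'"
  have "ap w' rh (Jw w' (Sw w' y) x) = ap w' be' (Jw w' (Jw w' x y) (ap w' ga (Jw w' x y)))"
   using r[of "Sw w' y"] ga(2) w' x y by simp
  also have "... = ap w' be (Jw w' y (Jw w' (ap w' ga (Jw w' x y)) x))"
   using agreeD[OF be'(2) w', of "Jw w' (Jw w' x y) (ap w' ga (Jw w' x y))"] w' x y F
   by (simp add: bim_const_eqs)
  finally show "ap w' rh (Jw w' (Sw w' y) x) = ap w' be (Jw w' y (Jw w' (ap w' rh (Jw w' y x)) x))"
   using r[OF y] by simp
 qed
 thus ?thesis using rh by blast
qed

text \<open>A functor that runs through the sequence with start \<open>a\<close> and step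
  \<open>h\<close>. The step may differ from world to world, and by induction such a functor is
  unique up to agreement.\<close>

definition rspec :: "world => fnl => trm => (world => trm => trm => trm) => bool" where
 "rspec w ga a h <-> ga \<in> Fu w \<and> ap w ga (zw w) = a \<and>
  (\<forall>w'. W w' --> w << w' --> (\<forall>m\<in>N w'. ap w' ga (Sw w' m) = h w' m (ap w' ga m)))"

text \<open>By uniqueness the choice of the functor does not affect the value. The default keeps the
  value inside the world even where no functor runs through the sequence.\<close>

definition rv :: "world => trm => (world => trm => trm => trm) => trm => trm" where
 "rv w a h n = (if \<exists>ga. rspec w ga a h then ap w (SOME ga. rspec w ga a h) n else zw w)"

lemma fun_induct:
 assumes w: "W w" and F: "ga \<in> Fu w" "ga' \<in> Fu w"
  and 0: "ap w ga (zw w) = ap w ga' (zw w)"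
  and S: "\<And>w' m. W w' ==> w << w' ==> m \<in> N w' ==> ap w' ga m = ap w' ga' m ==> ap w' ga (Sw w' m) = ap w' ga' (Sw w' m)"
 shows "agree w ga (%w' n. ap w' ga' n)"
proof -
 let ?u = "ga ## ga' ## (%_::nat. FC ZeroFn)" and ?r = "%_::nat. zero"
 let ?A = "Eq (App (FVar 0) (Var 0)) (App (FVar 1) (Var 0))"
 have e0: "en w ?r ?u" using F by (auto simp: env_def split: nat.split)
 have *: "sat w' (a ## ?r) ?u ?A <-> ap w' ga a = ap w' ga' a" if "W w'" "w << w'" "a \<in> N w'" for w' a
 proof -
  have "en w' (a ## ?r) ?u" using env_consN[OF env_mono[OF e0 that(2)]] that by simp
  thus ?thesis using that F_mono[OF that(2) F(1)] F_mono[OF that(2) F(2)]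
   by (subst sat_Eq) (auto simp: nf_App nf_idem)
 qed
 have "sat w' (a ## ?r) ?u ?A" if "W w'" "w << w'" "a \<in> N w'" for w' a
 proof (rule induct_sat[OF w e0 _ _ _ that])
  show "sat w (zw w ## ?r) ?u ?A" using 0 w by (subst * ) auto
  fix w' a assume "W w'" "w << w'" "a \<in> N w'" "sat w' (a ## ?r) ?u ?A"
  thus "sat w' (Sw w' a ## ?r) ?u ?A" using S[of w' a] *[of w' a] by (subst * ) auto
 qed simp
 thus ?thesis using * unfolding agree_def by blast
qed

lemma rspec_unique: assumes "W w" "rspec w ga a h" "rspec w ga' a h" shows "agree w ga (%w' n. ap w' ga' n)"
 by (rule fun_induct) (use assms in "auto simp: rspec_def")

lemma rv_eq: assumes "W w" "rspec w ga a h" "n \<in> N w" shows "rv w a h n = ap w ga n"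
proof -
 have "rspec w (SOME ga. rspec w ga a h) a h" by (rule someI[of "%ga. rspec w ga a h"]) (rule assms)
 from agreeD[OF rspec_unique[OF assms(1) this assms(2)] assms(1) wle_refl assms(3)] assms(2)
 show ?thesis by (auto simp: rv_def)
qed

lemma rv_N [simp]: "W w ==> n \<in> N w ==> rv w a h n \<in> N w"
 using rv_eq[of w _ a h n] by (cases "\<exists>ga. rspec w ga a h") (auto simp: rv_def rspec_def)

lemma rv_cong:
 assumes w: "W w" and "a = a'" "n = n'"
  "\<And>w' m r. W w' ==> w << w' ==> m \<in> N w' ==> r \<in> N w' ==> h w' m r = h' w' m r"
 shows "rv w a h n = rv w a' h' n'"
proof -
 have "rspec w ga a h <-> rspec w ga a' h'" for ga
  unfolding rspec_def using assms ap_N F_mono by auto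
 thus ?thesis using assms by (simp add: rv_def)
qed

lemma rv_rec:
 assumes w: "W w" and s: "rspec w ga a h"
 shows "rv w a h (zw w) = a" "m \<in> N w ==> rv w a h (Sw w m) = h w m (rv w a h m)"
 using rv_eq[OF w s] s w by (auto simp: rspec_def)

text \<open>With the parameter held fixed, a recursion with parameter runs through a sequence in the
  sense of \<open>rspec\<close>, and such sequences are unique.\<close>

lemma rec_agree:
 assumes w: "W w" and F: "rh \<in> Fu w" "al \<in> Fu w" "be \<in> Fu w" and al: "agree w al ph" and be: "agree w be ps"
  and r: "rec_spec w rh al be"
 shows "agree w rh (%w' x. rv w' (ph w' (Lw w' x)) (%w'' m r. ps w'' (Jw w'' m (Jw w'' r (nf w'' (Lw w' x))))) (Kw w' x))"
 unfolding agree_def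
proof (intro allI impI ballI)
 fix w' x assume w': "W w'" "w << w'" and x: "x \<in> N w'"
 let ?l = "Lw w' x"
 have l: "?l \<in> N w'" "Kw w' x \<in> N w'" using w' x by simp_all
 have F': "rh \<in> Fu w'" "al \<in> Fu w'" "be \<in> Fu w'" using F w' F_mono by blast+
 have "rp w' (%w'' n. ap w'' rh (Jw w'' n (nf w'' ?l)))"
  using w' l F' by (intro rp_ap rp_pair rp_id rp_const) auto
 then obtain ga where ga: "ga \<in> Fu w'" "agree w' ga (%w'' n. ap w'' rh (Jw w'' n (nf w'' ?l)))" by (auto simp: rp_def)
 have "rspec w' ga (ph w' ?l) (%w'' m r. ps w'' (Jw w'' m (Jw w'' r (nf w'' ?l))))"
  unfolding rspec_def
 proof (intro conjI allI impI ballI)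
  show "ap w' ga (zw w') = ph w' ?l"
   using agreeD[OF ga(2) w'(1) wle_refl, of "zw w'"] r w' l agreeD[OF al w' l(1)]
   by (simp add: rec_spec_def nf_idem)
 next
  fix w'' m assume w'': "W w''" "w' << w''" and m: "m \<in> N w''"
  have le: "w << w''" using w' w'' wle_trans by blast
  have l'': "nf w'' ?l \<in> N w''" using w' w'' l by simp
  have g: "ap w'' ga k = ap w'' rh (Jw w'' k (nf w'' ?l))" if "k \<in> N w''" for k
   using agreeD[OF ga(2) w'' that] .
  have "ap w'' ga (Sw w'' m) = ap w'' be (Jw w'' m (Jw w'' (ap w'' rh (Jw w'' m (nf w'' ?l))) (nf w'' ?l)))"
   using g[of "Sw w'' m"] r w'' le l'' m by (simp add: rec_spec_def)
  thus "ap w'' ga (Sw w'' m) = ps w'' (Jw w'' m (Jw w'' (ap w'' ga m) (nf w'' ?l)))"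
   using g[OF m] agreeD[OF be w''(1) le] m l'' w'' F_mono[OF w''(2) F'(1)] by simp
 qed (rule ga)
 from rv_eq[OF w'(1) this l(2)] agreeD[OF ga(2) w'(1) wle_refl l(2)]
 show "ap w' rh x = rv w' (ph w' ?l) (%w'' m r. ps w'' (Jw w'' m (Jw w'' r (nf w'' ?l)))) (Kw w' x)"
  using w' l x by (simp add: nf_idem bim_const_eqs)
qed

subsection \<open>Formulas that define families of functions\<close>

text \<open>The last clause says that the family depends on \<open>Ph\<close> only through its
  values. This is what permits \<open>call\<close> to evaluate a formula at a copy of
  \<open>Ph\<close>.\<close>

definition represents :: "fm => (fnl => world => trm => trm) => bool" where
 "represents X ps <-> X \<in> formulas bim_language \<and>
  (\<forall>w Ph. W w --> Ph \<in> Fu w --> rp w (ps Ph) \<and>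
   (\<forall>rh th de. en w rh th --> de \<in> Fu w --> (sat w rh (de ## Ph ## th) X <-> agree w de (ps Ph))) \<and>
   (\<forall>Ph'\<in>Fu w. agree w Ph' (%w' a. ap w' Ph a) --> (\<forall>a\<in>N w. ps Ph' w a = ps Ph w a)))"

lemma bim_fmls: "X \<in> formulas bim_language ==> X \<in> fmls Sy"
 using formulas_mono bim_lang by blast

lemma bim_terms: "X \<in> terms bim_language ==> X \<in> Ter"
 using terms_mono bim_lang by blast

lemma representsD:
 assumes "represents X ps"
 shows "X \<in> formulas bim_language" "X \<in> fmls Sy"
  "W w ==> Ph \<in> Fu w ==> rp w (ps Ph)"
  "W w ==> Ph \<in> Fu w ==> en w rh th ==> de \<in> Fu w ==> sat w rh (de ## Ph ## th) X <-> agree w de (ps Ph)"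
  "W w ==> Ph \<in> Fu w ==> Ph' \<in> Fu w ==> agree w Ph' (%w' a. ap w' Ph a) ==> a \<in> N w ==> ps Ph' w a = ps Ph w a"
 using assms bim_fmls unfolding represents_def by blast+

lemma represents_N: "represents X ps ==> W w ==> Ph \<in> Fu w ==> a \<in> N w ==> ps Ph w a \<in> N w"
 using rp_N[OF _ representsD(3)] by (metis wle_refl)

lemma represents_cong:
 assumes "represents X ps" "\<And>w Ph a. W w ==> Ph \<in> Fu w ==> a \<in> N w ==> ps Ph w a = ps' Ph w a"
 shows "represents X ps'"
 unfolding represents_def
proof (intro conjI allI impI ballI)
 fix w Ph assume w: "W w" "Ph \<in> Fu w"
 have *: "ps Ph w' a = ps' Ph w' a" if "W w'" "w << w'" "a \<in> N w'" for w' a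
  using assms(2)[OF that(1) _ that(3)] w that F_mono by blast
 hence **: "agree w de (ps Ph) <-> agree w de (ps' Ph)" for de by (auto simp: agree_def)
 show "rp w (ps' Ph)" using representsD(3)[OF assms(1) w] ** by (auto simp: rp_def)
 show "sat w rh (de ## Ph ## th) X <-> agree w de (ps' Ph)" if "en w rh th" "de \<in> Fu w" for rh th de
  using representsD(4)[OF assms(1) w that] ** by simp
 show "ps' Ph' w a = ps' Ph w a" if "Ph' \<in> Fu w" "agree w Ph' (%w' a. ap w' Ph a)" "a \<in> N w" for Ph' a
  using representsD(5)[OF assms(1) w that] assms(2) w that by metis
qed (use representsD(1)[OF assms(1)] in simp)

lemma basic_represents:
 assumes E: "E \<in> terms bim_language"
  and G: "\<And>w Ph de rh th a. W w ==> Ph \<in> Fu w ==> de \<in> Fu w ==> en w rh th ==> a \<in> N w ==>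
   nf w (sub_trm (a ## rh) (de ## Ph ## th) E) = G w (ap w Ph) a"
  and cong: "\<And>w f f' a. W w ==> a \<in> N w ==> (\<And>x. x \<in> N w ==> f x = f' x) ==> G w f a = G w f' a"
  and rp: "\<And>w Ph. W w ==> Ph \<in> Fu w ==> rp w (%w' a. G w' (ap w' Ph) a)"
 shows "represents (basic E) (%Ph w a. G w (ap w Ph) a)"
 unfolding represents_def
proof (intro conjI allI impI ballI)
 fix w Ph assume w: "W w" "Ph \<in> Fu w"
 show "rp w (%w a. G w (ap w Ph) a)" using rp[OF w] .
 show "sat w rh (de ## Ph ## th) (basic E) <-> agree w de (%w a. G w (ap w Ph) a)" if e: "en w rh th" and de: "de \<in> Fu w" for rh th de
 proof -
  have e1: "en w rh (de ## Ph ## th)" using e w de by (intro env_consF)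
  have "nf w' (sub_trm (a ## rh) (de ## Ph ## th) E) = G w' (ap w' Ph) a" "nf w' (App de a) = ap w' de a"
   if w': "W w'" "w << w'" "a \<in> N w'" for w' a
   using G[OF w'(1) F_mono[OF w'(2) w(2)] F_mono[OF w'(2) de] env_mono[OF e w'(2)] w'(3)] by (simp_all add: ap_def)
  thus ?thesis unfolding basic_def agree_def
   by (subst sat_AllEq[OF w(1) e1]) (use E bim_terms in auto)
 qed
 show "G w (ap w Ph') a = G w (ap w Ph) a" if "Ph' \<in> Fu w" "agree w Ph' (%w' a. ap w' Ph a)" "a \<in> N w" for Ph' a
  by (rule cong) (use w that agreeD in auto)
qed (use E in simp)

text \<open>\<open>X\<close> is evaluated at the copy \<open>Ph'\<close>; extensionality of the
  represented family leads back to \<open>Ph\<close>.\<close>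

lemma sat_call:
 assumes X: "represents X ps" and R: "R \<in> fmls Sy" and w: "W w" "Ph \<in> Fu w" "de \<in> Fu w" and e: "en w rh th"
 shows "sat w rh (de ## Ph ## th) (call X R) <->
  (\<exists>Ph'\<in>Fu w. \<exists>ups\<in>Fu w. agree w Ph' (%w' a. ap w' Ph a) \<and> agree w ups (ps Ph) \<and> sat w rh (ups ## Ph' ## de ## Ph ## th) R)"
proof -
 have e1: "en w rh (de ## Ph ## th)" using e w by (intro env_consF)
 let ?C = "AllN (Eq (App (FVar 1) (Var 0)) (App (FVar 3) (Var 0)))"
 have fm: "ExF (And ?C (And X R)) \<in> fmls Sy" "And ?C (And X R) \<in> fmls Sy" using representsD(2)[OF X] R by simp_all
 have "sat w rh (ups ## Ph' ## de ## Ph ## th) (And ?C (And X R)) <->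
   agree w Ph' (%w' a. ap w' Ph a) \<and> agree w ups (ps Ph) \<and> sat w rh (ups ## Ph' ## de ## Ph ## th) R"
  if F: "Ph' \<in> Fu w" "ups \<in> Fu w" for Ph' ups
 proof -
  have e2: "en w rh (ups ## Ph' ## de ## Ph ## th)" by (intro env_consF e1 F)
  have "sat w rh (ups ## Ph' ## de ## Ph ## th) ?C <-> agree w Ph' (%w' a. ap w' Ph a)"
   unfolding agree_def by (subst sat_AllEq[OF w(1) e2]) (auto simp: ap_def numeral_eq_Suc)
  moreover have "sat w rh (ups ## Ph' ## de ## Ph ## th) X <-> agree w ups (ps Ph')"
   by (rule representsD(4)[OF X w(1) F(1) e1 F(2)])
  moreover have "agree w ups (ps Ph') <-> agree w ups (ps Ph)" if "agree w Ph' (%w' a. ap w' Ph a)"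
  proof -
   have "ps Ph' w' a = ps Ph w' a" if w': "W w'" "w << w'" "a \<in> N w'" for w' a
    by (rule representsD(5)[OF X w'(1)]) (use w F w' F_mono agree_mono \<open>agree w Ph' _\<close> in auto)
   thus ?thesis by (auto simp: agree_def)
  qed
  ultimately show ?thesis by (auto simp: sat_And[OF w(1)])
 qed
 note * = this
 have "sat w rh (de ## Ph ## th) (call X R) <-> (\<exists>Ph'\<in>Fu w. \<exists>ups\<in>Fu w. sat w rh (ups ## Ph' ## de ## Ph ## th) (And ?C (And X R)))"
  unfolding call_def using sat_ExF[OF w(1) e1 fm(1)] sat_ExF[OF w(1) env_consF[OF e1] fm(2)] by simp
 thus ?thesis using * by simp
qed

lemma sat_call2:
 assumes X: "represents X ps" and Y: "represents Y ch" and R: "R \<in> formulas bim_language"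
  and w: "W w" "Ph \<in> Fu w" "de \<in> Fu w" and e: "en w rh th"
  and R': "\<And>ups sg Ph' Ph''. ups \<in> Fu w ==> sg \<in> Fu w ==> Ph' \<in> Fu w ==> Ph'' \<in> Fu w ==>
   sat w rh (sg ## Ph'' ## ups ## Ph' ## de ## Ph ## th) R <-> P ups sg"
 shows "sat w rh (de ## Ph ## th) (call X (call Y R)) <->
  (\<exists>ups\<in>Fu w. \<exists>sg\<in>Fu w. agree w ups (ps Ph) \<and> agree w sg (ch Ph) \<and> P ups sg)"
proof -
 have fm: "R \<in> fmls Sy" "call Y R \<in> fmls Sy" using R representsD(1)[OF Y] bim_fmls by simp_all
 have Yc: "agree w sg (ch Ph') <-> agree w sg (ch Ph)" if "agree w Ph' (%w' a. ap w' Ph a)" "Ph' \<in> Fu w" for Ph' sg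
 proof -
  have "ch Ph' w' a = ch Ph w' a" if w': "W w'" "w << w'" "a \<in> N w'" for w' a
   by (rule representsD(5)[OF Y w'(1)]) (use w w' F_mono agree_mono \<open>agree w Ph' _\<close> \<open>Ph' \<in> Fu w\<close> in auto)
  thus ?thesis by (auto simp: agree_def)
 qed
 have e1: "en w rh (de ## Ph ## th)" using e w by (intro env_consF)
 have refl: "agree w Ph' (%w' a. ap w' Ph' a)" for Ph' by (simp add: agree_def)
 have inner: "sat w rh (ups ## Ph' ## de ## Ph ## th) (call Y R) <-> (\<exists>sg\<in>Fu w. agree w sg (ch Ph') \<and> P ups sg)"
  if "ups \<in> Fu w" "Ph' \<in> Fu w" for ups Ph'
  unfolding sat_call[OF Y fm(1) w(1) that(2,1) e1] using R'[OF that(1) _ that(2)] refl that(2) by blast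
 show ?thesis unfolding sat_call[OF X fm(2) w e]
  using inner Yc refl w(2) by blast
qed

text \<open>\<open>G\<close> is the operation that \<open>E\<close> denotes. It sees the two
  functors only through their values, so by \<open>cong\<close> they may be replaced by the families
  with which they agree.\<close>

lemma comp2_represents:
 assumes X: "represents X ps" and Y: "represents Y ch" and E: "E \<in> terms bim_language"
  and G: "\<And>w ups sg rh Ph' Ph'' th a. W w ==> ups \<in> Fu w ==> sg \<in> Fu w ==> en w rh th ==> a \<in> N w ==>
   nf w (sub_trm (a ## rh) (sg ## Ph'' ## ups ## Ph' ## th) E) = G w (ap w ups) (ap w sg) a"
  and cong: "\<And>w f f' g g' a. W w ==> a \<in> N w ==> (\<And>x. x \<in> N w ==> f x = f' x) ==> (\<And>x. x \<in> N w ==> g x = g' x)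
   ==> (\<And>x. x \<in> N w ==> g x \<in> N w) ==> G w f g a = G w f' g' a"
  and rp: "\<And>w ups sg. W w ==> ups \<in> Fu w ==> sg \<in> Fu w ==> rp w (%w' a. G w' (ap w' ups) (ap w' sg) a)"
 shows "represents (comp2 X Y E) (%Ph w a. G w (ps Ph w) (ch Ph w) a)"
 unfolding represents_def
proof (intro conjI allI impI ballI)
 fix w Ph assume w: "W w" "Ph \<in> Fu w"
 have cg: "G w' (ap w' ups) (ap w' sg) a = G w' (ps Ph w') (ch Ph w') a"
  if "agree w ups (ps Ph)" "agree w sg (ch Ph)" "sg \<in> Fu w" "W w'" "w << w'" "a \<in> N w'" for ups sg w' a
 proof (rule cong[OF that(4,6)])
  fix x assume x: "x \<in> N w'"
  show "ap w' ups x = ps Ph w' x" "ap w' sg x = ch Ph w' x" using agreeD[OF that(1,4,5) x] agreeD[OF that(2,4,5) x] .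
  show "ap w' sg x \<in> N w'" by (rule ap_N[OF that(4) F_mono[OF that(5,3)] x])
 qed
 obtain ups sg where ex: "ups \<in> Fu w" "agree w ups (ps Ph)" "sg \<in> Fu w" "agree w sg (ch Ph)"
  using representsD(3)[OF X w] representsD(3)[OF Y w] by (auto simp: rp_def)
 show "rp w (%w a. G w (ps Ph w) (ch Ph w) a)"
  by (rule rp_cong[OF rp[OF w(1) ex(1,3)]]) (use cg ex in blast)
 show "sat w rh (de ## Ph ## th) (comp2 X Y E) <-> agree w de (%w a. G w (ps Ph w) (ch Ph w) a)"
  if e: "en w rh th" and de: "de \<in> Fu w" for rh th de
 proof -
  let ?R = "AllN (Eq (App (FVar 4) (Var 0)) E)"
  have R: "?R \<in> formulas bim_language" using E by simp
  have "sat w rh (de ## Ph ## th) (comp2 X Y E) <-> (\<exists>ups\<in>Fu w. \<exists>sg\<in>Fu w. agree w ups (ps Ph) \<and> agree w sg (ch Ph) \<and>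
    agree w de (%w a. G w (ap w ups) (ap w sg) a))"
   unfolding comp2_def
  proof (rule sat_call2[OF X Y R w de e])
   fix ups sg Ph' Ph'' assume F: "ups \<in> Fu w" "sg \<in> Fu w" "Ph' \<in> Fu w" "Ph'' \<in> Fu w"
   have e2: "en w rh (de ## Ph ## th)" using e w de by (intro env_consF)
   have e1: "en w rh (sg ## Ph'' ## ups ## Ph' ## de ## Ph ## th)" by (intro env_consF e2 F)
   have "nf w' (sub_trm (a ## rh) (sg ## Ph'' ## ups ## Ph' ## de ## Ph ## th) E) = G w' (ap w' ups) (ap w' sg) a"
    if w': "W w'" "w << w'" "a \<in> N w'" for w' a
    by (rule G[OF w'(1) F_mono[OF w'(2) F(1)] F_mono[OF w'(2) F(2)] env_mono[OF e2 w'(2)] w'(3)])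
   thus "sat w rh (sg ## Ph'' ## ups ## Ph' ## de ## Ph ## th) ?R <-> agree w de (%w a. G w (ap w ups) (ap w sg) a)"
    unfolding agree_def by (subst sat_AllEq[OF w(1) e1]) (use E bim_terms in "auto simp: numeral_eq_Suc ap_def")
  qed
  also have "... <-> agree w de (%w a. G w (ps Ph w) (ch Ph w) a)"
  proof -
   have *: "agree w de (%w a. G w (ap w ups) (ap w sg) a) <-> agree w de (%w a. G w (ps Ph w) (ch Ph w) a)"
    if "agree w ups (ps Ph)" "agree w sg (ch Ph)" "sg \<in> Fu w" for ups sg
    using cg[OF that] by (simp add: agree_def)
   show ?thesis
   proof
    assume "\<exists>ups\<in>Fu w. \<exists>sg\<in>Fu w. agree w ups (ps Ph) \<and> agree w sg (ch Ph) \<and> agree w de (%w a. G w (ap w ups) (ap w sg) a)"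
    then obtain ups sg where "sg \<in> Fu w" "agree w ups (ps Ph)" "agree w sg (ch Ph)" "agree w de (%w a. G w (ap w ups) (ap w sg) a)"
     by (elim bexE conjE)
    thus "agree w de (%w a. G w (ps Ph w) (ch Ph w) a)" using *[of ups sg] by simp
   next
    assume "agree w de (%w a. G w (ps Ph w) (ch Ph w) a)"
    hence "agree w de (%w a. G w (ap w ups) (ap w sg) a)" using *[OF ex(2,4,3)] by simp
    thus "\<exists>ups\<in>Fu w. \<exists>sg\<in>Fu w. agree w ups (ps Ph) \<and> agree w sg (ch Ph) \<and> agree w de (%w a. G w (ap w ups) (ap w sg) a)"
     using ex by (intro bexI[of _ ups] bexI[of _ sg] conjI)
   qed
  qed
  finally show ?thesis .
 qed
 show "G w (ps Ph' w) (ch Ph' w) a = G w (ps Ph w) (ch Ph w) a" if "Ph' \<in> Fu w" "agree w Ph' (%w' a. ap w' Ph a)" "a \<in> N w" for Ph' a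
  by (rule cong) (use w that representsD(5)[OF X] representsD(5)[OF Y] represents_N[OF Y] in auto)
qed (use representsD(1)[OF X] representsD(1)[OF Y] E in simp)

text \<open>Existence comes from \<open>closure_rec\<close> and uniqueness from
  \<open>rec_agree\<close>.\<close>

lemma rec2_represents:
 assumes X: "represents X ps" and Y: "represents Y ch"
 shows "represents (rec2 X Y) (%Ph w x. rv w (ps Ph w (Lw w x))
  (%w' m r. ch Ph w' (Jw w' m (Jw w' r (nf w' (Lw w x))))) (Kw w x))"
 unfolding represents_def
proof (intro conjI allI impI ballI)
 show "rec2 X Y \<in> formulas bim_language" using representsD(1)[OF X] representsD(1)[OF Y] by simp
 fix w Ph assume w: "W w" "Ph \<in> Fu w"
 let ?f = "%w x. rv w (ps Ph w (Lw w x)) (%w' m r. ch Ph w' (Jw w' m (Jw w' r (nf w' (Lw w x))))) (Kw w x)"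
 obtain ups sg where ex: "ups \<in> Fu w" "agree w ups (ps Ph)" "sg \<in> Fu w" "agree w sg (ch Ph)"
  using representsD(3)[OF X w] representsD(3)[OF Y w] by (auto simp: rp_def)
 obtain ze where ze: "ze \<in> Fu w" "rec_spec w ze ups sg" using closure_rec[OF w(1) ex(1,3)] by blast
 have ag: "agree w de ?f" if "de \<in> Fu w" "ups \<in> Fu w" "sg \<in> Fu w" "agree w ups (ps Ph)" "agree w sg (ch Ph)" "rec_spec w de ups sg" for de ups sg
  by (rule rec_agree[OF w(1) that])
 show "rp w ?f" using ag[OF ze(1) ex(1,3,2,4) ze(2)] ze(1) by (auto simp: rp_def)
 show "sat w rh (de ## Ph ## th) (rec2 X Y) <-> agree w de ?f" if e: "en w rh th" and de: "de \<in> Fu w" for rh th de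
 proof -
  let ?B = "Eq (App (FVar 4) (pairJ (suc (Var 0)) (Var 1)))
       (App (FVar 0) (pairJ (Var 0) (pairJ (App (FVar 4) (pairJ (Var 0) (Var 1))) (Var 1))))"
  let ?A = "And (Eq (App (FVar 4) (pairJ zero (Var 0))) (App (FVar 2) (Var 0))) (AllN ?B)"
  have fm: "AllN ?A \<in> formulas bim_language" "?A \<in> fmls Sy" by simp_all
  have "sat w rh (de ## Ph ## th) (rec2 X Y) <-> (\<exists>ups\<in>Fu w. \<exists>sg\<in>Fu w. agree w ups (ps Ph) \<and> agree w sg (ch Ph) \<and> rec_spec w de ups sg)"
   unfolding rec2_def
  proof (rule sat_call2[OF X Y fm(1) w de e])
   fix ups sg Ph' Ph'' assume F: "ups \<in> Fu w" "sg \<in> Fu w" "Ph' \<in> Fu w" "Ph'' \<in> Fu w"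
   let ?th = "sg ## Ph'' ## ups ## Ph' ## de ## Ph ## th"
   have e1: "en w rh ?th" using e w de F by (intro env_consF)
   have *: "sat w' (x ## rh) ?th ?A <-> ap w' de (Jw w' (zw w') x) = ap w' ups x \<and>
    (\<forall>w''. W w'' --> w' << w'' --> (\<forall>y\<in>N w''. ap w'' de (Jw w'' (Sw w'' y) (nf w'' x)) =
      ap w'' sg (Jw w'' y (Jw w'' (ap w'' de (Jw w'' y (nf w'' x))) (nf w'' x)))))"
    if w': "W w'" "w << w'" and x: "x \<in> N w'" for w' x
   proof -
    have F': "ups \<in> Fu w'" "sg \<in> Fu w'" "de \<in> Fu w'" using F de w' F_mono by blast+
    have e2: "en w' (x ## rh) ?th" using e1 w' x by (intro env_consN) (auto intro: env_mono)
    have "sat w' (x ## rh) ?th (Eq (App (FVar 4) (pairJ zero (Var 0))) (App (FVar 2) (Var 0))) <->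
     ap w' de (Jw w' (zw w') x) = ap w' ups x"
     by (subst sat_Eq[OF w'(1) e2]) (use w' F' x in "auto simp: numeral_eq_Suc nf_App nf_pairJ nf_idem")
    moreover have "nf w'' (sub_trm (y ## x ## rh) ?th (App (FVar 4) (pairJ (suc (Var 0)) (Var 1)))) =
      ap w'' de (Jw w'' (Sw w'' y) (nf w'' x))"
     "nf w'' (sub_trm (y ## x ## rh) ?th (App (FVar 0) (pairJ (Var 0) (pairJ (App (FVar 4) (pairJ (Var 0) (Var 1))) (Var 1))))) =
      ap w'' sg (Jw w'' y (Jw w'' (ap w'' de (Jw w'' y (nf w'' x))) (nf w'' x)))"
     if w'': "W w''" "w' << w''" and y: "y \<in> N w''" for w'' y
    proof -
     have "ups \<in> Fu w''" "sg \<in> Fu w''" "de \<in> Fu w''" "x \<in> Tm w''" using F' w'' F_mono T_mono w' x by auto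
     thus "nf w'' (sub_trm (y ## x ## rh) ?th (App (FVar 4) (pairJ (suc (Var 0)) (Var 1)))) =
      ap w'' de (Jw w'' (Sw w'' y) (nf w'' x))"
     "nf w'' (sub_trm (y ## x ## rh) ?th (App (FVar 0) (pairJ (Var 0) (pairJ (App (FVar 4) (pairJ (Var 0) (Var 1))) (Var 1))))) =
      ap w'' sg (Jw w'' y (Jw w'' (ap w'' de (Jw w'' y (nf w'' x))) (nf w'' x)))"
      using w'' y by (auto simp: numeral_eq_Suc nf_App nf_pairJ nf_idem)
    qed
    ultimately show ?thesis by (simp add: sat_And[OF w'(1)] sat_AllEq[OF w'(1) e2])
   qed
   have "sat w rh ?th (AllN ?A) <-> (\<forall>w'. W w' --> w << w' --> (\<forall>x\<in>N w'. sat w' (x ## rh) ?th ?A))"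
    by (rule sat_AllN'[OF w(1) e1 fm(2)])
   also have "... <-> rec_spec w de ups sg"
   proof
    assume a: "\<forall>w'. W w' --> w << w' --> (\<forall>x\<in>N w'. sat w' (x ## rh) ?th ?A)"
    show "rec_spec w de ups sg" unfolding rec_spec_def
    proof (intro allI impI ballI conjI)
     fix w' x assume w': "W w'" "w << w'" and x: "x \<in> N w'"
     show "ap w' de (Jw w' (zw w') x) = ap w' ups x" using a *[OF w' x] w' x by blast
     fix y assume "y \<in> N w'"
     thus "ap w' de (Jw w' (Sw w' y) x) = ap w' sg (Jw w' y (Jw w' (ap w' de (Jw w' y x)) x))"
      using a *[OF w' x] w' x wle_refl nf_idem[OF w'(1) x] by metis
    qed
   next
    assume r: "rec_spec w de ups sg"
    show "\<forall>w'. W w' --> w << w' --> (\<forall>x\<in>N w'. sat w' (x ## rh) ?th ?A)"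
    proof (intro allI impI ballI)
     fix w' x assume w': "W w'" "w << w'" and x: "x \<in> N w'"
     have "ap w'' de (Jw w'' (Sw w'' y) (nf w'' x)) = ap w'' sg (Jw w'' y (Jw w'' (ap w'' de (Jw w'' y (nf w'' x))) (nf w'' x)))"
      if "W w''" "w' << w''" "y \<in> N w''" for w'' y
      using r that w' x wle_trans[OF w'(2) that(2)] N_up[OF w'(1) that(1,2) x] unfolding rec_spec_def by blast
     thus "sat w' (x ## rh) ?th ?A" using *[OF w' x] r w' x unfolding rec_spec_def by blast
    qed
   qed
   finally show "sat w rh ?th (AllN ?A) <-> rec_spec w de ups sg" .
  qed
  also have "... <-> agree w de ?f"
  proof
   assume "\<exists>ups\<in>Fu w. \<exists>sg\<in>Fu w. agree w ups (ps Ph) \<and> agree w sg (ch Ph) \<and> rec_spec w de ups sg"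
   thus "agree w de ?f" using ag de by blast
  next
   assume d: "agree w de ?f"
   \<comment> \<open>The functor \<open>ze\<close> satisfies the recursion equations and agrees with
     the same family as \<open>de\<close>; so \<open>de\<close> inherits the equations.\<close>
   have eq: "ap w' de x = ap w' ze x" if "W w'" "w << w'" "x \<in> N w'" for w' x
    using agreeD[OF d that] agreeD[OF ag[OF ze(1) ex(1,3,2,4) ze(2)] that] by simp
   have "rec_spec w de ups sg" unfolding rec_spec_def
   proof (intro allI impI ballI conjI)
    fix w' x assume w': "W w'" "w << w'" and x: "x \<in> N w'"
    show "ap w' de (Jw w' (zw w') x) = ap w' ups x"
     using ze(2) w' x eq[OF w'] by (simp add: rec_spec_def)
    fix y assume "y \<in> N w'"
    thus "ap w' de (Jw w' (Sw w' y) x) = ap w' sg (Jw w' y (Jw w' (ap w' de (Jw w' y x)) x))"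
     using ze(2) w' x eq[OF w'] by (simp add: rec_spec_def)
   qed
   thus "\<exists>ups\<in>Fu w. \<exists>sg\<in>Fu w. agree w ups (ps Ph) \<and> agree w sg (ch Ph) \<and> rec_spec w de ups sg"
    using ex by blast
  qed
  finally show ?thesis .
 qed
 show "rv w (ps Ph' w (Lw w a)) (%w' m r. ch Ph' w' (Jw w' m (Jw w' r (nf w' (Lw w a))))) (Kw w a) = ?f w a"
  if "Ph' \<in> Fu w" "agree w Ph' (%w' a. ap w' Ph a)" "a \<in> N w" for Ph' a
 proof (rule rv_cong[OF w(1) _ refl])
  show "ps Ph' w (Lw w a) = ps Ph w (Lw w a)" using representsD(5)[OF X] w that by simp
  fix w' m r assume w': "W w'" "w << w'" "m \<in> N w'" "r \<in> N w'"
  show "ch Ph' w' (Jw w' m (Jw w' r (nf w' (Lw w a)))) = ch Ph w' (Jw w' m (Jw w' r (nf w' (Lw w a))))"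
   by (rule representsD(5)[OF Y w'(1)]) (use w w' that F_mono agree_mono in auto)
 qed
qed

lemma comp_represents:
 assumes "represents X ps" "represents Y ch"
 shows "represents (comp2 X Y E_comp) (%Ph w a. ps Ph w (ch Ph w a))"
  and "represents (comp2 X Y E_app) (%Ph w a. ps Ph w (Jw w (ch Ph w a) a))"
  and "represents (comp2 X Y E_pair) (%Ph w a. Jw w (ps Ph w a) (ch Ph w a))"
  and "represents (comp2 X Y E_step) (%Ph w z. ps Ph w
   (Jw w (ch Ph w (Jw w (Kw w (Lw w z)) (Jw w (Kw w z) (zw w)))) (Lw w (Lw w z))))"
proof -
 note [simp] = numeral_eq_Suc nf_App nf_pairJ nf_idem
 show "represents (comp2 X Y E_comp) (%Ph w a. ps Ph w (ch Ph w a))"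
 proof (rule comp2_represents[OF assms, where G = "%w f g a. f (g a)"])
  show "rp w (%w' a. (%w f g a. f (g a)) w' (ap w' ups) (ap w' sg) a)" if "W w" "ups \<in> Fu w" "sg \<in> Fu w" for w ups sg
   by (rule rp_ap[OF that(1,2) rp_fun[OF that(3)]])
 qed auto
 show "represents (comp2 X Y E_app) (%Ph w a. ps Ph w (Jw w (ch Ph w a) a))"
 proof (rule comp2_represents[OF assms, where G = "%w f g a. f (Jw w (g a) a)"])
  show "rp w (%w' a. (%w f g a. f (Jw w (g a) a)) w' (ap w' ups) (ap w' sg) a)" if "W w" "ups \<in> Fu w" "sg \<in> Fu w" for w ups sg
   by (rule rp_ap[OF that(1,2) rp_pair[OF that(1) rp_fun[OF that(3)] rp_id[OF that(1)]]])
 qed auto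
 show "represents (comp2 X Y E_pair) (%Ph w a. Jw w (ps Ph w a) (ch Ph w a))"
 proof (rule comp2_represents[OF assms, where G = "%w f g a. Jw w (f a) (g a)"])
  show "rp w (%w' a. (%w f g a. Jw w (f a) (g a)) w' (ap w' ups) (ap w' sg) a)" if "W w" "ups \<in> Fu w" "sg \<in> Fu w" for w ups sg
   by (rule rp_pair[OF that(1) rp_fun[OF that(2)] rp_fun[OF that(3)]])
 qed auto
 show "represents (comp2 X Y E_step) (%Ph w z. ps Ph w
   (Jw w (ch Ph w (Jw w (Kw w (Lw w z)) (Jw w (Kw w z) (zw w)))) (Lw w (Lw w z))))"
 proof (rule comp2_represents[OF assms, where G = "%w f g a. f (Jw w (g (Jw w (Kw w (Lw w a)) (Jw w (Kw w a) (zw w)))) (Lw w (Lw w a)))"])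
  show "rp w (%w' a. (%w f g a. f (Jw w (g (Jw w (Kw w (Lw w a)) (Jw w (Kw w a) (zw w)))) (Lw w (Lw w a)))) w' (ap w' ups) (ap w' sg) a)" if "W w" "ups \<in> Fu w" "sg \<in> Fu w" for w ups sg
   by (intro rp_ap[OF that(1)] rp_pair[OF that(1)] rp_id[OF that(1)] rp_zero[OF that(1)] bim_F that)
 qed auto
qed

end

section \<open>The translation of formulas into the language of BIM\<close>

primrec venv :: "nat => nat => trm" where
 "venv M 0 = zero"
| "venv M (Suc j) = pairJ (Var (M - Suc j)) (venv M j)"

text \<open>The index 0 is the code \<open>Ph\<close>, behind which the function variables are
  shifted by one. In the base case \<open>Eq zero zero\<close> serves as truth.\<close>

primrec bindF :: "nat => fm" where
 "bindF 0 = Eq zero zero"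
| "bindF (Suc n) = And (bindF n)
  (AllN (Eq (App (FVar 0) (pairJ (numeral_trm n) (Var 0))) (App (FVar (Suc n)) (Var 0))))"

text \<open>The second \<open>ExF\<close> binds a dummy: \<open>call\<close> expects a function
  being defined at the index 0 and the code \<open>Ph\<close> at the index 1.\<close>

definition atom_fm :: "trm => trm => nat => fm" where
 "atom_fm s t M = ExF (And (bindF M) (ExF (call (trm_fm s) (call (trm_fm t)
  (Eq (App (FVar 2) (venv M M)) (App (FVar 0) (venv M M)))))))"

primrec tsize :: "tree => nat" where
 "tsize Leaf = 0"
| "tsize (Branch a b) = Suc (tsize a + tsize b)"

text \<open>Equations of BIM are kept because the translation has to be the identity on BIM. As the
  number \<open>M\<close> of variables to be coded the size of the code is taken, a bound for all
  indices that is easy to compute.\<close>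

primrec bim_fm :: "fm => fm" where
 "bim_fm (Eq s t) = (if s \<in> terms bim_language \<and> t \<in> terms bim_language then Eq s t
  else atom_fm s t (tsize (code_fm (Eq s t))))"
| "bim_fm Bot = Bot"
| "bim_fm (And A B) = And (bim_fm A) (bim_fm B)"
| "bim_fm (Or A B) = Or (bim_fm A) (bim_fm B)"
| "bim_fm (Imp A B) = Imp (bim_fm A) (bim_fm B)"
| "bim_fm (AllN A) = AllN (bim_fm A)"
| "bim_fm (ExN A) = ExN (bim_fm A)"
| "bim_fm (AllF A) = AllF (bim_fm A)"
| "bim_fm (ExF A) = ExF (bim_fm A)"

lemma tuple_fm_formula: "(\<And>X. X \<in> set Xs ==> X \<in> formulas bim_language) ==> tuple_fm Xs \<in> formulas bim_language"
 by (induction Xs) auto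

lemma prd_fm_formula [simp]: "prd_fm d \<in> formulas bim_language"
 by (induction d) (auto intro!: tuple_fm_formula)

lemma fsym_fm_formula [simp]: "fsym_fm c \<in> formulas bim_language"
 by (cases c) auto

lemma trm_fm_formula [simp]: "trm_fm t \<in> formulas bim_language"
 and fnl_fm_formula [simp]: "fnl_fm u \<in> formulas bim_language"
 by (induction t and u) (auto intro!: tuple_fm_formula)

lemma venv_terms [simp]: "venv M j \<in> terms bim_language" by (induction j) auto
lemma bindF_formula [simp]: "bindF M \<in> formulas bim_language" by (induction M) auto
lemma atom_fm_formula [simp]: "atom_fm s t M \<in> formulas bim_language" by (simp add: atom_fm_def)

lemma bim_fm_formula [simp]: "bim_fm A \<in> formulas bim_language" by (induction A) auto

lemma bim_fm_id: "A \<in> formulas bim_language ==> bim_fm A = A" by (induction A) auto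

lemma tsize_num_tree [simp]: "tsize (num_tree n) = n" by (induction n) auto

lemma tsize_list_tree: "x \<in> set xs ==> tsize x \<le> tsize (list_tree xs)"
 by (induction xs) auto

text \<open>Indices are coded in unary notation, so the size of a code exceeds every index in it.
  Under \<open>Lam\<close> the same bound still suffices.\<close>

lemma over_tsize: "tsize (code_trm t) \<le> M ==> over_trm {..<M} {..<M} t"
 and over_tsize_fnl: "tsize (code_fnl u) \<le> M ==> over_fnl {..<M} {..<M} u"
proof (induction t and u arbitrary: M and M)
 case (Fn c ts)
 have "over_trm {..<M} {..<M} t" if t: "t \<in> set ts" for t
 proof (rule Fn.IH[OF t])
  have "tsize (code_trm t) \<le> tsize (list_tree (map code_trm ts))" using t by (auto intro: tsize_list_tree)
  thus "tsize (code_trm t) \<le> M" using Fn.prems by (simp add: node_def)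
 qed
 thus ?case by simp
next
 case (Lam t)
 have "over_trm {..<M} {..<M} t" by (rule Lam.IH) (use Lam.prems in "simp add: node_def")
 moreover have "{..<M} \<subseteq> insert 0 (Suc ` {..<M})"
 proof
  fix x assume "x \<in> {..<M}" thus "x \<in> insert 0 (Suc ` {..<M})" by (cases x) auto
 qed
 ultimately show ?case using over_mono by (metis over_fnl.simps(3) subset_refl)
qed (auto simp: node_def)

context bim0
begin

section \<open>Values of terms in the worlds\<close>

primrec tup :: "world => trm list => trm" where
 "tup w [] = zw w"
| "tup w (a # as) = Jw w a (tup w as)"

definition prj :: "world => nat => trm => trm" where
 "prj w i x = Kw w ((Lw w ^^ i) x)"

text \<open>Arguments come coded as by \<open>tup\<close>. The step of \<open>Rec0\<close> also
  receives the tail of the code; for a single argument this is the end marker 0, so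
  \<open>J(m, J(r, 0))\<close> codes the two arguments of \<open>h\<close>.\<close>

primrec pev :: "prd => world => trm => trm" where
 "pev Succ w x = Sw w (Kw w x)"
| "pev (Const n q) w x = nf w (numeral_trm q)"
| "pev (Proj n i) w x = prj w i x"
| "pev (Comp n g hs) w x = pev g w (tup w (map (%f. f w x) (map pev hs)))"
| "pev (Rec0 q h) w x = rv w (nf w (numeral_trm q))
  (%w' m r. pev h w' (Jw w' m (Jw w' r (nf w' (Lw w x))))) (Kw w x)"
| "pev (RecP g h) w x = rv w (pev g w (Lw w x))
  (%w' m r. pev h w' (Jw w' m (Jw w' r (nf w' (Lw w x))))) (Kw w x)"

primrec cev :: "fsym => world => trm => trm" where
 "cev Zero w x = zw w"
| "cev ZeroFn w x = zw w"
| "cev Ident w x = Kw w x"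
| "cev PairJ w x = Jw w (Kw w x) (Kw w (Lw w x))"
| "cev ProjK w x = Kw w (Kw w x)"
| "cev ProjL w x = Lw w (Kw w x)"
| "cev (PR d) w x = pev d w x"

text \<open>Variables denote families over the worlds, since the step of a recursion is evaluated in
  all later worlds; an element bound by \<open>Lam\<close> becomes the family of its normal forms.
  In the clause for \<open>Fn\<close> the evaluation functions of the arguments are collected by
  \<open>map\<close>, the form of nested recursion that \<open>primrec\<close> accepts.\<close>

primrec eval :: "trm => (nat => world => trm) => (nat => world => trm => trm) => world => trm"
 and feval :: "fnl => (nat => world => trm) => (nat => world => trm => trm) => world => trm => trm" where
 "eval (Var n) rh th w = rh n w"
| "eval (Fn c ts) rh th w = cev c w (tup w (map (%f. f rh th w) (map eval ts)))"
| "eval (App u t) rh th w = feval u rh th w (eval t rh th w)"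
| "eval (Rec t u s) rh th w = rv w (eval t rh th w)
  (%w' m r. feval u rh th w' (pev pr_pair w' (Jw w' r (Jw w' m (zw w'))))) (eval s rh th w)"
| "feval (FVar n) rh th w a = th n w a"
| "feval (FC c) rh th w a = cev c w (Jw w a (zw w))"
| "feval (Lam t) rh th w a = eval t ((%w'. nf w' a) ## rh) th w"

lemma tuple_represents:
 "list_all2 represents Xs pss ==> represents (tuple_fm Xs) (%Ph w a. tup w (map (%ps. ps Ph w a) pss))"
proof (induction rule: list_all2_induct)
 case Nil
 have "represents (basic zero) (%Ph w a. (%w f a. zw w) w (ap w Ph) a)"
  by (rule basic_represents) (auto intro: rp_zero)
 thus ?case by simp
next
 case (Cons X Xs ps pss)
 thus ?case using comp_represents(3) by simp
qed

lemma basic_const: "represents (basic (numeral_trm q)) (%Ph w a. nf w (numeral_trm q))"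
proof -
 have "represents (basic (numeral_trm q)) (%Ph w a. (%w f a. nf w (numeral_trm q)) w (ap w Ph) a)"
  by (rule basic_represents) (auto intro: rp_const)
 thus ?thesis by simp
qed

lemma basic_prj: "represents (basic (projK (Lpow i (Var 0)))) (%Ph w a. prj w i a)"
proof -
 have "represents (basic (projK (Lpow i (Var 0)))) (%Ph w a. (%w f a. prj w i a) w (ap w Ph) a)"
 proof (rule basic_represents)
  show "rp w (%w' a. prj w' i a)" if "W w" for w
   unfolding prj_def by (intro rp_ap[OF that] bim_F rp_Lpow[OF that] rp_id[OF that])
 qed (auto simp: prj_def nf_App nf_Lpow nf_idem)
 thus ?thesis by simp
qed

lemma prd_represents: "represents (prd_fm d) (%Ph. pev d)"
proof (induction d)
 case Succ
 have "represents (basic (suc (projK (Var 0)))) (%Ph w a. (%w f a. Sw w (Kw w a)) w (ap w Ph) a)"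
 proof (rule basic_represents)
  show "rp w (%w' a. Sw w' (Kw w' a))" if "W w" for w
   by (intro rp_ap[OF that] bim_F Succ_F rp_id[OF that])
 qed (auto simp: nf_App nf_idem)
 thus ?case unfolding prd_fm.simps by (rule represents_cong) simp
next
 case (Const n q)
 show ?case unfolding prd_fm.simps by (rule represents_cong[OF basic_const]) simp
next
 case (Proj n i)
 have "represents (prd_fm (Proj n i)) (%Ph w a. prj w i a)" using basic_prj by simp
 thus ?case by (rule represents_cong) auto
next
 case (Comp n g hs)
 have "list_all2 represents (map prd_fm hs) (map (%h Ph. pev h) hs)"
  using Comp.IH(2) by (simp add: list_all2_conv_all_nth)
 from comp_represents(1)[OF Comp.IH(1) tuple_represents[OF this]]
 have "represents (prd_fm (Comp n g hs)) (%Ph w a. pev g w (tup w (map (%ps. ps Ph w a) (map (%h Ph. pev h) hs))))"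
  by simp
 thus ?case by (rule represents_cong) (simp add: comp_def)
next
 case (Rec0 q h)
 have "represents (prd_fm (Rec0 q h)) (%Ph w x. rv w (nf w (numeral_trm q))
  (%w' m r. pev h w' (Jw w' m (Jw w' r (nf w' (Lw w x))))) (Kw w x))"
  using rec2_represents[OF basic_const Rec0.IH] by simp
 thus ?case by (rule represents_cong) simp
next
 case (RecP g h)
 have "represents (prd_fm (RecP g h)) (%Ph w x. rv w (pev g w (Lw w x))
  (%w' m r. pev h w' (Jw w' m (Jw w' r (nf w' (Lw w x))))) (Kw w x))"
  using rec2_represents[OF RecP.IH] by simp
 thus ?case by (rule represents_cong) simp
qed

lemma pev_N [simp]: "W w ==> x \<in> N w ==> pev d w x \<in> N w"
 using represents_N[OF prd_represents, of w "FC ZeroFn"] by simp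

lemma fsym_represents: "represents (fsym_fm c) (%Ph. cev c)"
proof -
 have 0: "represents (basic zero) (%Ph w a. zw w)" using basic_const[of 0] by simp
 have b: "represents (basic E) (%Ph w a. G w a)"
  if "E \<in> terms bim_language" "\<And>w Ph de rh th a. W w ==> a \<in> N w ==> nf w (sub_trm (a ## rh) (de ## Ph ## th) E) = G w a"
   "\<And>w. W w ==> rp w G" for E G
  using basic_represents[where G = "%w f a. G w a" and E = E] that by simp
 note simps = nf_App nf_pairJ nf_idem
 show ?thesis
 proof (cases c)
  case Zero thus ?thesis using 0 by (auto intro: represents_cong)
 next
  case ZeroFn thus ?thesis using 0 by (auto intro: represents_cong)
 next
  case Ident
  have "represents (basic (projK (Var 0))) (%Ph w a. Kw w a)"
   by (rule b) (auto simp: simps intro!: rp_fun)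
  thus ?thesis using Ident by (auto intro: represents_cong)
 next
  case PairJ
  have "represents (basic (pairJ (projK (Var 0)) (projK (projL (Var 0))))) (%Ph w a. Jw w (Kw w a) (Kw w (Lw w a)))"
   by (rule b) (auto simp: simps intro!: rp_fun rp_pair rp_ap)
  thus ?thesis using PairJ by (auto intro: represents_cong)
 next
  case ProjK
  have "represents (basic (projK (projK (Var 0)))) (%Ph w a. Kw w (Kw w a))"
   by (rule b) (auto simp: simps intro!: rp_fun rp_ap)
  thus ?thesis using ProjK by (auto intro: represents_cong)
 next
  case ProjL
  have "represents (basic (projL (projK (Var 0)))) (%Ph w a. Lw w (Kw w a))"
   by (rule b) (auto simp: simps intro!: rp_fun rp_ap)
  thus ?thesis using ProjL by (auto intro: represents_cong)
 next
  case (PR d) 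
  have "represents (fsym_fm c) (%Ph. pev d)" using PR prd_represents by simp
  thus ?thesis by (rule represents_cong) (simp add: PR)
 qed
qed

lemma cev_N [simp]: "W w ==> x \<in> N w ==> cev c w x \<in> N w"
 using represents_N[OF fsym_represents, of w "FC ZeroFn"] by simp

lemma tup_N [simp]: "W w ==> (\<And>a. a \<in> set as ==> a \<in> N w) ==> tup w as \<in> N w"
 by (induction as) auto

text \<open>Equality of the values and membership in the world are proved together, because the
  claim about functors applies only to arguments known to lie in the world.\<close>

lemma eval_cong:
 "over_trm X Y t ==> W w ==> (\<And>i w'. i \<in> X ==> W w' ==> w << w' ==> rh i w' = rh' i w' \<and> rh i w' \<in> N w')
  ==> (\<And>i w' a. i \<in> Y ==> W w' ==> w << w' ==> a \<in> N w' ==> th i w' a = th' i w' a \<and> th i w' a \<in> N w')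
  ==> eval t rh th w = eval t rh' th' w \<and> eval t rh th w \<in> N w"
 and feval_cong:
 "over_fnl X Y u ==> W w ==> (\<And>i w'. i \<in> X ==> W w' ==> w << w' ==> rh i w' = rh' i w' \<and> rh i w' \<in> N w')
  ==> (\<And>i w' a. i \<in> Y ==> W w' ==> w << w' ==> a \<in> N w' ==> th i w' a = th' i w' a \<and> th i w' a \<in> N w')
  ==> a \<in> N w ==> feval u rh th w a = feval u rh' th' w a \<and> feval u rh th w a \<in> N w"
proof (induction t and u arbitrary: X rh rh' w and X rh rh' w a)
 case (Var n) thus ?case using Var.prems(3)[of n w] by simp
next
 case (Fn c ts)
 have *: "eval t rh th w = eval t rh' th' w \<and> eval t rh th w \<in> N w" if "t \<in> set ts" for t
  by (rule Fn.IH[OF that _ Fn.prems(2-4)]) (use Fn.prems(1) that in auto)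
 hence "map (%f. f rh th w) (map eval ts) = map (%f. f rh' th' w) (map eval ts)" by simp
 moreover have "cev c w (tup w (map (%f. f rh th w) (map eval ts))) \<in> N w"
 proof (intro cev_N tup_N Fn.prems(2))
  fix a assume "a \<in> set (map (%f. f rh th w) (map eval ts))"
  then obtain t where "t \<in> set ts" "a = eval t rh th w" by auto
  thus "a \<in> N w" using * by blast
 qed
 ultimately show ?case by (simp only: eval.simps simp_thms)
next
 case (App u t)
 have ov: "over_fnl X Y u" "over_trm X Y t" using App.prems(1) by auto
 have t: "eval t rh th w = eval t rh' th' w \<and> eval t rh th w \<in> N w" by (rule App.IH(2)[OF ov(2) App.prems(2-4)])
 have "feval u rh th w (eval t rh th w) = feval u rh' th' w (eval t rh th w) \<and> feval u rh th w (eval t rh th w) \<in> N w"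
  by (rule App.IH(1)[OF ov(1) App.prems(2-4) conjunct2[OF t]])
 thus ?case unfolding eval.simps conjunct1[OF t, symmetric] .
next
 case (Rec t u s)
 have ov: "over_trm X Y t" "over_fnl X Y u" "over_trm X Y s" using Rec.prems(1) by auto
 have t: "eval t rh th w = eval t rh' th' w \<and> eval t rh th w \<in> N w" by (rule Rec.IH(1)[OF ov(1) Rec.prems(2-4)])
 have s: "eval s rh th w = eval s rh' th' w \<and> eval s rh th w \<in> N w" by (rule Rec.IH(3)[OF ov(3) Rec.prems(2-4)])
 have u: "feval u rh th w' a = feval u rh' th' w' a" if w': "W w'" "w << w'" and "a \<in> N w'" for w' a
  by (rule conjunct1[OF Rec.IH(2)[OF ov(2) w'(1) Rec.prems(3)[OF _ _ wle_trans[OF w'(2)]]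
   Rec.prems(4)[OF _ _ wle_trans[OF w'(2)]] that(3)]])
 have "rv w (eval t rh th w) (%w' m r. feval u rh th w' (pev pr_pair w' (Jw w' r (Jw w' m (zw w'))))) (eval s rh th w)
  = rv w (eval t rh' th' w) (%w' m r. feval u rh' th' w' (pev pr_pair w' (Jw w' r (Jw w' m (zw w'))))) (eval s rh' th' w)"
  by (rule rv_cong[OF Rec.prems(2)]) (use t s u in auto)
 thus ?case unfolding eval.simps using rv_N[OF Rec.prems(2) conjunct2[OF s]] by (rule conjI)
next
 case (FVar n) thus ?case using FVar.prems(4)[of n w a] by simp
next
 case (FC c) thus ?case by simp
next
 case (Lam t)
 have "eval t ((%w'. nf w' a) ## rh) th w = eval t ((%w'. nf w' a) ## rh') th' w \<and> eval t ((%w'. nf w' a) ## rh) th w \<in> N w"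
 proof (rule Lam.IH[of "insert 0 (Suc ` X)"])
  fix i w' assume "i \<in> insert 0 (Suc ` X)" and w': "W w'" "w << w'"
  thus "((%w'. nf w' a) ## rh) i w' = ((%w'. nf w' a) ## rh') i w' \<and> ((%w'. nf w' a) ## rh) i w' \<in> N w'"
   using Lam.prems(3)[OF _ w', of "i - 1"] N_up[OF Lam.prems(2) w' Lam.prems(5)] by (cases i) auto
 next
  show "\<And>i w' a. i \<in> Y ==> W w' ==> w << w' ==> a \<in> N w' ==> th i w' a = th' i w' a \<and> th i w' a \<in> N w'" by (rule Lam.prems(4))
 qed (use Lam.prems(1,2) in simp_all)
 thus ?case unfolding feval.simps .
qed

definition decN :: "trm => nat => world => trm" where
 "decN e i w = prj w i (nf w e)"

definition decF :: "fnl => nat => world => trm => trm" where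
 "decF Ph i w a = ap w Ph (Jw w (nf w (numeral_trm i)) a)"

lemma prj_N [simp]: "W w ==> x \<in> N w ==> prj w i x \<in> N w" by (simp add: prj_def)

lemma decN_N: "W w ==> W w' ==> w << w' ==> e \<in> N w ==> decN e i w' \<in> N w'" by (simp add: decN_def)

lemma decF_N: "W w' ==> w << w' ==> Ph \<in> Fu w ==> a \<in> N w' ==> decF Ph i w' a \<in> N w'"
 using F_mono[of w w' Ph Sy] by (simp add: decF_def)

lemma prj_0: "prj w 0 x = Kw w x" and prj_Suc: "prj w (Suc i) x = prj w i (Lw w x)"
 by (simp_all add: prj_def funpow_swap1)

lemma trm_represents: "represents (trm_fm t) (%Ph w e. eval t (decN e) (decF Ph) w)"
 and fnl_represents: "represents (fnl_fm u) (%Ph w z. feval u (decN (Lw w z)) (decF Ph) w (Kw w z))"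
proof (induction t and u)
 case (Var n)
 have "represents (trm_fm (Var n)) (%Ph w a. prj w n a)" using basic_prj by simp
 thus ?case by (rule represents_cong) (simp add: decN_def nf_idem)
next
 case (Fn c ts)
 have "list_all2 represents (map trm_fm ts) (map (%t Ph w e. eval t (decN e) (decF Ph) w) ts)"
  using Fn.IH by (simp add: list_all2_conv_all_nth)
 from comp_represents(1)[OF fsym_represents tuple_represents[OF this]]
 show ?case by (simp add: comp_def)
next
 case (App u t)
 have "represents (trm_fm (App u t)) (%Ph w a. feval u (decN (Lw w (Jw w (eval t (decN a) (decF Ph) w) a))) (decF Ph) w
   (Kw w (Jw w (eval t (decN a) (decF Ph) w) a)))" using comp_represents(2)[OF App.IH] by simp
 thus ?case
  by (rule represents_cong) (use represents_N[OF App.IH(2)] in "simp add: bim_const_eqs")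
next
 case (Rec t u s)
 have h: "represents (comp2 (fnl_fm u) (prd_fm pr_pair) E_step) (%Ph w z. feval u (decN (Lw w (Lw w z))) (decF Ph) w
   (pev pr_pair w (Jw w (Kw w (Lw w z)) (Jw w (Kw w z) (zw w)))))"
  by (rule represents_cong[OF comp_represents(4)[OF Rec.IH(2) prd_represents]]) (simp add: bim_const_eqs)
 have "represents (trm_fm (Rec t u s)) (%Ph w a. rv w (eval t (decN a) (decF Ph) w)
   (%w' m r. feval u (decN (nf w' a)) (decF Ph) w' (pev pr_pair w' (Jw w' r (Jw w' m (zw w')))))
   (eval s (decN a) (decF Ph) w))"
  unfolding trm_fm.simps
 proof (rule represents_cong[OF comp_represents(2)[OF rec2_represents[OF Rec.IH(1) h] Rec.IH(3)]])
  fix w Ph a assume w: "W w" "Ph \<in> Fu w" "a \<in> N w"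
  have s: "eval s (decN a) (decF Ph) w \<in> N w" using represents_N[OF Rec.IH(3) w] .
  show "rv w (eval t (decN (Lw w (Jw w (eval s (decN a) (decF Ph) w) a))) (decF Ph) w)
   (%w' m r. feval u (decN (Lw w' (Lw w' (Jw w' m (Jw w' r (nf w' (Lw w (Jw w (eval s (decN a) (decF Ph) w) a)))))))) (decF Ph) w'
    (pev pr_pair w' (Jw w' (Kw w' (Lw w' (Jw w' m (Jw w' r (nf w' (Lw w (Jw w (eval s (decN a) (decF Ph) w) a)))))))
     (Jw w' (Kw w' (Jw w' m (Jw w' r (nf w' (Lw w (Jw w (eval s (decN a) (decF Ph) w) a)))))) (zw w')))))
   (Kw w (Jw w (eval s (decN a) (decF Ph) w) a)) =
  rv w (eval t (decN a) (decF Ph) w)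
   (%w' m r. feval u (decN (nf w' a)) (decF Ph) w' (pev pr_pair w' (Jw w' r (Jw w' m (zw w')))))
   (eval s (decN a) (decF Ph) w)"
   by (rule rv_cong[OF w(1)]) (use w s in "auto simp: bim_const_eqs")
 qed
 thus ?case
 proof (rule represents_cong)
  fix w Ph a assume w: "W w" "Ph \<in> Fu w" "a \<in> N w"
  show "rv w (eval t (decN a) (decF Ph) w)
   (%w' m r. feval u (decN (nf w' a)) (decF Ph) w' (pev pr_pair w' (Jw w' r (Jw w' m (zw w')))))
   (eval s (decN a) (decF Ph) w) = eval (Rec t u s) (decN a) (decF Ph) w"
   unfolding eval.simps
  proof (rule rv_cong[OF w(1) refl refl])
   fix w' m r assume w': "W w'" "w << w'" and mr: "m \<in> N w'" "r \<in> N w'"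
   \<comment> \<open>\<open>rec2\<close> passes the code of the environment on in normalized form.
     Decoding normalizes anyway, so the decoded values are the same.\<close>
   have "feval u (decN (nf w' a)) (decF Ph) w' x = feval u (decN a) (decF Ph) w' x \<and>
    feval u (decN (nf w' a)) (decF Ph) w' x \<in> N w'" if x: "x \<in> N w'" for x
   proof (rule feval_cong[of UNIV UNIV, OF over_UNIV_fnl w'(1) _ _ x])
    fix i w'' assume w'': "W w''" "w' << w''"
    have "nf w'' (nf w' a) = nf w'' a" using w' w'' w T_mono by simp
    thus "decN (nf w' a) i w'' = decN a i w'' \<and> decN (nf w' a) i w'' \<in> N w''"
     using decN_N[OF w(1) w''(1) wle_trans[OF w'(2) w''(2)] w(3)] by (simp add: decN_def)
   next
    fix i w'' a assume "W w''" "w' << w''" "a \<in> N w''"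
    thus "decF Ph i w'' a = decF Ph i w'' a \<and> decF Ph i w'' a \<in> N w''"
     using decF_N[of w'' w Ph a i] w w' wle_trans by blast
   qed
   thus "feval u (decN (nf w' a)) (decF Ph) w' (pev pr_pair w' (Jw w' r (Jw w' m (zw w')))) =
    feval u (decN a) (decF Ph) w' (pev pr_pair w' (Jw w' r (Jw w' m (zw w'))))" using w' mr by simp
  qed
 qed
next
 case (FVar n)
 let ?G = "%w f a. f (Jw w (nf w (numeral_trm n)) (Kw w a))"
 have "represents (fnl_fm (FVar n)) (%Ph w a. ?G w (ap w Ph) a)"
  unfolding fnl_fm.simps
 proof (rule basic_represents)
  show "rp w (%w' a. ap w' Ph (Jw w' (nf w' (numeral_trm n)) (Kw w' a)))" if "W w" "Ph \<in> Fu w" for w Ph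
   by (intro rp_ap[OF that(1)] rp_pair[OF that(1)] rp_const[OF that(1)] rp_id[OF that(1)] that bim_F numeral_T)
 qed (auto simp: nf_App nf_pairJ nf_idem)
 thus ?case by (rule represents_cong) (simp add: decF_def)
next
 case (FC c)
 have "represents (basic (pairJ (projK (Var 0)) zero)) (%Ph w a. (%w f a. Jw w (Kw w a) (zw w)) w (ap w Ph) a)"
  by (rule basic_represents) (auto simp: nf_App nf_pairJ nf_idem intro!: rp_pair rp_fun rp_zero)
 from comp_represents(1)[OF fsym_represents this] show ?case by simp
next
 case (Lam t)
 have "represents (fnl_fm (Lam t)) (%Ph w e. eval t (decN e) (decF Ph) w)" using Lam.IH by simp
 thus ?case
 proof (rule represents_cong)
  fix w Ph a assume w: "W w" "Ph \<in> Fu w" "a \<in> N w"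
  have "eval t (decN a) (decF Ph) w = eval t ((%w'. nf w' (Kw w a)) ## decN (Lw w a)) (decF Ph) w \<and>
   eval t (decN a) (decF Ph) w \<in> N w"
  proof (rule eval_cong[of UNIV UNIV, OF over_UNIV w(1)])
   fix i w' assume w': "W w'" "w << w'"
   show "decN a i w' = ((%w'. nf w' (Kw w a)) ## decN (Lw w a)) i w' \<and> decN a i w' \<in> N w'"
    using w' w ap_up[OF w(1) w' _ w(3)] by (cases i) (auto simp: decN_def prj_0 prj_Suc)
  next
   fix i w' a assume "W w'" "w << w'" "a \<in> N w'"
   thus "decF Ph i w' a = decF Ph i w' a \<and> decF Ph i w' a \<in> N w'" using decF_N w by blast
  qed
  thus "eval t (decN a) (decF Ph) w = feval (Lam t) (decN (Lw w a)) (decF Ph) w (Kw w a)" by simp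
 qed
qed

definition cst :: "(nat => trm) => nat => world => trm" where "cst rh i w = nf w (rh i)"

definition fam :: "(nat => fnl) => nat => world => trm => trm" where "fam th i w a = ap w (th i) a"

lemma cst_N: "en w rh th ==> W w' ==> w << w' ==> cst rh i w' \<in> N w'"
 using env_T[OF env_mono] by (simp add: cst_def)

lemma fam_N: "en w rh th ==> W w' ==> w << w' ==> a \<in> N w' ==> fam th i w' a \<in> N w'"
 using env_F[OF env_mono] by (simp add: fam_def)

lemma eval_N: "W w ==> en w rh th ==> eval t (cst rh) (fam th) w \<in> N w"
 using eval_cong[of UNIV UNIV t w "cst rh" "cst rh" "fam th" "fam th"] cst_N fam_N by simp

subsection \<open>Codes of finitely many values\<close>

lemma venv_T: "en w rh th ==> sub_trm rh th (venv M j) \<in> Tm w"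
 by (rule sub_T) (auto intro: bim_terms)

text \<open>\<open>venv M j\<close> codes the last \<open>j\<close> of the variables below
  \<open>M\<close>, which accounts for the offset \<open>M - j\<close>; the case
  \<open>j = M\<close> gives all of them in increasing order.\<close>

lemma venv_value:
 assumes w: "W w" and e: "en w rh th" and "i < j" "j \<le> M"
 shows "prj w i (nf w (sub_trm rh th (venv M j))) = nf w (rh (M - j + i))"
 using assms(3,4)
proof (induction j arbitrary: i)
 case (Suc j)
 have *: "nf w (sub_trm rh th (venv M (Suc j))) = Jw w (nf w (rh (M - Suc j))) (nf w (sub_trm rh th (venv M j)))"
  using w venv_T[OF e] env_T[OF e] by (simp add: nf_pairJ)
 have N: "nf w (rh (M - Suc j)) \<in> N w" "nf w (sub_trm rh th (venv M j)) \<in> N w"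
  using w venv_T[OF e] env_T[OF e] by simp_all
 show ?case
 proof (cases i)
  case 0 thus ?thesis using w N * by (simp add: prj_0 bim_const_eqs)
 next
  case (Suc k)
  moreover have "prj w k (nf w (sub_trm rh th (venv M j))) = nf w (rh (M - j + k))"
   by (rule Suc.IH) (use Suc.prems \<open>i = Suc k\<close> in auto)
  moreover have "M - Suc j + Suc k = M - j + k" using Suc.prems by simp
  ultimately show ?thesis unfolding * using w N by (simp only: prj_Suc bim_const_eqs)
 qed
qed simp

definition codesF :: "world => fnl => (nat => fnl) => nat => bool" where
 "codesF w Ph th M <-> (\<forall>i<M. \<forall>w'. W w' --> w << w' --> (\<forall>a\<in>N w'. decF Ph i w' a = ap w' (th i) a))"

text \<open>Recursion serves as a case distinction on the index: at 0 the new code returns the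
  function \<open>th 0\<close>, and at \<open>k + 1\<close> it consults the code of the remaining
  functions at \<open>k\<close>, whatever the previous value.\<close>

lemma codesF_ex: assumes w: "W w" shows "(\<And>i. th i \<in> Fu w) ==> \<exists>Ph\<in>Fu w. codesF w Ph th M"
proof (induction M arbitrary: th)
 case 0
 show ?case by (intro bexI[of _ "FC ZeroFn"]) (simp_all add: codesF_def)
next
 case (Suc M)
 from Suc.IH[of "%i. th (Suc i)"] Suc.prems obtain Ph where Ph: "Ph \<in> Fu w" "codesF w Ph (%i. th (Suc i)) M" by blast
 have "rp w (%w' z. ap w' Ph (Jw w' (Kw w' z) (Lw w' (Lw w' z))))"
  by (intro rp_ap[OF w] rp_pair[OF w] rp_id[OF w] Ph bim_F)
 then obtain be where be: "be \<in> Fu w" "agree w be (%w' z. ap w' Ph (Jw w' (Kw w' z) (Lw w' (Lw w' z))))" by (auto simp: rp_def)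
 from closure_rec[OF w Suc.prems[of 0] be(1)] obtain Ps where Ps: "Ps \<in> Fu w" "rec_spec w Ps (th 0) be" by blast
 have "codesF w Ps th (Suc M)" unfolding codesF_def
 proof (intro allI impI ballI)
  fix i w' a assume i: "i < Suc M" and w': "W w'" "w << w'" and a: "a \<in> N w'"
  show "decF Ps i w' a = ap w' (th i) a"
  proof (cases i)
   case 0 thus ?thesis using Ps(2) w' a by (simp add: rec_spec_def decF_def)
  next
   case (Suc k)
   have k: "nf w' (numeral_trm k) \<in> N w'" by simp
   have "Ps \<in> Fu w'" using Ps F_mono w' by blast
   have "decF Ps i w' a = ap w' be (Jw w' (nf w' (numeral_trm k)) (Jw w' (ap w' Ps (Jw w' (nf w' (numeral_trm k)) a)) a))"
    using Ps(2) w' a Suc k by (simp add: decF_def rec_spec_def nf_App)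
   also have "... = decF Ph k w' a"
    using agreeD[OF be(2) w', of "Jw w' (nf w' (numeral_trm k)) (Jw w' (ap w' Ps (Jw w' (nf w' (numeral_trm k)) a)) a)"]
     w' a k \<open>Ps \<in> Fu w'\<close> by (simp add: bim_const_eqs decF_def)
   also have "... = ap w' (th i) a" using Ph(2) w' a Suc i by (simp add: codesF_def)
   finally show ?thesis .
  qed
 qed
 thus ?case using Ps by blast
qed

lemma bindF_sat: assumes w: "W w" and e: "en w rh th" and Ph: "Ph \<in> Fu w"
 shows "sat w rh (Ph ## th) (bindF M) <-> codesF w Ph th M"
proof (induction M)
 case 0
 have "sat w rh (Ph ## th) (Eq zero zero)" by (subst sat_Eq[OF w env_consF[OF e Ph]]) auto
 thus ?case by (simp add: codesF_def)
next
 case (Suc M)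
 have e': "en w rh (Ph ## th)" using e Ph by (rule env_consF)
 have "sat w rh (Ph ## th) (AllN (Eq (App (FVar 0) (pairJ (numeral_trm M) (Var 0))) (App (FVar (Suc M)) (Var 0)))) <->
  (\<forall>w'. W w' --> w << w' --> (\<forall>a\<in>N w'. decF Ph M w' a = ap w' (th M) a))"
  (is "?L <-> ?R")
 proof -
  have "?L <-> (\<forall>w'. W w' --> w << w' --> (\<forall>a\<in>N w'. nf w' (sub_trm (a ## rh) (Ph ## th) (App (FVar 0) (pairJ (numeral_trm M) (Var 0)))) =
   nf w' (sub_trm (a ## rh) (Ph ## th) (App (FVar (Suc M)) (Var 0)))))"
   by (rule sat_AllEq[OF w e']) (auto intro: bim_terms)
  moreover have "nf w' (sub_trm (a ## rh) (Ph ## th) (App (FVar 0) (pairJ (numeral_trm M) (Var 0)))) = decF Ph M w' a"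
   "nf w' (sub_trm (a ## rh) (Ph ## th) (App (FVar (Suc M)) (Var 0))) = ap w' (th M) a"
   if "W w'" "w << w'" "a \<in> N w'" for w' a
   using that F_mono[OF that(2) Ph] by (simp_all add: decF_def nf_App nf_pairJ nf_idem ap_def[of w' "th M"])
  ultimately show ?thesis by simp
 qed
 thus ?case using Suc by (auto simp: sat_And[OF w] codesF_def less_Suc_eq)
qed

text \<open>Decoding returns the given values for the indices below \<open>M\<close>, and the term
  has no other variables.\<close>

lemma eval_code:
 assumes w: "W w" and e: "en w rh th" and Ph: "Ph \<in> Fu w" "codesF w Ph th M"
 defines "c \<equiv> nf w (sub_trm rh th (venv M M))"
 shows "c \<in> N w"
  "over_trm {..<M} {..<M} t ==> W w' ==> w << w' ==> eval t (decN (nf w' c)) (decF Ph) w' = eval t (cst rh) (fam th) w'"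
  "over_fnl {..<M} {..<M} u ==> W w' ==> w << w' ==> a \<in> N w' ==>
   feval u (decN (nf w' c)) (decF Ph) w' a = feval u (cst rh) (fam th) w' a"
proof -
 show c: "c \<in> N w" using venv_T[OF e] by (simp add: c_def)
 have N: "decN (nf w' c) i w'' = cst rh i w'' \<and> decN (nf w' c) i w'' \<in> N w''"
  if w': "W w'" "w << w'" and w'': "W w''" "w' << w''" and i: "i \<in> {..<M}" for w' w'' i
 proof -
  have le: "w << w''" using w' w'' wle_trans by blast
  have "nf w'' (nf w' c) = nf w'' c" using w w' w'' c T_mono by simp
  also have "... = nf w'' (sub_trm rh th (venv M M))" unfolding c_def using w w'' le venv_T[OF e] by simp
  finally have "decN (nf w' c) i w'' = nf w'' (rh i)"
   using venv_value[OF w''(1) env_mono[OF e le] _ order.refl, of i M] i by (simp add: decN_def)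
  thus ?thesis using cst_N[OF e w''(1) le] by (simp add: cst_def)
 qed
 have F: "decF Ph i w'' a = fam th i w'' a \<and> decF Ph i w'' a \<in> N w''"
  if w': "W w'" "w << w'" and w'': "W w''" "w' << w''" and "i \<in> {..<M}" "a \<in> N w''" for w' w'' i a
 proof -
  have le: "w << w''" using w' w'' wle_trans by blast
  thus ?thesis using Ph that fam_N[OF e w''(1) le] by (simp add: codesF_def fam_def)
 qed
 show "eval t (decN (nf w' c)) (decF Ph) w' = eval t (cst rh) (fam th) w'"
  if "over_trm {..<M} {..<M} t" and w': "W w'" "w << w'"
  by (rule conjunct1[OF eval_cong[OF that(1,2)]]) (rule N[OF w'] F[OF w'], assumption+)+
 show "feval u (decN (nf w' c)) (decF Ph) w' a = feval u (cst rh) (fam th) w' a"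
  if "over_fnl {..<M} {..<M} u" and w': "W w'" "w << w'" and a: "a \<in> N w'"
  by (rule conjunct1[OF feval_cong[OF that(1,2) _ _ a]]) (rule N[OF w'] F[OF w'], assumption+)+
qed

text \<open>The language of the worlds may lack the symbols of \<open>t\<close>. Still the function
  defined by the formula for \<open>t\<close>, applied to the code of the environment, is an element
  whose normal forms are the values of \<open>t\<close> in all later worlds. With its counterpart
  for functors this makes instantiation by arbitrary terms sound.\<close>

lemma term_value:
 assumes w: "W w" and e: "en w rh th"
 shows "\<exists>r\<in>N w. \<forall>w'. W w' --> w << w' --> nf w' r = eval t (cst rh) (fam th) w'"
proof -
 let ?M = "tsize (code_trm t)"
 obtain Ph where Ph: "Ph \<in> Fu w" "codesF w Ph th ?M" using codesF_ex[OF w] env_F[OF e] by blast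
 obtain de where de: "de \<in> Fu w" "agree w de (%w e. eval t (decN e) (decF Ph) w)"
  using representsD(3)[OF trm_represents w Ph(1)] by (auto simp: rp_def)
 let ?c = "nf w (sub_trm rh th (venv ?M ?M))"
 note c = eval_code[OF w e Ph]
 show ?thesis
 proof (intro bexI[of _ "ap w de ?c"] allI impI)
  fix w' assume w': "W w'" "w << w'"
  have "nf w' (ap w de ?c) = ap w' de (nf w' ?c)" by (rule ap_up[OF w w' de(1) c(1)])
  also have "... = eval t (decN (nf w' ?c)) (decF Ph) w'"
   by (rule agreeD[OF de(2) w']) (use w w' c(1) in simp)
  also have "... = eval t (cst rh) (fam th) w'" by (rule c(2)[OF over_tsize[OF order.refl] w'])
  finally show "nf w' (ap w de ?c) = eval t (cst rh) (fam th) w'" .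
 qed (use w de c in simp)
qed

lemma functor_value:
 assumes w: "W w" and e: "en w rh th"
 shows "\<exists>ga\<in>Fu w. agree w ga (feval u (cst rh) (fam th))"
proof -
 let ?M = "tsize (code_fnl u)"
 obtain Ph where Ph: "Ph \<in> Fu w" "codesF w Ph th ?M" using codesF_ex[OF w] env_F[OF e] by blast
 let ?f = "%w z. feval u (decN (Lw w z)) (decF Ph) w (Kw w z)"
 have f: "rp w ?f" by (rule representsD(3)[OF fnl_represents w Ph(1)])
 let ?c = "nf w (sub_trm rh th (venv ?M ?M))"
 note c = eval_code[OF w e Ph]
 have "rp w (%w' a. ?f w' (Jw w' a (nf w' ?c)))"
  using rp_comp[OF w f rp_pair[OF w rp_id[OF w] rp_const[OF w]]] w c(1) by simp
 thus ?thesis unfolding rp_def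
 proof (elim bexE, intro bexI)
  fix ga assume ga: "ga \<in> Fu w" "agree w ga (%w' a. ?f w' (Jw w' a (nf w' ?c)))"
  show "agree w ga (feval u (cst rh) (fam th))"
  proof (rule agree_cong[OF ga(2)])
   fix w' a assume w': "W w'" "w << w'" "a \<in> N w'"
   have "nf w' ?c \<in> N w'" using w w' c by simp
   thus "?f w' (Jw w' a (nf w' ?c)) = feval u (cst rh) (fam th) w' a"
    using w' c(3)[OF over_tsize_fnl[OF order.refl] w'] by (simp add: bim_const_eqs)
  qed
 qed
qed

section \<open>Truth values in the worlds\<close>

text \<open>In contrast to \<open>sat\<close>, this notion of truth is given by recursion and makes
  sense for formulas outside the language of the worlds.\<close>

primrec sem :: "fm => world => (nat => trm) => (nat => fnl) => bool" where
 "sem (Eq s t) w rh th <-> eval s (cst rh) (fam th) w = eval t (cst rh) (fam th) w"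
| "sem Bot w rh th <-> False"
| "sem (And A B) w rh th <-> sem A w rh th \<and> sem B w rh th"
| "sem (Or A B) w rh th <-> sem A w rh th \<or> sem B w rh th"
| "sem (Imp A B) w rh th <-> (\<forall>w'. W w' --> w << w' --> sem A w' rh th --> sem B w' rh th)"
| "sem (AllN A) w rh th <-> (\<forall>w'. W w' --> w << w' --> (\<forall>a\<in>N w'. sem A w' (a ## rh) th))"
| "sem (ExN A) w rh th <-> (\<exists>a\<in>N w. sem A w (a ## rh) th)"
| "sem (AllF A) w rh th <-> (\<forall>w'. W w' --> w << w' --> (\<forall>u\<in>Fu w'. sem A w' rh (u ## th)))"
| "sem (ExF A) w rh th <-> (\<exists>u\<in>Fu w. sem A w rh (u ## th))"

lemma eval_bim: 
 assumes w: "W w" and e: "en w rh th"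
 shows "t \<in> terms bim_language ==> eval t (cst rh) (fam th) w = nf w (sub_trm rh th t)"
  "u \<in> functors bim_language ==> a \<in> N w ==> feval u (cst rh) (fam th) w a = ap w (sub_fnl rh th u) a"
proof (induction t and u arbitrary: and a)
 case (Var n) thus ?case by (simp add: cst_def)
next
 case (Fn c ts)
 then consider "c = Zero" "ts = []" | "c = PairJ" "length ts = 2" by (auto simp: bim_language_def)
 thus ?case
 proof cases
  case 2
  then obtain s t where ts: "ts = [s, t]" by (auto simp: numeral_2_eq_2 length_Suc_conv)
  hence "s \<in> Ter" "t \<in> Ter" "s \<in> terms bim_language" "t \<in> terms bim_language"
   using Fn.prems bim_terms by auto
  thus ?thesis using 2 ts Fn.IH w sub_T[OF e]
   by (simp add: nf_pairJ bim_const_eqs)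
 qed simp
next
 case (App u t)
 hence "u \<in> functors bim_language" "t \<in> terms bim_language" by auto
 hence "u \<in> Fun" "t \<in> Ter" using functors_mono[OF _ bim_lang] bim_terms by blast+
 thus ?case using App w sub_T[OF e] sub_F[OF e] by (simp add: nf_App)
next
 case (FC c)
 hence "c \<in> {ZeroFn, Ident, PR Succ, ProjK, ProjL}" by (auto simp: bim_language_def)
 thus ?case using FC w by (auto simp: bim_const_eqs)
qed (auto simp: fam_def bim_language_def)

lemma atom_sat:
 assumes w: "W w" and e: "en w rh th" and o: "over_trm {..<M} {..<M} s" "over_trm {..<M} {..<M} t"
 shows "sat w rh th (atom_fm s t M) <-> eval s (cst rh) (fam th) w = eval t (cst rh) (fam th) w"
proof -
 let ?E = "Eq (App (FVar 2) (venv M M)) (App (FVar 0) (venv M M))"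
 let ?C = "call (trm_fm s) (call (trm_fm t) ?E)"
 let ?c = "nf w (sub_trm rh th (venv M M))"
 have fm: "?E \<in> formulas bim_language" "?C \<in> fmls Sy" "And (bindF M) (ExF ?C) \<in> fmls Sy"
  by (auto intro!: bim_fmls)
 let ?v = "%t Ph. eval t (decN ?c) (decF Ph) w"
 have call: "sat w rh (de ## Ph ## th) ?C <-> ?v s Ph = ?v t Ph" if F: "Ph \<in> Fu w" "de \<in> Fu w" and cF: "codesF w Ph th M" for Ph de
 proof -
  have cN: "?c \<in> N w" by (rule eval_code(1)[OF w e F(1) cF])
  have "sat w rh (de ## Ph ## th) ?C <-> (\<exists>ups\<in>Fu w. \<exists>sg\<in>Fu w. agree w ups (%w e. eval s (decN e) (decF Ph) w) \<and>
    agree w sg (%w e. eval t (decN e) (decF Ph) w) \<and> ap w ups ?c = ap w sg ?c)"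
  proof (rule sat_call2[OF trm_represents trm_represents fm(1) w F e])
   fix ups sg Ph' Ph'' assume F': "ups \<in> Fu w" "sg \<in> Fu w" "Ph' \<in> Fu w" "Ph'' \<in> Fu w"
   have e': "en w rh (sg ## Ph'' ## ups ## Ph' ## de ## Ph ## th)" using e F F' by (intro env_consF)
   have v: "sub_trm rh ta (venv M j) = sub_trm rh th (venv M j)" for ta j by (induction j) auto
   show "sat w rh (sg ## Ph'' ## ups ## Ph' ## de ## Ph ## th) ?E <-> ap w ups ?c = ap w sg ?c"
    by (subst sat_Eq[OF w e'])
     (use w F' venv_T[OF e] v[of "sg ## Ph'' ## ups ## Ph' ## de ## Ph ## th" M] in "auto simp: numeral_eq_Suc nf_App intro: bim_terms")
  qed
  also have "... <-> ?v s Ph = ?v t Ph"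
  proof
   assume "\<exists>ups\<in>Fu w. \<exists>sg\<in>Fu w. agree w ups (%w e. eval s (decN e) (decF Ph) w) \<and>
    agree w sg (%w e. eval t (decN e) (decF Ph) w) \<and> ap w ups ?c = ap w sg ?c"
   then obtain ups sg where "agree w ups (%w e. eval s (decN e) (decF Ph) w)"
    "agree w sg (%w e. eval t (decN e) (decF Ph) w)" "ap w ups ?c = ap w sg ?c" by (elim bexE conjE)
   thus "?v s Ph = ?v t Ph" using agreeD[OF _ w wle_refl cN] by metis
  next
   assume eq: "?v s Ph = ?v t Ph"
   obtain ups where ups: "ups \<in> Fu w" "agree w ups (%w e. eval s (decN e) (decF Ph) w)"
    using representsD(3)[OF trm_represents[of s] w F(1)] unfolding rp_def by (elim bexE)
   obtain sg where sg: "sg \<in> Fu w" "agree w sg (%w e. eval t (decN e) (decF Ph) w)"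
    using representsD(3)[OF trm_represents[of t] w F(1)] unfolding rp_def by (elim bexE)
   have "ap w ups ?c = ap w sg ?c" using eq agreeD[OF ups(2) w wle_refl cN] agreeD[OF sg(2) w wle_refl cN] by simp
   thus "\<exists>ups\<in>Fu w. \<exists>sg\<in>Fu w. agree w ups (%w e. eval s (decN e) (decF Ph) w) \<and>
    agree w sg (%w e. eval t (decN e) (decF Ph) w) \<and> ap w ups ?c = ap w sg ?c"
    using ups sg by (intro bexI[of _ ups] bexI[of _ sg] conjI)
  qed
  finally show ?thesis .
 qed
 have val: "?v r Ph = eval r (cst rh) (fam th) w" if "Ph \<in> Fu w" "codesF w Ph th M" "over_trm {..<M} {..<M} r" for Ph r
  using eval_code(1,2)[OF w e that(1,2)] that(3) w nf_idem by (metis wle_refl)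
 have "sat w rh th (atom_fm s t M) <-> (\<exists>Ph\<in>Fu w. codesF w Ph th M \<and> (\<exists>de\<in>Fu w. sat w rh (de ## Ph ## th) ?C))"
  unfolding atom_fm_def sat_ExF[OF w e fm(3)]
  using bindF_sat[OF w e] sat_ExF[OF w env_consF[OF e] fm(2)] by (simp add: sat_And[OF w])
 also have "... <-> eval s (cst rh) (fam th) w = eval t (cst rh) (fam th) w"
 proof
  assume "\<exists>Ph\<in>Fu w. codesF w Ph th M \<and> (\<exists>de\<in>Fu w. sat w rh (de ## Ph ## th) ?C)"
  then obtain Ph de where *: "Ph \<in> Fu w" "codesF w Ph th M" "de \<in> Fu w" "sat w rh (de ## Ph ## th) ?C" by (elim bexE conjE)
  thus "eval s (cst rh) (fam th) w = eval t (cst rh) (fam th) w"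
   using call[OF *(1,3,2)] val[OF *(1,2)] o by simp
 next
  assume eq: "eval s (cst rh) (fam th) w = eval t (cst rh) (fam th) w"
  obtain Ph where Ph: "Ph \<in> Fu w" "codesF w Ph th M" using codesF_ex[OF w] env_F[OF e] by blast
  \<comment> \<open>\<open>Ph\<close> itself fills the slot of the dummy function.\<close>
  have "sat w rh (Ph ## Ph ## th) ?C" using call[OF Ph(1,1,2)] val[OF Ph] o eq by simp
  thus "\<exists>Ph\<in>Fu w. codesF w Ph th M \<and> (\<exists>de\<in>Fu w. sat w rh (de ## Ph ## th) ?C)"
   using Ph by (intro bexI[of _ Ph] conjI)
 qed
 finally show ?thesis .
qed

text \<open>This connects \<open>sem\<close> with derivability, because \<open>sat\<close> applies
  to the translation. Properties of \<open>sat\<close>, such as persistence in later worlds and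
  induction, carry over to \<open>sem\<close>.\<close>

lemma sem_bim_fm: "W w ==> en w rh th ==> sem A w rh th <-> sat w rh th (bim_fm A)"
proof (induction A arbitrary: w rh th)
 case (Eq s t)
 show ?case
 proof (cases "s \<in> terms bim_language \<and> t \<in> terms bim_language")
  case True
  thus ?thesis using eval_bim(1)[OF Eq] sat_Eq[OF Eq] bim_terms by simp
 next
  case False
  have "over_trm {..<tsize (code_fm (Eq s t))} {..<tsize (code_fm (Eq s t))} s"
   "over_trm {..<tsize (code_fm (Eq s t))} {..<tsize (code_fm (Eq s t))} t"
   by (rule over_tsize, simp add: node_def)+
  from atom_sat[OF Eq this] show ?thesis by (simp only: sem.simps bim_fm.simps if_not_P[OF False])
 qed
next
 case Bot thus ?case by simp
next
 case (And A B) thus ?case by (simp add: sat_And)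
next
 case (Or A B) thus ?case by (simp add: sat_Or bim_fmls)
next
 case (Imp A B) thus ?case by (simp add: sat_Imp bim_fmls env_mono)
next
 case (AllN A) thus ?case by (simp add: sat_AllN' bim_fmls env_mono env_consN)
next
 case (ExN A) thus ?case by (simp add: sat_ExN' bim_fmls env_mono env_consN)
next
 case (AllF A) thus ?case by (simp add: sat_AllF bim_fmls env_mono env_consF)
next
 case (ExF A) thus ?case by (simp add: sat_ExF bim_fmls env_mono env_consF)
qed

lemma sem_mono: "W w ==> en w rh th ==> sem A w rh th ==> W w' ==> w << w' ==> sem A w' rh th"
 using sem_bim_fm sat_mono env_mono by metis

section \<open>Substitution and soundness for the truth values\<close>

lemma eval_ren: "eval (ren_trm r q t) rh th = eval t (%i. rh (r i)) (%i. th (q i))"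
 and feval_ren: "feval (ren_fnl r q u) rh th = feval u (%i. rh (r i)) (%i. th (q i))"
proof (induction t and u arbitrary: rh th r q and rh th r q)
 case (Fn c ts)
 hence "map (%f. f rh th w) (map eval (map (ren_trm r q) ts)) = map (%f. f (%i. rh (r i)) (%i. th (q i)) w) (map eval ts)" for w
  by simp
 thus ?case by (intro ext) (simp only: eval.simps ren_trm.simps sub_trm.simps)
next
 case (Lam t)
 have "(%i. (x ## rh) (up_ren r i)) = x ## (%i. rh (r i))" for x :: "world => trm"
  by (rule ext) (simp add: up_ren_def split: nat.split)
 thus ?case using Lam by (intro ext) simp
qed (auto intro!: ext)

lemma eval_sub: "eval (sub_trm sg ta t) rh th = eval t (%i. eval (sg i) rh th) (%i. feval (ta i) rh th)"
 and feval_sub: "feval (sub_fnl sg ta u) rh th = feval u (%i. eval (sg i) rh th) (%i. feval (ta i) rh th)"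
proof (induction t and u arbitrary: rh th sg ta and rh th sg ta)
 case (Fn c ts)
 hence "map (%f. f rh th w) (map eval (map (sub_trm sg ta) ts)) =
   map (%f. f (%i. eval (sg i) rh th) (%i. feval (ta i) rh th) w) (map eval ts)" for w
  by simp
 thus ?case by (intro ext) (simp only: eval.simps ren_trm.simps sub_trm.simps)
next
 case (Lam t)
 have "(%i. eval (up_trm sg i) (x ## rh) th) = x ## (%i. eval (sg i) rh th)" for x :: "world => trm"
  by (rule ext) (auto simp: up_trm_def eval_ren split: nat.split)
 thus ?case using Lam by (intro ext) (simp add: feval_ren)
qed (auto intro!: ext)

lemma cst_cons_Suc: "(%i. cst (a ## rh) (Suc i)) = cst rh" by (intro ext) (simp add: cst_def)
lemma fam_cons_Suc: "(%i. fam (a ## th) (Suc i)) = fam th" by (intro ext) (simp add: fam_def)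

text \<open>A term with symbols foreign to the worlds cannot be placed in an environment, only an
  element with the same value can. Hence the second environment is just required to match the values
  of the substituted terms in all later worlds.\<close>

lemma sem_sub:
 "W w ==> en w rh th ==> en w rh' th' ==>
 (\<And>i w'. W w' ==> w << w' ==> nf w' (rh' i) = eval (sg i) (cst rh) (fam th) w') ==>
 (\<And>i w' a. W w' ==> w << w' ==> a \<in> N w' ==> ap w' (th' i) a = feval (ta i) (cst rh) (fam th) w' a) ==>
 sem (sub_fm sg ta A) w rh th <-> sem A w rh' th'"
proof (induction A arbitrary: w rh th rh' th' sg ta)
 case (Eq s t)
 have "eval (sub_trm sg ta r) (cst rh) (fam th) w = eval r (cst rh') (fam th') w" for r
 proof -
  have "eval r (cst rh') (fam th') w = eval r (%i. eval (sg i) (cst rh) (fam th)) (%i. feval (ta i) (cst rh) (fam th)) w \<and>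
    eval r (cst rh') (fam th') w \<in> N w"
   by (rule eval_cong[of UNIV UNIV, OF over_UNIV Eq.prems(1)])
    (use Eq.prems(4,5) cst_N[OF Eq.prems(3)] fam_N[OF Eq.prems(3)] in
     \<open>simp_all add: cst_def[of rh', symmetric] fam_def[of th', symmetric]\<close>)
  thus ?thesis by (simp add: eval_sub)
 qed
 thus ?case by simp
next
 case Bot thus ?case by simp
next
 case (And A B) show ?case using And.IH[OF And.prems] by simp
next
 case (Or A B) show ?case using Or.IH[OF Or.prems] by simp
next
 case (Imp A B)
 have "sem (sub_fm sg ta A) w' rh th <-> sem A w' rh' th'" "sem (sub_fm sg ta B) w' rh th <-> sem B w' rh' th'"
  if w': "W w'" "w << w'" for w'
  by (rule Imp.IH; use Imp.prems w' env_mono wle_trans[OF w'(2)] in blast)+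
 thus ?case by simp
next
 case (AllN A)
 have *: "sem (sub_fm (up_trm sg) (%n. ren_fnl Suc id (ta n)) A) w' (a ## rh) th <-> sem A w' (a ## rh') th'"
  if w': "W w'" "w << w'" and a: "a \<in> N w'" for w' a
 proof (rule AllN.IH[OF w'(1)])
  show "en w' (a ## rh) th" "en w' (a ## rh') th'" using AllN.prems(2,3) w' a env_mono env_consN nf_N_T by metis+
  fix i w'' assume w'': "W w''" "w' << w''"
  show "nf w'' ((a ## rh') i) = eval (up_trm sg i) (cst (a ## rh)) (fam th) w''"
   using AllN.prems(4)[OF w''(1) wle_trans[OF w'(2) w''(2)]]
   by (auto simp: eval_ren cst_cons_Suc up_trm_def split: nat.split) (simp add: cst_def)
  fix x assume x: "x \<in> N w''"
  show "ap w'' (th' i) x = feval (ren_fnl Suc id (ta i)) (cst (a ## rh)) (fam th) w'' x"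
   using AllN.prems(5)[OF w''(1) wle_trans[OF w'(2) w''(2)] x] by (simp add: feval_ren cst_cons_Suc)
 qed
 thus ?case by simp
next
 case (ExN A)
 have *: "sem (sub_fm (up_trm sg) (%n. ren_fnl Suc id (ta n)) A) w (a ## rh) th <-> sem A w (a ## rh') th'"
  if a: "a \<in> N w" for a
 proof (rule ExN.IH[OF ExN.prems(1)])
  show "en w (a ## rh) th" "en w (a ## rh') th'" using ExN.prems(1-3) a env_consN nf_N_T by metis+
  fix i w'' assume w'': "W w''" "w << w''"
  show "nf w'' ((a ## rh') i) = eval (up_trm sg i) (cst (a ## rh)) (fam th) w''"
   using ExN.prems(4)[OF w'']
   by (auto simp: eval_ren cst_cons_Suc up_trm_def split: nat.split) (simp add: cst_def)
  fix x assume x: "x \<in> N w''"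
  show "ap w'' (th' i) x = feval (ren_fnl Suc id (ta i)) (cst (a ## rh)) (fam th) w'' x"
   using ExN.prems(5)[OF w'' x] by (simp add: feval_ren cst_cons_Suc)
 qed
 thus ?case by simp
next
 case (AllF A)
 have *: "sem (sub_fm (%n. ren_trm id Suc (sg n)) (up_fnl ta) A) w' rh (u ## th) <-> sem A w' rh' (u ## th')"
  if w': "W w'" "w << w'" and u: "u \<in> Fu w'" for w' u
 proof (rule AllF.IH[OF w'(1)])
  show "en w' rh (u ## th)" "en w' rh' (u ## th')" using AllF.prems(2,3) w' u env_mono env_consF by metis+
  fix i w'' assume w'': "W w''" "w' << w''"
  show "nf w'' (rh' i) = eval (ren_trm id Suc (sg i)) (cst rh) (fam (u ## th)) w''"
   using AllF.prems(4)[OF w''(1) wle_trans[OF w'(2) w''(2)]] by (simp add: eval_ren fam_cons_Suc)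
  fix x assume x: "x \<in> N w''"
  show "ap w'' ((u ## th') i) x = feval (up_fnl ta i) (cst rh) (fam (u ## th)) w'' x"
   using AllF.prems(5)[OF w''(1) wle_trans[OF w'(2) w''(2)] x]
   by (auto simp: feval_ren fam_cons_Suc up_fnl_def split: nat.split) (simp add: fam_def)
 qed
 thus ?case by simp
next
 case (ExF A)
 have *: "sem (sub_fm (%n. ren_trm id Suc (sg n)) (up_fnl ta) A) w rh (u ## th) <-> sem A w rh' (u ## th')"
  if u: "u \<in> Fu w" for u
 proof (rule ExF.IH[OF ExF.prems(1)])
  show "en w rh (u ## th)" "en w rh' (u ## th')" using ExF.prems(2,3) u env_consF by metis+
  fix i w'' assume w'': "W w''" "w << w''"
  show "nf w'' (rh' i) = eval (ren_trm id Suc (sg i)) (cst rh) (fam (u ## th)) w''"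
   using ExF.prems(4)[OF w''] by (simp add: eval_ren fam_cons_Suc)
  fix x assume x: "x \<in> N w''"
  show "ap w'' ((u ## th') i) x = feval (up_fnl ta i) (cst rh) (fam (u ## th)) w'' x"
   using ExF.prems(5)[OF w'' x]
   by (auto simp: feval_ren fam_cons_Suc up_fnl_def split: nat.split) (simp add: fam_def)
 qed
 thus ?case by simp
qed

lemma sem_inst:
 assumes w: "W w" and e: "en w rh th"
 shows "\<exists>r\<in>N w. sem (instN t A) w rh th <-> sem A w (r ## rh) th" "\<exists>ga\<in>Fu w. sem (instF u A) w rh th <-> sem A w rh (ga ## th)"
proof -
 obtain r where r: "r \<in> N w" "\<forall>w'. W w' --> w << w' --> nf w' r = eval t (cst rh) (fam th) w'"
  using term_value[OF w e] by blast
 have "sem (instN t A) w rh th <-> sem A w (r ## rh) th" unfolding instN_def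
 proof (rule sem_sub[OF w e env_consN[OF e]])
  show "r \<in> Tm w" using w r by simp
  fix i w' assume "W w'" "w << w'"
  thus "nf w' ((r ## rh) i) = eval (case i of 0 => t | Suc m => Var m) (cst rh) (fam th) w'"
   using r(2) by (cases i) (simp_all add: cst_def)
 qed (simp add: fam_def)
 thus "\<exists>r\<in>N w. sem (instN t A) w rh th <-> sem A w (r ## rh) th" using r(1) by blast
 obtain ga where ga: "ga \<in> Fu w" "agree w ga (feval u (cst rh) (fam th))" using functor_value[OF w e] by blast
 have "sem (instF u A) w rh th <-> sem A w rh (ga ## th)" unfolding instF_def
 proof (rule sem_sub[OF w e env_consF[OF e ga(1)]])
  fix i w' a assume "W w'" "w << w'" "a \<in> N w'"
  thus "ap w' ((ga ## th) i) a = feval (case i of 0 => u | Suc m => FVar m) (cst rh) (fam th) w' a"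
   using agreeD[OF ga(2)] by (cases i) (simp_all add: fam_def)
 qed (simp add: cst_def)
 thus "\<exists>ga\<in>Fu w. sem (instF u A) w rh th <-> sem A w rh (ga ## th)" using ga(1) by blast
qed

lemma sem_lift:
 assumes w: "W w" and e: "en w rh th"
 shows "a \<in> N w ==> sem (liftN A) w (a ## rh) th <-> sem A w rh th" "u \<in> Fu w ==> sem (liftF A) w rh (u ## th) <-> sem A w rh th"
proof -
 show "sem (liftN A) w (a ## rh) th <-> sem A w rh th" if "a \<in> N w"
  by (rule sem_sub[OF w env_consN[OF e] e]) (use w that in "auto simp: cst_def fam_def")
 show "sem (liftF A) w rh (u ## th) <-> sem A w rh th" if "u \<in> Fu w"
  by (rule sem_sub[OF w env_consF[OF e] e]) (use w that in "auto simp: cst_def fam_def")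
qed

text \<open>The language of \<open>S'\<close> may exceed that of the worlds. Where a rule
  instantiates a quantifier with a term of \<open>S'\<close>, \<open>sem_inst\<close> replaces the
  term by an element of the world.\<close>

lemma sem_sound:
 assumes ax: "\<And>A w rh th. A \<in> axs S' ==> A \<in> fmls S' ==> W w ==> en w rh th ==> sem A w rh th"
 shows "deriv S' Ga A ==> W w ==> en w rh th ==> (\<And>B. B \<in> Ga ==> sem B w rh th) ==> sem A w rh th"
proof (induction arbitrary: w rh th rule: deriv.induct)
 case (Axiom A Ga) thus ?case using ax by blast
next
 case (OrE Ga A B C)
 hence "sem (Or A B) w rh th" by blast
 thus ?case using OrE.IH(2)[OF OrE.prems(1,2)] OrE.IH(3)[OF OrE.prems(1,2)] OrE.prems(3) by auto
next
 case (ImpI A Ga B)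
 have "sem B w' rh th" if "W w'" "w << w'" "sem A w' rh th" for w'
 proof (rule ImpI.IH[OF that(1) env_mono[OF ImpI.prems(2) that(2)]])
  fix B assume "B \<in> insert A Ga"
  thus "sem B w' rh th" using sem_mono[OF ImpI.prems(1,2) ImpI.prems(3) that(1,2)] that(3) by auto
 qed
 thus ?case by simp
next
 case (ImpE Ga A B)
 have "sem (Imp A B) w rh th" "sem A w rh th" using ImpE by blast+
 thus ?case using ImpE.prems(1) by simp
next
 case (AllNI Ga A)
 have "sem A w' (a ## rh) th" if w': "W w'" "w << w'" and a: "a \<in> N w'" for w' a
 proof (rule AllNI.IH[OF w'(1)])
  have e: "en w' rh th" using AllNI.prems w' env_mono by blast
  thus "en w' (a ## rh) th" using a w' env_consN by simp
  fix B assume "B \<in> liftN ` Ga"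
  thus "sem B w' (a ## rh) th" using sem_lift(1)[OF w'(1) e a] AllNI.prems sem_mono w' by auto
 qed
 thus ?case by simp
next
 case (AllFI Ga A)
 have "sem A w' rh (u ## th)" if w': "W w'" "w << w'" and u: "u \<in> Fu w'" for w' u
 proof (rule AllFI.IH[OF w'(1)])
  have e: "en w' rh th" using AllFI.prems w' env_mono by blast
  thus "en w' rh (u ## th)" using u w' env_consF by simp
  fix B assume "B \<in> liftF ` Ga"
  thus "sem B w' rh (u ## th)" using sem_lift(2)[OF w'(1) e u] AllFI.prems sem_mono w' by auto
 qed
 thus ?case by simp
next
 case (AllNE Ga A t)
 hence "sem (AllN A) w rh th" by blast
 thus ?case using sem_inst(1)[OF AllNE.prems(1,2), of t A] AllNE.prems(1) by auto
next
 case (AllFE Ga A u)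
 hence "sem (AllF A) w rh th" by blast
 thus ?case using sem_inst(2)[OF AllFE.prems(1,2), of u A] AllFE.prems(1) by auto
next
 case (ExNI Ga t A)
 hence "sem (instN t A) w rh th" by blast
 thus ?case using sem_inst(1)[OF ExNI.prems(1,2), of t A] by auto
next
 case (ExFI Ga u A)
 hence "sem (instF u A) w rh th" by blast
 thus ?case using sem_inst(2)[OF ExFI.prems(1,2), of u A] by auto
next
 case (ExNE Ga A C)
 hence "sem (ExN A) w rh th" by blast
 then obtain a where a: "a \<in> N w" "sem A w (a ## rh) th" by auto
 have "sem (liftN C) w (a ## rh) th"
  by (rule ExNE.IH(2)[OF ExNE.prems(1)])
   (use a ExNE.prems env_consN sem_lift(1)[OF ExNE.prems(1,2) a(1)] in auto)
 thus ?case using sem_lift(1)[OF ExNE.prems(1,2) a(1)] by simp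
next
 case (ExFE Ga A C)
 hence "sem (ExF A) w rh th" by blast
 then obtain u where u: "u \<in> Fu w" "sem A w rh (u ## th)" by auto
 have "sem (liftF C) w rh (u ## th)"
  by (rule ExFE.IH(2)[OF ExFE.prems(1)])
   (use u ExFE.prems env_consF sem_lift(2)[OF ExFE.prems(1,2) u(1)] in auto)
 thus ?case using sem_lift(2)[OF ExFE.prems(1,2) u(1)] by simp
qed auto

end

lemma apply_const_sub: "sub_trm sg ta (apply_const c ts) = apply_const c (map (sub_trm sg ta) ts)"
 by (auto simp: apply_const_def split: list.split)

context bim0
begin

section \<open>Validity of the axioms\<close>

lemma Sw_neq [simp]: "W w ==> a \<in> N w ==> Sw w a \<noteq> zw w"
 using bim_const_eqs(6) by blast

lemma Jw_KL [simp]: "W w ==> a \<in> N w ==> Jw w (Kw w a) (Lw w a) = a"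
 using bim_const_eqs(5) by blast

lemma sem_bim: "A \<in> formulas bim_language ==> W w ==> en w rh th ==> sem A w rh th <-> sat w rh th A"
 by (simp add: sem_bim_fm bim_fm_id)

lemma nf_eq_up: "W w ==> W w' ==> w << w' ==> s \<in> Tm w ==> t \<in> Tm w ==> nf w s = nf w t ==> nf w' s = nf w' t"
 using nf_nf_up by metis

lemma sem_cong:
 assumes w: "W w" and e: "en w rh th" "en w rh' th'" and "\<And>i. nf w (rh i) = nf w (rh' i)"
  and "\<And>i. agree w (th i) (%w' a. ap w' (th' i) a)"
 shows "sem A w rh th <-> sem A w rh' th'"
proof -
 have "sem (sub_fm Var FVar A) w rh' th' <-> sem A w rh th"
 proof (rule sem_sub[OF w e(2,1)])
  fix i w' assume w': "W w'" "w << w'"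
  show "nf w' (rh i) = eval (Var i) (cst rh') (fam th') w'"
   using nf_eq_up[OF w w' env_T[OF e(1)] env_T[OF e(2)] assms(4)] by (simp add: cst_def)
  fix a assume "a \<in> N w'"
  thus "ap w' (th i) a = feval (FVar i) (cst rh') (fam th') w' a"
   using agreeD[OF assms(5) w'] by (simp add: fam_def)
 qed
 thus ?thesis by simp
qed

lemma sem_cong1: "W w ==> en w rh th ==> s \<in> Tm w ==> t \<in> Tm w ==> nf w s = nf w t ==> sem A w (s ## rh) th <-> sem A w (t ## rh) th"
 by (rule sem_cong) (auto intro: env_consN simp: agree_def split: nat.split)

lemma sem_instN: "W w ==> en w rh th ==> r \<in> Tm w ==> (\<And>w'. W w' ==> w << w' ==> nf w' r = eval t (cst rh) (fam th) w') ==>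
  sem (instN t A) w rh th <-> sem A w (r ## rh) th"
 unfolding instN_def
 by (rule sem_sub) (auto intro: env_consN simp: fam_def cst_def split: nat.split)

lemma sem_equality_axiom:
 assumes w: "W w" and e: "en w rh th"
 shows "sem (Imp (And (instN (Var i) A) (Eq (Var i) (Var j))) (instN (Var j) A)) w rh th"
proof -
 have "sem (instN (Var j) A) w' rh th"
  if w': "W w'" "w << w'" and s: "sem (instN (Var i) A) w' rh th" and eq: "nf w' (rh i) = nf w' (rh j)" for w'
 proof -
  have e': "en w' rh th" using e w' env_mono by blast
  have *: "sem (instN (Var k) A) w' rh th <-> sem A w' (rh k ## rh) th" for k
   by (rule sem_instN[OF w'(1) e' env_T[OF e']]) (simp add: cst_def)
  show ?thesis using s * sem_cong1[OF w'(1) e' env_T[OF e'] env_T[OF e'] eq] by simp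
 qed
 thus ?thesis by (simp add: cst_def)
qed

text \<open>Induction for an arbitrary formula is induction of the theory for its translation into
  BIM.\<close>

lemma sem_induct:
 assumes w: "W w" and e: "en w rh th" and 0: "sem A w (zw w ## rh) th"
  and Suc: "\<And>w' a. W w' ==> w << w' ==> a \<in> N w' ==> sem A w' (a ## rh) th ==> sem A w' (Sw w' a ## rh) th"
  and w': "W w'" "w << w'" and a: "a \<in> N w'"
 shows "sem A w' (a ## rh) th"
proof -
 have *: "sem A w1 (b ## rh) th <-> sat w1 (b ## rh) th (bim_fm A)" if "W w1" "w << w1" "b \<in> N w1" for w1 b
  by (rule sem_bim_fm[OF that(1) env_consN[OF env_mono[OF e that(2)]]]) (use that in simp)
 have "sat w' (a ## rh) th (bim_fm A)"
 proof (rule induct_sat[OF w e bim_fmls[OF bim_fm_formula] _ _ w' a])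
  show "sat w (zw w ## rh) th (bim_fm A)" using 0 *[OF w wle_refl, of "zw w"] by simp
  fix w1 b assume w1: "W w1" "w << w1" "b \<in> N w1" "sat w1 (b ## rh) th (bim_fm A)"
  thus "sat w1 (Sw w1 b ## rh) th (bim_fm A)"
   using *[OF w1(1,2), of b] *[OF w1(1,2), of "Sw w1 b"] Suc[OF w1(1-3)] by simp
 qed
 thus ?thesis using *[OF w' a] by simp
qed

lemma sem_induction_axiom:
 assumes w: "W w" and e: "en w rh th"
 shows "sem (Imp (And (instN zero A)
       (AllN (Imp A (sub_fm (%n. case n of 0 => suc (Var 0) | Suc m => Var (Suc m)) FVar A))))
     (AllN A)) w rh th"
proof -
 have "sem A w2 (a ## rh) th"
  if w1: "W w1" "w << w1" and 0: "sem (instN zero A) w1 rh th"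
  and step: "sem (AllN (Imp A (sub_fm (%n. case n of 0 => suc (Var 0) | Suc m => Var (Suc m)) FVar A))) w1 rh th"
  and w2: "W w2" "w1 << w2" and a: "a \<in> N w2" for w1 w2 a
 proof (rule sem_induct[OF w1(1) _ _ _ w2 a])
  show e1: "en w1 rh th" using e w1 env_mono by blast
  have "sem (instN zero A) w1 rh th <-> sem A w1 (zw w1 ## rh) th"
   by (rule sem_instN[OF w1(1) e1]) (use w1 in auto)
  thus "sem A w1 (zw w1 ## rh) th" using 0 by simp
  fix w3 b assume w3: "W w3" "w1 << w3" and b: "b \<in> N w3" "sem A w3 (b ## rh) th"
  have e3: "en w3 (b ## rh) th" "en w3 (Sw w3 b ## rh) th" using e1 w3 b env_mono env_consN nf_N_T ap_N Succ_F by metis+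
  have "sem (sub_fm (%n. case n of 0 => suc (Var 0) | Suc m => Var (Suc m)) FVar A) w3 (b ## rh) th"
   using step w3 b wle_refl by auto
  moreover have "sem (sub_fm (%n. case n of 0 => suc (Var 0) | Suc m => Var (Suc m)) FVar A) w3 (b ## rh) th
   <-> sem A w3 (Sw w3 b ## rh) th"
  proof (rule sem_sub[OF w3(1) e3])
   fix i w' assume w': "W w'" "w3 << w'"
   show "nf w' ((Sw w3 b ## rh) i) = eval (case i of 0 => suc (Var 0) | Suc m => Var (Suc m)) (cst (b ## rh)) (fam th) w'"
    using w' w3 b ap_up[OF w3(1) w' Succ_F b(1)] by (cases i) (auto simp: cst_def bim_const_eqs)
  qed (simp add: fam_def)
  ultimately show "sem A w3 (Sw w3 b ## rh) th" by simp
 qed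
 thus ?thesis by simp
qed

section \<open>Defining equations, abstraction and the recursor\<close>

lemma eval_apply_const:
 "W w ==> (\<And>t. t \<in> set ts ==> eval t rh th w \<in> N w) ==>
  eval (apply_const c ts) rh th w = cev c w (tup w (map (%t. eval t rh th w) ts))"
 by (auto simp: apply_const_def comp_def split: list.split)

lemma eval_numeral: "W w ==> eval (numeral_trm q) rh th w = nf w (numeral_trm q)"
 by (induction q) (auto simp: bim_const_eqs nf_App)

lemma prj_tup: "W w ==> i < length as ==> (\<And>a. a \<in> set as ==> a \<in> N w) ==> prj w i (tup w as) = as ! i"
proof (induction as arbitrary: i)
 case (Cons a as)
 have "tup w as \<in> N w" "a \<in> N w" using Cons.prems by auto
 thus ?case using Cons by (cases i) (auto simp: prj_0 prj_Suc bim_const_eqs)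
qed simp

text \<open>\<open>closure_rec\<close> with the dummy parameter 0; \<open>be\<close> discards the
  parameter before it applies the step.\<close>

lemma rspec_ex:
 assumes w: "W w" and a: "a \<in> N w" and h: "rp w (%w' z. h w' (Kw w' z) (Lw w' z))"
 shows "\<exists>ga. rspec w ga a h"
proof -
 from a w have "rp w (%w' x. nf w' a)" by (intro rp_const) auto
 then obtain al where al: "al \<in> Fu w" "agree w al (%w' x. nf w' a)" by (auto simp: rp_def)
 have "rp w (%w' z. h w' (Kw w' (Jw w' (Kw w' z) (Kw w' (Lw w' z)))) (Lw w' (Jw w' (Kw w' z) (Kw w' (Lw w' z)))))"
  by (rule rp_comp[OF w h]) (intro rp_pair[OF w] rp_ap[OF w] rp_id[OF w] bim_F)
 then obtain be where be: "be \<in> Fu w" "agree w be (%w' z. h w' (Kw w' (Jw w' (Kw w' z) (Kw w' (Lw w' z)))) (Lw w' (Jw w' (Kw w' z) (Kw w' (Lw w' z)))))"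
  by (auto simp: rp_def)
 obtain ze where ze: "ze \<in> Fu w" "rec_spec w ze al be" using closure_rec[OF w al(1) be(1)] by blast
 have "rp w (%w' n. ap w' ze (Jw w' n (zw w')))"
  by (intro rp_ap[OF w] rp_pair[OF w] rp_id[OF w] rp_zero[OF w] ze)
 then obtain ga where ga: "ga \<in> Fu w" "agree w ga (%w' n. ap w' ze (Jw w' n (zw w')))" by (auto simp: rp_def)
 have "rspec w ga a h" unfolding rspec_def
 proof (intro conjI allI impI ballI)
  show "ap w ga (zw w) = a"
   using agreeD[OF ga(2) w wle_refl, of "zw w"] ze(2) w agreeD[OF al(2) w wle_refl, of "zw w"] a
   by (simp add: rec_spec_def nf_idem)
  fix w' m assume w': "W w'" "w << w'" and m: "m \<in> N w'"
  have F: "ze \<in> Fu w'" using ze F_mono w' by blast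
  have g: "ap w' ga k = ap w' ze (Jw w' k (zw w'))" if "k \<in> N w'" for k using agreeD[OF ga(2) w' that] .
  let ?z = "Jw w' m (Jw w' (ap w' ze (Jw w' m (zw w'))) (zw w'))"
  have "ap w' ga (Sw w' m) = ap w' be ?z"
   using g[of "Sw w' m"] ze(2) w' m by (simp add: rec_spec_def)
  also have "... = h w' m (ap w' ga m)"
   using agreeD[OF be(2) w', of ?z] w' m F g[OF m] by (simp add: bim_const_eqs)
  finally show "ap w' ga (Sw w' m) = h w' m (ap w' ga m)" .
 qed (rule ga)
 thus ?thesis ..
qed

lemma rp_pev: "W w ==> rp w (pev d)"
 using representsD(3)[OF prd_represents _ bim_F(1)] .

lemma pev_rec_step:
 fixes d :: prd
 assumes w: "W w" and x: "x \<in> N w" and a: "a \<in> N w"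
 defines "h \<equiv> %w' m r. pev d w' (Jw w' m (Jw w' r (nf w' x)))"
 shows "rv w a h (zw w) = a" "m \<in> N w ==> rv w a h (Sw w m) = pev d w (Jw w m (Jw w (rv w a h m) x))"
proof -
 have "rp w (%w' z. pev d w' (Jw w' (Kw w' z) (Jw w' (Lw w' z) (nf w' x))))"
  by (rule rp_comp[OF w rp_pev[OF w]]) (intro rp_pair[OF w] rp_ap[OF w] rp_id[OF w] bim_F rp_const[OF w], use w x in simp)
 then obtain ga where ga: "rspec w ga a h" using rspec_ex[OF w a, of h] by (auto simp: h_def)
 show "rv w a h (zw w) = a" by (rule rv_rec(1)[OF w ga])
 show "rv w a h (Sw w m) = pev d w (Jw w m (Jw w (rv w a h m) x))" if "m \<in> N w"
  using rv_rec(2)[OF w ga that] w x by (simp add: h_def nf_idem)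
qed

lemma pev_RecP:
 assumes w: "W w" and x: "x \<in> N w"
 shows "pev (RecP g h) w (Jw w (zw w) x) = pev g w x"
  "m \<in> N w ==> pev (RecP g h) w (Jw w (Sw w m) x) = pev h w (Jw w m (Jw w (pev (RecP g h) w (Jw w m x)) x))"
 using pev_rec_step[OF w x pev_N[OF w x, of g], where d = h] w x by (auto simp: bim_const_eqs)

lemma pev_Rec0:
 assumes w: "W w" and x: "x \<in> N w"
 shows "pev (Rec0 q h) w (Jw w (zw w) x) = nf w (numeral_trm q)"
  "m \<in> N w ==> pev (Rec0 q h) w (Jw w (Sw w m) x) = pev h w (Jw w m (Jw w (pev (Rec0 q h) w (Jw w m x)) x))"
 using pev_rec_step[OF w x, of "nf w (numeral_trm q)", where d = h] w x by (auto simp: bim_const_eqs)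

lemma sem_defining:
 assumes w: "W w" and e: "en w rh th" and A: "A \<in> defining_equations"
 shows "sem A w rh th"
proof -
 note ev = eval_apply_const[OF w]
 have N: "eval t (cst rh) (fam th) w \<in> N w" for t by (rule eval_N[OF w e])
 have tN: "tup w (map (%t. eval t (cst rh) (fam th) w) ts) \<in> N w" for ts
  by (rule tup_N[OF w]) (use N in auto)
 note [simp] = ev[OF N] w eval_numeral bim_const_eqs N
 show ?thesis using A
 proof cases
  case (1 n q) thus ?thesis by simp
 next
  case (2 n i)
  hence "i < n" by (auto elim: describes.cases)
  hence "prj w i (tup w (map (%t. eval t (cst rh) (fam th) w) (map Var [0..<n]))) = eval (Var i) (cst rh) (fam th) w"
   by (subst prj_tup) (use N in "auto simp del: eval.simps")
  thus ?thesis using 2 by (simp add: comp_def)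
 next
  case (3 n g hs) thus ?thesis by (simp add: comp_def)
 next
  case (4 q h) thus ?thesis using pev_Rec0(1)[OF w, of "zw w"] by simp
 next
  case (5 q h)
  thus ?thesis using pev_Rec0(2)[OF w, of "zw w" "eval (Var 0) (cst rh) (fam th) w"] N[of "Var 0"] by simp
 next
  case (6 g h n)
  define vs where "vs = map Var [1..<n + 1]"
  have "eval (apply_const (PR (RecP g h)) (zero # vs)) (cst rh) (fam th) w = eval (apply_const (PR g) vs) (cst rh) (fam th) w"
   using pev_RecP(1)[OF w tN[of vs]] by (simp del: pev.simps)
  thus ?thesis unfolding 6(1) vs_def[symmetric] by (simp only: sem.simps)
 next
  case (7 g h n)
  define vs where "vs = map Var [1..<n + 1]"
  have vs: "map Var [0..<n + 1] = Var 0 # vs" unfolding vs_def by (subst upt_conv_Cons) auto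
  have S: "eval (suc (Var 0)) (cst rh) (fam th) w = Sw w (eval (Var 0) (cst rh) (fam th) w)"
   using N[of "Var 0"] by simp
  have "eval (apply_const (PR (RecP g h)) (suc (Var 0) # vs)) (cst rh) (fam th) w =
   eval (apply_const (PR h) (Var 0 # apply_const (PR (RecP g h)) (Var 0 # vs) # vs)) (cst rh) (fam th) w"
   unfolding ev[OF N] list.map S tup.simps cev.simps
   by (rule pev_RecP(2)[OF w tN[of vs] N[of "Var 0"]])
  thus ?thesis unfolding 7(1) vs_def[symmetric] vs by (simp only: sem.simps)
 qed
qed

lemma eval_up:
 assumes w: "W w" and e: "en w rh th" and w': "W w'" "w << w'"
 shows "nf w' (eval t (cst rh) (fam th) w) = eval t (cst rh) (fam th) w'"
proof -
 obtain r where r: "r \<in> N w" "\<forall>w'. W w' --> w << w' --> nf w' r = eval t (cst rh) (fam th) w'"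
  using term_value[OF w e] by blast
 hence "eval t (cst rh) (fam th) w = r" using w nf_idem by force
 thus ?thesis using r w' by simp
qed

lemma sem_lambda:
 assumes w: "W w" and e: "en w rh th"
 shows "sem (Eq (App (Lam t) s) (inst_trm s t)) w rh th"
proof -
 let ?s = "eval s (cst rh) (fam th) w"
 have "eval t ((%w'. nf w' ?s) ## cst rh) (fam th) w = eval t (%i. eval (case i of 0 => s | Suc m => Var m) (cst rh) (fam th))
  (%i. feval (FVar i) (cst rh) (fam th)) w \<and> eval t ((%w'. nf w' ?s) ## cst rh) (fam th) w \<in> N w"
 proof (rule eval_cong[of UNIV UNIV, OF over_UNIV w])
  fix i w' assume w': "W w'" "w << w'"
  show "((%w'. nf w' ?s) ## cst rh) i w' = eval (case i of 0 => s | Suc m => Var m) (cst rh) (fam th) w' \<and>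
    ((%w'. nf w' ?s) ## cst rh) i w' \<in> N w'"
   using eval_up[OF w e w'] eval_N[OF w'(1) env_mono[OF e w'(2)]] cst_N[OF e w'] by (cases i) auto
 qed (use fam_N[OF e] in auto)
 thus ?thesis by (simp add: inst_trm_def eval_sub)
qed

text \<open>By \<open>functor_value\<close> the functor of the recursor is representable, hence so
  is the step of the recursion.\<close>

lemma Rec_rspec:
 assumes w: "W w" and e: "en w rh th"
 shows "\<exists>ga. rspec w ga (eval t (cst rh) (fam th) w)
  (%w' m r. feval u (cst rh) (fam th) w' (pev pr_pair w' (Jw w' r (Jw w' m (zw w')))))"
proof (rule rspec_ex[OF w eval_N[OF w e]])
 obtain ga where "ga \<in> Fu w" "agree w ga (feval u (cst rh) (fam th))" using functor_value[OF w e] by blast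
 hence "rp w (feval u (cst rh) (fam th))" by (rule rpI)
 thus "rp w (%w' z. feval u (cst rh) (fam th) w' (pev pr_pair w' (Jw w' (Lw w' z) (Jw w' (Kw w' z) (zw w')))))"
  by (rule rp_comp[OF w _ rp_comp[OF w rp_pev[OF w]]])
   (intro rp_pair[OF w] rp_ap[OF w] rp_id[OF w] rp_zero[OF w] bim_F)
qed

lemma sem_recursor:
 assumes w: "W w" and e: "en w rh th"
 shows "sem (Eq (Rec t u zero) t) w rh th"
  "sem (Eq (Rec t u (suc s)) (App u (apply_const (PR pr_pair) [Rec t u s, s]))) w rh th"
proof -
 obtain ga where ga: "rspec w ga (eval t (cst rh) (fam th) w)
  (%w' m r. feval u (cst rh) (fam th) w' (pev pr_pair w' (Jw w' r (Jw w' m (zw w')))))"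
  using Rec_rspec[OF w e] by blast
 show "sem (Eq (Rec t u zero) t) w rh th" using rv_rec(1)[OF w ga] by simp
 show "sem (Eq (Rec t u (suc s)) (App u (apply_const (PR pr_pair) [Rec t u s, s]))) w rh th"
  using rv_rec(2)[OF w ga eval_N[OF w e, of s]] eval_N[OF w e, of s] w
  by (simp add: apply_const_def bim_const_eqs)
qed

subsection \<open>Definition by cases\<close>

text \<open>A recursion whose step discards the previous value is a definition by cases.\<close>

lemma case_fun:
 assumes w: "W w" and "rp w ph" "rp w ps"
 shows "\<exists>ze\<in>Fu w. \<forall>w'. W w' --> w << w' --> (\<forall>x\<in>N w'. ap w' ze (Jw w' (zw w') x) = ph w' x \<and>
  (\<forall>y\<in>N w'. ap w' ze (Jw w' (Sw w' y) x) = ps w' (Jw w' y x)))"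
proof -
 obtain al where al: "al \<in> Fu w" "agree w al ph" using assms by (auto simp: rp_def)
 have "rp w (%w' z. ps w' (Jw w' (Kw w' z) (Lw w' (Lw w' z))))"
  by (rule rp_comp[OF w assms(3)]) (intro rp_pair[OF w] rp_ap[OF w] rp_id[OF w] bim_F)
 then obtain be where be: "be \<in> Fu w" "agree w be (%w' z. ps w' (Jw w' (Kw w' z) (Lw w' (Lw w' z))))" by (auto simp: rp_def)
 obtain ze where ze: "ze \<in> Fu w" "rec_spec w ze al be" using closure_rec[OF w al(1) be(1)] by blast
 show ?thesis
 proof (intro bexI[OF _ ze(1)] allI impI ballI conjI)
  fix w' x assume w': "W w'" "w << w'" and x: "x \<in> N w'"
  have F: "ze \<in> Fu w'" using ze F_mono w' by blast
  show "ap w' ze (Jw w' (zw w') x) = ph w' x" using ze(2) w' x agreeD[OF al(2) w' x] by (simp add: rec_spec_def)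
  fix y assume y: "y \<in> N w'"
  show "ap w' ze (Jw w' (Sw w' y) x) = ps w' (Jw w' y x)"
   using ze(2) w' x y F agreeD[OF be(2) w', of "Jw w' y (Jw w' (ap w' ze (Jw w' y x)) x)"]
   by (simp add: rec_spec_def bim_const_eqs)
 qed
qed

end

section \<open>The common extension\<close>

definition joint_language :: language where
 "joint_language = bim_language \<union> ha1_language"

definition joint :: fsystem where
 "joint = \<lparr>lang = joint_language,
  axs = equality_axioms joint_language \<union> induction_axioms joint_language \<union> bim_constant_axioms \<union>
   {bim_composition, bim_pairing, bim_primitive_recursion, bim_unbounded_search} \<union>
   {Neg (Eq (suc zero) zero)} \<union> defining_equations \<union>
   lambda_axioms joint_language \<union> recursor_axioms joint_language\<rparr>"

lemma lang_add [simp]: "lang (S \<oplus>\<^sub>a C) = lang S" and axs_add [simp]: "axs (S \<oplus>\<^sub>a C) = axs S \<union> C"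
 by (simp_all add: add_axioms_def)

lemma lang_axs [simp]:
 "lang BIM = bim_language" "lang joint = joint_language" "lang EL = ha1_language"
 by (simp_all add: BIM_def joint_def EL_def HA1_def)

lemma joint_sub: "bim_language \<subseteq> joint_language" "ha1_language \<subseteq> joint_language"
 by (auto simp: joint_language_def)

text \<open>In the end \<open>C\<close> is empty or the set of the Cantor equations. Both versions
  of the theorem are treated at once.\<close>

interpretation BIM: bim "BIM \<oplus>\<^sub>a C" for C
 by unfold_locales (auto simp: BIM_def)

interpretation J: bim "joint \<oplus>\<^sub>a C" for C
proof
 show "Sym Zero \<in> lang (joint \<oplus>\<^sub>a C)" "Sym (PR Succ) \<in> lang (joint \<oplus>\<^sub>a C)"
  "bim_language \<subseteq> lang (joint \<oplus>\<^sub>a C)" using joint_sub by auto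
qed (auto simp: joint_def)

lemma bim_axioms_formulas: "bim_constant_axioms \<union>
   {bim_composition, bim_pairing, bim_primitive_recursion, bim_unbounded_search} \<subseteq> formulas bim_language"
 by (auto simp: bim_constant_axioms_def bim_composition_def bim_pairing_def bim_primitive_recursion_def
   bim_unbounded_search_def less_fm_def)

lemma joint_sound:
 assumes C: "C \<subseteq> formulas bim_language" and d: "deriv (joint \<oplus>\<^sub>a C) Ga A"
  and w: "wrld (BIM \<oplus>\<^sub>a C) w" "env (BIM \<oplus>\<^sub>a C) w rh th" and Ga: "\<And>B. B \<in> Ga ==> BIM.sem C B w rh th"
 shows "BIM.sem C A w rh th"
proof (rule BIM.sem_sound[OF _ d w Ga])
 fix A w rh th
 assume A: "A \<in> axs (joint \<oplus>\<^sub>a C)" and w: "wrld (BIM \<oplus>\<^sub>a C) w" and e: "env (BIM \<oplus>\<^sub>a C) w rh th"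
 consider "A \<in> equality_axioms joint_language" | "A \<in> induction_axioms joint_language"
  | "A \<in> bim_constant_axioms \<union> {bim_composition, bim_pairing, bim_primitive_recursion, bim_unbounded_search} \<union> C"
  | "A = Neg (Eq (suc zero) zero)" | "A \<in> defining_equations" | "A \<in> lambda_axioms joint_language"
  | "A \<in> recursor_axioms joint_language"
  using A by (auto simp: joint_def)
 thus "BIM.sem C A w rh th"
 proof cases
  case 1
  thus ?thesis unfolding equality_axioms_def using BIM.sem_equality_axiom[OF w e] by auto
 next
  case 2
  thus ?thesis unfolding induction_axioms_def using BIM.sem_induction_axiom[OF w e] by auto
 next
  case 3
  hence "A \<in> formulas bim_language" "A \<in> axs (BIM \<oplus>\<^sub>a C)" using C bim_axioms_formulas by (auto simp: BIM_def)
  thus ?thesis using BIM.sem_bim[OF _ w e] BIM.axiom_sat[OF _ _ w e] by simp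
 next
  case 4
  thus ?thesis by (simp add: BIM.bim_const_eqs(3) BIM.Sw_neq)
 next
  case 5 thus ?thesis by (rule BIM.sem_defining[OF w e])
 next
  case 6 thus ?thesis unfolding lambda_axioms_def using BIM.sem_lambda[OF w e] by blast
 next
  case 7 thus ?thesis unfolding recursor_axioms_def using BIM.sem_recursor[OF w e] by blast
 qed
qed

text \<open>The joint system is sound in the worlds of BIM, and BIM is complete for its own worlds.
  Since completeness concerns finitely many hypotheses, the derivation is cut down to those it
  uses.\<close>

lemma bim_fm_deriv:
 assumes C: "C \<subseteq> formulas bim_language" and d: "deriv (joint \<oplus>\<^sub>a C) Ga A"
 shows "deriv (BIM \<oplus>\<^sub>a C) (bim_fm ` Ga) (bim_fm A)"
proof -
 obtain G where G: "finite G" "G \<subseteq> Ga" "deriv (joint \<oplus>\<^sub>a C) G A" using compact[OF d] by (elim exE conjE)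
 have "deriv (BIM \<oplus>\<^sub>a C) (bim_fm ` G) (bim_fm A)"
 proof (rule completeness)
  fix w rh th assume w: "wrld (BIM \<oplus>\<^sub>a C) w" "env (BIM \<oplus>\<^sub>a C) w rh th" and s: "\<And>B. B \<in> bim_fm ` G ==> sat w rh th B"
  have "BIM.sem C A w rh th"
   by (rule joint_sound[OF C G(3) w]) (use s BIM.sem_bim_fm[OF w] in auto)
  thus "sat w rh th (bim_fm A)" using BIM.sem_bim_fm[OF w] by simp
 qed (use G in auto)
 thus ?thesis by (rule weaken) (use G in auto)
qed

section \<open>The worlds of a theory with abstraction and primitive recursive constants\<close>

lemma describes_pos: "describes d n ==> 0 < n"
 by (induction rule: describes.induct) auto

lemma describes_Proj [simp]: "describes (Proj n i) m <-> m = n \<and> i < n"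
 by (auto elim: describes.cases intro: describes.intros)
lemma describes_Const [simp]: "describes (Const n q) m <-> m = n \<and> 0 < n"
 by (auto elim: describes.cases intro: describes.intros)
lemma describes_Comp [simp]: "describes (Comp n g hs) m <-> m = n \<and> 0 < n \<and> describes g (length hs) \<and> (\<forall>h\<in>set hs. describes h n)"
 by (auto elim: describes.cases intro: describes.intros)
lemma describes_Rec0 [simp]: "describes (Rec0 q h) m <-> m = 1 \<and> describes h 2"
 by (auto elim: describes.cases intro: describes.intros(5)[unfolded One_nat_def])
lemma describes_RecP: "describes (RecP g h) m <-> (\<exists>n. m = n + 1 \<and> describes g n \<and> describes h (n + 2))"
 by (auto elim: describes.cases intro: describes.intros(6)[simplified])

lemma describes_add [simp]: "describes pr_add 2"
 and describes_mult [simp]: "describes pr_mult 2"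
 and describes_power [simp]: "describes (pr_power q) 1"
 and describes_pair [simp]: "describes pr_pair 2"
proof -
 show add: "describes pr_add 2" unfolding pr_add_def describes_RecP by (intro exI[of _ 1]) simp
 show mult: "describes pr_mult 2" unfolding pr_mult_def describes_RecP by (intro exI[of _ 1]) (simp add: add[simplified] numeral_2_eq_2[symmetric])
 show pow: "describes (pr_power q) 1" for q unfolding pr_power_def using mult by (simp add: numeral_2_eq_2[symmetric])
 show "describes pr_pair 2" unfolding pr_pair_def using mult pow by (simp add: numeral_2_eq_2[symmetric])
qed

lemmas [simp] = describes_add[unfolded numeral_2_eq_2] describes_mult[unfolded numeral_2_eq_2]
 describes_power[unfolded One_nat_def] describes_pair[unfolded numeral_2_eq_2]

lemma apply_const_1: "apply_const c [t] = App (FC c) t"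
 and apply_const_2: "apply_const c [s, t] = Fn c [s, t]"
 by (simp_all add: apply_const_def)

lemma apply_const_terms:
 "Sym (PR d) \<in> L ==> describes d (length ts) ==> (\<And>t. t \<in> set ts ==> t \<in> terms L) ==> apply_const (PR d) ts \<in> terms L"
 using describes_pos by (auto simp: apply_const_def split: list.split)

lemma list_sub_Var: "map (sub_trm (%i. if i < length ts then ts ! i else z) th) (map Var [0..<length ts]) = ts"
 by (rule nth_equalityI) auto

context eqind
begin

declare zero_succ(1) [simp]

text \<open>Only finitely many variables occur in \<open>s\<close>, and their values are exchanged
  one after the other. \<open>shiftN k\<close> moves the variable \<open>k\<close> to the index 0,
  where \<open>nf_cong1\<close> applies.\<close>

lemma nf_cong:
 assumes w: "W w" and e: "en w rh th" "en w rh' th" and eq: "\<And>i. nf w (rh i) = nf w (rh' i)" and s: "s \<in> Ter"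
 shows "nf w (sub_trm rh th s) = nf w (sub_trm rh' th s)"
proof -
 obtain X Y where XY: "finite X" "over_trm X Y s" using finite_over by blast
 obtain M where M: "X \<subseteq> {..<M}" using finite_nat_bounded XY(1) by blast
 have step: "nf w (sub_trm sg th s) = nf w (sub_trm (sg(k := t)) th s)"
  if sg: "en w sg th" and t: "t \<in> Tm w" "nf w (sg k) = nf w t" for sg k t
 proof -
  let ?s = "sub_trm (shiftN k) FVar s"
  have s': "?s \<in> Ter" by (rule sub_terms[OF s]) (auto simp: shiftN_def)
  have "sub_trm (x ## sg) th ?s = sub_trm (sg(k := x)) th s" for x
  proof -
   have "(sub_trm (x ## sg) th \<circ> shiftN k) = sg(k := x)" by (rule ext) (simp add: shiftN_def)
   thus ?thesis by (simp add: sub_sub comp_def)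
  qed
  thus ?thesis
   using nf_cong1[OF w sg env_T[OF sg, of k] s'] nf_cong1[OF w sg t(1) s'] t(2) by (metis fun_upd_triv)
 qed
 have "nf w (sub_trm rh th s) = nf w (sub_trm (%i. if i < k then rh' i else rh i) th s) \<and> en w (%i. if i < k then rh' i else rh i) th" for k
 proof (induction k)
  case 0 thus ?case using e by simp
 next
  case (Suc k)
  let ?sg = "%i. if i < k then rh' i else rh i"
  have "?sg(k := rh' k) = (%i. if i < Suc k then rh' i else rh i)" by (rule ext) auto
  moreover have "nf w (sub_trm ?sg th s) = nf w (sub_trm (?sg(k := rh' k)) th s)"
   by (rule step) (use Suc e eq env_T in auto)
  moreover have "en w (%i. if i < Suc k then rh' i else rh i) th" using e by (simp add: env_def)
  ultimately show ?case using Suc by simp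
 qed
 from this[of M] have "nf w (sub_trm rh th s) = nf w (sub_trm (%i. if i < M then rh' i else rh i) th s)" by simp
 also have "sub_trm (%i. if i < M then rh' i else rh i) th s = sub_trm rh' th s"
  by (rule sub_cong_over[OF XY(2)]) (use M in auto)
 finally show ?thesis .
qed

lemma axiom_eq: "Eq s t \<in> axs Sy ==> s \<in> Ter ==> t \<in> Ter ==> W w ==> en w rh th
  ==> nf w (sub_trm rh th s) = nf w (sub_trm rh th t)"
 using axiom_sat[of "Eq s t" w rh th] sat_Eq[of w rh th s t] by simp

lemma eq_induct:
 assumes w: "W w" and e: "en w rh th" and st: "s \<in> Ter" "t \<in> Ter"
  and 0: "nf w (sub_trm (zw w ## rh) th s) = nf w (sub_trm (zw w ## rh) th t)"
  and S: "\<And>w' a. W w' ==> w << w' ==> a \<in> N w' ==> en w' rh th ==> nf w' (sub_trm (a ## rh) th s) = nf w' (sub_trm (a ## rh) th t) ==>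
   nf w' (sub_trm (Sw w' a ## rh) th s) = nf w' (sub_trm (Sw w' a ## rh) th t)"
  and a: "a \<in> N w"
 shows "nf w (sub_trm (a ## rh) th s) = nf w (sub_trm (a ## rh) th t)"
proof -
 have *: "sat w' (b ## rh) th (Eq s t) <-> nf w' (sub_trm (b ## rh) th s) = nf w' (sub_trm (b ## rh) th t)"
  if "W w'" "w << w'" "b \<in> N w'" for w' b
  by (rule sat_Eq[OF that(1) env_consN[OF env_mono[OF e that(2)] N_T[OF that(1,3)]] st])
 have "sat w (a ## rh) th (Eq s t)"
 proof (rule induct_sat[OF w e _ _ _ w wle_refl a])
  show "sat w (zw w ## rh) th (Eq s t)" using * 0 w by simp
  fix w' b assume w': "W w'" "w << w'" "b \<in> N w'" and "sat w' (b ## rh) th (Eq s t)"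
  thus "sat w' (Sw w' b ## rh) th (Eq s t)"
   using *[OF w'] *[OF w'(1,2), of "Sw w' b"] S[OF w' env_mono[OF e w'(2)]] by simp
 qed (use st in simp)
 thus ?thesis using *[OF w wle_refl a] by simp
qed

end

locale ha = eqind +
 assumes ha_lang: "ha1_language \<subseteq> lang Sy"
  and defining: "defining_equations \<subseteq> axs Sy"
  and lambda: "lambda_axioms (lang Sy) \<subseteq> axs Sy"
  and recursor: "recursor_axioms (lang Sy) \<subseteq> axs Sy"
  and one_neq_zero: "Neg (Eq (suc zero) zero) \<in> axs Sy"
begin

lemma PR_lang: "describes d n ==> Sym (PR d) \<in> lang Sy"
 using ha_lang by (auto simp: ha1_language_def)

lemma Lam_Rec_lang [simp]: "LamSym \<in> lang Sy" "RecSym \<in> lang Sy"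
 using ha_lang by (auto simp: ha1_language_def)

lemma PR_F [simp]: "describes d 1 ==> FC (PR d) \<in> Fu w"
 using PR_lang by (auto simp: F_def)

lemma apply_T: "describes d (length ts) ==> (\<And>t. t \<in> set ts ==> t \<in> Tm w) ==> apply_const (PR d) ts \<in> Tm w"
 using apply_const_terms[OF PR_lang] by (auto simp: T_def apply_const_def split: list.split)

lemma apply_terms: "describes d (length ts) ==> (\<And>t. t \<in> set ts ==> t \<in> Ter) ==> apply_const (PR d) ts \<in> Ter"
 by (rule apply_const_terms[OF PR_lang])

lemma numeral_T' [simp]: "numeral_trm n \<in> Tm w" by (induction n) auto
lemma numeral_terms' [simp]: "numeral_trm n \<in> Ter" by (induction n) auto

definition lenv :: "trm list => nat => trm" where
 "lenv ts i = (if i < length ts then ts ! i else zero)"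

definition cenv :: "nat => fnl" where "cenv _ = FC (PR Succ)"

lemma lenv_env: "(\<And>t. t \<in> set ts ==> t \<in> Tm w) ==> en w (lenv ts) cenv"
 by (auto simp: env_def lenv_def cenv_def)

lemma lenv_Var: "map (sub_trm (lenv ts) th) (map Var [0..<length ts]) = ts"
 unfolding lenv_def[abs_def] by (rule list_sub_Var)

lemma lenv_Var_tl: "length ts = Suc n ==> map (sub_trm (lenv ts) th) (map Var [1..<n + 1]) = tl ts"
 by (rule nth_equalityI) (auto simp: lenv_def nth_tl nth_append simp del: upt_Suc)

lemma def_sub:
 assumes "Eq s t \<in> defining_equations" "s \<in> Ter" "t \<in> Ter" "W w" "\<And>t. t \<in> set ts ==> t \<in> Tm w"
 shows "nf w (sub_trm (lenv ts) cenv s) = nf w (sub_trm (lenv ts) cenv t)"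
 by (rule axiom_eq) (use assms defining lenv_env in auto)

lemma nf_Const:
 assumes "W w" "describes (Const n q) n" "length ts = n" "\<And>t. t \<in> set ts ==> t \<in> Tm w"
 shows "nf w (apply_const (PR (Const n q)) ts) = nf w (numeral_trm q)"
proof -
 have "nf w (sub_trm (lenv ts) cenv (apply_const (PR (Const n q)) (map Var [0..<n]))) = nf w (sub_trm (lenv ts) cenv (numeral_trm q))"
  by (rule def_sub) (use assms in "auto intro!: defining_equations.intros apply_terms")
 thus ?thesis using assms(3) lenv_Var[of ts cenv] by (simp add: apply_const_sub)
qed

lemma nf_Proj:
 assumes "W w" "describes (Proj n i) n" "length ts = n" "\<And>t. t \<in> set ts ==> t \<in> Tm w"
 shows "nf w (apply_const (PR (Proj n i)) ts) = nf w (ts ! i)"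
proof -
 have "i < n" using assms(2) by (auto elim: describes.cases)
 have "nf w (sub_trm (lenv ts) cenv (apply_const (PR (Proj n i)) (map Var [0..<n]))) = nf w (sub_trm (lenv ts) cenv (Var i))"
  by (rule def_sub) (use assms in "auto intro!: defining_equations.intros apply_terms")
 thus ?thesis using assms(3) lenv_Var[of ts cenv] \<open>i < n\<close> by (simp add: apply_const_sub lenv_def)
qed

lemma nf_Comp:
 assumes "W w" "describes (Comp n g hs) n" "length ts = n" "\<And>t. t \<in> set ts ==> t \<in> Tm w"
 shows "nf w (apply_const (PR (Comp n g hs)) ts) = nf w (apply_const (PR g) (map (%h. apply_const (PR h) ts) hs))"
proof -
 have d: "describes g (length hs)" "\<And>h. h \<in> set hs ==> describes h n" using assms(2) by (auto elim: describes.cases)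
 have "nf w (sub_trm (lenv ts) cenv (apply_const (PR (Comp n g hs)) (map Var [0..<n]))) =
   nf w (sub_trm (lenv ts) cenv (apply_const (PR g) (map (%h. apply_const (PR h) (map Var [0..<n])) hs)))"
  by (rule def_sub) (use assms d in "auto intro!: defining_equations.intros apply_terms")
 thus ?thesis using assms(3) lenv_Var[of ts cenv] by (simp add: apply_const_sub comp_def)
qed

lemma nf_Rec0:
 assumes "W w" "describes (Rec0 q h) 1"
 shows "nf w (App (FC (PR (Rec0 q h))) zero) = nf w (numeral_trm q)"
  "t \<in> Tm w ==> nf w (App (FC (PR (Rec0 q h))) (suc t)) = nf w (Fn (PR h) [t, App (FC (PR (Rec0 q h))) t])"
proof -
 have d: "describes h 2" using assms(2) by (auto elim: describes.cases)
 have "nf w (sub_trm (lenv []) cenv (apply_const (PR (Rec0 q h)) [zero])) = nf w (sub_trm (lenv []) cenv (numeral_trm q))"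
  by (rule def_sub) (use assms in "auto intro!: defining_equations.intros apply_terms")
 thus "nf w (App (FC (PR (Rec0 q h))) zero) = nf w (numeral_trm q)" by (simp add: apply_const_def)
 assume t: "t \<in> Tm w"
 have "nf w (sub_trm (lenv [t]) cenv (apply_const (PR (Rec0 q h)) [suc (Var 0)])) =
  nf w (sub_trm (lenv [t]) cenv (apply_const (PR h) [Var 0, apply_const (PR (Rec0 q h)) [Var 0]]))"
  by (rule def_sub) (use assms d t in "auto intro!: defining_equations.intros apply_terms simp: numeral_2_eq_2")
 thus "nf w (App (FC (PR (Rec0 q h))) (suc t)) = nf w (Fn (PR h) [t, App (FC (PR (Rec0 q h))) t])"
  by (simp add: apply_const_def lenv_def)
qed

lemma nf_RecP:
 assumes "W w" "describes (RecP g h) (n + 1)" "length ts = n" "\<And>t. t \<in> set ts ==> t \<in> Tm w"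
 shows "nf w (apply_const (PR (RecP g h)) (zero # ts)) = nf w (apply_const (PR g) ts)"
  "t \<in> Tm w ==> nf w (apply_const (PR (RecP g h)) (suc t # ts)) =
   nf w (apply_const (PR h) (t # apply_const (PR (RecP g h)) (t # ts) # ts))"
proof -
 from assms(2) have "describes g n \<and> describes h (n + 2)"
  by cases auto
 hence d: "describes g n" "describes h (n + 2)" by auto
 have u: "map Var [0..<n + 1] = Var 0 # map Var [1..<n + 1]" by (subst upt_conv_Cons) auto
 have 0: "map (sub_trm (lenv (t # ts)) cenv) (map Var [1..<n + 1]) = ts" for t
  using lenv_Var_tl[of "t # ts" n cenv] assms(3) by simp
 have "nf w (sub_trm (lenv (zero # ts)) cenv (apply_const (PR (RecP g h)) (zero # map Var [1..<n + 1]))) =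
   nf w (sub_trm (lenv (zero # ts)) cenv (apply_const (PR g) (map Var [1..<n + 1])))"
 proof (rule def_sub)
  show "Eq (apply_const (PR (RecP g h)) (zero # map Var [1..<n + 1])) (apply_const (PR g) (map Var [1..<n + 1])) \<in> defining_equations"
   by (rule defining_equations.intros) (rule assms)
 qed (use assms d in "auto intro!: apply_terms simp del: upt_Suc")
 thus "nf w (apply_const (PR (RecP g h)) (zero # ts)) = nf w (apply_const (PR g) ts)"
  unfolding apply_const_sub list.map 0 by simp
 assume t: "t \<in> Tm w"
 have "nf w (sub_trm (lenv (t # ts)) cenv (apply_const (PR (RecP g h)) (suc (Var 0) # map Var [1..<n + 1]))) =
   nf w (sub_trm (lenv (t # ts)) cenv (apply_const (PR h)
     (Var 0 # apply_const (PR (RecP g h)) (map Var [0..<n + 1]) # map Var [1..<n + 1])))"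
 proof (rule def_sub)
  show "Eq (apply_const (PR (RecP g h)) (suc (Var 0) # map Var [1..<n + 1])) (apply_const (PR h)
     (Var 0 # apply_const (PR (RecP g h)) (map Var [0..<n + 1]) # map Var [1..<n + 1])) \<in> defining_equations"
   by (rule defining_equations.intros) (rule assms)
 qed (use assms d t in "auto intro!: apply_terms simp del: upt_Suc")
 thus "nf w (apply_const (PR (RecP g h)) (suc t # ts)) =
   nf w (apply_const (PR h) (t # apply_const (PR (RecP g h)) (t # ts) # ts))"
  unfolding u apply_const_sub list.map 0 by (simp add: lenv_def)
qed

lemma nf_beta:
 assumes w: "W w" and e: "en w rh th" and t: "t \<in> Ter" and a: "a \<in> Tm w"
 shows "nf w (App (sub_fnl rh th (Lam t)) a) = nf w (sub_trm (a ## rh) th t)"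
proof -
 \<comment> \<open>The parameters of \<open>t\<close> are shifted to free an index for the argument;
   the axiom is used with a variable as argument, and the environment then supplies
   \<open>a\<close>.\<close>
 let ?t = "ren_trm (up_ren Suc) id t"
 have t': "?t \<in> Ter" using t by (simp add: ren_terms)
 have it: "inst_trm (Var 0) ?t \<in> Ter"
  unfolding inst_trm_def by (rule sub_terms[OF t']) (auto split: nat.split)
 have "Eq (App (Lam ?t) (Var 0)) (inst_trm (Var 0) ?t) \<in> axs Sy"
  using lambda t' by (auto simp: lambda_axioms_def)
 from axiom_eq[OF this _ it w env_consN[OF e a]] t'
 have "nf w (App (sub_fnl (a ## rh) th (Lam ?t)) a) = nf w (sub_trm (a ## rh) th (inst_trm (Var 0) ?t))" by simp
 moreover have "sub_fnl (a ## rh) th (Lam ?t) = sub_fnl rh th (Lam t)"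
 proof -
  have "sub_fnl (a ## rh) th (ren_fnl Suc id (Lam t)) = sub_fnl rh th (Lam t)"
   by (simp only: sub_ren_fnl) (simp add: comp_def)
  thus ?thesis by simp
 qed
 moreover have "sub_trm (a ## rh) th (inst_trm (Var 0) ?t) = sub_trm (a ## rh) th t"
 proof -
  have "(%x. sub_trm (a ## rh) th (case up_ren Suc x of 0 => Var 0 | Suc m => Var m)) = a ## rh"
   by (rule ext) (auto simp: up_ren_def split: nat.split)
  thus ?thesis by (simp add: inst_trm_def sub_sub sub_ren comp_def)
 qed
 ultimately show ?thesis by simp
qed

lemma ap_beta:
 assumes w: "W w" and e: "en w rh th" and t: "t \<in> Ter" and a: "a \<in> N w"
 shows "ap w (sub_fnl rh th (Lam t)) a = nf w (sub_trm (a ## rh) th t)"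
 using nf_beta[OF w e t N_T[OF w a]] by (simp add: ap_def)

lemma nf_recursor:
 assumes w: "W w" and e: "en w rh th" and t: "t \<in> Ter" "u \<in> Fun"
 shows "nf w (sub_trm rh th (Rec t u zero)) = nf w (sub_trm rh th t)"
  "s \<in> Ter ==> nf w (sub_trm rh th (Rec t u (suc s))) = nf w (sub_trm rh th (App u (Fn (PR pr_pair) [Rec t u s, s])))"
proof -
 show "nf w (sub_trm rh th (Rec t u zero)) = nf w (sub_trm rh th t)"
  by (rule axiom_eq) (use recursor t w e in "auto simp: recursor_axioms_def")
 note d = describes_pair
 assume s: "s \<in> Ter"
 have "Eq (Rec t u (suc s)) (App u (apply_const (PR pr_pair) [Rec t u s, s])) \<in> axs Sy"
  using recursor t s by (auto simp: recursor_axioms_def)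
 from axiom_eq[OF this _ _ w e] show "nf w (sub_trm rh th (Rec t u (suc s))) = nf w (sub_trm rh th (App u (Fn (PR pr_pair) [Rec t u s, s])))"
  using t s d PR_lang[OF d] by (simp add: apply_const_def numeral_2_eq_2)
qed

text \<open>Abstraction over the last argument turns the recursor into a functor, as
  \<open>rspec\<close> and the recursion axiom of BIM call for.\<close>

lemma recursor_functor:
 assumes w: "W w" and e: "en w rh th" and t: "t \<in> Ter" "u \<in> Fun"
 defines "de \<equiv> sub_fnl rh th (Lam (Rec (ren_trm Suc id t) (ren_fnl Suc id u) (Var 0)))"
 shows "de \<in> Fu w" "ap w de (zw w) = nf w (sub_trm rh th t)"
  "m \<in> N w ==> ap w de (Sw w m) = ap w (sub_fnl rh th u) (nf w (Fn (PR pr_pair) [ap w de m, m]))"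
proof -
 let ?t = "ren_trm Suc id t" and ?u = "ren_fnl Suc id u"
 let ?R = "Rec ?t ?u (Var 0)"
 have t': "?t \<in> Ter" "?u \<in> Fun" "?R \<in> Ter"
  using t by (simp_all add: ren_terms ren_functors)
 show F: "de \<in> Fu w" unfolding de_def by (rule sub_F[OF e]) (use t' in simp)
 have sR: "sub_trm (a ## rh) th (Rec ?t ?u r) = Rec (sub_trm rh th t) (sub_fnl rh th u) (sub_trm (a ## rh) th r)" for a r
  by (simp add: sub_ren sub_ren_fnl comp_def)
 have "ap w de (zw w) = nf w (App de zero)" using nf_App[OF w F zero_T] by simp
 also have "... = nf w (sub_trm rh th (Rec t u zero))" using nf_beta[OF w e t'(3) zero_T] unfolding sR de_def by simp
 also have "... = nf w (sub_trm rh th t)" by (rule nf_recursor(1)[OF w e t(1,2)])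
 finally show "ap w de (zw w) = nf w (sub_trm rh th t)" .
 assume m: "m \<in> N w"
 have mT: "m \<in> Tm w" by (rule N_T[OF w m])
 have e': "en w (m ## rh) th" by (rule env_consN[OF e mT])
 let ?p = "Fn (PR pr_pair) [Rec (sub_trm rh th t) (sub_fnl rh th u) m, m]"
 have RT: "Rec (sub_trm rh th t) (sub_fnl rh th u) m \<in> Tm w" using sub_T[OF e' t'(3)] unfolding sR by simp
 have r: "ap w de m = nf w (Rec (sub_trm rh th t) (sub_fnl rh th u) m)"
  using ap_beta[OF w e t'(3) m] unfolding sR de_def by simp
 have pT: "?p \<in> Tm w" unfolding apply_const_2[symmetric] by (rule apply_T) (use RT mT in auto)
 have p: "nf w ?p = nf w (Fn (PR pr_pair) [ap w de m, m])"
 proof -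
  have pair: "Fn (PR pr_pair) [Var 0, Var 1] \<in> Ter" unfolding apply_const_2[symmetric] by (rule apply_terms) auto
  have "en w (%_. zero) cenv" by (auto simp: env_def cenv_def)
  hence "en w (m ## (%_. zero)) cenv" by (rule env_consN[OF _ mT])
  from nf_cong1[OF w this RT pair] show ?thesis unfolding r by simp
 qed
 have "ap w de (Sw w m) = nf w (App de (suc m))" using w m F mT by (simp add: nf_App nf_idem)
 also have "... = nf w (sub_trm (m ## rh) th (Rec ?t ?u (suc (Var 0))))"
  using nf_beta[OF w e t'(3), of "suc m"] mT unfolding sR de_def by simp
 also have "... = nf w (sub_trm (m ## rh) th (App ?u (Fn (PR pr_pair) [?R, Var 0])))"
  by (rule nf_recursor(2)[OF w e' t'(1,2)]) simp
 also have "... = nf w (App (sub_fnl rh th u) ?p)" by (simp add: sub_ren sub_ren_fnl comp_def)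
 also have "... = ap w (sub_fnl rh th u) (nf w ?p)" by (rule nf_App[OF w sub_F[OF e t(2)] pT])
 finally show "ap w de (Sw w m) = ap w (sub_fnl rh th u) (nf w (Fn (PR pr_pair) [ap w de m, m]))" unfolding p .
qed

end

section \<open>Values of terms in a theory with the symbols of both systems\<close>

locale bimha = bim0 + ha
begin

lemma tup_up: "W w ==> W w' ==> w << w' ==> (\<And>t. t \<in> set ts ==> t \<in> Tm w) ==>
  nf w' (tup w (map (nf w) ts)) = tup w' (map (nf w') ts)"
proof (induction ts)
 case (Cons t ts)
 have "tup w (map (nf w) ts) \<in> N w" by (rule tup_N) (use Cons.prems in auto)
 thus ?case using Cons by (simp add: Jw_up)
qed simp

text \<open>By its defining equations a constant given by recursion runs through the sequence that
  the recursion prescribes, and \<open>rspec\<close> determines such a sequence.\<close>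

lemma pev_apply:
 "describes d n ==> W w ==> length ts = n ==> (\<And>t. t \<in> set ts ==> t \<in> Tm w) ==>
  nf w (apply_const (PR d) ts) = pev d w (tup w (map (nf w) ts))"
proof (induction arbitrary: w ts rule: describes.induct)
 case 1
 then obtain t where "ts = [t]" "t \<in> Tm w" by (auto simp: length_Suc_conv)
 thus ?case using 1 by (simp add: apply_const_def nf_App bim_const_eqs)
next
 case (2 n q)
 thus ?case using nf_Const[of w n q ts] by simp
next
 case (3 i n)
 hence "prj w i (tup w (map (nf w) ts)) = map (nf w) ts ! i" by (intro prj_tup) auto
 thus ?case using 3 nf_Proj[of w n i ts] by simp
next
 case (4 n g hs)
 have h: "nf w (apply_const (PR h) ts) = pev h w (tup w (map (nf w) ts))" if "h \<in> set hs" for h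
  by (rule 4(5)[OF that 4(6-8)])
 have "nf w (apply_const (PR (Comp n g hs)) ts) = nf w (apply_const (PR g) (map (%h. apply_const (PR h) ts) hs))"
  by (rule nf_Comp) (use 4 in auto)
 also have "... = pev g w (tup w (map (nf w) (map (%h. apply_const (PR h) ts) hs)))"
  by (rule 4(4)[OF 4(6)]) (use 4 in "auto intro!: apply_T")
 also have "map (nf w) (map (%h. apply_const (PR h) ts) hs) = map (%h. pev h w (tup w (map (nf w) ts))) hs"
  using h by simp
 finally show ?case by (simp add: comp_def)
next
 case (5 h q)
 then obtain t where t: "ts = [t]" "t \<in> Tm w" by (auto simp: length_Suc_conv)
 have d: "describes (Rec0 q h) 1" using 5 by simp
 let ?x = "tup w (map (nf w) ts)"
 have "rspec w (FC (PR (Rec0 q h))) (nf w (numeral_trm q)) (%w' m r. pev h w' (Jw w' m (Jw w' r (nf w' (Lw w ?x)))))"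
  unfolding rspec_def
 proof (intro conjI allI impI ballI)
  show F: "FC (PR (Rec0 q h)) \<in> Fu w" using d by simp
  show "ap w (FC (PR (Rec0 q h))) (zw w) = nf w (numeral_trm q)"
   using nf_Rec0(1)[OF 5(3) d] nf_App[OF 5(3) F zero_T] by simp
  fix w' m assume w': "W w'" "w << w'" and m: "m \<in> N w'"
  have F': "FC (PR (Rec0 q h)) \<in> Fu w'" using d by simp
  have "ap w' (FC (PR (Rec0 q h))) (Sw w' m) = nf w' (App (FC (PR (Rec0 q h))) (suc m))"
   using w' m F' by (simp add: nf_App nf_idem)
  also have "... = nf w' (apply_const (PR h) [m, App (FC (PR (Rec0 q h))) m])"
   using nf_Rec0(2)[OF w'(1) d] m w' by (simp add: apply_const_def)
  also have "... = pev h w' (tup w' (map (nf w') [m, App (FC (PR (Rec0 q h))) m]))"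
   by (rule 5(2)[OF w'(1)]) (use m w' F' in auto)
  finally show "ap w' (FC (PR (Rec0 q h))) (Sw w' m) = pev h w' (Jw w' m (Jw w' (ap w' (FC (PR (Rec0 q h))) m) (nf w' (Lw w ?x))))"
   using m w' F' t 5(3) by (simp add: nf_App nf_idem bim_const_eqs)
 qed
 from rv_eq[OF 5(3) this, of "Kw w ?x"] show ?case
  using t 5(3) d nf_App[OF 5(3) _ t(2)] by (simp add: apply_const_def bim_const_eqs)
next
 case (6 g n h)
 have d: "describes (RecP g h) (n + 1)" using 6 by (auto simp: describes_RecP)
 from 6(6) obtain t us where t: "ts = t # us" "length us = n" "t \<in> Tm w" "\<And>u. u \<in> set us ==> u \<in> Tm w"
  using 6(7) by (cases ts) auto
 note w = 6(5)
 let ?x = "tup w (map (nf w) ts)" and ?b = "apply_const (PR (RecP g h)) (map Var [0..<n + 1])"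
 \<comment> \<open>The constant as a functor of the recursion variable, with the other arguments
   \<open>us\<close> frozen by abstraction.\<close>
 let ?ga = "sub_fnl (lenv us) cenv (Lam ?b)"
 have xN: "tup w (map (nf w) us) \<in> N w" by (rule tup_N[OF w]) (use t in auto)
 have e: "en w (lenv us) cenv" using lenv_env t by simp
 have b: "?b \<in> Ter" by (rule apply_terms) (use d in auto)
 have sb: "sub_trm (a ## lenv us) cenv ?b = apply_const (PR (RecP g h)) (a # us)" for a
 proof -
  have "map (sub_trm (a ## lenv us) cenv) (map Var [0..<n + 1]) = a # us"
   using t(2) by (intro nth_equalityI) (auto simp: lenv_def nth_Cons nth_append split: nat.split simp del: upt_Suc)
  thus ?thesis by (simp only: apply_const_sub)
 qed
 have F: "?ga \<in> Fu w" by (rule sub_F[OF e]) (use b in simp)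
 have ap: "ap w' ?ga m = nf w' (apply_const (PR (RecP g h)) (m # us))" if "W w'" "w << w'" "m \<in> N w'" for w' m
  using ap_beta[OF that(1) env_mono[OF e that(2)] b that(3)] unfolding sb .
 have "rspec w ?ga (pev g w (Lw w ?x)) (%w' m r. pev h w' (Jw w' m (Jw w' r (nf w' (Lw w ?x)))))"
  unfolding rspec_def
 proof (intro conjI allI impI ballI)
  show "?ga \<in> Fu w" by (rule F)
  have zt: "zero # us = zero # us" ..
  have "ap w ?ga (zw w) = nf w (sub_trm (zero ## lenv us) cenv ?b)"
   using nf_beta[OF w e b zero_T] nf_App[OF w F zero_T] by simp
  also have "... = nf w (apply_const (PR g) us)" unfolding sb
   by (rule nf_RecP(1)[OF w d t(2,4)])
  also have "... = pev g w (tup w (map (nf w) us))" by (rule 6(3)[OF w t(2,4)])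
  finally show "ap w ?ga (zw w) = pev g w (Lw w ?x)" using t xN w by (simp add: bim_const_eqs)
  fix w' m assume w': "W w'" "w << w'" and m: "m \<in> N w'"
  have us: "u \<in> Tm w'" if "u \<in> set us" for u using t(4)[OF that] T_mono w' by blast
  have R: "apply_const (PR (RecP g h)) (m # us) \<in> Tm w'" by (rule apply_T) (use d t us m w' in auto)
  have "ap w' ?ga (Sw w' m) = nf w' (sub_trm (suc m ## lenv us) cenv ?b)"
   using nf_beta[OF w'(1) env_mono[OF e w'(2)] b, of "suc m"] nf_App[OF w'(1) F_mono[OF w'(2) F], of "suc m"] m w'
   by (simp add: nf_App nf_idem)
  also have "... = nf w' (apply_const (PR h) (m # apply_const (PR (RecP g h)) (m # us) # us))" unfolding sb
   by (rule nf_RecP(2)[OF w'(1) d t(2) us]) (use m w' in auto)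
  also have "... = pev h w' (tup w' (map (nf w') (m # apply_const (PR (RecP g h)) (m # us) # us)))"
   by (rule 6(4)[OF w'(1)]) (use t us m w' R in auto)
  also have "... = pev h w' (Jw w' m (Jw w' (ap w' ?ga m) (nf w' (Lw w ?x))))"
   using tup_up[OF w w' t(4)] t xN w w' m ap[OF w' m] by (simp add: bim_const_eqs nf_idem)
  finally show "ap w' ?ga (Sw w' m) = pev h w' (Jw w' m (Jw w' (ap w' ?ga m) (nf w' (Lw w ?x))))" .
 qed
 from rv_eq[OF w this, of "Kw w ?x"]
 have "pev (RecP g h) w ?x = ap w ?ga (nf w t)" using t xN w by (simp add: bim_const_eqs)
 also have "... = nf w (App ?ga t)" using nf_App[OF w F t(3)] by simp
 also have "... = nf w (apply_const (PR (RecP g h)) ts)" using nf_beta[OF w e b t(3)] unfolding sb t(1) .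
 finally show ?case by simp
qed

lemma cst_cons: "(%w'. nf w' a) ## cst rh = cst (a ## rh)"
 by (intro ext) (simp add: cst_def split: nat.split)

lemma eval_nf:
 "t \<in> Ter ==> W w ==> en w rh th ==> eval t (cst rh) (fam th) w = nf w (sub_trm rh th t)"
 "u \<in> Fun ==> W w ==> en w rh th ==> a \<in> N w ==> feval u (cst rh) (fam th) w a = ap w (sub_fnl rh th u) a"
proof (induction t and u arbitrary: w rh th and w rh th a)
 case (Var n) thus ?case by (simp add: cst_def)
next
 case (Fn c ts)
 have ts: "t \<in> Ter" if "t \<in> set ts" for t using Fn.prems(1) that by auto
 have IH: "eval t (cst rh) (fam th) w = nf w (sub_trm rh th t)" if "t \<in> set ts" for t
  by (rule Fn.IH[OF that ts[OF that] Fn.prems(2,3)])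
 have T: "sub_trm rh th t \<in> Tm w" if "t \<in> set ts" for t using sub_T[OF Fn.prems(3) ts[OF that]] .
 have ev: "eval (Fn c ts) (cst rh) (fam th) w = cev c w (tup w (map (nf w) (map (sub_trm rh th) ts)))"
  using IH by (simp add: comp_def cong: map_cong)
 consider "c = Zero" "ts = []" | "c = PairJ" "length ts = 2" | d where "c = PR d" "describes d (length ts)" "length ts \<noteq> 1"
  using Fn.prems(1) by (cases c) auto
 thus ?case
 proof cases
  case 1 thus ?thesis by simp
 next
  case 2
  then obtain s t where st: "ts = [s, t]" by (auto simp: numeral_2_eq_2 length_Suc_conv)
  have N: "nf w (sub_trm rh th s) \<in> N w" "nf w (sub_trm rh th t) \<in> N w" using T st by auto
  show ?thesis unfolding ev using 2 st T N Fn.prems(2) by (simp add: nf_pairJ bim_const_eqs)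
 next
  case 3
  have "nf w (apply_const (PR d) (map (sub_trm rh th) ts)) = pev d w (tup w (map (nf w) (map (sub_trm rh th) ts)))"
   by (rule pev_apply[OF 3(2) Fn.prems(2)]) (use T in auto)
  moreover have "apply_const (PR d) (map (sub_trm rh th) ts) = Fn (PR d) (map (sub_trm rh th) ts)"
   using 3(3) by (auto simp: apply_const_def split: list.split)
  ultimately show ?thesis unfolding ev using 3 by simp
 qed
next
 case (App u t)
 have ut: "u \<in> Fun" "t \<in> Ter" using App.prems by auto
 show ?case using App.IH(2)[OF ut(2) App.prems(2,3)] App.IH(1)[OF ut(1) App.prems(2,3)] App.prems(2)
  sub_T[OF App.prems(3) ut(2)] sub_F[OF App.prems(3) ut(1)] by (simp add: nf_App)
next
 case (Rec t u s)
 have t: "t \<in> Ter" "u \<in> Fun" "s \<in> Ter" using Rec.prems by auto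
 note w = Rec.prems(2) and e = Rec.prems(3)
 let ?R = "Rec (ren_trm Suc id t) (ren_fnl Suc id u) (Var 0)"
 let ?ga = "sub_fnl rh th (Lam ?R)"
 have R: "?R \<in> Ter" using t by (simp add: ren_terms ren_functors)
 note rf = recursor_functor[OF _ _ t(1,2)]
 have "rspec w ?ga (eval t (cst rh) (fam th) w) (%w' m r. feval u (cst rh) (fam th) w' (pev pr_pair w' (Jw w' r (Jw w' m (zw w')))))"
  unfolding rspec_def
 proof (intro conjI allI impI ballI)
  show "?ga \<in> Fu w" by (rule rf(1)[OF w e])
  show "ap w ?ga (zw w) = eval t (cst rh) (fam th) w" unfolding rf(2)[OF w e] using Rec.IH(1)[OF t(1) w e] by simp
  fix w' m assume w': "W w'" "w << w'" and m: "m \<in> N w'"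
  note e' = env_mono[OF e w'(2)]
  have gm: "ap w' ?ga m \<in> N w'" by (rule ap_N[OF w'(1) rf(1)[OF w'(1) e'] m])
  let ?p = "Fn (PR pr_pair) [ap w' ?ga m, m]"
  have "nf w' (apply_const (PR pr_pair) [ap w' ?ga m, m]) = pev pr_pair w' (tup w' (map (nf w') [ap w' ?ga m, m]))"
   by (rule pev_apply[OF describes_pair w'(1)]) (use gm m w' N_T in auto)
  hence p: "nf w' ?p = pev pr_pair w' (Jw w' (ap w' ?ga m) (Jw w' m (zw w')))"
   using w' m gm by (simp add: apply_const_2 nf_idem)
  have pT: "?p \<in> Tm w'" unfolding apply_const_2[symmetric] by (rule apply_T) (use gm m w' N_T in auto)
  show "ap w' ?ga (Sw w' m) = feval u (cst rh) (fam th) w' (pev pr_pair w' (Jw w' (ap w' ?ga m) (Jw w' m (zw w'))))"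
   unfolding rf(3)[OF w'(1) e' m] p[symmetric] using Rec.IH(2)[OF t(2) w'(1) e' nf_N[OF pT]] by simp
 qed
 note rs = this and F = rf(1)[OF w e]
 have sT: "sub_trm rh th s \<in> Tm w" by (rule sub_T[OF e t(3)])
 have "eval (Rec t u s) (cst rh) (fam th) w = ap w ?ga (nf w (sub_trm rh th s))"
  unfolding eval.simps Rec.IH(3)[OF t(3) w e] by (rule rv_eq[OF w rs]) (use sT in simp)
 also have "... = nf w (App ?ga (sub_trm rh th s))" using nf_App[OF w F sT] by simp
 also have "... = nf w (sub_trm rh th (Rec t u s))"
  using nf_beta[OF w e R sT] by (simp add: sub_ren sub_ren_fnl comp_def)
 finally show ?case .
next
 case (FVar n) thus ?case by (simp add: fam_def)
next
 case (FC c)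
 consider "c \<in> {ZeroFn, Ident, ProjK, ProjL}" | d where "c = PR d" "describes d 1" using FC.prems(1) by (cases c) auto
 thus ?case
 proof cases
  case 1 thus ?thesis using FC by (auto simp: bim_const_eqs)
 next
  case 2
  have "nf w (apply_const (PR d) [a]) = pev d w (tup w (map (nf w) [a]))"
   by (rule pev_apply[OF 2(2) FC.prems(2)]) (use FC.prems in auto)
  thus ?thesis using 2 FC.prems by (simp add: apply_const_def ap_def nf_idem)
 qed
next
 case (Lam t)
 have t: "t \<in> Ter" using Lam.prems by simp
 have "feval (Lam t) (cst rh) (fam th) w a = eval t (cst (a ## rh)) (fam th) w" by (simp add: cst_cons)
 also have "... = nf w (sub_trm (a ## rh) th t)"
  by (rule Lam.IH[OF t Lam.prems(2)]) (use Lam.prems env_consN in simp)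
 also have "... = ap w (sub_fnl rh th (Lam t)) a" using ap_beta[OF Lam.prems(2,3) t Lam.prems(4)] by simp
 finally show ?case .
qed

text \<open>Where the theory has all symbols and their axioms, both notions of truth coincide. A
  translation that preserves \<open>sem\<close> is therefore provably equivalent to the original
  formula.\<close>

lemma sem_sat: "A \<in> fmls Sy ==> W w ==> en w rh th ==> sem A w rh th <-> sat w rh th A"
proof (induction A arbitrary: w rh th)
 case (Eq s t) thus ?case by (simp add: eval_nf sat_Eq)
next
 case Bot thus ?case by simp
next
 case (And A B) thus ?case by (simp add: sat_And)
next
 case (Or A B) thus ?case by (simp add: sat_Or)
next
 case (Imp A B) thus ?case by (simp add: sat_Imp env_mono)
next
 case (AllN A) thus ?case by (simp add: sat_AllN' env_mono env_consN)
next
 case (ExN A) thus ?case by (simp add: sat_ExN' env_mono env_consN)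
next
 case (AllF A) thus ?case by (simp add: sat_AllF env_mono env_consF)
next
 case (ExF A) thus ?case by (simp add: sat_ExF env_mono env_consF)
qed

lemma Iff_derivable:
 assumes "A \<in> fmls Sy" "B \<in> fmls Sy" "\<And>w rh th. W w ==> en w rh th ==> sat w rh th A <-> sat w rh th B"
 shows "deriv Sy {} (Iff A B)"
proof (rule completeness)
 fix w rh th assume "W w" "en w rh th"
 thus "sat w rh th (Iff A B)" using assms env_mono by (simp add: sat_And sat_Imp)
qed (use assms in auto)

lemma bim_fm_Iff: "A \<in> fmls Sy ==> deriv Sy {} (Iff (bim_fm A) A)"
 by (rule Iff_derivable[OF bim_fmls[OF bim_fm_formula]]) (simp_all only: sem_sat[symmetric] sem_bim_fm)

end

section \<open>Arithmetic in EL\<close>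

definition pr_pred :: prd where "pr_pred = Rec0 0 (Proj 2 0)"
definition pr_isz :: prd where "pr_isz = Rec0 1 (Const 2 0)"
definition pr_tri :: prd where "pr_tri = Rec0 0 (Comp 2 Succ [pr_add])"
definition pr_sub :: prd where "pr_sub = RecP (Proj 1 0) (Comp 3 pr_pred [Proj 3 1])"  \<comment> \<open>\<open>(y, x) \<mapsto> x - y\<close>, truncated\<close>

text \<open>The Cantor pairing; \<open>pr_diag\<close> describes \<open>J(m, n) \<mapsto> m + n\<close>.\<close>

definition pr_J :: prd where "pr_J = Comp 2 pr_add [Proj 2 0, Comp 2 pr_tri [pr_add]]"
definition pr_diag :: prd where
 "pr_diag = Rec0 0 (Comp 2 pr_add [Comp 2 pr_isz [Comp 2 pr_sub [Comp 2 Succ [Proj 2 0],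
  Comp 2 pr_tri [Comp 2 Succ [Proj 2 1]]]], Proj 2 1])"
text \<open>A diagonal \<open>s\<close> begins with the triangular number of \<open>s\<close>, and
  the first component is the offset from there. Note that \<open>pr_sub\<close> takes the subtrahend
  as its first argument.\<close>

definition pr_K :: prd where "pr_K = Comp 1 pr_sub [Comp 1 pr_tri [pr_diag], Proj 1 0]"
definition pr_L :: prd where "pr_L = Comp 1 pr_sub [pr_K, pr_diag]"

text \<open>
 \<open>pr_val\<close> describes the exponent of 2, by which the recursor decodes \<open>2 ^ a * 3 ^ b\<close>: it counts the
 even numbers among the first z iterates of halving even numbers.
\<close>

definition pr_par :: prd where "pr_par = Rec0 0 (Comp 2 pr_isz [Proj 2 1])"
definition pr_half :: prd where "pr_half = Rec0 0 (Comp 2 pr_add [Comp 2 pr_par [Proj 2 0], Proj 2 1])"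
definition pr_cond :: prd where "pr_cond = RecP (Proj 2 0) (Proj 4 3)"
definition pr_step :: prd where "pr_step = Comp 1 pr_cond [pr_par, pr_half, Proj 1 0]"
definition pr_iter :: prd where "pr_iter = RecP (Proj 1 0) (Comp 3 pr_step [Proj 3 1])"
definition pr_count :: prd where
 "pr_count = RecP (Const 1 0) (Comp 3 pr_add [Comp 3 pr_isz [Comp 3 pr_par [Comp 3 pr_iter [Proj 3 0, Proj 3 2]]], Proj 3 1])"
definition pr_val :: prd where "pr_val = Comp 1 pr_count [Proj 1 0, Proj 1 0]"

lemma describes_RecP_n: "describes g n ==> describes h (Suc (Suc n)) ==> describes (RecP g h) (Suc n)"
 by (auto simp: describes_RecP)

lemma describes_more [simp]:
 "describes pr_pred (Suc 0)" "describes pr_isz (Suc 0)" "describes pr_tri (Suc 0)" "describes pr_sub (Suc (Suc 0))"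
 "describes pr_J (Suc (Suc 0))" "describes pr_diag (Suc 0)" "describes pr_K (Suc 0)" "describes pr_L (Suc 0)"
 "describes pr_par (Suc 0)" "describes pr_half (Suc 0)" "describes pr_cond (Suc (Suc (Suc 0)))" "describes pr_step (Suc 0)"
 "describes pr_iter (Suc (Suc 0))" "describes pr_count (Suc (Suc 0))" "describes pr_val (Suc 0)"
proof -
 note [simp] = numeral_eq_Suc
 show [simp]: "describes pr_pred (Suc 0)" "describes pr_isz (Suc 0)" "describes pr_tri (Suc 0)"
  by (simp_all add: pr_pred_def pr_isz_def pr_tri_def)
 show [simp]: "describes pr_sub (Suc (Suc 0))" unfolding pr_sub_def by (rule describes_RecP_n) simp_all
 show "describes pr_J (Suc (Suc 0))" by (simp add: pr_J_def)
 show [simp]: "describes pr_diag (Suc 0)" by (simp add: pr_diag_def)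
 show [simp]: "describes pr_K (Suc 0)" by (simp add: pr_K_def)
 show "describes pr_L (Suc 0)" by (simp add: pr_L_def)
 show [simp]: "describes pr_par (Suc 0)" by (simp add: pr_par_def)
 show [simp]: "describes pr_half (Suc 0)" by (simp add: pr_half_def)
 show [simp]: "describes pr_cond (Suc (Suc (Suc 0)))" unfolding pr_cond_def by (rule describes_RecP_n) simp_all
 show [simp]: "describes pr_step (Suc 0)" by (simp add: pr_step_def)
 show [simp]: "describes pr_iter (Suc (Suc 0))" unfolding pr_iter_def by (rule describes_RecP_n) simp_all
 show [simp]: "describes pr_count (Suc (Suc 0))" unfolding pr_count_def by (rule describes_RecP_n) simp_all
 show "describes pr_val (Suc 0)" by (simp add: pr_val_def)
qed

lemma apply_const_3: "apply_const c [s, t, r] = Fn c [s, t, r]"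
 by (simp add: apply_const_def)

context ha
begin

abbreviation "f1 w d \<equiv> ap w (FC (PR d))"
definition f2 :: "world => prd => trm => trm => trm" where "f2 w d a b = nf w (Fn (PR d) [a, b])"
definition f3 :: "world => prd => trm => trm => trm => trm" where "f3 w d a b c = nf w (Fn (PR d) [a, b, c])"

lemma PR_lang' [simp]:
 "describes d (Suc 0) ==> Sym (PR d) \<in> lang Sy" "describes d (Suc (Suc 0)) ==> Sym (PR d) \<in> lang Sy"
 "describes d (Suc (Suc (Suc 0))) ==> Sym (PR d) \<in> lang Sy"
 by (rule PR_lang, assumption)+

lemma N_T' [simp]: "W w ==> a \<in> N w ==> a \<in> Tm w" by (rule N_T)

lemma PR_F' [simp]: "describes d (Suc 0) ==> FC (PR d) \<in> Fu w" by simp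

lemma Fn_T2 [simp]: "describes d (Suc (Suc 0)) ==> s \<in> Tm w ==> t \<in> Tm w ==> Fn (PR d) [s, t] \<in> Tm w"
 using apply_T[of d "[s, t]" w] by (auto simp: apply_const_def)

lemma Fn_T3 [simp]: "describes d (Suc (Suc (Suc 0))) ==> s \<in> Tm w ==> t \<in> Tm w ==> r \<in> Tm w ==> Fn (PR d) [s, t, r] \<in> Tm w"
 using apply_T[of d "[s, t, r]" w] by (auto simp: apply_const_def)

lemma nf_apply_cong:
 assumes w: "W w" and d: "describes d (length ts)" and ts: "\<And>t. t \<in> set ts ==> t \<in> Tm w"
 shows "nf w (apply_const (PR d) ts) = nf w (apply_const (PR d) (map (nf w) ts))"
proof -
 have "nf w (sub_trm (lenv ts) cenv (apply_const (PR d) (map Var [0..<length ts]))) =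
   nf w (sub_trm (lenv (map (nf w) ts)) cenv (apply_const (PR d) (map Var [0..<length ts])))"
 proof (rule nf_cong[OF w])
  show "en w (lenv ts) cenv" "en w (lenv (map (nf w) ts)) cenv" using ts w by (auto intro!: lenv_env)
  show "nf w (lenv ts i) = nf w (lenv (map (nf w) ts) i)" for i
   using ts w by (auto simp: lenv_def nf_nf)
  show "apply_const (PR d) (map Var [0..<length ts]) \<in> Ter" by (rule apply_terms) (use d in auto)
 qed
 thus ?thesis using lenv_Var[of ts cenv] lenv_Var[of "map (nf w) ts" cenv] by (simp add: apply_const_sub)
qed

lemma nf_Fn2: "W w ==> describes d (Suc (Suc 0)) ==> s \<in> Tm w ==> t \<in> Tm w ==> nf w (Fn (PR d) [s, t]) = f2 w d (nf w s) (nf w t)"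
 using nf_apply_cong[of w d "[s, t]"] by (auto simp: apply_const_def f2_def)

lemma nf_Fn3: "W w ==> describes d (Suc (Suc (Suc 0))) ==> s \<in> Tm w ==> t \<in> Tm w ==> r \<in> Tm w ==>
  nf w (Fn (PR d) [s, t, r]) = f3 w d (nf w s) (nf w t) (nf w r)"
 using nf_apply_cong[of w d "[s, t, r]"] by (auto simp: apply_const_def f3_def)

lemma f2_N [simp]: "W w ==> describes d (Suc (Suc 0)) ==> a \<in> N w ==> b \<in> N w ==> f2 w d a b \<in> N w"
 by (simp add: f2_def)

lemma f3_N [simp]: "W w ==> describes d (Suc (Suc (Suc 0))) ==> a \<in> N w ==> b \<in> N w ==> c \<in> N w ==> f3 w d a b c \<in> N w"
 by (simp add: f3_def)

lemmas homs = nf_App nf_Fn2 nf_Fn3 nf_idem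

lemma ops_Proj [simp]:
 assumes "W w" "a \<in> N w"
 shows "f1 w (Proj 1 0) a = a" "b \<in> N w ==> f2 w (Proj 2 0) a b = a" "b \<in> N w ==> f2 w (Proj 2 1) a b = b"
  "b \<in> N w ==> c \<in> N w ==> f3 w (Proj 3 0) a b c = a" "b \<in> N w ==> c \<in> N w ==> f3 w (Proj 3 1) a b c = b"
  "b \<in> N w ==> c \<in> N w ==> f3 w (Proj 3 2) a b c = c"
proof -
 note [simp] = assms apply_const_1 apply_const_2 apply_const_3 nf_idem
 show "f1 w (Proj 1 0) a = a" using nf_Proj[of w 1 0 "[a]"] by (simp add: ap_def)
 assume b: "b \<in> N w"
 have 2: "\<forall>t. t = a \<or> t = b --> t \<in> Tm w" using b by auto
 show "f2 w (Proj 2 0) a b = a" "f2 w (Proj 2 1) a b = b"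
  using nf_Proj[of w 2 0 "[a, b]"] nf_Proj[of w 2 1 "[a, b]"] b 2 by (simp_all add: f2_def)
 assume c: "c \<in> N w"
 have 3: "\<forall>t. t = a \<or> t = b \<or> t = c --> t \<in> Tm w" using b c by auto
 show "f3 w (Proj 3 0) a b c = a" "f3 w (Proj 3 1) a b c = b" "f3 w (Proj 3 2) a b c = c"
  using nf_Proj[of w 3 0 "[a, b, c]"] nf_Proj[of w 3 1 "[a, b, c]"] nf_Proj[of w 3 2 "[a, b, c]"] b c 3
  by (simp_all add: f3_def)
qed

lemmas [simp] = ops_Proj[unfolded One_nat_def]

lemma ops_Const:
 assumes "W w" "a \<in> N w"
 shows "f1 w (Const 1 q) a = nf w (numeral_trm q)" "b \<in> N w ==> f2 w (Const 2 q) a b = nf w (numeral_trm q)"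
proof -
 note [simp] = assms apply_const_1 apply_const_2
 show "f1 w (Const 1 q) a = nf w (numeral_trm q)" using nf_Const[of w 1 q "[a]"] by (simp add: ap_def)
 assume b: "b \<in> N w"
 have 2: "\<forall>t. t = a \<or> t = b --> t \<in> Tm w" using b by auto
 show "f2 w (Const 2 q) a b = nf w (numeral_trm q)" using nf_Const[of w 2 q "[a, b]"] b 2 by (simp add: f2_def)
qed

lemma ops_Comp:
 assumes w: "W w" and N: "a \<in> N w"
 shows "describes g 1 ==> describes h 1 ==> f1 w (Comp 1 g [h]) a = f1 w g (f1 w h a)"
  "describes g 2 ==> describes h 1 ==> describes k 1 ==> f1 w (Comp 1 g [h, k]) a = f2 w g (f1 w h a) (f1 w k a)"
  "describes g 3 ==> describes h 1 ==> describes k 1 ==> describes l 1 ==>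
   f1 w (Comp 1 g [h, k, l]) a = f3 w g (f1 w h a) (f1 w k a) (f1 w l a)"
  "b \<in> N w ==> describes g 1 ==> describes h 2 ==> f2 w (Comp 2 g [h]) a b = f1 w g (f2 w h a b)"
  "b \<in> N w ==> describes g 2 ==> describes h 2 ==> describes k 2 ==> f2 w (Comp 2 g [h, k]) a b = f2 w g (f2 w h a b) (f2 w k a b)"
  "b \<in> N w ==> c \<in> N w ==> describes g 1 ==> describes h 3 ==> f3 w (Comp 3 g [h]) a b c = f1 w g (f3 w h a b c)"
  "b \<in> N w ==> c \<in> N w ==> describes g 2 ==> describes h 3 ==> describes k 3 ==>
   f3 w (Comp 3 g [h, k]) a b c = f2 w g (f3 w h a b c) (f3 w k a b c)"
proof -
 note [simp] = w N numeral_2_eq_2 numeral_3_eq_3 apply_const_1 apply_const_2 apply_const_3 homs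
 note d = ap_def[of w "FC (PR (Comp 1 _ _))"] f2_def[of w "Comp 2 _ _"] f3_def[of w "Comp 3 _ _"]
 show "describes g 1 ==> describes h 1 ==> f1 w (Comp 1 g [h]) a = f1 w g (f1 w h a)"
  using nf_Comp[of w 1 g "[h]" "[a]"] by simp
 show "describes g 2 ==> describes h 1 ==> describes k 1 ==> f1 w (Comp 1 g [h, k]) a = f2 w g (f1 w h a) (f1 w k a)"
  using nf_Comp[of w 1 g "[h, k]" "[a]"] by simp
 show "describes g 3 ==> describes h 1 ==> describes k 1 ==> describes l 1 ==>
   f1 w (Comp 1 g [h, k, l]) a = f3 w g (f1 w h a) (f1 w k a) (f1 w l a)"
  using nf_Comp[of w 1 g "[h, k, l]" "[a]"] by simp
 have 2: "\<forall>t. t = a \<or> t = b --> t \<in> Tm w" if "b \<in> N w" using that by auto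
 have 3: "\<forall>t. t = a \<or> t = b \<or> t = c --> t \<in> Tm w" if "b \<in> N w" "c \<in> N w" using that by auto
 show "b \<in> N w ==> describes g 1 ==> describes h 2 ==> f2 w (Comp 2 g [h]) a b = f1 w g (f2 w h a b)"
  using nf_Comp[of w 2 g "[h]" "[a, b]"] 2 by simp
 show "b \<in> N w ==> describes g 2 ==> describes h 2 ==> describes k 2 ==> f2 w (Comp 2 g [h, k]) a b = f2 w g (f2 w h a b) (f2 w k a b)"
  using nf_Comp[of w 2 g "[h, k]" "[a, b]"] 2 by simp
 show "b \<in> N w ==> c \<in> N w ==> describes g 1 ==> describes h 3 ==> f3 w (Comp 3 g [h]) a b c = f1 w g (f3 w h a b c)"
  using nf_Comp[of w 3 g "[h]" "[a, b, c]"] 3 by simp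
 show "b \<in> N w ==> c \<in> N w ==> describes g 2 ==> describes h 3 ==> describes k 3 ==>
   f3 w (Comp 3 g [h, k]) a b c = f2 w g (f3 w h a b c) (f3 w k a b c)"
  using nf_Comp[of w 3 g "[h, k]" "[a, b, c]"] 3 by simp
qed

lemma ops_Rec:
 assumes w: "W w" and a: "a \<in> N w"
 shows "describes h 2 ==> f1 w (Rec0 q h) (zw w) = nf w (numeral_trm q)"
  "describes h 2 ==> f1 w (Rec0 q h) (Sw w a) = f2 w h a (f1 w (Rec0 q h) a)"
  "b \<in> N w ==> describes g 1 ==> describes h 3 ==> f2 w (RecP g h) (zw w) b = f1 w g b"
  "b \<in> N w ==> describes g 1 ==> describes h 3 ==> f2 w (RecP g h) (Sw w a) b = f3 w h a (f2 w (RecP g h) a b) b"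
proof -
 note [simp] = w a numeral_2_eq_2 numeral_3_eq_3 apply_const_1 apply_const_2 apply_const_3 homs
 show "f1 w (Rec0 q h) (zw w) = nf w (numeral_trm q)" if "describes h 2"
  using nf_Rec0(1)[of w q h] that by simp
 show "f1 w (Rec0 q h) (Sw w a) = f2 w h a (f1 w (Rec0 q h) a)" if "describes h 2"
  using nf_Rec0(2)[of w q h a] that by simp
 assume b: "b \<in> N w" and d: "describes g 1" "describes h 3"
 have R: "describes (RecP g h) (Suc (Suc 0))" by (rule describes_RecP_n) (use d in simp_all)
 show "f2 w (RecP g h) (zw w) b = f1 w g b" using nf_RecP(1)[of w g h 1 "[b]"] b d R by simp
 show "f2 w (RecP g h) (Sw w a) b = f3 w h a (f2 w (RecP g h) a b) b" using nf_RecP(2)[of w g h 1 "[b]" a] b d R by simp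
qed

lemma cond_eqs:
 assumes w: "W w" and N: "a \<in> N w" "b \<in> N w" "c \<in> N w"
 shows "f3 w pr_cond (zw w) a b = a" "f3 w pr_cond (Sw w c) a b = b"
proof -
 note [simp] = w N numeral_eq_Suc apply_const_1 apply_const_2 apply_const_3 homs
 have d: "describes (RecP (Proj 2 0) (Proj 4 3)) 3" using describes_more(11) by (simp add: pr_cond_def)
 have "f3 w pr_cond (zw w) a b = nf w (apply_const (PR (RecP (Proj 2 0) (Proj 4 3))) [zero, a, b])"
  using d by (simp add: pr_cond_def)
 also have "... = nf w (apply_const (PR (Proj 2 0)) [a, b])"
  by (rule nf_RecP(1)) (use d in auto)
 also have "... = a" by (subst nf_Proj) auto
 finally show "f3 w pr_cond (zw w) a b = a" .
 have "f3 w pr_cond (Sw w c) a b = nf w (apply_const (PR (RecP (Proj 2 0) (Proj 4 3))) [suc c, a, b])"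
  using d by (simp add: pr_cond_def)
 also have "... = nf w (apply_const (PR (Proj 4 3)) [c, apply_const (PR (RecP (Proj 2 0) (Proj 4 3))) [c, a, b], a, b])"
  by (rule nf_RecP(2)) (use d in auto)
 also have "... = b" by (subst nf_Proj) (use d in auto)
 finally show "f3 w pr_cond (Sw w c) a b = b" .
qed

subsection \<open>Induction on equations\<close>

text \<open>Terms with a list of values for their variables describe the two sides of an equation to
  be proved by induction, so that the induction formula need not be written out.\<close>

definition V :: "world => trm => trm list => trm" where
 "V w s bs = nf w (sub_trm (lenv bs) cenv s)"

lemma V_T: "W w ==> set bs \<subseteq> N w ==> s \<in> Ter ==> sub_trm (lenv bs) cenv s \<in> Tm w"
 by (rule sub_T[OF lenv_env]) auto

lemma V_N [simp]: "W w ==> set bs \<subseteq> N w ==> s \<in> Ter ==> V w s bs \<in> N w"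
 by (simp add: V_def V_T)

lemma Fn2_terms [simp]: "describes d (Suc (Suc 0)) ==> s \<in> Ter ==> t \<in> Ter ==> Fn (PR d) [s, t] \<in> Ter"
 using PR_lang by auto

lemma FC_functors [simp]: "describes d (Suc 0) ==> FC (PR d) \<in> Fun"
 using PR_lang by auto

lemma V_simps:
 assumes "W w" "set bs \<subseteq> N w"
 shows "i < length bs ==> V w (Var i) bs = bs ! i" "V w zero bs = zw w"
  "s \<in> Ter ==> V w (suc s) bs = Sw w (V w s bs)"
  "describes d (Suc 0) ==> s \<in> Ter ==> V w (App (FC (PR d)) s) bs = f1 w d (V w s bs)"
  "describes d (Suc (Suc 0)) ==> s \<in> Ter ==> t \<in> Ter ==>
   V w (Fn (PR d) [s, t]) bs = f2 w d (V w s bs) (V w t bs)"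
 using assms V_T[OF assms] by (auto simp: V_def lenv_def homs subset_iff)

text \<open>Base and step are required in every world and for all parameters; so they are plain
  algebraic statements without mention of later worlds. Two premises are provided for the sake of
  \<open>diag_row\<close>.\<close>

lemma uniform_induct:
 assumes T: "x \<in> Ter" "x' \<in> Ter" "y \<in> Ter" "y' \<in> Ter"
   "z \<in> Ter" "z' \<in> Ter"
  and 0: "\<And>w bs. W w ==> set bs \<subseteq> N w ==> length bs = n ==> V w x (zw w # bs) = V w x' (zw w # bs) ==>
   V w y (zw w # bs) = V w y' (zw w # bs) ==> V w z (zw w # bs) = V w z' (zw w # bs)"
  and S: "\<And>w bs a. W w ==> set bs \<subseteq> N w ==> length bs = n ==> a \<in> N w ==>
   (V w x (a # bs) = V w x' (a # bs) ==> V w y (a # bs) = V w y' (a # bs) ==> V w z (a # bs) = V w z' (a # bs)) ==>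
   V w x (Sw w a # bs) = V w x' (Sw w a # bs) ==> V w y (Sw w a # bs) = V w y' (Sw w a # bs) ==>
   V w z (Sw w a # bs) = V w z' (Sw w a # bs)"
  and w: "W w" "set bs \<subseteq> N w" "length bs = n" "a \<in> N w"
  and p: "V w x (a # bs) = V w x' (a # bs)" "V w y (a # bs) = V w y' (a # bs)"
 shows "V w z (a # bs) = V w z' (a # bs)"
proof -
 let ?A = "Imp (And (Eq x x') (Eq y y')) (Eq z z')"
 have A: "?A \<in> fmls Sy" using T by simp
 let ?rh = "lenv bs"
 have e: "en w ?rh cenv" by (rule lenv_env) (use w in auto)
 have cons: "lenv (b # cs) = b ## lenv cs" for b cs by (rule ext) (auto simp: lenv_def split: nat.split)
 let ?P = "%w a bs. V w x (a # bs) = V w x' (a # bs) --> V w y (a # bs) = V w y' (a # bs) --> V w z (a # bs) = V w z' (a # bs)"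
 have up: "nf w' (sub_trm (b ## ?rh) cenv s) = V w' s (nf w' b # map (nf w') bs)"
  if "W w'" "w << w'" "b \<in> Tm w'" "s \<in> Ter" for w' b s
  unfolding V_def cons
 proof (rule nf_cong[OF that(1)])
  have bs: "set bs \<subseteq> Tm w'" using w that T_mono by fastforce
  show "en w' (b ## ?rh) cenv" using env_consN[OF env_mono[OF e that(2)] that(3)] .
  show "en w' (nf w' b ## lenv (map (nf w') bs)) cenv"
   using that bs by (intro env_consN lenv_env) auto
  show "nf w' ((b ## ?rh) i) = nf w' ((nf w' b ## lenv (map (nf w') bs)) i)" for i
   using that bs by (auto simp: lenv_def nf_nf subset_iff split: nat.split)
 qed (rule that)
 have sat: "sat w1 (b ## ?rh) cenv ?A <-> (\<forall>w2. W w2 --> w1 << w2 --> ?P w2 (nf w2 b) (map (nf w2) bs))"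
  if w1: "W w1" "w << w1" "b \<in> N w1" for w1 b
 proof -
  have e1: "en w1 (b ## ?rh) cenv" using env_consN[OF env_mono[OF e w1(2)] N_T[OF w1(1,3)]] .
  have "sat w2 (b ## ?rh) cenv (Eq s t) <-> V w2 s (nf w2 b # map (nf w2) bs) = V w2 t (nf w2 b # map (nf w2) bs)"
   if "W w2" "w1 << w2" "s \<in> Ter" "t \<in> Ter" for w2 s t
  proof -
   have "b \<in> Tm w2" using T_mono[OF that(2) N_T[OF w1(1,3)]] .
   thus ?thesis using sat_Eq[OF that(1) env_mono[OF e1 that(2)] that(3,4)] up[OF that(1) wle_trans[OF w1(2) that(2)]] that by simp
  qed
  thus ?thesis
   using sat_Imp[OF w1(1) e1, of "And (Eq x x') (Eq y y')" "Eq z z'"] T by (simp add: sat_And imp_conjL)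
 qed
 have bsN: "set (map (nf w2) bs) \<subseteq> N w2" if "W w2" "w << w2" for w2
  using w that T_mono by fastforce
 have len: "length (map (nf w2) bs) = n" for w2 using w by simp
 have "sat w (a ## ?rh) cenv ?A"
 proof (rule induct_sat[OF w(1) e A _ _ w(1) wle_refl w(4)])
  have "?P w2 (nf w2 (zw w)) (map (nf w2) bs)" if w2: "W w2" "w << w2" for w2
   using 0[OF w2(1) bsN[OF w2] len] nf_up[OF w(1) w2 zero_T] by simp
  thus "sat w (zw w ## ?rh) cenv ?A" using sat[OF w(1) wle_refl, of "zw w"] w by simp
 next
  fix w1 b assume w1: "W w1" "w << w1" "b \<in> N w1" and IH: "sat w1 (b ## ?rh) cenv ?A"
  have "?P w2 (nf w2 (Sw w1 b)) (map (nf w2) bs)" if w2: "W w2" "w1 << w2" for w2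
  proof -
   have le: "w << w2" using w1 w2 wle_trans by blast
   have bT: "b \<in> Tm w1" "b \<in> Tm w2" using w1 w2 T_mono by auto
   have "nf w2 (Sw w1 b) = nf w2 (suc b)" unfolding ap_def by (rule nf_up[OF w1(1) w2]) (use bT in simp)
   hence s: "nf w2 (Sw w1 b) = Sw w2 (nf w2 b)" using w2 bT by (simp add: nf_App)
   have "?P w2 (nf w2 b) (map (nf w2) bs)" using IH[unfolded sat[OF w1]] w2 by blast
   hence IH': "V w2 x (nf w2 b # map (nf w2) bs) = V w2 x' (nf w2 b # map (nf w2) bs) ==>
     V w2 y (nf w2 b # map (nf w2) bs) = V w2 y' (nf w2 b # map (nf w2) bs) ==>
     V w2 z (nf w2 b # map (nf w2) bs) = V w2 z' (nf w2 b # map (nf w2) bs)" by (rule mp[OF mp])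
   have nb: "nf w2 b \<in> N w2" using w2 bT by simp
   show ?thesis unfolding s by (intro impI, rule S[OF w2(1) bsN[OF w2(1) le] len nb IH'])
  qed
  thus "sat w1 (Sw w1 b ## ?rh) cenv ?A" using sat[OF w1(1,2), of "Sw w1 b"] w1 by simp
 qed
 hence "?P w (nf w a) (map (nf w) bs)" using sat[OF w(1) wle_refl w(4)] w(1) by simp
 moreover have "nf w a = a" "map (nf w) bs = bs" using w nf_idem by (auto intro!: map_idI)
 ultimately show ?thesis using p by simp
qed

lemma uniform_induct_eq:
 assumes T: "z \<in> Ter" "z' \<in> Ter"
  and 0: "\<And>w bs. W w ==> set bs \<subseteq> N w ==> length bs = n ==> V w z (zw w # bs) = V w z' (zw w # bs)"
  and S: "\<And>w bs a. W w ==> set bs \<subseteq> N w ==> length bs = n ==> a \<in> N w ==>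
   V w z (a # bs) = V w z' (a # bs) ==> V w z (Sw w a # bs) = V w z' (Sw w a # bs)"
  and w: "W w" "set bs \<subseteq> N w" "length bs = n" "a \<in> N w"
 shows "V w z (a # bs) = V w z' (a # bs)"
 by (rule uniform_induct[where x = zero and x' = zero and y = zero and y' = zero and n = n]; use assms in simp)

lemma induct1:
 assumes "z \<in> Ter" "z' \<in> Ter"
  and 0: "\<And>w. W w ==> V w z [zw w] = V w z' [zw w]"
  and S: "\<And>w a. W w ==> a \<in> N w ==> V w z [a] = V w z' [a] ==> V w z [Sw w a] = V w z' [Sw w a]"
  and w: "W w" "a \<in> N w"
 shows "V w z [a] = V w z' [a]"
 by (rule uniform_induct_eq[where n = 0]) (use assms in auto)

lemma induct2:
 assumes "z \<in> Ter" "z' \<in> Ter"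
  and 0: "\<And>w b. W w ==> b \<in> N w ==> V w z [zw w, b] = V w z' [zw w, b]"
  and S: "\<And>w a b. W w ==> a \<in> N w ==> b \<in> N w ==> V w z [a, b] = V w z' [a, b] ==> V w z [Sw w a, b] = V w z' [Sw w a, b]"
  and w: "W w" "a \<in> N w" "b \<in> N w"
 shows "V w z [a, b] = V w z' [a, b]"
 by (rule uniform_induct_eq[where n = 1]) (use assms in "auto simp: length_Suc_conv")

lemma induct3:
 assumes "z \<in> Ter" "z' \<in> Ter"
  and 0: "\<And>w b c. W w ==> b \<in> N w ==> c \<in> N w ==> V w z [zw w, b, c] = V w z' [zw w, b, c]"
  and S: "\<And>w a b c. W w ==> a \<in> N w ==> b \<in> N w ==> c \<in> N w ==> V w z [a, b, c] = V w z' [a, b, c] ==>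
   V w z [Sw w a, b, c] = V w z' [Sw w a, b, c]"
  and w: "W w" "a \<in> N w" "b \<in> N w" "c \<in> N w"
 shows "V w z [a, b, c] = V w z' [a, b, c]"
 by (rule uniform_induct_eq[where n = 2]) (use assms in "auto simp: length_Suc_conv numeral_2_eq_2")

subsection \<open>Laws of addition and truncated subtraction\<close>

lemma rec_eqs:
 assumes "W w" "a \<in> N w" "b \<in> N w"
 shows "f2 w pr_add (zw w) b = b" "f2 w pr_add (Sw w a) b = Sw w (f2 w pr_add a b)"
  "f1 w pr_pred (zw w) = zw w" "f1 w pr_pred (Sw w a) = a"
  "f1 w pr_isz (zw w) = Sw w (zw w)" "f1 w pr_isz (Sw w a) = zw w"
  "f1 w pr_tri (zw w) = zw w" "f1 w pr_tri (Sw w a) = Sw w (f2 w pr_add a (f1 w pr_tri a))"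
  "f2 w pr_sub (zw w) b = b" "f2 w pr_sub (Sw w a) b = f1 w pr_pred (f2 w pr_sub a b)"
  "f2 w pr_J a b = f2 w pr_add a (f1 w pr_tri (f2 w pr_add a b))"
proof -
 note [simp] = assms ops_Const ops_Comp ops_Rec homs
 note [simp] = describes_more[simplified numeral_2_eq_2]
 have num: "nf w (numeral_trm 1) = Sw w (zw w)" by (simp add: nf_App)
 have d: "describes pr_pred 1" "describes pr_tri 1" "describes (Proj 3 1) 3" "describes (Comp 3 Succ [Proj 3 1]) 3"
  "describes (Comp 3 pr_pred [Proj 3 1]) 3" "describes (Proj 2 0) 2" "describes (Comp 2 pr_tri [pr_add]) 2" "describes Succ 1"
  "describes (Comp 2 Succ [pr_add]) 2" "describes (Const 2 0) 2"
  by (simp_all add: numeral_eq_Suc)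
 show "f2 w pr_add (zw w) b = b" "f2 w pr_add (Sw w a) b = Sw w (f2 w pr_add a b)"
  using ops_Rec(3,4)[of w a b "Proj 1 0" "Comp 3 Succ [Proj 3 1]"] d ops_Comp(6)[of w a "f2 w pr_add a b" b Succ "Proj 3 1"]
  by (simp_all add: pr_add_def[symmetric, unfolded One_nat_def] del: ops_Comp ops_Rec)
 show "f1 w pr_pred (zw w) = zw w" "f1 w pr_pred (Sw w a) = a"
  using ops_Rec(1,2)[of w a "Proj 2 0" 0] d by (simp_all add: pr_pred_def[symmetric, unfolded One_nat_def] del: ops_Comp ops_Rec)
 show "f1 w pr_isz (zw w) = Sw w (zw w)" "f1 w pr_isz (Sw w a) = zw w"
  using ops_Rec(1,2)[of w a "Const 2 0" 1] d num by (simp_all add: pr_isz_def[symmetric, unfolded One_nat_def] del: ops_Comp ops_Rec)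
 show "f1 w pr_tri (zw w) = zw w" "f1 w pr_tri (Sw w a) = Sw w (f2 w pr_add a (f1 w pr_tri a))"
  using ops_Rec(1,2)[of w a "Comp 2 Succ [pr_add]" 0] d ops_Comp(4)[of w a "f1 w pr_tri a" Succ pr_add]
  by (simp_all add: pr_tri_def[symmetric, unfolded One_nat_def] del: ops_Comp ops_Rec)
 show "f2 w pr_sub (zw w) b = b" "f2 w pr_sub (Sw w a) b = f1 w pr_pred (f2 w pr_sub a b)"
  using ops_Rec(3,4)[of w a b "Proj 1 0" "Comp 3 pr_pred [Proj 3 1]"] d ops_Comp(6)[of w a "f2 w pr_sub a b" b pr_pred "Proj 3 1"]
  by (simp_all add: pr_sub_def[symmetric, unfolded One_nat_def] del: ops_Comp ops_Rec)
 show "f2 w pr_J a b = f2 w pr_add a (f1 w pr_tri (f2 w pr_add a b))"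
  using ops_Comp(5)[of w a b pr_add "Proj 2 0" "Comp 2 pr_tri [pr_add]"] ops_Comp(4)[of w a b pr_tri pr_add] d
  by (simp add: pr_J_def[symmetric, unfolded One_nat_def] del: ops_Comp ops_Rec)
qed

lemma zw_N: "W w ==> zw w \<in> N w" by simp

text \<open>Each equation is freed of the premises on arguments it does not mention, which the
  simplifier could not instantiate.\<close>

lemmas rec_simps = rec_eqs(1,9)[OF _ zw_N] rec_eqs(2,10,11) rec_eqs(3,5,7)[OF _ zw_N zw_N] rec_eqs(4,6,8)[OF _ _ zw_N]

lemma Sw_inj: "W w ==> a \<in> N w ==> b \<in> N w ==> Sw w a = Sw w b <-> a = b"
 using rec_simps(9) by metis

text \<open>HA1 only excludes \<open>S(0) = 0\<close>. From \<open>S(a) = 0\<close> that case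
  follows by applying the test for zero to both sides.\<close>

lemma Sw_neq': "W w ==> a \<in> N w ==> Sw w a \<noteq> zw w"
proof
 assume w: "W w" "a \<in> N w" and eq: "Sw w a = zw w"
 have "Sw w (zw w) = zw w" using rec_eqs(5,6)[OF w w(2)] eq by simp
 moreover have "sat w (lenv []) cenv (Neg (Eq (suc zero) zero))"
  by (rule axiom_sat[OF one_neq_zero]) (use w lenv_env[of "[]"] in auto)
 ultimately show False
  using sat_Imp_D[OF _ w(1) _ w(1) wle_refl, of "lenv []" cenv "Eq (suc zero) zero" Bot] lenv_env[of "[]" w] w
  by (auto simp: sat_Eq nf_App)
qed

lemma add_laws:
 assumes w: "W w" "a \<in> N w" "b \<in> N w"
 shows "f2 w pr_add a (zw w) = a" "f2 w pr_add a (Sw w b) = Sw w (f2 w pr_add a b)"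
  "f2 w pr_add a b = f2 w pr_add b a" "c \<in> N w ==> f2 w pr_add (f2 w pr_add a b) c = f2 w pr_add a (f2 w pr_add b c)"
proof -
 let ?add = "%s t. Fn (PR pr_add) [s, t]"
 note [simp] = V_simps rec_simps
 have 0: "f2 w pr_add a (zw w) = a" if "W w" "a \<in> N w" for w a
  using induct1[of "?add (Var 0) zero" "Var 0" w a, OF _ _ _ _ that] that by simp
 have S: "f2 w pr_add a (Sw w b) = Sw w (f2 w pr_add a b)" if "W w" "a \<in> N w" "b \<in> N w" for w a b
  using induct2[of "?add (Var 0) (suc (Var 1))" "suc (?add (Var 0) (Var 1))" w a b, OF _ _ _ _ that] that by simp
 show "f2 w pr_add a (zw w) = a" "f2 w pr_add a (Sw w b) = Sw w (f2 w pr_add a b)" using 0 S w by auto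
 show "f2 w pr_add a b = f2 w pr_add b a"
  using induct2[of "?add (Var 0) (Var 1)" "?add (Var 1) (Var 0)" w a b, OF _ _ _ _ w] w 0 S by simp
 assume c: "c \<in> N w"
 show "f2 w pr_add (f2 w pr_add a b) c = f2 w pr_add a (f2 w pr_add b c)"
  using induct3[of "?add (?add (Var 0) (Var 1)) (Var 2)" "?add (Var 0) (?add (Var 1) (Var 2))" w a b c, OF _ _ _ _ w c] w c
  by (simp add: numeral_2_eq_2)
qed

lemma add_left_comm:
 assumes "W w" "a \<in> N w" "b \<in> N w" "c \<in> N w"
 shows "f2 w pr_add a (f2 w pr_add b c) = f2 w pr_add b (f2 w pr_add a c)"
 using add_laws(4)[OF assms] add_laws(4)[of w b a c] add_laws(3)[of w a b] assms by metis

lemma sub_SS: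
 assumes "W w" "a \<in> N w" "b \<in> N w"
 shows "f2 w pr_sub (Sw w a) (Sw w b) = f2 w pr_sub a b"
proof -
 note [simp] = V_simps rec_simps
 have "V w (Fn (PR pr_sub) [suc (Var 0), suc (Var 1)]) (a # [b]) = V w (Fn (PR pr_sub) [Var 0, Var 1]) (a # [b])"
 proof (rule uniform_induct_eq[where n = 1])
  fix w bs assume "W w" "set bs \<subseteq> N w" "length bs = 1"
  thus "V w (Fn (PR pr_sub) [suc (Var 0), suc (Var 1)]) (zw w # bs) = V w (Fn (PR pr_sub) [Var 0, Var 1]) (zw w # bs)"
   by (auto simp: length_Suc_conv)
 next
  fix w bs a assume "W w" "set bs \<subseteq> N w" "length bs = 1" "a \<in> N w" and
   "V w (Fn (PR pr_sub) [suc (Var 0), suc (Var 1)]) (a # bs) = V w (Fn (PR pr_sub) [Var 0, Var 1]) (a # bs)"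
  thus "V w (Fn (PR pr_sub) [suc (Var 0), suc (Var 1)]) (Sw w a # bs) = V w (Fn (PR pr_sub) [Var 0, Var 1]) (Sw w a # bs)"
   by (auto simp: length_Suc_conv)
 qed (use assms in simp_all)
 thus ?thesis using assms by simp
qed

lemma sub_add:
 assumes "W w" "a \<in> N w" "b \<in> N w"
 shows "f2 w pr_sub a (f2 w pr_add b a) = b"
proof -
 note [simp] = V_simps rec_simps add_laws(1,2)
 let ?z = "Fn (PR pr_sub) [Var 0, Fn (PR pr_add) [Var 1, Var 0]]"
 have "V w ?z (a # [b]) = V w (Var 1) (a # [b])"
 proof (rule uniform_induct_eq[where n = 1])
  fix w bs assume "W w" "set bs \<subseteq> N w" "length bs = 1"
  thus "V w ?z (zw w # bs) = V w (Var 1) (zw w # bs)" by (auto simp: length_Suc_conv)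
 next
  fix w bs a assume "W w" "set bs \<subseteq> N w" "length bs = 1" "a \<in> N w" and "V w ?z (a # bs) = V w (Var 1) (a # bs)"
  thus "V w ?z (Sw w a # bs) = V w (Var 1) (Sw w a # bs)"
   using sub_SS[of w a] by (auto simp: length_Suc_conv simp del: rec_simps(4))
 qed (use assms in simp_all)
 thus ?thesis using assms by simp
qed

subsection \<open>The Cantor pairing\<close>

lemma Cantor_eqs:
 assumes "W w" "m \<in> N w" "n \<in> N w"
 shows "f2 w pr_J (zw w) (zw w) = zw w" "f2 w pr_J (zw w) (Sw w n) = Sw w (f2 w pr_J n (zw w))"
  "f2 w pr_J (Sw w m) n = Sw w (f2 w pr_J m (Sw w n))"
 using assms by (simp_all add: rec_simps add_laws(1,2))

text \<open>The number \<open>p + 1\<close> opens a new diagonal if and only if the triangular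
  number of \<open>d + 1\<close> is at most \<open>p + 1\<close>, where \<open>d\<close> is the
  diagonal of \<open>p\<close>. The truncated difference is then 0, and \<open>pr_isz\<close> adds
  1.\<close>

lemma diag_eqs:
 assumes "W w" "p \<in> N w"
 shows "f1 w pr_diag (zw w) = zw w"
  "f1 w pr_diag (Sw w p) = f2 w pr_add (f1 w pr_isz (f2 w pr_sub (Sw w p) (f1 w pr_tri (Sw w (f1 w pr_diag p))))) (f1 w pr_diag p)"
proof -
 let ?h3 = "Comp 2 pr_tri [Comp 2 Succ [Proj 2 1]]" and ?h4 = "Comp 2 Succ [Proj 2 0]"
 let ?h2 = "Comp 2 pr_sub [?h4, ?h3]"
 let ?h1 = "Comp 2 pr_isz [?h2]"
 have d: "describes (Comp 2 pr_add [?h1, Proj 2 1]) 2" "describes ?h1 2" "describes ?h2 2" "describes ?h3 2" "describes ?h4 2"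
  "describes (Proj 2 1) 2" "describes (Proj 2 0) 2" "describes pr_isz 1" "describes pr_tri 1" "describes pr_sub 2" "describes Succ 1"
  "describes (Comp 2 Succ [Proj 2 1]) 2"
  by (simp_all add: numeral_eq_Suc)
 have N: "f1 w pr_diag p \<in> N w" using assms by simp
 show "f1 w pr_diag (zw w) = zw w" "f1 w pr_diag (Sw w p) = f2 w pr_add (f1 w pr_isz (f2 w pr_sub (Sw w p) (f1 w pr_tri (Sw w (f1 w pr_diag p))))) (f1 w pr_diag p)"
  using ops_Rec(1,2)[of w p "Comp 2 pr_add [?h1, Proj 2 1]" 0] assms N
   ops_Comp(5)[OF assms(1,2) N describes_add d(2,6)] ops_Comp(4)[OF assms(1,2) N d(8,3)]
   ops_Comp(5)[OF assms(1,2) N d(10,5,4)] ops_Comp(4)[OF assms(1,2) N d(9,12)] ops_Comp(4)[OF assms(1,2) N d(11,6)]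
   ops_Comp(4)[OF assms(1,2) N d(11,7)] d(1)
  by (simp_all add: pr_diag_def[symmetric, unfolded One_nat_def])
qed

text \<open>As \<open>s = k + S(n)\<close>, the position \<open>k\<close> is not the last one of its
  diagonal: the triangular number of \<open>s + 1\<close> exceeds the next number by
  \<open>S(n)\<close>, so the diagonal does not change.\<close>

lemma diag_step:
 assumes w: "W w" and kn: "k \<in> N w" "n \<in> N w" and s: "s = f2 w pr_add k (Sw w n)"
  and IH: "f1 w pr_diag (f2 w pr_add k (f1 w pr_tri s)) = s"
 shows "f1 w pr_diag (Sw w (f2 w pr_add k (f1 w pr_tri s))) = s"
proof -
 have sN: "s \<in> N w" using w kn s by simp
 let ?t = "f1 w pr_tri s" and ?p = "f2 w pr_add k (f1 w pr_tri s)"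
 have tN: "?t \<in> N w" "?p \<in> N w" using w sN kn by simp_all
 have "f1 w pr_tri (Sw w s) = f2 w pr_add (Sw w n) (Sw w ?p)"
  using w kn sN tN by (simp add: rec_simps add_laws(2) s add_laws(4) add_left_comm)
 hence "f2 w pr_sub (Sw w ?p) (f1 w pr_tri (Sw w s)) = Sw w n" using w kn tN sub_add[of w "Sw w ?p" "Sw w n"] by simp
 thus ?thesis using diag_eqs(2)[OF w tN(2)] w kn sN by (simp add: IH rec_simps)
qed

text \<open>The position \<open>k = s\<close> is the last one of its diagonal: the next number is
  the triangular number of \<open>s + 1\<close> itself.\<close>

lemma diag_switch:
 assumes w: "W w" and s: "s \<in> N w" and IH: "f1 w pr_diag (f2 w pr_add s (f1 w pr_tri s)) = s"
 shows "f1 w pr_diag (f1 w pr_tri (Sw w s)) = Sw w s"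
proof -
 let ?p = "f2 w pr_add s (f1 w pr_tri s)"
 have pN: "?p \<in> N w" using w s by simp
 have t: "f1 w pr_tri (Sw w s) = Sw w ?p" using w s by (simp add: rec_simps)
 have "f2 w pr_sub (Sw w ?p) (Sw w ?p) = zw w" using sub_add[of w "Sw w ?p" "zw w"] w pN by (simp add: rec_simps)
 thus ?thesis using diag_eqs(2)[OF w pN] w s by (simp add: IH t rec_simps)
qed

text \<open>The hypothesis \<open>kn\<close> expresses \<open>k \<le> s\<close> as an equation. Thus
  the induction along the diagonal concerns an implication between equations, as
  \<open>uniform_induct\<close> provides.\<close>

lemma diag_row:
 assumes w: "W w" and ks: "k \<in> N w" "s \<in> N w" and h: "f1 w pr_diag (f1 w pr_tri s) = s"
  and kn: "f2 w pr_add k (f2 w pr_sub k s) = s"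
 shows "f1 w pr_diag (f2 w pr_add k (f1 w pr_tri s)) = s"
proof -
 let ?D = "%t. App (FC (PR pr_diag)) t" and ?T = "%t. App (FC (PR pr_tri)) t"
  and ?a = "%s t. Fn (PR pr_add) [s, t]" and ?m = "%s t. Fn (PR pr_sub) [s, t]"
 note [simp] = V_simps
 have "V w (?D (?a (Var 0) (?T (Var 1)))) (k # [s]) = V w (Var 1) (k # [s])"
 proof (rule uniform_induct[where x = "?D (?T (Var 1))" and x' = "Var 1" and y = "?a (Var 0) (?m (Var 0) (Var 1))" and y' = "Var 1" and n = 1])
  fix w bs assume "W w" "set bs \<subseteq> N w" "length bs = 1"
   and "V w (?D (?T (Var 1))) (zw w # bs) = V w (Var 1) (zw w # bs)"
  thus "V w (?D (?a (Var 0) (?T (Var 1)))) (zw w # bs) = V w (Var 1) (zw w # bs)"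
   by (auto simp: length_Suc_conv rec_eqs)
 next
  fix w bs a assume w: "W w" and bs: "set bs \<subseteq> N w" "length bs = 1" and a: "a \<in> N w"
   and IH: "V w (?D (?T (Var 1))) (a # bs) = V w (Var 1) (a # bs) ==>
    V w (?a (Var 0) (?m (Var 0) (Var 1))) (a # bs) = V w (Var 1) (a # bs) ==>
    V w (?D (?a (Var 0) (?T (Var 1)))) (a # bs) = V w (Var 1) (a # bs)"
   and 1: "V w (?D (?T (Var 1))) (Sw w a # bs) = V w (Var 1) (Sw w a # bs)"
   and 2: "V w (?a (Var 0) (?m (Var 0) (Var 1))) (Sw w a # bs) = V w (Var 1) (Sw w a # bs)"
  obtain s where s: "bs = [s]" "s \<in> N w" using bs by (auto simp: length_Suc_conv)
  let ?n = "f2 w pr_sub (Sw w a) s"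
  have n: "?n \<in> N w" using w a s by simp
  have "f2 w pr_add (Sw w a) ?n = s" using 2 w a s by simp
  hence e: "s = f2 w pr_add a (Sw w ?n)" using w a n by (simp add: rec_simps add_laws(2))
  hence "f2 w pr_sub a s = Sw w ?n" using sub_add[of w a "Sw w ?n"] add_laws(3)[of w a "Sw w ?n"] w a n by simp
  hence "f1 w pr_diag (f2 w pr_add a (f1 w pr_tri s)) = s" using IH 1 w a s e by simp
  from diag_step[OF w a n e this] show "V w (?D (?a (Var 0) (?T (Var 1)))) (Sw w a # bs) = V w (Var 1) (Sw w a # bs)"
   using w a s by (simp add: rec_simps)
 qed (use assms in simp_all)
 thus ?thesis using w ks by simp
qed

text \<open>Induction on the diagonal: \<open>diag_row\<close> leads from its beginning to its end,
  and \<open>diag_switch\<close> from there to the beginning of the next.\<close>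

lemma diag_tri: assumes w: "W w" and s: "s \<in> N w" shows "f1 w pr_diag (f1 w pr_tri s) = s"
proof -
 note [simp] = V_simps
 have 0: "f1 w pr_diag (f1 w pr_tri (zw w)) = zw w" if "W w" for w
  using that rec_simps(8)[of w] diag_eqs(1)[of w "zw w"] by simp
 have S: "f1 w pr_diag (f1 w pr_tri (Sw w a)) = Sw w a" if w: "W w" and a: "a \<in> N w" and h: "f1 w pr_diag (f1 w pr_tri a) = a" for w a
 proof -
  have "f2 w pr_sub a a = zw w" using sub_add[of w a "zw w"] w a by (simp add: rec_simps)
  hence "f1 w pr_diag (f2 w pr_add a (f1 w pr_tri a)) = a"
   using diag_row[OF w a a h] w a by (simp add: add_laws(1))
  from diag_switch[OF w a this] show ?thesis .
 qed
 show ?thesis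
  using induct1[of "App (FC (PR pr_diag)) (App (FC (PR pr_tri)) (Var 0))" "Var 0" w s, OF _ _ _ _ w s] w s 0 S by simp
qed

lemma diag_J: assumes w: "W w" and mn: "m \<in> N w" "n \<in> N w" shows "f1 w pr_diag (f2 w pr_J m n) = f2 w pr_add m n"
proof -
 let ?s = "f2 w pr_add m n"
 have s: "?s \<in> N w" using w mn by simp
 have "f2 w pr_sub m ?s = n" using sub_add[of w m n] add_laws(3)[of w m n] w mn by simp
 hence "f1 w pr_diag (f2 w pr_add m (f1 w pr_tri ?s)) = ?s" using diag_row[OF w mn(1) s diag_tri[OF w s]] by simp
 thus ?thesis using rec_eqs(11)[OF w mn] by simp
qed

lemma KL_J:
 assumes w: "W w" and mn: "m \<in> N w" "n \<in> N w"
 shows "f1 w pr_K (f2 w pr_J m n) = m" "f1 w pr_L (f2 w pr_J m n) = n"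
proof -
 let ?p = "f2 w pr_J m n" and ?s = "f2 w pr_add m n"
 have pN: "?p \<in> N w" using w mn by simp
 have d: "describes pr_sub 2" "describes pr_tri 1" "describes pr_diag 1" "describes pr_K 1" "describes (Comp 1 pr_tri [pr_diag]) 1" "describes (Proj 1 0) 1"
  by (simp_all add: numeral_2_eq_2)
 have k: "f1 w pr_K p = f2 w pr_sub (f1 w pr_tri (f1 w pr_diag p)) p" if "p \<in> N w" for p
  using ops_Comp(2)[OF w that d(1,5,6)] ops_Comp(1)[OF w that d(2,3)] w that by (simp add: pr_K_def)
 have l: "f1 w pr_L p = f2 w pr_sub (f1 w pr_K p) (f1 w pr_diag p)" if "p \<in> N w" for p
  using ops_Comp(2)[OF w that d(1,4,3)] by (simp add: pr_L_def)
 show K: "f1 w pr_K ?p = m"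
  using k[OF pN] diag_J[OF w mn] w mn rec_eqs(11)[OF w mn] sub_add[of w "f1 w pr_tri ?s" m] by simp
 show "f1 w pr_L ?p = n"
  using l[OF pN] diag_J[OF w mn] K w mn sub_add[of w m n] add_laws(3)[of w m n] by simp
qed

text \<open>When \<open>p\<close> grows by one, the Cantor equations move its pair from
  \<open>(m, 0)\<close> to \<open>(0, m + 1)\<close> and from \<open>(m, b + 1)\<close> to
  \<open>(m + 1, b)\<close>. So every \<open>p\<close> is the code of a pair, and
  \<open>KL_J\<close> decodes it.\<close>

lemma J_KL: assumes w: "W w" and p: "p \<in> N w" shows "f2 w pr_J (f1 w pr_K p) (f1 w pr_L p) = p"
proof -
 note [simp] = V_simps
 let ?z = "Fn (PR pr_J) [App (FC (PR pr_K)) (Var 0), App (FC (PR pr_L)) (Var 0)]"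
 have "V w ?z (p # []) = V w (Var 0) (p # [])"
 proof (rule uniform_induct_eq[where n = 0])
  fix w bs assume w: "W w" "length (bs::trm list) = 0"
  have "f1 w pr_K (zw w) = zw w" "f1 w pr_L (zw w) = zw w"
   using KL_J[OF w(1), of "zw w" "zw w"] Cantor_eqs(1)[OF w(1), of "zw w" "zw w"] by simp_all
  thus "V w ?z (zw w # bs) = V w (Var 0) (zw w # bs)"
   using w Cantor_eqs(1)[OF w(1), of "zw w" "zw w"] by simp
 next
  fix w bs a assume w: "W w" and bs: "length (bs::trm list) = 0" and a: "a \<in> N w" and IH: "V w ?z (a # bs) = V w (Var 0) (a # bs)"
  let ?m = "f1 w pr_K a" and ?n = "f1 w pr_L a"
  have mn: "?m \<in> N w" "?n \<in> N w" using w a by simp_all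
  have J: "f2 w pr_J ?m ?n = a" using IH bs w a by simp
  have *: "f2 w pr_J (f1 w pr_K (Sw w a)) (f1 w pr_L (Sw w a)) = Sw w a" if "Sw w a = f2 w pr_J x y" "x \<in> N w" "y \<in> N w" for x y
   using that KL_J[OF w that(2,3)] by simp
  from zero_or_suc[OF w mn(2)] have "f2 w pr_J (f1 w pr_K (Sw w a)) (f1 w pr_L (Sw w a)) = Sw w a"
  proof
   assume "?n = zw w"
   thus ?thesis using *[of "zw w" "Sw w ?m"] Cantor_eqs(2)[OF w mn(1) mn(1)] J w mn by simp
  next
   assume "\<exists>b\<in>N w. ?n = Sw w b"
   then obtain b where b: "b \<in> N w" "?n = Sw w b" ..
   thus ?thesis using *[of "Sw w ?m" b] Cantor_eqs(3)[OF w mn(1) b(1)] J w mn by simp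
  qed
  thus "V w ?z (Sw w a # bs) = V w (Var 0) (Sw w a # bs)" using w a bs by simp
 qed (use assms in simp_all)
 thus ?thesis using w p by simp
qed

end

subsection \<open>The exponent of 2\<close>

context ha
begin

lemma val_eqs:
 assumes w [simp]: "W w" and ab [simp]: "a \<in> N w" "b \<in> N w"
 shows "f2 w pr_mult (zw w) b = zw w" "f2 w pr_mult (Sw w a) b = f2 w pr_add (f2 w pr_mult a b) b"
  "f1 w (pr_power q) (zw w) = Sw w (zw w)" "f1 w (pr_power q) (Sw w a) = f2 w pr_mult (nf w (numeral_trm q)) (f1 w (pr_power q) a)"
  "f2 w pr_pair a b = f2 w pr_mult (f1 w (pr_power 2) a) (f1 w (pr_power 3) b)"
  "f1 w pr_par (zw w) = zw w" "f1 w pr_par (Sw w a) = f1 w pr_isz (f1 w pr_par a)"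
  "f1 w pr_half (zw w) = zw w" "f1 w pr_half (Sw w a) = f2 w pr_add (f1 w pr_par a) (f1 w pr_half a)"
  "f1 w pr_step a = f3 w pr_cond (f1 w pr_par a) (f1 w pr_half a) a"
  "f2 w pr_iter (zw w) b = b" "f2 w pr_iter (Sw w a) b = f1 w pr_step (f2 w pr_iter a b)"
  "f2 w pr_count (zw w) b = zw w"
  "f2 w pr_count (Sw w a) b = f2 w pr_add (f1 w pr_isz (f1 w pr_par (f2 w pr_iter a b))) (f2 w pr_count a b)"
  "f1 w pr_val a = f2 w pr_count a a"
proof -
 note fold = pr_mult_def[symmetric, unfolded One_nat_def] pr_power_def[symmetric, unfolded One_nat_def]
  pr_pair_def[symmetric, unfolded One_nat_def]
  pr_par_def[symmetric, unfolded One_nat_def] pr_half_def[symmetric, unfolded One_nat_def] pr_step_def[symmetric, unfolded One_nat_def]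
  pr_iter_def[symmetric, unfolded One_nat_def] pr_count_def[symmetric, unfolded One_nat_def] pr_val_def[symmetric, unfolded One_nat_def]
 note u = One_nat_def numeral_2_eq_2 numeral_3_eq_3
 note [simp] = ops_Const(1)[unfolded One_nat_def]
 have [simp]: "f2 w (Const 2 r) x y = nf w (numeral_trm r)" if "x \<in> N w" "y \<in> N w" for r x y using ops_Const(2)[OF w] that by simp
 have d3: "describes g (Suc (Suc (Suc 0))) ==> describes g 3" "describes g 3 ==> describes g (Suc (Suc (Suc 0)))"
  "describes g (Suc (Suc 0)) ==> describes g 2" "describes g 2 ==> describes g (Suc (Suc 0))" for g by (simp_all add: numeral_eq_Suc)
 note [simp] = d3(1,3)
 have len: "length [x, y] = Suc (Suc 0)" for x y :: prd by simp
 have c0: "describes (Comp 3 pr_add [Proj 3 1, Proj 3 2]) 3" "describes (Comp 2 pr_mult [Const 2 q, Proj 2 1]) 2"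
  "describes (Comp 2 pr_isz [Proj 2 1]) 2" "describes (Comp 2 pr_par [Proj 2 0]) 2"
  "describes (Comp 2 pr_add [Comp 2 pr_par [Proj 2 0], Proj 2 1]) 2"
  "describes (Comp 3 pr_step [Proj 3 1]) 3" "describes (Comp 3 pr_iter [Proj 3 0, Proj 3 2]) 3"
  "describes (Comp 3 pr_par [Comp 3 pr_iter [Proj 3 0, Proj 3 2]]) 3"
  "describes (Comp 3 pr_isz [Comp 3 pr_par [Comp 3 pr_iter [Proj 3 0, Proj 3 2]]]) 3"
  "describes (Comp 3 pr_add [Comp 3 pr_isz [Comp 3 pr_par [Comp 3 pr_iter [Proj 3 0, Proj 3 2]]], Proj 3 1]) 3"
  "describes (Comp 2 (pr_power 2) [Proj 2 0]) 2" "describes (Comp 2 (pr_power 3) [Proj 2 1]) 2"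
  by (simp_all add: numeral_eq_Suc)
 note c = c0[unfolded One_nat_def]
 have "describes (RecP (Const 1 0) (Comp 3 pr_add [Proj 3 1, Proj 3 2])) 2" using describes_mult by (simp add: pr_mult_def)
 have m: "f3 w (Comp 3 pr_add [Proj 3 1, Proj 3 2]) a x b = f2 w pr_add x b" if "x \<in> N w" for x
  using ops_Comp(7)[of w a x b pr_add "Proj 3 1" "Proj 3 2"] that by simp
 show "f2 w pr_mult (zw w) b = zw w" "f2 w pr_mult (Sw w a) b = f2 w pr_add (f2 w pr_mult a b) b"
  using ops_Rec(3,4)[of w a b "Const 1 0" "Comp 3 pr_add [Proj 3 1, Proj 3 2]"] c m by (simp_all add: fold)
 have m: "f2 w (Comp 2 pr_mult [Const 2 q, Proj 2 1]) a x = f2 w pr_mult (nf w (numeral_trm q)) x" if "x \<in> N w" for x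
  using ops_Comp(5)[of w a x pr_mult "Const 2 q" "Proj 2 1"] that by simp
 show "f1 w (pr_power q) (zw w) = Sw w (zw w)" "f1 w (pr_power q) (Sw w a) = f2 w pr_mult (nf w (numeral_trm q)) (f1 w (pr_power q) a)"
  using ops_Rec(1,2)[of w a "Comp 2 pr_mult [Const 2 q, Proj 2 1]" 1] c m by (simp_all add: fold nf_App)
 show "f2 w pr_pair a b = f2 w pr_mult (f1 w (pr_power 2) a) (f1 w (pr_power 3) b)"
  using ops_Comp(5)[of w a b pr_mult "Comp 2 (pr_power 2) [Proj 2 0]" "Comp 2 (pr_power 3) [Proj 2 1]"]
   ops_Comp(4)[of w a b "pr_power 2" "Proj 2 0"] ops_Comp(4)[of w a b "pr_power 3" "Proj 2 1"] c by (simp add: fold)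
 have m: "f2 w (Comp 2 pr_isz [Proj 2 1]) a x = f1 w pr_isz x" if "x \<in> N w" for x
  using ops_Comp(4)[of w a x pr_isz "Proj 2 1"] that by simp
 show "f1 w pr_par (zw w) = zw w" "f1 w pr_par (Sw w a) = f1 w pr_isz (f1 w pr_par a)"
  using ops_Rec(1,2)[of w a "Comp 2 pr_isz [Proj 2 1]" 0] c m by (simp_all add: fold)
 have m: "f2 w (Comp 2 pr_add [Comp 2 pr_par [Proj 2 0], Proj 2 1]) a x = f2 w pr_add (f1 w pr_par a) x" if "x \<in> N w" for x
  using ops_Comp(5)[of w a x pr_add "Comp 2 pr_par [Proj 2 0]" "Proj 2 1"] ops_Comp(4)[of w a x pr_par "Proj 2 0"] that c by simp
 show "f1 w pr_half (zw w) = zw w" "f1 w pr_half (Sw w a) = f2 w pr_add (f1 w pr_par a) (f1 w pr_half a)"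
  using ops_Rec(1,2)[of w a "Comp 2 pr_add [Comp 2 pr_par [Proj 2 0], Proj 2 1]" 0] c m by (simp_all add: fold)
 show "f1 w pr_step a = f3 w pr_cond (f1 w pr_par a) (f1 w pr_half a) a"
  using ops_Comp(3)[of w a pr_cond pr_par pr_half "Proj 1 0"] c by (simp add: fold)
 have m: "f3 w (Comp 3 pr_step [Proj 3 1]) a x b = f1 w pr_step x" if "x \<in> N w" for x
  using ops_Comp(6)[of w a x b pr_step "Proj 3 1"] that by simp
 show "f2 w pr_iter (zw w) b = b" "f2 w pr_iter (Sw w a) b = f1 w pr_step (f2 w pr_iter a b)"
  using ops_Rec(3,4)[of w a b "Proj 1 0" "Comp 3 pr_step [Proj 3 1]"] c m by (simp_all add: fold)
 let ?i = "Comp 3 pr_iter [Proj 3 0, Proj 3 2]"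
 have m: "f3 w (Comp 3 pr_add [Comp 3 pr_isz [Comp 3 pr_par [?i]], Proj 3 1]) a x b =
   f2 w pr_add (f1 w pr_isz (f1 w pr_par (f2 w pr_iter a b))) x" if "x \<in> N w" for x
  using ops_Comp(7)[of w a x b pr_add "Comp 3 pr_isz [Comp 3 pr_par [?i]]" "Proj 3 1"] ops_Comp(6)[of w a x b pr_isz "Comp 3 pr_par [?i]"]
   ops_Comp(6)[of w a x b pr_par ?i] ops_Comp(7)[of w a x b pr_iter "Proj 3 0" "Proj 3 2"] that c by simp
 show "f2 w pr_count (zw w) b = zw w"
  "f2 w pr_count (Sw w a) b = f2 w pr_add (f1 w pr_isz (f1 w pr_par (f2 w pr_iter a b))) (f2 w pr_count a b)"
  using ops_Rec(3,4)[of w a b "Const 1 0" "Comp 3 pr_add [Comp 3 pr_isz [Comp 3 pr_par [?i]], Proj 3 1]"] c m by (simp_all add: fold)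
 show "f1 w pr_val a = f2 w pr_count a a"
  using ops_Comp(2)[of w a pr_count "Proj 1 0" "Proj 1 0"] by (simp add: fold)
qed

lemmas val_simps = val_eqs(1,11,13)[OF _ zw_N] val_eqs(2,12,14) val_eqs(3,6,8)[OF _ zw_N zw_N] val_eqs(7,9,10,15)[OF _ _ zw_N]

lemma mult_add:
 assumes w: "W w" "a \<in> N w" "b \<in> N w" "c \<in> N w"
 shows "f2 w pr_mult (f2 w pr_add a b) c = f2 w pr_add (f2 w pr_mult a c) (f2 w pr_mult b c)"
proof -
 let ?a = "%s t. Fn (PR pr_add) [s, t]" and ?m = "%s t. Fn (PR pr_mult) [s, t]"
 note [simp] = V_simps rec_simps val_simps
 have S: "f2 w pr_add (f2 w pr_add x y) c = f2 w pr_add (f2 w pr_add x c) y" if "W w" "x \<in> N w" "y \<in> N w" "c \<in> N w" for w x y c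
  using add_laws(4)[of w x y c] add_laws(4)[of w x c y] add_laws(3)[of w y c] that by simp
 show ?thesis
  using induct3[of "?m (?a (Var 0) (Var 1)) (Var 2)" "?a (?m (Var 0) (Var 2)) (?m (Var 1) (Var 2))" w a b c, OF _ _ _ _ w] w
  by (simp add: numeral_2_eq_2 S)
qed

text \<open>Multiplication by 2 and 3 is resolved into addition, since the laws of parity and
  halving speak of sums \<open>a + a\<close>.\<close>

lemma pow_simps:
 assumes "W w" "a \<in> N w" "b \<in> N w"
 shows "f2 w pr_pair (zw w) b = f1 w (pr_power 3) b" "f2 w pr_pair (Sw w a) b = f2 w pr_add (f2 w pr_pair a b) (f2 w pr_pair a b)"
  "f1 w (pr_power 3) (zw w) = Sw w (zw w)"
  "f1 w (pr_power 3) (Sw w a) = f2 w pr_add (f2 w pr_add (f1 w (pr_power 3) a) (f1 w (pr_power 3) a)) (f1 w (pr_power 3) a)"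
proof -
 have n: "nf w (numeral_trm 2) = Sw w (Sw w (zw w))" "nf w (numeral_trm 3) = Sw w (Sw w (Sw w (zw w)))"
  using assms by (simp_all add: numeral_2_eq_2 numeral_3_eq_3 nf_App)
 have p: "f1 w (pr_power q) (Sw w a) = f2 w pr_mult (nf w (numeral_trm q)) (f1 w (pr_power q) a)" for q
  using val_eqs(4) assms by blast
 note p2 = p[of 2, unfolded n] and p3 = p[of 3, unfolded n]
 show "f2 w pr_pair (zw w) b = f1 w (pr_power 3) b" using assms val_eqs(5)[of w "zw w" b] by (simp add: val_simps rec_simps)
 show "f2 w pr_pair (Sw w a) b = f2 w pr_add (f2 w pr_pair a b) (f2 w pr_pair a b)"
  using assms val_eqs(5)[of w "Sw w a" b] val_eqs(5)[of w a b] by (simp add: p2 val_simps rec_simps mult_add)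
 show "f1 w (pr_power 3) (zw w) = Sw w (zw w)" using assms by (simp add: val_simps)
 show "f1 w (pr_power 3) (Sw w a) = f2 w pr_add (f2 w pr_add (f1 w (pr_power 3) a) (f1 w (pr_power 3) a)) (f1 w (pr_power 3) a)"
  using assms by (simp add: p3 val_simps rec_simps)
qed

lemmas pair_simps = pow_simps(1)[OF _ zw_N] pow_simps(2) pow_simps(3)[OF _ zw_N zw_N] pow_simps(4)[OF _ _ zw_N]

lemma par_laws:
 assumes w: "W w" "a \<in> N w"
 shows "f1 w pr_isz (f1 w pr_isz (f1 w pr_par a)) = f1 w pr_par a" (is "?P1")
  "b \<in> N w ==> f1 w pr_par (f2 w pr_add (f2 w pr_add a a) b) = f1 w pr_par b" (is "_ ==> ?P2")
  "f1 w pr_par (f2 w pr_add a a) = zw w" (is "?P3")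
  "f1 w pr_half (f2 w pr_add a a) = a" (is "?P4")
  "f1 w pr_par (f1 w (pr_power 3) a) = Sw w (zw w)" (is "?P5")
proof -
 let ?a = "%s t. Fn (PR pr_add) [s, t]" and ?p = "%t. App (FC (PR pr_par)) t" and ?h = "%t. App (FC (PR pr_half)) t"
 let ?i = "%t. App (FC (PR pr_isz)) t" and ?q = "%t. App (FC (PR (pr_power 3))) t"
 note [simp] = V_simps rec_simps val_simps add_laws(1,2)
 have 1: "f1 w pr_isz (f1 w pr_isz (f1 w pr_par a)) = f1 w pr_par a" if w: "W w" "a \<in> N w" for w a
  using induct1[of "?i (?i (?p (Var 0)))" "?p (Var 0)" w a, OF _ _ _ _ w] w by simp
 show "?P1" by (rule 1[OF w])
 have 2: "f1 w pr_par (f2 w pr_add (f2 w pr_add a a) b) = f1 w pr_par b" if w: "W w" "a \<in> N w" "b \<in> N w" for w a b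
  using induct2[of "?p (?a (?a (Var 0) (Var 0)) (Var 1))" "?p (Var 1)" w a b, OF _ _ _ _ w] w by (simp add: 1)
 thus "?P2" if "b \<in> N w" using w that by simp
 have 3: "f1 w pr_par (f2 w pr_add a a) = zw w" if w: "W w" "a \<in> N w" for w a
  using 2[of w a "zw w"] w by simp
 thus "?P3" using w by simp
 show "?P4"
  using induct1[of "?h (?a (Var 0) (Var 0))" "Var 0" w a, OF _ _ _ _ w] w by (simp add: 3)
 show "?P5"
  using induct1[of "?p (?q (Var 0))" "suc zero" w a, OF _ _ _ _ w] w by (simp add: 2 pair_simps)
qed

text \<open>Parity selects the branch: a double is halved, whereas a power of 3, being odd, is a
  fixed point.\<close>

lemma step_laws:
 assumes w: "W w" "a \<in> N w" "b \<in> N w"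
 shows "f1 w pr_step (f2 w pr_add a a) = a" "f1 w pr_step (f1 w (pr_power 3) a) = f1 w (pr_power 3) a"
  "f2 w pr_iter (Sw w a) (f2 w pr_add b b) = f2 w pr_iter a b" "f2 w pr_iter a (f1 w (pr_power 3) b) = f1 w (pr_power 3) b"
proof -
 let ?a = "%s t. Fn (PR pr_add) [s, t]" and ?q = "%t. App (FC (PR (pr_power 3))) t" and ?i = "%s t. Fn (PR pr_iter) [s, t]"
 note [simp] = V_simps rec_simps val_simps par_laws cond_eqs
 have 1: "f1 w pr_step (f2 w pr_add a a) = a" if "W w" "a \<in> N w" for w a using that by simp
 have 2: "f1 w pr_step (f1 w (pr_power 3) a) = f1 w (pr_power 3) a" if "W w" "a \<in> N w" for w a using that by simp
 show "f1 w pr_step (f2 w pr_add a a) = a" "f1 w pr_step (f1 w (pr_power 3) a) = f1 w (pr_power 3) a" using 1 2 w by auto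
 note [simp del] = val_simps(12)
 show "f2 w pr_iter (Sw w a) (f2 w pr_add b b) = f2 w pr_iter a b"
  using induct2[of "?i (suc (Var 0)) (?a (Var 1) (Var 1))" "?i (Var 0) (Var 1)" w a b, OF _ _ _ _ w] w by (simp add: 1)
 show "f2 w pr_iter a (f1 w (pr_power 3) b) = f1 w (pr_power 3) b"
  using induct2[of "?i (Var 0) (?q (Var 1))" "?q (Var 1)" w a b, OF _ _ _ _ w] w by (simp add: 2)
qed

text \<open>The first \<open>a\<close> iterates of \<open>2 ^ a * 3 ^ c\<close> are even; after them
  the iteration rests at an odd number. So any number of rounds of the form \<open>a + b\<close>
  counts exactly \<open>a\<close>.\<close>

lemma count_laws:
 assumes w: "W w" "a \<in> N w" "b \<in> N w"
 shows "f2 w pr_count (Sw w a) (f2 w pr_add b b) = Sw w (f2 w pr_count a b)" "f2 w pr_count a (f1 w (pr_power 3) b) = zw w"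
  "c \<in> N w ==> f2 w pr_count (f2 w pr_add a b) (f2 w pr_pair a c) = a"
proof -
 let ?a = "%s t. Fn (PR pr_add) [s, t]" and ?q = "%t. App (FC (PR (pr_power 3))) t" and ?c = "%s t. Fn (PR pr_count) [s, t]"
 let ?p = "%s t. Fn (PR pr_pair) [s, t]"
 note [simp] = V_simps rec_simps val_simps par_laws add_laws(1,2)
 have iter: "f2 w pr_iter (Sw w a) (f2 w pr_add b b) = f2 w pr_iter a b" "f2 w pr_iter a (f1 w (pr_power 3) b) = f1 w (pr_power 3) b"
  if "W w" "a \<in> N w" "b \<in> N w" for w a b using step_laws(3,4) that by auto
 have 1: "f2 w pr_count (Sw w a) (f2 w pr_add b b) = Sw w (f2 w pr_count a b)" if w: "W w" "a \<in> N w" "b \<in> N w" for w a b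
 proof -
  have e: "f2 w pr_count (Sw w (Sw w a)) (f2 w pr_add b b) = Sw w (f2 w pr_count (Sw w a) b)"
   if w: "W w" "a \<in> N w" "b \<in> N w" and "f2 w pr_count (Sw w a) (f2 w pr_add b b) = Sw w (f2 w pr_count a b)" for w a b
   using that(4) w val_eqs(14)[OF w(1) _ _, of "Sw w a" "f2 w pr_add b b"] iter[OF w] by (simp del: val_simps(5,6))
    (simp add: w)
  have z: "f2 w pr_count (Sw w (zw w)) (f2 w pr_add b b) = Sw w (zw w)" if "W w" "b \<in> N w" for w b using that by simp
  show ?thesis
   using induct2[of "?c (suc (Var 0)) (?a (Var 1) (Var 1))" "suc (?c (Var 0) (Var 1))" w a b, OF _ _ _ _ w] w e z by (simp del: val_simps(6))
 qed
 have 2: "f2 w pr_count a (f1 w (pr_power 3) b) = zw w" if w: "W w" "a \<in> N w" "b \<in> N w" for w a b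
  using induct2[of "?c (Var 0) (?q (Var 1))" zero w a b, OF _ _ _ _ w] w by (simp add: iter(2))
 show "f2 w pr_count (Sw w a) (f2 w pr_add b b) = Sw w (f2 w pr_count a b)" "f2 w pr_count a (f1 w (pr_power 3) b) = zw w"
  using 1 2 w by auto
 assume c: "c \<in> N w"
 show "f2 w pr_count (f2 w pr_add a b) (f2 w pr_pair a c) = a"
  using induct3[of "?c (?a (Var 0) (Var 1)) (?p (Var 0) (Var 2))" "Var 0" w a b c, OF _ _ _ _ w c] w c
  by (simp add: numeral_2_eq_2 pair_simps 1 2 del: val_simps(6))
qed

text \<open>An explicit difference witnesses \<open>a + 1 \<le> 2 ^ a * 3 ^ b\<close>. Hence the
  code itself is a sufficient number of rounds for \<open>pr_val\<close>.\<close>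

lemma pair_fuel:
 assumes w: "W w" "a \<in> N w" "b \<in> N w"
 shows "f2 w pr_pair a b = Sw w (f2 w pr_add a (f2 w pr_sub (Sw w a) (f2 w pr_pair a b)))"
proof -
 let ?a = "%s t. Fn (PR pr_add) [s, t]" and ?q = "%t. App (FC (PR (pr_power 3))) t" and ?s = "%s t. Fn (PR pr_sub) [s, t]"
 let ?p = "%s t. Fn (PR pr_pair) [s, t]"
 note [simp] = V_simps pair_simps
 have 0: "Sw w (f1 w pr_pred (f1 w (pr_power 3) b)) = f1 w (pr_power 3) b" if w: "W w" "b \<in> N w" for w b
 proof -
  have S: "Sw w (f1 w pr_pred (f1 w (pr_power 3) (Sw w b))) = f1 w (pr_power 3) (Sw w b)"
   if w: "W w" "b \<in> N w" and "Sw w (f1 w pr_pred (f1 w (pr_power 3) b)) = f1 w (pr_power 3) b" for w b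
  proof -
   let ?r = "f1 w pr_pred (f1 w (pr_power 3) b)" and ?x = "f1 w (pr_power 3) b"
   have "f1 w (pr_power 3) (Sw w b) = f2 w pr_add (f2 w pr_add ?x ?x) (Sw w ?r)" using that by simp
   also have "... = Sw w (f2 w pr_add (f2 w pr_add ?x ?x) ?r)" by (rule add_laws(2)) (use w in simp_all)
   finally show ?thesis using w by (simp only: rec_simps(9) f2_N N_T' ) (simp add: rec_simps)
  qed
  show ?thesis
   using induct1[of "suc (App (FC (PR pr_pred)) (?q (Var 0)))" "?q (Var 0)" w b, OF _ _ _ _ w] w S by (simp add: rec_simps del: pair_simps(4))
 qed
 have 0: "Sw w (f2 w pr_sub (Sw w (zw w)) (f1 w (pr_power 3) b)) = f1 w (pr_power 3) b" if "W w" "b \<in> N w" for w b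
  using 0[OF that] that by (simp add: rec_simps)
 have S: "f2 w pr_pair (Sw w a) b = Sw w (f2 w pr_add (Sw w a) (f2 w pr_sub (Sw w (Sw w a)) (f2 w pr_pair (Sw w a) b)))"
  if w: "W w" "a \<in> N w" "b \<in> N w" and IH: "f2 w pr_pair a b = Sw w (f2 w pr_add a (f2 w pr_sub (Sw w a) (f2 w pr_pair a b)))" for w a b
 proof -
  define r where "r = f2 w pr_sub (Sw w a) (f2 w pr_pair a b)"
  have r: "r \<in> N w" using w by (simp add: r_def)
  let ?R = "f2 w pr_add r (f2 w pr_add a r)"
  have R: "?R \<in> N w" using w r by simp
  have "f2 w pr_pair (Sw w a) b = f2 w pr_add (Sw w (f2 w pr_add a r)) (Sw w (f2 w pr_add a r))"
   using IH w unfolding r_def[symmetric] by simp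
  also have "... = Sw w (f2 w pr_add (Sw w a) ?R)" using w r by (simp add: rec_simps add_laws(2,4))
  finally have P: "f2 w pr_pair (Sw w a) b = Sw w (f2 w pr_add (Sw w a) ?R)" .
  also have "... = f2 w pr_add ?R (Sw w (Sw w a))" using w r R add_laws(3)[of w "Sw w a" ?R] by (simp add: add_laws(2))
  finally have "f2 w pr_sub (Sw w (Sw w a)) (f2 w pr_pair (Sw w a) b) = ?R" using sub_add[of w "Sw w (Sw w a)" ?R] w R by simp
  thus ?thesis using P by simp
 qed
 show ?thesis
  using induct2[of "?p (Var 0) (Var 1)" "suc (?a (Var 0) (?s (suc (Var 0)) (?p (Var 0) (Var 1))))" w a b, OF _ _ _ _ w] w S 0
  by (simp add: rec_simps del: pair_simps(2) rec_simps(4))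
qed

lemma val_pair: assumes w: "W w" "a \<in> N w" "b \<in> N w" shows "f1 w pr_val (f2 w pr_pair a b) = a"
proof -
 let ?r = "f2 w pr_sub (Sw w a) (f2 w pr_pair a b)"
 have r: "?r \<in> N w" using w by simp
 have "f1 w pr_val (f2 w pr_pair a b) = f2 w pr_count (f2 w pr_pair a b) (f2 w pr_pair a b)" using w by (simp add: val_simps)
 also have "... = f2 w pr_count (f2 w pr_add a (Sw w ?r)) (f2 w pr_pair a b)"
  using pair_fuel[OF w] add_laws(2)[OF w(1,2) r] by simp
 also have "... = a" by (rule count_laws(3)) (use w r in simp_all)
 finally show ?thesis .
qed

end

section \<open>The function existence axioms of BIM in EL\<close>

context ha
begin

lemma sat_AllFAllFExF:
 assumes w: "W w" and e: "en w rh th" and A: "A \<in> fmls Sy"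
  and ex: "\<And>w al be. W w ==> al \<in> Fu w ==> be \<in> Fu w ==> en w rh (be ## al ## th) ==> \<exists>ga\<in>Fu w. sat w rh (ga ## be ## al ## th) A"
 shows "sat w rh th (AllF (AllF (ExF A)))"
proof -
 have "sat w2 rh (be ## al ## th) (ExF A)" if w1: "W w1" "w << w1" "al \<in> Fu w1" and w2: "W w2" "w1 << w2" "be \<in> Fu w2" for w1 w2 al be
 proof -
  have F: "al \<in> Fu w2" using w1 w2 F_mono by blast
  have e2: "en w2 rh (be ## al ## th)" by (intro env_consF[OF _ w2(3)] env_consF[OF _ F] env_mono[OF e] wle_trans[OF w1(2) w2(2)])
  thus ?thesis using sat_ExF[OF w2(1) e2 A] ex[OF w2(1) F w2(3) e2] by simp
 qed
 moreover have "en w1 rh (al ## th)" if "W w1" "w << w1" "al \<in> Fu w1" for w1 al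
  by (intro env_consF[OF _ that(3)] env_mono[OF e] that)
 ultimately show ?thesis using sat_AllF[OF w e] sat_AllF A by simp
qed

end

locale bimch = bimc + ha
begin

text \<open>Abstraction supplies the witness. \<open>t'\<close> is \<open>t\<close> as it is written
  below the quantifier that binds the new function.\<close>

lemma explicit_functor:
 assumes w: "W w" and F: "al \<in> Fu w" "be \<in> Fu w" and e: "en w rh (be ## al ## th)" and t: "t \<in> Ter"
  and t': "t' \<in> Ter" "\<And>a ga. sub_trm (a ## rh) (ga ## be ## al ## th) t' = sub_trm (a ## rh) (be ## al ## th) t"
 shows "\<exists>ga\<in>Fu w. sat w rh (ga ## be ## al ## th) (AllN (Eq (App (FVar 0) (Var 0)) t'))"
proof (rule bexI)
 let ?ga = "sub_fnl rh (be ## al ## th) (Lam t)"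
 show ga: "?ga \<in> Fu w" by (rule sub_F[OF e]) (use t in simp)
 have e': "en w rh (?ga ## be ## al ## th)" by (rule env_consF[OF e ga])
 show "sat w rh (?ga ## be ## al ## th) (AllN (Eq (App (FVar 0) (Var 0)) t'))"
  unfolding sat_AllN'[OF w e' formulas.intros(1)[OF terms_functors.intros(3)[OF terms_functors.intros(5) terms_functors.intros(1)] t'(1)]]
 proof (intro allI impI ballI)
  fix w' a assume w': "W w'" "w << w'" and a: "a \<in> N w'"
  have e'': "en w' (a ## rh) (?ga ## be ## al ## th)" by (rule env_consN[OF env_mono[OF e' w'(2)]]) (use w' a in simp)
  have "nf w' (App ?ga a) = nf w' (sub_trm (a ## rh) (be ## al ## th) t)"
   by (rule nf_beta[OF w'(1) env_mono[OF e w'(2)] t]) (use w' a in simp)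
  thus "sat w' (a ## rh) (?ga ## be ## al ## th) (Eq (App (FVar 0) (Var 0)) t')"
   using sat_Eq[OF w'(1) e'' terms_functors.intros(3)[OF terms_functors.intros(5) terms_functors.intros(1)] t'(1), of 0 0] t'(2) by simp
 qed
qed

lemma sat_composition: assumes w: "W w" and e: "en w rh th" shows "sat w rh th bim_composition"
 unfolding bim_composition_def
proof (rule sat_AllFAllFExF[OF w e], simp)
 fix w al be assume *: "W w" "al \<in> Fu w" "be \<in> Fu w" "en w rh (be ## al ## th)"
 show "\<exists>ga\<in>Fu w. sat w rh (ga ## be ## al ## th) (AllN (Eq (App (FVar 0) (Var 0)) (App (FVar 2) (App (FVar 1) (Var 0)))))"
  by (rule explicit_functor[OF *, where t = "App (FVar 1) (App (FVar 0) (Var 0))"]) (simp_all add: numeral_2_eq_2)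
qed

lemma sat_pairing: assumes w: "W w" and e: "en w rh th" shows "sat w rh th bim_pairing"
 unfolding bim_pairing_def
proof (rule sat_AllFAllFExF[OF w e], simp)
 fix w al be assume *: "W w" "al \<in> Fu w" "be \<in> Fu w" "en w rh (be ## al ## th)"
 show "\<exists>ga\<in>Fu w. sat w rh (ga ## be ## al ## th) (AllN (Eq (App (FVar 0) (Var 0)) (pairJ (App (FVar 2) (Var 0)) (App (FVar 1) (Var 0)))))"
  by (rule explicit_functor[OF *, where t = "pairJ (App (FVar 1) (Var 0)) (App (FVar 0) (Var 0))"]) (simp_all add: numeral_2_eq_2)
qed

text \<open>The recursor is given only the coded pair of the previous value and the argument, of which \<open>pr_val\<close>
 recovers the value; so the value carries the argument along.\<close>

definition rec_start :: trm where "rec_start = pairJ zero (App (FVar 1) (Var 0))"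
definition rec_step :: trm where
 "rec_step = (let v = App (FC (PR pr_val)) (Var 0) in
  pairJ (suc (projK v)) (App (FVar 0) (pairJ (pairJ (Var 1) (projK v)) (projL v))))"

lemma rec_terms [simp]: "rec_start \<in> Ter" "rec_step \<in> Ter"
 by (simp_all add: rec_start_def rec_step_def Let_def)

definition rec_fun :: "(nat => trm) => (nat => fnl) => fnl" where
 "rec_fun rh th = sub_fnl rh th (Lam (Rec (ren_trm Suc id rec_start) (ren_fnl Suc id (Lam rec_step)) (Var 0)))"

lemma rec_fun:
 assumes w: "W w" and e: "en w (k ## rh) (be ## al ## th)" and k: "k \<in> Tm w"
 shows "rec_fun (k ## rh) (be ## al ## th) \<in> Fu w"
  "ap w (rec_fun (k ## rh) (be ## al ## th)) (zw w) = Jw w (zw w) (ap w al (nf w k))"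
  "n \<in> N w ==> ap w (rec_fun (k ## rh) (be ## al ## th)) (Sw w n) = Jw w (Sw w (Kw w (ap w (rec_fun (k ## rh) (be ## al ## th)) n)))
   (ap w be (Jw w (Jw w (nf w k) (Kw w (ap w (rec_fun (k ## rh) (be ## al ## th)) n))) (Lw w (ap w (rec_fun (k ## rh) (be ## al ## th)) n))))"
proof -
 let ?d = "rec_fun (k ## rh) (be ## al ## th)"
 have L: "Lam rec_step \<in> Fun" by simp
 note rf = recursor_functor[OF w e rec_terms(1) L, folded rec_fun_def f2_def]
 have F: "al \<in> Fu w" "be \<in> Fu w" using env_F[OF e, of 0] env_F[OF e, of 1] by simp_all
 show d: "?d \<in> Fu w" by (rule rf(1))
 show "ap w ?d (zw w) = Jw w (zw w) (ap w al (nf w k))"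
  unfolding rf(2) using w k F by (simp add: rec_start_def nf_pairJ nf_App)
 assume n: "n \<in> N w"
 let ?p = "f2 w pr_pair (ap w ?d n) n"
 have p: "?p \<in> N w" using w d n by simp
 have "ap w ?d (Sw w n) = nf w (sub_trm (?p ## k ## rh) (be ## al ## th) rec_step)"
  unfolding rf(3)[OF n] by (rule ap_beta[OF w e rec_terms(2) p])
 also have "... = Jw w (Sw w (Kw w (ap w ?d n))) (ap w be (Jw w (Jw w (nf w k) (Kw w (ap w ?d n))) (Lw w (ap w ?d n))))"
  using w k F p n d val_pair[of w "ap w ?d n" n] by (simp add: rec_step_def nf_pairJ nf_App nf_idem Let_def)
 finally show "ap w ?d (Sw w n) = Jw w (Sw w (Kw w (ap w ?d n))) (ap w be (Jw w (Jw w (nf w k) (Kw w (ap w ?d n))) (Lw w (ap w ?d n))))" .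
qed

text \<open>The first component starts at 0 and grows by one at each step, so it always equals the
  argument that the recursor itself does not reveal.\<close>

lemma K_rec_fun:
 assumes w: "W w" and e: "en w (k ## rh) (be ## al ## th)" and k: "k \<in> Tm w" and n: "n \<in> N w"
 shows "Kw w (ap w (rec_fun (k ## rh) (be ## al ## th)) n) = n"
proof -
 let ?R = "Rec (ren_trm Suc id rec_start) (ren_fnl Suc id (Lam rec_step)) (Var 0)" and ?d = "rec_fun (k ## rh) (be ## al ## th)"
 have R: "?R \<in> Ter" by (simp add: ren_terms ren_functors del: ren_fnl.simps)
 have v: "nf w (sub_trm (a ## k ## rh) (be ## al ## th) (projK ?R)) = Kw w (ap w ?d a)"
  if "W w" "en w (k ## rh) (be ## al ## th)" "a \<in> N w" for w a
 proof -
  have "sub_trm (a ## k ## rh) (be ## al ## th) ?R \<in> Tm w" by (rule sub_T[OF env_consN[OF that(2)] R]) (use that in simp)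
  thus ?thesis using ap_beta[OF that(1,2) R that(3)] that by (simp add: nf_App rec_fun_def del: sub_fnl.simps(3) sub_trm.simps(4))
 qed
 have "nf w (sub_trm (n ## k ## rh) (be ## al ## th) (projK ?R)) = nf w (sub_trm (n ## k ## rh) (be ## al ## th) (Var 0))"
 proof (rule eq_induct[OF w e])
  have "ap w al (nf w k) \<in> N w" using env_F[OF e, of 1] w k by simp
  thus "nf w (sub_trm (zw w ## k ## rh) (be ## al ## th) (projK ?R)) = nf w (sub_trm (zw w ## k ## rh) (be ## al ## th) (Var 0))"
   using v[OF w e, of "zw w"] rec_fun(2)[OF w e k] w by (simp add: bim_const_eqs nf_idem)
 next
  fix w' a assume w': "W w'" "w << w'" and a: "a \<in> N w'" and e': "en w' (k ## rh) (be ## al ## th)"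
   and IH: "nf w' (sub_trm (a ## k ## rh) (be ## al ## th) (projK ?R)) = nf w' (sub_trm (a ## k ## rh) (be ## al ## th) (Var 0))"
  have k': "k \<in> Tm w'" using k w' T_mono by blast
  have F: "be \<in> Fu w'" "?d \<in> Fu w'" using env_F[OF e', of 0] rec_fun(1)[OF w' (1) e' k'] by simp_all
  have "Kw w' (ap w' ?d a) = a" using IH v[OF w'(1) e' a] a w' by (simp add: nf_idem)
  thus "nf w' (sub_trm (Sw w' a ## k ## rh) (be ## al ## th) (projK ?R)) = nf w' (sub_trm (Sw w' a ## k ## rh) (be ## al ## th) (Var 0))"
   using v[OF w'(1) e', of "Sw w' a"] rec_fun(3)[OF w'(1) e' k' a] w' a F k' by (simp add: bim_const_eqs nf_idem)
 qed (use R n in simp_all)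
 thus ?thesis using v[OF w e n] w n by (simp add: nf_idem)
qed

lemma sat_primitive_recursion: assumes w: "W w" and e: "en w rh th" shows "sat w rh th bim_primitive_recursion"
 unfolding bim_primitive_recursion_def
proof (rule sat_AllFAllFExF[OF w e])
 let ?A = "And (Eq (App (FVar 0) (pairJ (Var 1) zero)) (App (FVar 2) (Var 1)))
      (Eq (App (FVar 0) (pairJ (Var 1) (suc (Var 0))))
        (App (FVar 1) (pairJ (pairJ (Var 1) (Var 0)) (App (FVar 0) (pairJ (Var 1) (Var 0))))))"
 show AA: "AllN (AllN ?A) \<in> fmls Sy" by simp
 fix w al be assume w: "W w" and F: "al \<in> Fu w" "be \<in> Fu w" and e: "en w rh (be ## al ## th)"
 let ?R = "Rec (ren_trm Suc id rec_start) (ren_fnl Suc id (Lam rec_step)) (Var 0)" and ?d = "%k. rec_fun (k ## rh) (be ## al ## th)"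
 \<comment> \<open>BIM asks for a function of the single number \<open>J(k, n)\<close>: the
   recursion variable becomes its second projection and the parameter its first.\<close>
 let ?s = "%i. case i of 0 => projL (Var 0) | Suc j => (case j of 0 => projK (Var 0) | Suc m => Var (Suc m))"
 have R: "?R \<in> Ter" by (simp add: ren_terms ren_functors del: ren_fnl.simps)
 have t: "projL (sub_trm ?s FVar ?R) \<in> Ter"
  using sub_terms[OF R, of ?s FVar] by (simp split: nat.split del: sub_trm.simps(4))
 let ?g = "sub_fnl rh (be ## al ## th) (Lam (projL (sub_trm ?s FVar ?R)))"
 have g: "?g \<in> Fu w" by (rule sub_F[OF e]) (use t in simp)
 have val: "ap w' ?g (Jw w' k n) = Lw w' (ap w' (?d k) n)" if w': "W w'" "w << w'" and kn: "k \<in> N w'" "n \<in> N w'" for w' k n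
 proof -
  note e' = env_mono[OF e w'(2)]
  let ?z = "Jw w' k n"
  have z: "?z \<in> N w'" using w' kn by simp
  have ek: "en w' (k ## rh) (be ## al ## th)" "en w' (n ## k ## rh) (be ## al ## th)" using e' kn w' by (intro env_consN; simp)+
  let ?r = "projL ?z ## projK ?z ## rh"
  have er: "en w' ?r (be ## al ## th)" using e' z w' by (intro env_consN) simp_all
  have RT: "sub_trm ?r (be ## al ## th) ?R \<in> Tm w'" by (rule sub_T[OF er R])
  have s: "sub_trm (?z ## rh) (be ## al ## th) (sub_trm ?s FVar ?R) = sub_trm ?r (be ## al ## th) ?R"
  proof -
   have "sub_trm (?z ## rh) (be ## al ## th) \<circ> ?s = ?r" by (rule ext) (simp split: nat.split)
   moreover have "sub_fnl (?z ## rh) (be ## al ## th) \<circ> FVar = be ## al ## th" by (rule ext) simp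
   ultimately show ?thesis by (simp only: sub_sub)
  qed
  have c: "nf w' (sub_trm ?r (be ## al ## th) ?R) = nf w' (sub_trm (n ## k ## rh) (be ## al ## th) ?R)"
   by (rule nf_cong[OF w'(1) er ek(2) _ R])
    (use w' kn z in "simp add: nf_App nf_idem bim_const_eqs split: nat.split")
  have "ap w' ?g ?z = nf w' (sub_trm (?z ## rh) (be ## al ## th) (projL (sub_trm ?s FVar ?R)))" by (rule ap_beta[OF w'(1) e' t z])
  also have "... = nf w' (projL (sub_trm ?r (be ## al ## th) ?R))" unfolding sub_trm.simps(3) s by (simp del: sub_trm.simps(4))
  also have "... = Lw w' (nf w' (sub_trm ?r (be ## al ## th) ?R))" by (rule nf_App[OF w'(1) bim_F(4) RT])
  also have "... = Lw w' (ap w' (?d k) n)" unfolding c using ap_beta[OF w'(1) ek(1) R kn(2)] by (simp only: rec_fun_def)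
  finally show ?thesis .
 qed
 show "\<exists>ga\<in>Fu w. sat w rh (ga ## be ## al ## th) (AllN (AllN ?A))"
 proof (rule bexI[OF _ g])
  have eg: "en w rh (?g ## be ## al ## th)" by (rule env_consF[OF e g])
  have main: "sat w2 (n ## k ## rh) (?g ## be ## al ## th) ?A" if w1: "W w1" "w << w1" "k \<in> N w1" and w2: "W w2" "w1 << w2" "n \<in> N w2" for w1 w2 k n
  proof -
   have le: "w << w2" using w1 w2 wle_trans by blast
   have kT: "k \<in> Tm w2" using T_mono[OF w2(2) N_T[OF w1(1,3)]] .
   let ?k = "nf w2 k"
   have k: "?k \<in> N w2" using kT by simp
   have ek: "en w2 (?k ## rh) (be ## al ## th)" by (rule env_consN[OF env_mono[OF e le]]) (use w2 k in simp)
   have kT': "?k \<in> Tm w2" using w2 kT by simp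
   have F2: "al \<in> Fu w2" "be \<in> Fu w2" "?g \<in> Fu w2" using F g F_mono[OF le] by blast+
   have eA: "en w2 (n ## k ## rh) (?g ## be ## al ## th)" by (intro env_consN env_mono[OF eg le] kT) (use w2 in simp)
   have kk: "nf w2 ?k = ?k" using nf_idem[OF w2(1) k] .
   have D: "?d ?k \<in> Fu w2" by (rule rec_fun(1)[OF w2(1) ek kT'])
   have z: "zw w2 \<in> N w2" by simp
   have 0: "ap w2 ?g (Jw w2 ?k (zw w2)) = ap w2 al ?k"
    unfolding val[OF w2(1) le k z] rec_fun(2)[OF w2(1) ek kT'] kk using w2 k F2 by (simp add: bim_const_eqs)
   have S: "ap w2 ?g (Jw w2 ?k (Sw w2 n)) = ap w2 be (Jw w2 (Jw w2 ?k n) (ap w2 ?g (Jw w2 ?k n)))"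
    unfolding val[OF w2(1) le k ap_N[OF w2(1) Succ_F w2(3)]] val[OF w2(1) le k w2(3)]
     rec_fun(3)[OF w2(1) ek kT' w2(3)] kk K_rec_fun[OF w2(1) ek kT' w2(3)]
    using w2 k F2 D by (simp add: bim_const_eqs)
   have "sat w2 (n ## k ## rh) (?g ## be ## al ## th) ?A <->
    ap w2 ?g (Jw w2 ?k (zw w2)) = ap w2 al ?k \<and>
    ap w2 ?g (Jw w2 ?k (Sw w2 n)) = ap w2 be (Jw w2 (Jw w2 ?k n) (ap w2 ?g (Jw w2 ?k n)))"
    using w2 kT F2 eA
    by (simp add: sat_And[OF w2(1)] sat_Eq nf_App nf_pairJ nf_idem numeral_2_eq_2 del: sub_fnl.simps(3))
   thus ?thesis using 0 S by (simp only:)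
  qed
  have "sat w1 (k ## rh) (?g ## be ## al ## th) (AllN ?A)" if w1: "W w1" "w << w1" "k \<in> N w1" for w1 k
  proof -
   have e1: "en w1 (k ## rh) (?g ## be ## al ## th)" by (intro env_consN env_mono[OF eg w1(2)]) (use w1 in simp)
   have "?A \<in> fmls Sy" by simp
   thus ?thesis using sat_AllN'[OF w1(1) e1] main[OF w1] by blast
  qed
  moreover have "AllN ?A \<in> fmls Sy" by simp
  ultimately show "sat w rh (?g ## be ## al ## th) (AllN (AllN ?A))" using sat_AllN'[OF w eg] by blast
 qed
qed

end

section \<open>Eliminating the constants of BIM from EL\<close>

primrec el_sym :: "fsym => fsym" where
 "el_sym Zero = Zero"
| "el_sym ZeroFn = PR (Const 1 0)"
| "el_sym Ident = PR (Proj 1 0)"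
| "el_sym PairJ = PR pr_J"
| "el_sym ProjK = PR pr_K"
| "el_sym ProjL = PR pr_L"
| "el_sym (PR d) = PR d"

primrec el_trm :: "trm => trm" and el_fnl :: "fnl => fnl" where
 "el_trm (Var n) = Var n"
| "el_trm (Fn c ts) = Fn (el_sym c) (map el_trm ts)"
| "el_trm (App u t) = App (el_fnl u) (el_trm t)"
| "el_trm (Rec t u s) = Rec (el_trm t) (el_fnl u) (el_trm s)"
| "el_fnl (FVar n) = FVar n"
| "el_fnl (FC c) = FC (el_sym c)"
| "el_fnl (Lam t) = Lam (el_trm t)"

primrec el_fm :: "fm => fm" where
 "el_fm (Eq s t) = Eq (el_trm s) (el_trm t)"
| "el_fm Bot = Bot"
| "el_fm (And A B) = And (el_fm A) (el_fm B)"
| "el_fm (Or A B) = Or (el_fm A) (el_fm B)"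
| "el_fm (Imp A B) = Imp (el_fm A) (el_fm B)"
| "el_fm (AllN A) = AllN (el_fm A)"
| "el_fm (ExN A) = ExN (el_fm A)"
| "el_fm (AllF A) = AllF (el_fm A)"
| "el_fm (ExF A) = ExF (el_fm A)"

lemma el_trm_ren: "el_trm (ren_trm r q t) = ren_trm r q (el_trm t)" and el_fnl_ren: "el_fnl (ren_fnl r q u) = ren_fnl r q (el_fnl u)"
 by (induction t and u arbitrary: r q and r q) auto

lemma el_trm_sub: "el_trm (sub_trm sg ta t) = sub_trm (%i. el_trm (sg i)) (%i. el_fnl (ta i)) (el_trm t)"
 and el_fnl_sub: "el_fnl (sub_fnl sg ta u) = sub_fnl (%i. el_trm (sg i)) (%i. el_fnl (ta i)) (el_fnl u)"
proof (induction t and u arbitrary: sg ta and sg ta)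
 case (Lam t)
 have "(%i. el_trm (up_trm sg i)) = up_trm (%i. el_trm (sg i))" by (rule ext) (simp add: up_trm_def el_trm_ren split: nat.split)
 thus ?case by (simp add: Lam el_fnl_ren)
qed auto

lemma el_fm_sub: "el_fm (sub_fm sg ta A) = sub_fm (%i. el_trm (sg i)) (%i. el_fnl (ta i)) (el_fm A)"
proof (induction A arbitrary: sg ta)
 case (Eq s t) thus ?case by (simp add: el_trm_sub)
next
 have u: "(%i. el_trm (up_trm sg i)) = up_trm (%i. el_trm (sg i))" for sg by (rule ext) (simp add: up_trm_def el_trm_ren split: nat.split)
 have f: "(%i. el_fnl (up_fnl ta i)) = up_fnl (%i. el_fnl (ta i))" for ta by (rule ext) (simp add: up_fnl_def el_fnl_ren split: nat.split)
 {
  case (AllN A) thus ?case by (simp add: u el_fnl_ren)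
 next
  case (ExN A) thus ?case by (simp add: u el_fnl_ren)
 next
  case (AllF A) thus ?case by (simp add: f el_trm_ren)
 next
  case (ExF A) thus ?case by (simp add: f el_trm_ren)
 }
qed auto

lemma el_fm_lift: "el_fm (liftN A) = liftN (el_fm A)" "el_fm (liftF A) = liftF (el_fm A)"
 by (simp_all add: el_fm_sub)

lemma el_trm_cons: "(%n. el_trm (case n of 0 => t | Suc m => f m)) = el_trm t ## (%m. el_trm (f m))"
 and el_fnl_cons: "(%n. el_fnl (case n of 0 => u | Suc m => g m)) = el_fnl u ## (%m. el_fnl (g m))"
 by (rule ext, simp split: nat.split)+

lemma el_fm_inst: "el_fm (instN t A) = instN (el_trm t) (el_fm A)" "el_fm (instF u A) = instF (el_fnl u) (el_fm A)" "el_trm (inst_trm t s) = inst_trm (el_trm t) (el_trm s)"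
proof -
 have e: "(%m. el_fnl (FVar m)) = FVar" "(%m. el_trm (Var m)) = Var" by (rule ext, simp)+
 show "el_fm (instN t A) = instN (el_trm t) (el_fm A)" unfolding instN_def el_fm_sub el_trm_cons e ..
 show "el_fm (instF u A) = instF (el_fnl u) (el_fm A)" unfolding instF_def el_fm_sub el_fnl_cons e ..
 show "el_trm (inst_trm t s) = inst_trm (el_trm t) (el_trm s)" unfolding inst_trm_def el_trm_sub el_trm_cons e ..
qed

lemma el_sym_arity: "has_arity c n ==> has_arity (el_sym c) n"
 by (cases c) (auto simp: numeral_2_eq_2)

lemma ha1_simps [simp]: "LamSym \<in> ha1_language" "RecSym \<in> ha1_language" "Sym Zero \<in> ha1_language"
 by (simp_all add: ha1_language_def)

lemma PR_ha1: "describes d n ==> Sym (PR d) \<in> ha1_language"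
 by (auto simp: ha1_language_def)

lemma PR_ha1' [simp]:
 "describes d (Suc 0) ==> Sym (PR d) \<in> ha1_language" "describes d (Suc (Suc 0)) ==> Sym (PR d) \<in> ha1_language"
 by (rule PR_ha1, assumption)+

lemma el_sym_ha1: "Sym c \<in> joint_language ==> has_arity c n ==> Sym (el_sym c) \<in> ha1_language"
 using el_sym_arity[of c n] by (cases c) (auto simp: PR_ha1)

lemma el_trm_terms: "t \<in> terms joint_language ==> el_trm t \<in> terms ha1_language"
 and el_fnl_functors: "u \<in> functors joint_language ==> el_fnl u \<in> functors ha1_language"
 by (induction rule: terms_functors.inducts) (auto intro: el_sym_arity el_sym_ha1)

lemma joint_formulas: "formulas bim_language \<subseteq> formulas joint_language" "formulas ha1_language \<subseteq> formulas joint_language"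
 using formulas_mono[OF _ joint_sub(1)] formulas_mono[OF _ joint_sub(2)] by blast+

lemma el_fm_formulas: "A \<in> formulas joint_language ==> el_fm A \<in> formulas ha1_language"
 by (induction rule: formulas.induct) (auto intro: el_trm_terms)

lemma el_sym_id: "Sym c \<in> ha1_language ==> el_sym c = c"
 by (cases c) (auto simp: ha1_language_def)

lemma el_trm_id: "t \<in> terms ha1_language ==> el_trm t = t" and el_fnl_id: "u \<in> functors ha1_language ==> el_fnl u = u"
 by (induction rule: terms_functors.inducts) (auto simp: el_sym_id intro!: map_idI)

lemma el_fm_id: "A \<in> formulas ha1_language ==> el_fm A = A"
 by (induction rule: formulas.induct) (auto simp: el_trm_id)

lemma el_fm_quantifier_free [simp]: "quantifier_free (el_fm A) = quantifier_free A"
 by (induction A) auto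

lemma el_fm_deriv:
 assumes "deriv S Ga A" and S: "lang S = joint_language" and ax: "\<And>A. A \<in> axs S ==> A \<in> fmls S ==> deriv EL {} (el_fm A)"
 shows "deriv EL (el_fm ` Ga) (el_fm A)"
proof -
 have f: "\<And>A. A \<in> fmls S ==> el_fm A \<in> fmls EL" "\<And>t. t \<in> terms (lang S) ==> el_trm t \<in> terms (lang EL)"
  "\<And>u. u \<in> functors (lang S) ==> el_fnl u \<in> functors (lang EL)"
  using S el_fm_formulas el_trm_terms el_fnl_functors by simp_all
 show ?thesis
  using assms(1)
proof (induction rule: deriv.induct)
 case (Axiom A Ga) show ?case by (rule weaken[OF ax[OF Axiom.hyps]]) simp
next
 case (Hyp A Ga) show ?case by (rule deriv.Hyp) (use Hyp.hyps f in simp_all)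
next
 case (BotE Ga A) show ?case unfolding el_fm.simps el_fm_inst by (rule deriv.BotE) (use BotE.IH BotE.hyps f in simp_all)
next
 case (AndI Ga A B) show ?case unfolding el_fm.simps el_fm_inst by (rule deriv.AndI) (use AndI.IH AndI.hyps f in simp_all)
next
 case (AndE1 Ga A B) show ?case unfolding el_fm.simps el_fm_inst by (rule deriv.AndE1[of _ _ _ "el_fm B"]) (use AndE1.IH AndE1.hyps f in simp_all)
next
 case (AndE2 Ga A B) show ?case unfolding el_fm.simps el_fm_inst by (rule deriv.AndE2[of _ _ "el_fm A"]) (use AndE2.IH AndE2.hyps f in simp_all)
next
 case (OrI1 Ga A B) show ?case unfolding el_fm.simps el_fm_inst by (rule deriv.OrI1) (use OrI1.IH OrI1.hyps f in simp_all)
next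
 case (OrI2 Ga B A) show ?case unfolding el_fm.simps el_fm_inst by (rule deriv.OrI2) (use OrI2.IH OrI2.hyps f in simp_all)
next
 case (OrE Ga A B C) show ?case unfolding el_fm.simps el_fm_inst by (rule deriv.OrE[of _ _ "el_fm A" "el_fm B"]) (use OrE.IH OrE.hyps f in simp_all)
next
 case (ImpI A Ga B) show ?case unfolding el_fm.simps el_fm_inst by (rule deriv.ImpI) (use ImpI.IH ImpI.hyps f in simp_all)
next
 case (ImpE Ga A B) show ?case unfolding el_fm.simps el_fm_inst by (rule deriv.ImpE[of _ _ "el_fm A"]) (use ImpE.IH ImpE.hyps f in simp_all)
next
 case (AllNI Ga A) thus ?case by (simp add: image_image el_fm_lift deriv.AllNI)
next
 case (AllNE Ga A t) show ?case unfolding el_fm.simps el_fm_inst by (rule deriv.AllNE) (use AllNE.IH AllNE.hyps f in simp_all)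
next
 case (ExNI Ga t A) show ?case unfolding el_fm.simps by (rule deriv.ExNI[of _ _ "el_trm t"]) (use ExNI.IH ExNI.hyps f in "simp_all add: el_fm_inst")
next
 case (ExNE Ga A C)
 show ?case by (rule deriv.ExNE[of _ _ "el_fm A"]) (use ExNE.IH ExNE.hyps f in "simp_all add: image_image el_fm_lift")
next
 case (AllFI Ga A) thus ?case by (simp add: image_image el_fm_lift deriv.AllFI)
next
 case (AllFE Ga A u) show ?case unfolding el_fm.simps el_fm_inst by (rule deriv.AllFE) (use AllFE.IH AllFE.hyps f in simp_all)
next
 case (ExFI Ga u A) show ?case unfolding el_fm.simps by (rule deriv.ExFI[of _ _ "el_fnl u"]) (use ExFI.IH ExFI.hyps f in "simp_all add: el_fm_inst")
next
 case (ExFE Ga A C)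
 show ?case by (rule deriv.ExFE[of _ _ "el_fm A"]) (use ExFE.IH ExFE.hyps f in "simp_all add: image_image el_fm_lift")
qed
qed

text \<open>The theory of all formulas whose translations EL proves. By \<open>EJ_deriv\<close> it
  is closed under derivation, so arguing in its worlds amounts to proving translations in EL, with
  J, K and L available as if they were primitive.\<close>

definition EJ :: fsystem where
 "EJ = \<lparr>lang = joint_language, axs = {A \<in> formulas joint_language. deriv EL {} (el_fm A)}\<rparr>"

lemma EJ_lang [simp]: "lang EJ = joint_language" by (simp add: EJ_def)

lemma EJ_deriv: "deriv EJ Ga A ==> deriv EL (el_fm ` Ga) (el_fm A)"
 by (rule el_fm_deriv) (auto simp: EJ_def)

lemma EJ_I: "A \<in> formulas joint_language ==> deriv EL {} (el_fm A) ==> A \<in> axs EJ"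
 by (simp add: EJ_def)

lemma EJ_axiom: "A \<in> formulas joint_language ==> el_fm A \<in> axs EL ==> A \<in> axs EJ"
 using el_fm_formulas by (auto simp: EJ_def intro: deriv.Axiom)

interpretation EL: ha EL
proof
 show "Sym Zero \<in> lang EL" "Sym (PR Succ) \<in> lang EL" by (auto simp: ha1_language_def intro: describes.intros)
qed (auto simp: EL_def HA1_def)

lemma joint_terms_simps [simp]:
 "Sym Zero \<in> joint_language" "Sym ZeroFn \<in> joint_language" "Sym Ident \<in> joint_language" "Sym PairJ \<in> joint_language"
 "Sym ProjK \<in> joint_language" "Sym ProjL \<in> joint_language" "Sym (PR Succ) \<in> joint_language"
 by (simp_all add: joint_language_def bim_language_def)

lemma joint_ha1_simps [simp]: "LamSym \<in> joint_language" "RecSym \<in> joint_language"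
 "describes d (Suc 0) ==> Sym (PR d) \<in> joint_language" "describes d (Suc (Suc 0)) ==> Sym (PR d) \<in> joint_language"
 by (simp_all add: joint_language_def)

lemma EL_pairing_axioms:
 assumes "A \<in> bim_constant_axioms \<union> cantor_pairing_axioms"
 shows "deriv EL {} (el_fm A)"
proof (rule completeness)
 have "A \<in> formulas bim_language" using assms by (auto simp: bim_constant_axioms_def cantor_pairing_axioms_def)
 hence "A \<in> formulas joint_language" using joint_formulas by blast
 thus "el_fm A \<in> fmls EL" by (simp add: el_fm_formulas)
 fix w rh th assume w: "EL.W w" and e: "EL.en w rh th"
 have T: "rh n \<in> EL.Tm w" for n using EL.env_T[OF e] .
 note [simp] = w T e EL.nf_idem
 have d: "describes (Const (Suc 0) 0) (Suc 0)" "describes (Proj (Suc 0) 0) (Suc 0)" by simp_all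
 have c: "EL.f1 w (Const (Suc 0) 0) a = EL.zw w" if "a \<in> EL.N w" for a
  using EL.ops_Const(1)[OF w that, of 0] by simp
 note eqs = EL.sat_Eq EL.nf_App EL.nf_Fn2 EL.KL_J EL.J_KL EL.Cantor_eqs(1)[OF w EL.zw_N[OF w] EL.zw_N[OF w]] EL.Cantor_eqs(2)[OF w EL.zw_N[OF w]] EL.Cantor_eqs(3) EL.Sw_inj EL.Sw_neq' c d
 consider "A \<in> bim_constant_axioms - {Neg (Eq (suc (Var 0)) zero), Imp (Eq (suc (Var 0)) (suc (Var 1))) (Eq (Var 0) (Var 1))}"
  | "A \<in> cantor_pairing_axioms"
  | "A = Neg (Eq (suc (Var 0)) zero)" | "A = Imp (Eq (suc (Var 0)) (suc (Var 1))) (Eq (Var 0) (Var 1))"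
  using assms by blast
 thus "sat w rh th (el_fm A)"
 proof cases
  case 1
  thus ?thesis by (auto simp: bim_constant_axioms_def eqs)
 next
  case 2
  thus ?thesis by (auto simp: cantor_pairing_axioms_def eqs)
 next
  case 3
  have "\<not> sat w' rh th (Eq (suc (Var 0)) zero)" if w': "EL.W w'" "w << w'" for w'
   using EL.env_T[OF env_mono[OF e w'(2)], of 0] w' env_mono[OF e w'(2)] by (simp add: EL.sat_Eq EL.nf_App EL.Sw_neq')
  thus ?thesis using 3 sat_Imp[OF w e, of "Eq (suc (Var 0)) zero" Bot] by simp
 next
  case 4
  have "sat w' rh th (Eq (Var 0) (Var 1))" if w': "EL.W w'" "w << w'" and "sat w' rh th (Eq (suc (Var 0)) (suc (Var 1)))" for w'
   using EL.env_T[OF env_mono[OF e w'(2)], of 0] EL.env_T[OF env_mono[OF e w'(2)], of 1] that env_mono[OF e w'(2)]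
   by (simp add: EL.sat_Eq EL.nf_App EL.Sw_inj)
  thus ?thesis using 4 sat_Imp[OF w e, of "Eq (suc (Var 0)) (suc (Var 1))" "Eq (Var 0) (Var 1)"] by simp
 qed
qed simp_all

lemma defining_ha1: "A \<in> defining_equations ==> A \<in> formulas ha1_language"
proof -
 have P: "apply_const (PR d) ts \<in> terms ha1_language" if "describes d (length ts)" "\<And>t. t \<in> set ts ==> t \<in> terms ha1_language" for d ts
  by (rule EL.apply_terms[unfolded lang_axs]) (use that in auto)
 have [simp]: "numeral_trm q \<in> terms ha1_language" for q using EL.numeral_terms' by simp
 have S: "suc (Var 0) \<in> terms ha1_language" using EL.zero_succ by simp
 have V: "describes d n ==> apply_const (PR d) (map Var [0..<n]) \<in> terms ha1_language"
  "describes d n ==> apply_const (PR d) (map Var [1..<n + 1]) \<in> terms ha1_language" for d n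
  by (auto intro!: P simp del: upt_Suc)
 assume "A \<in> defining_equations"
 thus ?thesis
 proof cases
  case (3 n g hs)
  hence "describes g (length hs)" "\<And>h. h \<in> set hs ==> describes h n" by auto
  thus ?thesis using 3 V by (auto intro!: P)
 next
  case (6 g h n)
  hence "describes g n" by (auto simp: describes_RecP)
  thus ?thesis using 6 V by (auto intro!: P simp del: upt_Suc)
 next
  case (7 g h n)
  hence "describes h (n + 2)" by (auto simp: describes_RecP)
  thus ?thesis using 7 V S by (auto intro!: P simp del: upt_Suc)
 qed (use S in "auto intro!: P simp: numeral_2_eq_2")
qed

text \<open>The translation commutes with substitution; so it maps each instance of an axiom schema
  of the joint language to an instance of the same schema of EL.\<close>

interpretation EJ: bimch EJ
proof
 show "Sym Zero \<in> lang EJ" "Sym (PR Succ) \<in> lang EJ" "bim_language \<subseteq> lang EJ" "ha1_language \<subseteq> lang EJ" using joint_sub by auto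
 have EL: "lambda_axioms ha1_language \<subseteq> axs EL" "recursor_axioms ha1_language \<subseteq> axs EL" "equality_axioms ha1_language \<subseteq> axs EL"
  "induction_axioms ha1_language \<subseteq> axs EL" "defining_equations \<subseteq> axs EL" "Neg (Eq (suc zero) zero) \<in> axs EL"
  using EL.lambda EL.recursor EL.equality EL.induction EL.defining EL.one_neq_zero by auto
 have fm: "formulas ha1_language \<subseteq> formulas joint_language" by (rule joint_formulas)
 have id: "A \<in> axs EJ" if "A \<in> formulas ha1_language" "A \<in> axs EL" for A
  using that fm el_fm_id by (intro EJ_axiom) auto
 show "bim_constant_axioms \<subseteq> axs EJ"
  using EL_pairing_axioms bim_axioms_formulas joint_formulas by (auto intro!: EJ_I)
 show "defining_equations \<subseteq> axs EJ" using id EL(5) defining_ha1 by blast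
 show "Neg (Eq (suc zero) zero) \<in> axs EJ" by (rule id) (use EL in "auto simp: ha1_language_def")
 show "equality_axioms (lang EJ) \<subseteq> axs EJ"
 proof
  fix A assume "A \<in> equality_axioms (lang EJ)"
  then consider "A = Eq (Var 0) (Var 0)" | B i j where "B \<in> formulas joint_language" "A = Imp (And (instN (Var i) B) (Eq (Var i) (Var j))) (instN (Var j) B)"
   by (auto simp: equality_axioms_def)
  thus "A \<in> axs EJ"
  proof cases
   case 1 thus ?thesis using EL(3) by (intro EJ_axiom) (auto simp: equality_axioms_def)
  next
   case 2
   hence "el_fm A \<in> equality_axioms ha1_language" using el_fm_formulas[OF 2(1)] by (auto simp: equality_axioms_def el_fm_inst)
   thus ?thesis using EL(3) 2 by (intro EJ_axiom) (auto intro!: instN_formulas)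
  qed
 qed
 show "induction_axioms (lang EJ) \<subseteq> axs EJ"
 proof
  fix A assume "A \<in> induction_axioms (lang EJ)"
  then obtain B where B: "B \<in> formulas joint_language" "A = Imp (And (instN zero B)
       (AllN (Imp B (sub_fm (%n. case n of 0 => suc (Var 0) | Suc m => Var (Suc m)) FVar B)))) (AllN B)"
   by (auto simp: induction_axioms_def)
  have "(%n. el_trm (case n of 0 => suc (Var 0) | Suc m => Var (Suc m))) = (%n. case n of 0 => suc (Var 0) | Suc m => Var (Suc m))"
   by (rule ext) (simp split: nat.split)
  hence "el_fm A \<in> induction_axioms ha1_language"
   using el_fm_formulas[OF B(1)] unfolding B(2) by (auto simp: induction_axioms_def el_fm_inst el_fm_sub)
  moreover have "A \<in> formulas joint_language" using B by (auto intro!: instN_formulas sub_formulas[OF B(1)] split: nat.split)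
  ultimately show "A \<in> axs EJ" using EL(4) by (intro EJ_axiom) auto
 qed
 show "lambda_axioms (lang EJ) \<subseteq> axs EJ"
 proof
  fix A assume "A \<in> lambda_axioms (lang EJ)"
  then obtain t s where A: "A = Eq (App (Lam t) s) (inst_trm s t)" "t \<in> terms joint_language" "s \<in> terms joint_language"
   by (auto simp: lambda_axioms_def)
  hence "el_fm A \<in> lambda_axioms ha1_language" by (auto simp: lambda_axioms_def el_fm_inst intro: el_trm_terms)
  moreover have "inst_trm s t \<in> terms joint_language" unfolding inst_trm_def by (rule sub_terms[OF A(2)]) (use A in "auto split: nat.split")
  hence "A \<in> formulas joint_language" using A by simp
  ultimately show "A \<in> axs EJ" using EL(1) by (intro EJ_axiom) auto
 qed
 show "recursor_axioms (lang EJ) \<subseteq> axs EJ"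
 proof
  fix A assume "A \<in> recursor_axioms (lang EJ)"
  then obtain t u s where A: "A = Eq (Rec t u zero) t \<or> A = Eq (Rec t u (suc s)) (App u (apply_const (PR pr_pair) [Rec t u s, s]))"
   "t \<in> terms joint_language" "u \<in> functors joint_language" "s \<in> terms joint_language \<or> s = zero"
   by (auto simp: recursor_axioms_def)
  hence s: "s \<in> terms joint_language" by auto
  have "el_fm A \<in> recursor_axioms ha1_language" using A el_trm_terms[OF A(2)] el_fnl_functors[OF A(3)] el_trm_terms[OF s]
   by (auto simp: recursor_axioms_def apply_const_2)
  moreover have "A \<in> formulas joint_language" using A s describes_pair
   by (auto simp: apply_const_2 numeral_2_eq_2)
  ultimately show "A \<in> axs EJ" using EL(2) by (intro EJ_axiom) auto
 qed
qed

text \<open>Completeness makes a valid formula derivable in \<open>EJ\<close>, and closure under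
  derivation makes it an axiom. In this way \<open>EJ\<close> satisfies the assumptions of stronger
  and stronger locales.\<close>

lemma EJ_valid: "A \<in> formulas joint_language ==> (\<And>w rh th. EJ.W w ==> EJ.en w rh th ==> sat w rh th A) ==> A \<in> axs EJ"
 using EJ_deriv[of "{}" A] completeness[of "{}" EJ A] by (auto intro!: EJ_I)

lemma bim_joint: "bim_constant_axioms \<union> {bim_composition, bim_pairing, bim_primitive_recursion, bim_unbounded_search} \<subseteq> formulas joint_language"
 using bim_axioms_formulas joint_formulas by blast

interpretation EJ: bimha EJ
proof
 show "{bim_composition, bim_pairing, bim_primitive_recursion} \<subseteq> axs EJ"
  using EJ_valid[OF _ EJ.sat_composition] EJ_valid[OF _ EJ.sat_pairing] EJ_valid[OF _ EJ.sat_primitive_recursion] bim_joint by simp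
qed

section \<open>Unbounded search from quantifier-free choice\<close>

locale bimhaq = bimha +
 assumes qf: "qf_ac00 (lang Sy) \<subseteq> axs Sy"
begin

text \<open>Bounded minimization: \<open>M(a, n)\<close> starts at 0 and moves up by one in each
  round until it meets a zero of \<open>al\<close>. After \<open>b(a)\<close> rounds, with
  \<open>b(a)\<close> known to be a zero, it has reached the least one. That \<open>n\<close> is not
  below the value is stated through addition.\<close>

lemma least_functor:
 assumes w: "W w" and F: "al \<in> Fu w" "b \<in> Fu w"
  and b: "\<And>w' a. W w' ==> w << w' ==> a \<in> N w' ==> ap w' al (Jw w' a (ap w' b a)) = zw w'"
 shows "\<exists>ga\<in>Fu w. \<forall>w'. W w' --> w << w' --> (\<forall>a\<in>N w'. ap w' al (Jw w' a (ap w' ga a)) = zw w' \<and>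
  (\<forall>n\<in>N w'. \<forall>k\<in>N w'. ap w' al (Jw w' a n) = zw w' --> ap w' ga a \<noteq> f2 w' pr_add (Sw w' k) n))"
proof -
 have "rp w (%w' x. Sw w' (Lw w' x))" by (intro rp_ap[OF w] rp_fun bim_F Succ_F)
 from case_fun[OF w rp_id[OF w] this] obtain ze where ze: "ze \<in> Fu w" "\<forall>w'. W w' --> w << w' --> (\<forall>x\<in>N w'. ap w' ze (Jw w' (zw w') x) = x \<and>
  (\<forall>y\<in>N w'. ap w' ze (Jw w' (Sw w' y) x) = Sw w' (Lw w' (Jw w' y x))))" by (elim bexE)
 have "rp w (%w' x. ap w' ze (Jw w' (ap w' al (Jw w' (Kw w' (Kw w' x)) (Lw w' x))) (Lw w' x)))"
  by (intro rp_pair[OF w] rp_ap[OF w] rp_id[OF w] bim_F F ze)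
 then obtain be where be: "be \<in> Fu w" "agree w be (%w' x. ap w' ze (Jw w' (ap w' al (Jw w' (Kw w' (Kw w' x)) (Lw w' x))) (Lw w' x)))"
  unfolding rp_def by (elim bexE)
 obtain M where M: "M \<in> Fu w" "\<forall>w'. W w' --> w << w' --> (\<forall>a\<in>N w'. ap w' M (Jw w' a (zw w')) = ap w' (FC ZeroFn) a \<and>
  (\<forall>b\<in>N w'. ap w' M (Jw w' a (Sw w' b)) = ap w' be (Jw w' (Jw w' a b) (ap w' M (Jw w' a b)))))"
  using closure_primrec[OF w bim_F(1) be(1)] by (elim bexE)
 have up: "al \<in> Fu w'" "b \<in> Fu w'" "M \<in> Fu w'" "ze \<in> Fu w'" if "w << w'" for w' using F M(1) ze(1) F_mono[OF that] by blast+
 have M0: "ap w' M (Jw w' a (zw w')) = zw w'" if "W w'" "w << w'" "a \<in> N w'" for w' a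
  using M(2) that by (simp add: bim_const_eqs)
 have MS: "ap w' M (Jw w' a (Sw w' n)) = ap w' ze (Jw w' (ap w' al (Jw w' a (ap w' M (Jw w' a n)))) (ap w' M (Jw w' a n)))"
  if "W w'" "w << w'" "a \<in> N w'" "n \<in> N w'" for w' a n
  using M(2) agreeD[OF be(2) that(1,2), of "Jw w' (Jw w' a n) (ap w' M (Jw w' a n))"] up[OF that(2)] that by (simp add: bim_const_eqs)
 have MS1: "ap w' M (Jw w' a (Sw w' n)) = ap w' M (Jw w' a n)"
  if "W w'" "w << w'" "a \<in> N w'" "n \<in> N w'" "ap w' al (Jw w' a (ap w' M (Jw w' a n))) = zw w'" for w' a n
  using MS[OF that(1-4)] ze(2) up[OF that(2)] that by simp
 have MS2: "ap w' M (Jw w' a (Sw w' n)) = Sw w' (ap w' M (Jw w' a n))"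
  if "W w'" "w << w'" "a \<in> N w'" "n \<in> N w'" "ap w' al (Jw w' a (ap w' M (Jw w' a n))) \<noteq> zw w'" for w' a n
 proof -
  have m: "ap w' M (Jw w' a n) \<in> N w'" "ap w' al (Jw w' a (ap w' M (Jw w' a n))) \<in> N w'" using up[OF that(2)] that by simp_all
  note w1 = that(1) and ne = that(5)
  obtain y where "y \<in> N w'" "ap w' al (Jw w' a (ap w' M (Jw w' a n))) = Sw w' y"
   using zero_or_suc[OF w1 m(2)] ne by auto
  thus ?thesis using MS[OF that(1-4)] ze(2) that m by (simp add: bim_const_eqs)
 qed
 define th where "th = al ## M ## (%_::nat. FC ZeroFn)"
 have eth: "en w (%_::nat. zero) th" using F M by (auto simp: env_def th_def split: nat.split)
 \<comment> \<open>Either a zero has been met, or \<open>M\<close> has moved in every round. At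
   \<open>n = b(a)\<close> both cases yield a zero.\<close>
 have inv1: "ap w' al (Jw w' a (ap w' M (Jw w' a n))) = zw w' \<or> ap w' M (Jw w' a n) = n"
  if w': "W w'" "w << w'" and a: "a \<in> N w'" and n: "n \<in> N w'" for w' a n
 proof -
  let ?m = "App (FVar 1) (pairJ (Var 1) (Var 0))" and ?rh = "a ## (%_::nat. zero)"
  let ?A = "Or (Eq (App (FVar 0) (pairJ (Var 1) ?m)) zero) (Eq ?m (Var 0))"
  have e: "en w' ?rh th" by (intro env_consN env_mono[OF eth w'(2)]) (use a w' in simp)
  have v: "sat w2 (c ## ?rh) th ?A <-> ap w2 al (Jw w2 (nf w2 a) (ap w2 M (Jw w2 (nf w2 a) c))) = zw w2 \<or> ap w2 M (Jw w2 (nf w2 a) c) = c"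
   if w2: "W w2" "w' << w2" and c: "c \<in> N w2" for w2 c
  proof -
   have le: "w << w2" using w' w2 wle_trans by blast
   have aT: "a \<in> Tm w2" by (rule T_mono[OF w2(2) N_T[OF w'(1) a]])
   have e2: "en w2 (c ## ?rh) th" by (intro env_consN env_mono[OF e w2(2)]) (use c w2 in simp)
   show ?thesis using w2 c aT up[OF le] e2 by (simp add: sat_Or sat_Eq nf_App nf_pairJ nf_idem th_def)
  qed
  have "sat w' (n ## ?rh) th ?A"
  proof (rule induct_sat[OF w'(1) e _ _ _ w'(1) wle_refl n])
   show "?A \<in> fmls Sy" by simp
   show "sat w' (zw w' ## ?rh) th ?A" using v[OF w'(1) wle_refl, of "zw w'"] M0[OF w' a] w' a by (simp add: nf_idem)
  next
   fix w2 c assume w2: "W w2" "w' << w2" and c: "c \<in> N w2" and IH: "sat w2 (c ## ?rh) th ?A"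
   have le: "w << w2" using w' w2 wle_trans by blast
   have a2: "nf w2 a \<in> N w2" by (rule nf_N[OF T_mono[OF w2(2) N_T[OF w'(1) a]]])
   have Sc: "Sw w2 c \<in> N w2" using w2 c by simp
   show "sat w2 (Sw w2 c ## ?rh) th ?A"
    unfolding v[OF w2 Sc]
    using IH[unfolded v[OF w2 c]] MS1[OF w2(1) le a2 c] MS2[OF w2(1) le a2 c] by metis
  qed
  thus ?thesis using v[OF w'(1) wle_refl n] w' a by (simp add: nf_idem)
 qed
 \<comment> \<open>\<open>M\<close> never passes a zero \<open>n\<close>: in terms of truncated
   subtraction, \<open>n\<close> equals \<open>(n - M) + M\<close>.\<close>
 have inv2: "n = f2 w' pr_add (f2 w' pr_sub (ap w' M (Jw w' a c)) n) (ap w' M (Jw w' a c))"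
  if w': "W w'" "w << w'" and a: "a \<in> N w'" "n \<in> N w'" "c \<in> N w'" and n: "ap w' al (Jw w' a n) = zw w'" for w' a n c
 proof -
  let ?m = "App (FVar 1) (pairJ (Var 2) (Var 0))" and ?rh = "n ## a ## (%_::nat. zero)"
  let ?t = "Fn (PR pr_add) [Fn (PR pr_sub) [?m, Var 1], ?m]"
  have e: "en w' ?rh th" by (intro env_consN env_mono[OF eth w'(2)]) (use a w' in simp_all)
  have v: "nf w2 (sub_trm (d ## ?rh) th (Var 1)) = nf w2 n"
   "nf w2 (sub_trm (d ## ?rh) th ?t) = f2 w2 pr_add (f2 w2 pr_sub (ap w2 M (Jw w2 (nf w2 a) d)) (nf w2 n)) (ap w2 M (Jw w2 (nf w2 a) d))"
   if w2: "W w2" "w' << w2" and d: "d \<in> N w2" for w2 d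
  proof -
   have le: "w << w2" using w' w2 wle_trans by blast
   have T: "a \<in> Tm w2" "n \<in> Tm w2" by (rule T_mono[OF w2(2) N_T[OF w'(1) a(1)]], rule T_mono[OF w2(2) N_T[OF w'(1) a(2)]])
   show "nf w2 (sub_trm (d ## ?rh) th (Var 1)) = nf w2 n" by simp
   show "nf w2 (sub_trm (d ## ?rh) th ?t) = f2 w2 pr_add (f2 w2 pr_sub (ap w2 M (Jw w2 (nf w2 a) d)) (nf w2 n)) (ap w2 M (Jw w2 (nf w2 a) d))"
    using w2 d T up[OF le] by (simp add: nf_App nf_pairJ nf_Fn2 nf_idem th_def numeral_2_eq_2)
  qed
  have "nf w' (sub_trm (c ## ?rh) th (Var 1)) = nf w' (sub_trm (c ## ?rh) th ?t)"
  proof (rule eq_induct[OF w'(1) e _ _ _ _ a(3)])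
   show "nf w' (sub_trm (zw w' ## ?rh) th (Var 1)) = nf w' (sub_trm (zw w' ## ?rh) th ?t)"
    unfolding v[OF w'(1) wle_refl zw_N[OF w'(1)]] using w' a M0[OF w' a(1)] by (simp add: nf_idem rec_simps add_laws(1))
  next
   fix w2 d assume w2: "W w2" "w' << w2" and d: "d \<in> N w2"
    and IH: "nf w2 (sub_trm (d ## ?rh) th (Var 1)) = nf w2 (sub_trm (d ## ?rh) th ?t)"
   have le: "w << w2" using w' w2 wle_trans by blast
   let ?a = "nf w2 a" and ?n = "nf w2 n" and ?r = "ap w2 M (Jw w2 (nf w2 a) d)"
   have N2: "?a \<in> N w2" "?n \<in> N w2"
    by (rule nf_N[OF T_mono[OF w2(2) N_T[OF w'(1) a(1)]]], rule nf_N[OF T_mono[OF w2(2) N_T[OF w'(1) a(2)]]])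
   have r: "?r \<in> N w2" using up[OF le] w2 N2 d by simp
   have n2: "ap w2 al (Jw w2 ?a ?n) = zw w2"
    using nf_up[OF w'(1) w2, of "App al (pairJ a n)"] nf_up[OF w'(1) w2 zero_T] n up[OF w'(2)] up[OF le] a w' w2 N2 T_mono[OF w2(2)]
    by (simp add: nf_App nf_pairJ nf_idem)
   have IH': "?n = f2 w2 pr_add (f2 w2 pr_sub ?r ?n) ?r" using IH unfolding v[OF w2 d] .
   have "?n = f2 w2 pr_add (f2 w2 pr_sub (ap w2 M (Jw w2 ?a (Sw w2 d))) ?n) (ap w2 M (Jw w2 ?a (Sw w2 d)))"
   proof (cases "ap w2 al (Jw w2 ?a ?r) = zw w2")
    case True
    thus ?thesis using MS1[OF w2(1) le N2(1) d] IH' by simp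
   next
    case False
    hence m: "ap w2 M (Jw w2 ?a (Sw w2 d)) = Sw w2 ?r" by (rule MS2[OF w2(1) le N2(1) d])
    have "?r \<noteq> ?n" using False n2 by auto
    hence "f2 w2 pr_sub ?r ?n \<noteq> zw w2" using IH' rec_simps(1)[OF w2(1) w2(1) r] by metis
    then obtain s where s: "s \<in> N w2" "f2 w2 pr_sub ?r ?n = Sw w2 s" using zero_or_suc[of w2 "f2 w2 pr_sub ?r ?n"] w2 r N2 by auto
    have n': "?n = f2 w2 pr_add s (Sw w2 ?r)" using IH' s w2 r by (simp add: rec_simps add_laws(2))
    hence "f2 w2 pr_sub (Sw w2 ?r) ?n = s" using sub_add[OF w2(1) _ s(1), of "Sw w2 ?r"] w2 r by simp
    thus ?thesis using n' m by simp
   qed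
   thus "nf w2 (sub_trm (Sw w2 d ## ?rh) th (Var 1)) = nf w2 (sub_trm (Sw w2 d ## ?rh) th ?t)"
    unfolding v[OF w2 ap_N[OF w2(1) Succ_F d]] .
  qed simp_all
  thus ?thesis unfolding v[OF w'(1) wle_refl a(3)] using w' a by (simp add: nf_idem)
 qed
 have "rp w (%w' a. ap w' M (Jw w' a (ap w' b a)))"
  by (intro rp_pair[OF w] rp_ap[OF w] rp_id[OF w] F M(1))
 then obtain ga where ga: "ga \<in> Fu w" "agree w ga (%w' a. ap w' M (Jw w' a (ap w' b a)))" unfolding rp_def by (elim bexE)
 show ?thesis
 proof (rule bexI[OF _ ga(1)], intro allI impI ballI conjI)
  fix w' a assume w': "W w'" "w << w'" and a: "a \<in> N w'"
  note g = agreeD[OF ga(2) w' a]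
  have bN: "ap w' b a \<in> N w'" using up[OF w'(2)] w' a by simp
  show "ap w' al (Jw w' a (ap w' ga a)) = zw w'" unfolding g using inv1[OF w' a bN] b[OF w' a] by auto
  fix n k assume nk: "n \<in> N w'" "k \<in> N w'" and 0: "ap w' al (Jw w' a n) = zw w'"
  show "ap w' ga a \<noteq> f2 w' pr_add (Sw w' k) n"
  proof
   assume eq: "ap w' ga a = f2 w' pr_add (Sw w' k) n"
   let ?r = "f2 w' pr_sub (f2 w' pr_add (Sw w' k) n) n"
   have r: "?r \<in> N w'" using w' nk by simp
   have "n = f2 w' pr_add ?r (f2 w' pr_add (Sw w' k) n)" using inv2[OF w' a nk(1) bN 0] g eq by simp
   also have "... = f2 w' pr_add (f2 w' pr_add ?r (Sw w' k)) n" by (rule add_laws(4)[symmetric]) (use w' r nk in simp_all)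
   also have "... = f2 w' pr_add (Sw w' (f2 w' pr_add ?r k)) n" using add_laws(2)[OF w'(1) r nk(2)] by simp
   finally have "n = f2 w' pr_add (Sw w' (f2 w' pr_add ?r k)) n" .
   hence "f2 w' pr_sub n n = Sw w' (f2 w' pr_add ?r k)" using sub_add[OF w'(1) nk(1), of "Sw w' (f2 w' pr_add ?r k)"] w' r nk by simp
   moreover have "f2 w' pr_sub n n = zw w'" using sub_add[OF w'(1) nk(1), of "zw w'"] w' nk by (simp add: rec_simps)
   ultimately show False using Sw_neq'[OF w'(1), of "f2 w' pr_add ?r k"] w' r nk by simp
  qed
 qed
qed

text \<open>By induction the function whose existence \<open>less_fm\<close> asserts is addition, so
  the formula has its arithmetical meaning.\<close>

lemma sat_less_D:
 assumes w: "W w" and e: "en w (n ## a ## rh) (ga ## th)" and na: "n \<in> N w" "a \<in> N w"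
  and less: "sat w (n ## a ## rh) (ga ## th) (less_fm (Var 0) (App (FVar 0) (Var 1)))"
 shows "\<exists>k\<in>N w. ap w ga a = f2 w pr_add (Sw w k) n"
proof -
 let ?r = "n ## a ## rh"
 let ?A = "And (Eq (App (FVar 0) (pairJ (Var 0) zero)) (Var 0))
            (AllN (Eq (App (FVar 0) (pairJ (Var 1) (suc (Var 0)))) (suc (App (FVar 0) (pairJ (Var 1) (Var 0))))))"
 let ?B = "Eq (App (FVar 0) (pairJ (Var 1) (suc (Var 0)))) (App (FVar 1) (Var 2))"
 have "sat w ?r (ga ## th) (ExF (And (AllN ?A) (ExN ?B)))"
  using less by (simp add: less_fm_def numeral_2_eq_2)
 from sat_ExF_D[OF this w e] obtain de where de: "de \<in> Fu w" "sat w ?r (de ## ga ## th) (And (AllN ?A) (ExN ?B))" by (elim bexE)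
 have e': "en w ?r (de ## ga ## th)" by (rule env_consF[OF e de(1)])
 have A: "sat w ?r (de ## ga ## th) (AllN ?A)" and B: "sat w ?r (de ## ga ## th) (ExN ?B)" using de(2) sat_And[OF w] by simp_all
 have ga: "ga \<in> Fu w" using env_F[OF e, of 0] by simp
 have B': "?B \<in> fmls Sy" by simp
 from B[unfolded sat_ExN'[OF w e' B']] obtain k where k: "k \<in> N w" "sat w (k ## ?r) (de ## ga ## th) ?B" by (elim bexE)
 have ek: "en w (k ## ?r) (de ## ga ## th)" by (rule env_consN[OF e']) (use w k in simp)
 have eq: "ap w de (Jw w n (Sw w k)) = ap w ga a"
  using k(2) w k na de(1) ga ek by (simp add: sat_Eq nf_App nf_pairJ nf_idem numeral_2_eq_2)
 have main: "ap w' de (Jw w' m (zw w')) = m \<and> ap w' de (Jw w' m (Sw w' j)) = Sw w' (ap w' de (Jw w' m j))"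
  if w': "W w'" "w << w'" and mj: "m \<in> N w'" "j \<in> N w'" for w' m j
 proof -
  have F: "de \<in> Fu w'" using F_mono[OF w'(2) de(1)] .
  have T: "m \<in> Tm w'" "j \<in> Tm w'" using w' mj by simp_all
  have e1: "en w' (m ## ?r) (de ## ga ## th)" by (rule env_consN[OF env_mono[OF e' w'(2)] T(1)])
  have e2: "en w' (j ## m ## ?r) (de ## ga ## th)" by (rule env_consN[OF e1 T(2)])
  have 1: "sat w' (m ## ?r) (de ## ga ## th) ?A" by (rule sat_AllN_D[OF A w e' w' T(1)])
  have 2: "sat w' (j ## m ## ?r) (de ## ga ## th) (Eq (App (FVar 0) (pairJ (Var 1) (suc (Var 0)))) (suc (App (FVar 0) (pairJ (Var 1) (Var 0)))))"
   by (rule sat_AllN_D[OF _ w'(1) e1 w'(1) wle_refl T(2)]) (use 1 sat_And[OF w'(1)] in simp)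
  have 3: "sat w' (m ## ?r) (de ## ga ## th) (Eq (App (FVar 0) (pairJ (Var 0) zero)) (Var 0))" using 1 sat_And[OF w'(1)] by simp
  show ?thesis using 2 3 w' mj F T e1 e2 by (simp add: sat_Eq nf_App nf_pairJ nf_idem)
 qed
 have add: "ap w de (Jw w n j) = f2 w pr_add j n" if j: "j \<in> N w" for j
 proof -
  let ?s = "App (FVar 0) (pairJ (Var 1) (Var 0))" and ?t = "Fn (PR pr_add) [Var 0, Var 1]"
  have v: "nf w2 (sub_trm (d ## ?r) (de ## ga ## th) ?s) = ap w2 de (Jw w2 (nf w2 n) d)" "nf w2 (sub_trm (d ## ?r) (de ## ga ## th) ?t) = f2 w2 pr_add d (nf w2 n)"
   if w2: "W w2" "w << w2" and d: "d \<in> N w2" for w2 d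
  proof -
   have "n \<in> Tm w2" "de \<in> Fu w2" using T_mono[OF w2(2) N_T[OF w na(1)]] F_mono[OF w2(2) de(1)] .
   thus "nf w2 (sub_trm (d ## ?r) (de ## ga ## th) ?s) = ap w2 de (Jw w2 (nf w2 n) d)" "nf w2 (sub_trm (d ## ?r) (de ## ga ## th) ?t) = f2 w2 pr_add d (nf w2 n)"
    using w2 d by (simp_all add: nf_App nf_pairJ nf_Fn2 nf_idem)
  qed
  have "nf w (sub_trm (j ## ?r) (de ## ga ## th) ?s) = nf w (sub_trm (j ## ?r) (de ## ga ## th) ?t)"
  proof (rule eq_induct[OF w e' _ _ _ _ j])
   show "nf w (sub_trm (zw w ## ?r) (de ## ga ## th) ?s) = nf w (sub_trm (zw w ## ?r) (de ## ga ## th) ?t)"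
    unfolding v[OF w wle_refl zw_N[OF w]] using main[OF w wle_refl na(1) zw_N[OF w]] w na by (simp add: nf_idem rec_simps)
  next
   fix w' d assume w': "W w'" "w << w'" and d: "d \<in> N w'" and IH: "nf w' (sub_trm (d ## ?r) (de ## ga ## th) ?s) = nf w' (sub_trm (d ## ?r) (de ## ga ## th) ?t)"
   have n': "nf w' n \<in> N w'" using T_mono[OF w'(2) N_T[OF w na(1)]] by simp
   show "nf w' (sub_trm (Sw w' d ## ?r) (de ## ga ## th) ?s) = nf w' (sub_trm (Sw w' d ## ?r) (de ## ga ## th) ?t)"
    unfolding v[OF w' ap_N[OF w'(1) Succ_F d]] using IH[unfolded v[OF w' d]] main[OF w' n' d] w' d n' by (simp add: rec_simps)
  qed simp_all
  thus ?thesis unfolding v[OF w wle_refl j] using w na by (simp add: nf_idem)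
 qed
 show ?thesis by (rule bexI[OF _ k(1)]) (use eq add[OF ap_N[OF w Succ_F k(1)]] in simp)
qed

text \<open>Choice yields some zero as a function of the argument, and \<open>least_functor\<close>
  passes from it to the least zero.\<close>

lemma sat_search: assumes w: "W w" and e: "en w rh th" shows "sat w rh th bim_unbounded_search"
proof -
 let ?E = "Eq (App (FVar 0) (pairJ (Var 1) (Var 0))) zero"
 let ?E' = "Eq (App (FVar 1) (pairJ (Var 0) (App (FVar 0) (Var 0)))) zero"
 let ?L = "less_fm (Var 0) (App (FVar 0) (Var 1))"
 let ?E'' = "Eq (App (FVar 1) (pairJ (Var 1) (Var 0))) zero"
 let ?C = "AllN (And ?E' (AllN (Imp ?L (Neg ?E''))))"
 have fm: "?E \<in> fmls Sy" "?E' \<in> fmls Sy" "?L \<in> fmls Sy" "?E'' \<in> fmls Sy" "?C \<in> fmls Sy" by (simp_all add: less_fm_def)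
 have ax: "Imp (AllN (ExN ?E)) (ExF (AllN ?E')) \<in> axs Sy"
 proof -
  have "sub_fm (%n. case n of 0 => App (FVar 0) (Var 0) | Suc m => Var m) (%k. FVar (Suc k)) ?E = ?E'" by simp
  hence "Imp (AllN (ExN ?E)) (ExF (AllN ?E')) \<in> qf_ac00 (lang Sy)" unfolding qf_ac00_def using fm(1)
   by (intro CollectI exI[of _ ?E]) simp
  thus ?thesis using qf by blast
 qed
 have "sat w2 rh (al ## th) (ExF ?C)"
  if w1: "W w1" "w << w1" "al \<in> Fu w1" and w2: "W w2" "w1 << w2" and ex: "sat w2 rh (al ## th) (AllN (ExN ?E))" for w1 w2 al
 proof -
  have al: "al \<in> Fu w2" using F_mono w1 w2 by blast
  have e2: "en w2 rh (al ## th)" by (intro env_consF[OF _ al] env_mono[OF e] wle_trans[OF w1(2) w2(2)])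
  have "sat w2 rh (al ## th) (Imp (AllN (ExN ?E)) (ExF (AllN ?E')))" by (rule axiom_sat[OF ax _ w2(1) e2]) (use fm in simp)
  from sat_Imp_D[OF this w2(1) e2 w2(1) wle_refl ex] obtain b where b: "b \<in> Fu w2" "sat w2 rh (b ## al ## th) (AllN ?E')"
   using sat_ExF_D[OF _ w2(1) e2] by blast
  have eb: "en w2 rh (b ## al ## th)" by (rule env_consF[OF e2 b(1)])
  have b': "ap w3 al (Jw w3 a (ap w3 b a)) = zw w3" if w3: "W w3" "w2 << w3" and a: "a \<in> N w3" for w3 a
  proof -
   have e3: "en w3 (a ## rh) (b ## al ## th)" by (rule env_consN[OF env_mono[OF eb w3(2)]]) (use w3 a in simp)
   have "sat w3 (a ## rh) (b ## al ## th) ?E'" by (rule sat_AllN_D[OF b(2) w2(1) eb w3]) (use w3 a in simp)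
   thus ?thesis using w3 a F_mono[OF w3(2) al] F_mono[OF w3(2) b(1)] e3 by (simp add: sat_Eq nf_App nf_pairJ nf_idem)
  qed
  have "\<exists>ga\<in>Fu w2. \<forall>w'. W w' --> w2 << w' --> (\<forall>a\<in>N w'. ap w' al (Jw w' a (ap w' ga a)) = zw w' \<and>
   (\<forall>n\<in>N w'. \<forall>k\<in>N w'. ap w' al (Jw w' a n) = zw w' --> ap w' ga a \<noteq> f2 w' pr_add (Sw w' k) n))"
   by (rule least_functor[OF w2(1) al b(1)]) (rule b')
  then obtain ga where ga: "ga \<in> Fu w2" and g: "\<forall>w'. W w' --> w2 << w' --> (\<forall>a\<in>N w'. ap w' al (Jw w' a (ap w' ga a)) = zw w' \<and>
   (\<forall>n\<in>N w'. \<forall>k\<in>N w'. ap w' al (Jw w' a n) = zw w' --> ap w' ga a \<noteq> f2 w' pr_add (Sw w' k) n))"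
   by (elim bexE)
  have eg: "en w2 rh (ga ## al ## th)" by (rule env_consF[OF e2 ga])
  have "sat w3 (a ## rh) (ga ## al ## th) (And ?E' (AllN (Imp ?L (Neg ?E''))))" if w3: "W w3" "w2 << w3" and a: "a \<in> N w3" for w3 a
  proof -
   have e3: "en w3 (a ## rh) (ga ## al ## th)" by (rule env_consN[OF env_mono[OF eg w3(2)]]) (use w3 a in simp)
   have "ap w3 al (Jw w3 a (ap w3 ga a)) = zw w3" using g w3 a by blast
   hence 1: "sat w3 (a ## rh) (ga ## al ## th) ?E'"
    using w3 a F_mono[OF w3(2) al] F_mono[OF w3(2) ga] e3 by (simp add: sat_Eq nf_App nf_pairJ nf_idem)
   have "\<not> sat w5 (n ## a ## rh) (ga ## al ## th) ?E''"
    if w4: "W w4" "w3 << w4" "n \<in> N w4" and w5: "W w5" "w4 << w5" and less: "sat w5 (n ## a ## rh) (ga ## al ## th) ?L" for w4 w5 n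
   proof
    assume 0: "sat w5 (n ## a ## rh) (ga ## al ## th) ?E''"
    have le: "w2 << w5" "w3 << w5" using w3 w4 w5 wle_trans by blast+
    have T: "n \<in> Tm w5" "a \<in> Tm w5" using T_mono[OF w5(2) N_T[OF w4(1,3)]] T_mono[OF le(2) N_T[OF w3(1) a]] .
    let ?n = "nf w5 n" and ?a = "nf w5 a"
    have N: "?n \<in> N w5" "?a \<in> N w5" using T by simp_all
    have T': "?n \<in> Tm w5" "?a \<in> Tm w5" using w5 T by simp_all
    have F5: "al \<in> Fu w5" "ga \<in> Fu w5" using F_mono[OF le(1)] al ga by blast+
    have erh: "en w5 rh (ga ## al ## th)" by (rule env_mono[OF eg le(1)])
    have e5: "en w5 (n ## a ## rh) (ga ## al ## th)" "en w5 (?n ## ?a ## rh) (ga ## al ## th)" "en w5 (n ## ?a ## rh) (ga ## al ## th)"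
     by (intro env_consN erh T T')+
    \<comment> \<open>The elements \<open>n\<close> and \<open>a\<close> were introduced in earlier
      worlds, so they are replaced by their normal forms in \<open>w5\<close>.\<close>
    have s: "sat w5 (?n ## ?a ## rh) (ga ## al ## th) A" if A: "A \<in> fmls Sy" "sat w5 (n ## a ## rh) (ga ## al ## th) A" for A
    proof -
     have "sem A w5 (?n ## ?a ## rh) (ga ## al ## th) <-> sem A w5 (n ## a ## rh) (ga ## al ## th)"
      by (rule sem_cong[OF w5(1) e5(2,1)]) (use w5 T F5 in "auto simp: nf_nf agree_def split: nat.split")
     thus ?thesis using A sem_sat[OF A(1) w5(1) e5(1)] sem_sat[OF A(1) w5(1) e5(2)] by simp
    qed
    have "ap w5 al (Jw w5 ?a ?n) = zw w5" using s[OF fm(4) 0] w5 N T T' F5 e5 by (simp add: sat_Eq nf_App nf_pairJ nf_nf)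
    moreover obtain k where "k \<in> N w5" "ap w5 ga ?a = f2 w5 pr_add (Sw w5 k) ?n"
     using sat_less_D[OF w5(1) e5(2) N s[OF fm(3) less]] by (elim bexE)
    ultimately show False using g w5(1) le(1) N by blast
   qed
   note neg = this
   have "sat w4 (n ## a ## rh) (ga ## al ## th) (Imp ?L (Neg ?E''))" if w4: "W w4" "w3 << w4" "n \<in> N w4" for w4 n
   proof -
    have e4: "en w4 (n ## a ## rh) (ga ## al ## th)" by (rule env_consN[OF env_mono[OF e3 w4(2)]]) (use w4 in simp)
    have "sat w5 (n ## a ## rh) (ga ## al ## th) (Neg ?E'')"
     if w5: "W w5" "w4 << w5" and less: "sat w5 (n ## a ## rh) (ga ## al ## th) ?L" for w5
    proof -
     have e5: "en w5 (n ## a ## rh) (ga ## al ## th)" by (rule env_mono[OF e4 w5(2)])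
     have "\<not> sat w6 (n ## a ## rh) (ga ## al ## th) ?E''" if w6: "W w6" "w5 << w6" for w6
      by (rule neg[OF w4 w6(1) wle_trans[OF w5(2) w6(2)] sat_mono[OF less w6(2)]])
     thus ?thesis using sat_Imp[OF w5(1) e5 fm(4) formulas.intros(2)] by blast
    qed
    thus ?thesis using sat_Imp[OF w4(1) e4 fm(3), of "Neg ?E''"] fm(4) by simp
   qed
   hence "sat w3 (a ## rh) (ga ## al ## th) (AllN (Imp ?L (Neg ?E'')))"
    using sat_AllN'[OF w3(1) e3, of "Imp ?L (Neg ?E'')"] fm by simp
   thus ?thesis using 1 sat_And[OF w3(1)] by simp
  qed
  hence "sat w2 rh (ga ## al ## th) ?C" using sat_AllN'[OF w2(1) eg, of "And ?E' (AllN (Imp ?L (Neg ?E'')))"] fm by simp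
  thus ?thesis using sat_ExF[OF w2(1) e2 fm(5)] ga by blast
 qed
 note main = this
 have "sat w1 rh (al ## th) (Imp (AllN (ExN ?E)) (ExF ?C))" if w1: "W w1" "w << w1" "al \<in> Fu w1" for w1 al
 proof -
  have e1: "en w1 rh (al ## th)" by (rule env_consF[OF env_mono[OF e w1(2)] w1(3)])
  show ?thesis using sat_Imp[OF w1(1) e1, of "AllN (ExN ?E)" "ExF ?C"] main[OF w1] fm by simp
 qed
 hence "sat w rh th (AllF (Imp (AllN (ExN ?E)) (ExF ?C)))"
  using sat_AllF[OF w e, of "Imp (AllN (ExN ?E)) (ExF ?C)"] fm by simp
 thus ?thesis unfolding bim_unbounded_search_def .
qed

end

interpretation EJ: bimhaq EJ
proof
 show "qf_ac00 (lang EJ) \<subseteq> axs EJ"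
 proof
  fix A assume "A \<in> qf_ac00 (lang EJ)"
  then obtain B where B: "B \<in> formulas joint_language" "quantifier_free B" "A = Imp (AllN (ExN B))
     (ExF (AllN (sub_fm (%n. case n of 0 => App (FVar 0) (Var 0) | Suc m => Var m) (%k. FVar (Suc k)) B)))"
   by (auto simp: qf_ac00_def)
  have "(%n. el_trm (case n of 0 => App (FVar 0) (Var 0) | Suc m => Var m)) = (%n. case n of 0 => App (FVar 0) (Var 0) | Suc m => Var m)"
   by (rule ext) (simp split: nat.split)
  hence "el_fm A \<in> qf_ac00 ha1_language" using el_fm_formulas[OF B(1)] B(2) unfolding B(3) by (auto simp: qf_ac00_def el_fm_sub)
  moreover have "sub_fm (%n. case n of 0 => App (FVar 0) (Var 0) | Suc m => Var m) (%k. FVar (Suc k)) B \<in> formulas joint_language"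
   by (rule sub_formulas[OF B(1)]) (auto split: nat.split)
  hence "A \<in> formulas joint_language" using B by simp
  ultimately show "A \<in> axs EJ" by (intro EJ_axiom) (auto simp: EL_def)
 qed
qed

lemma joint_EL:
 assumes d: "deriv (joint \<oplus>\<^sub>a C) Ga A" and C: "C \<subseteq> cantor_pairing_axioms"
 shows "deriv EL (el_fm ` Ga) (el_fm A)"
proof (rule el_fm_deriv[OF d])
 fix A assume A: "A \<in> axs (joint \<oplus>\<^sub>a C)" and f: "A \<in> fmls (joint \<oplus>\<^sub>a C)"
 have fA: "A \<in> formulas joint_language" using f by simp
 consider "A \<in> bim_constant_axioms \<union> cantor_pairing_axioms" | "A = bim_unbounded_search"
  | "A \<in> equality_axioms joint_language \<union> induction_axioms joint_language \<union> {bim_composition, bim_pairing, bim_primitive_recursion} \<union>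
   {Neg (Eq (suc zero) zero)} \<union> defining_equations \<union> lambda_axioms joint_language \<union> recursor_axioms joint_language"
  using A C by (auto simp: joint_def)
 hence "A \<in> axs EJ"
 proof cases
  case 1 thus ?thesis using EJ_I[OF fA EL_pairing_axioms] by simp
 next
  case 2 thus ?thesis using EJ_valid[OF _ EJ.sat_search] fA by simp
 next
  case 3
  thus ?thesis using EJ.equality EJ.induction EJ.bim_ax EJ.one_neq_zero EJ.defining EJ.lambda EJ.recursor by auto
 qed
 thus "deriv EL {} (el_fm A)" by (simp add: EJ_def)
qed simp

section \<open>Choice for quantifier-free formulas in the joint system\<close>

locale bimhas = bim + bimha
begin

text \<open>Comparability of numbers, with the differences as explicit witnesses. It is what turns a
  vanishing distance into an equality.\<close>

lemma sub_total:
 assumes w: "W w" and b: "a \<in> N w" "b \<in> N w"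
 shows "a = f2 w pr_add (f2 w pr_sub b a) b \<or> b = f2 w pr_add (f2 w pr_sub a b) a"
proof -
 let ?r = "b ## (%_::nat. zero)"
 let ?A = "Or (Eq (Var 0) (Fn (PR pr_add) [Fn (PR pr_sub) [Var 1, Var 0], Var 1])) (Eq (Var 1) (Fn (PR pr_add) [Fn (PR pr_sub) [Var 0, Var 1], Var 0]))"
 have e: "en w ?r cenv" using w b by (auto simp: env_def cenv_def split: nat.split)
 have v: "sat w' (c ## ?r) cenv ?A <-> c = f2 w' pr_add (f2 w' pr_sub (nf w' b) c) (nf w' b) \<or> nf w' b = f2 w' pr_add (f2 w' pr_sub c (nf w' b)) c"
  if w': "W w'" "w << w'" "c \<in> N w'" for w' c
 proof -
  have "b \<in> Tm w'" using T_mono[OF w'(2) N_T[OF w b(2)]] .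
  moreover have "en w' (c ## ?r) cenv" by (intro env_consN env_mono[OF e w'(2)]) (use w' in simp)
  ultimately show ?thesis using w' by (simp add: sat_Or sat_Eq nf_Fn2 nf_idem)
 qed
 have "sat w (a ## ?r) cenv ?A"
 proof (rule induct_sat[OF w e _ _ _ w wle_refl b(1)])
  show "?A \<in> fmls Sy" by simp
  show "sat w (zw w ## ?r) cenv ?A" using v[OF w wle_refl zw_N[OF w]] w b by (simp add: rec_simps add_laws(1) nf_idem)
 next
  fix w' c assume w': "W w'" "w << w'" "c \<in> N w'" and IH: "sat w' (c ## ?r) cenv ?A"
  note [simp] = w'(1,3)
  let ?b = "nf w' b"
  have B [simp]: "?b \<in> N w'" by (rule nf_N[OF T_mono[OF w'(2) N_T[OF w b(2)]]])
  have S [simp]: "Sw w' c \<in> N w'" by simp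
  from IH[unfolded v[OF w']] have "Sw w' c = f2 w' pr_add (f2 w' pr_sub ?b (Sw w' c)) ?b \<or> ?b = f2 w' pr_add (f2 w' pr_sub (Sw w' c) ?b) (Sw w' c)"
  proof
   assume "c = f2 w' pr_add (f2 w' pr_sub ?b c) ?b"
   hence "Sw w' c = f2 w' pr_add (Sw w' (f2 w' pr_sub ?b c)) ?b" by (simp add: rec_simps)
   thus ?thesis using sub_add[of w' ?b "Sw w' (f2 w' pr_sub ?b c)"] by simp
  next
   assume b: "?b = f2 w' pr_add (f2 w' pr_sub c ?b) c"
   have "f2 w' pr_sub c ?b \<in> N w'" by simp
   from zero_or_suc[OF w'(1) this] show ?thesis
   proof
    assume "f2 w' pr_sub c ?b = zw w'"
    hence "Sw w' c = f2 w' pr_add (Sw w' (zw w')) ?b" using b by (simp add: rec_simps)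
    thus ?thesis using sub_add[of w' ?b "Sw w' (zw w')"] by simp
   next
    assume "\<exists>r\<in>N w'. f2 w' pr_sub c ?b = Sw w' r"
    then obtain r where r: "r \<in> N w'" "f2 w' pr_sub c ?b = Sw w' r" ..
    hence "?b = f2 w' pr_add r (Sw w' c)" using b by (simp add: rec_simps add_laws(2))
    thus ?thesis using sub_add[of w' "Sw w' c" r] r(1) by simp
   qed
  qed
  thus "sat w' (Sw w' c ## ?r) cenv ?A" unfolding v[OF w'(1,2) S] .
 qed
 thus ?thesis using v[OF w wle_refl b(1)] w b by (simp add: nf_idem)
qed

lemma sub_eq: assumes w: "W w" and a: "a \<in> N w" "b \<in> N w"
 shows "f2 w pr_add (f2 w pr_sub a b) (f2 w pr_sub b a) = zw w <-> a = b"
proof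
 have s: "f2 w pr_sub a b \<in> N w" "f2 w pr_sub b a \<in> N w" using w a by simp_all
 assume 0: "f2 w pr_add (f2 w pr_sub a b) (f2 w pr_sub b a) = zw w"
 have "f2 w pr_sub a b = zw w"
  using zero_or_suc[OF w s(1)] 0 rec_simps(3)[OF w _ s(2)] Sw_neq'[OF w] w s by auto
 moreover from this have "f2 w pr_sub b a = zw w" using 0 w s by (simp add: rec_simps)
 ultimately show "a = b" using sub_total[OF w a] w a by (auto simp: rec_simps)
next
 assume "a = b"
 thus "f2 w pr_add (f2 w pr_sub a b) (f2 w pr_sub b a) = zw w" using sub_add[OF w a(1), of "zw w"] w a by (simp add: rec_simps)
qed

lemma if_eq: assumes w: "W w" and a: "a \<in> N w" "b \<in> N w"
 shows "f2 w pr_mult (f1 w pr_isz a) b = (if a = zw w then b else zw w)"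
  "f2 w pr_mult (f1 w pr_isz (f1 w pr_isz a)) b = (if a = zw w then zw w else b)"
  "f2 w pr_add a b = zw w <-> a = zw w \<and> b = zw w"
 using zero_or_suc[OF w a(1)] w a Sw_neq'[OF w] by (auto simp: rec_simps val_simps)

text \<open>The characteristic term of an equation is the distance of its sides. Conjunction becomes
  a sum, and disjunction and implication become products in which \<open>pr_isz\<close> decides
  whether the second term counts.\<close>

lemma quantifier_free_term:
 "quantifier_free A ==> A \<in> fmls Sy ==> \<exists>c\<in>Ter. \<forall>w rh th. W w --> en w rh th --> (sat w rh th A <-> nf w (sub_trm rh th c) = zw w)"
proof (induction A)
 case (Eq s t)
 let ?c = "Fn (PR pr_add) [Fn (PR pr_sub) [s, t], Fn (PR pr_sub) [t, s]]"
 have st: "s \<in> Ter" "t \<in> Ter" using Eq by auto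
 show ?case
 proof (rule bexI[of _ ?c], intro allI impI)
  fix w rh th assume w: "W w" and e: "en w rh th"
  note T = sub_T[OF e st(1)] sub_T[OF e st(2)]
  show "sat w rh th (Eq s t) <-> nf w (sub_trm rh th ?c) = zw w"
   using sub_eq[OF w nf_N[OF T(1)] nf_N[OF T(2)]] w T by (simp add: sat_Eq[OF w e st] nf_Fn2)
 qed (use st in simp)
next
 case Bot
 show ?case by (rule bexI[of _ "suc zero"]) (auto simp: nf_App Sw_neq')
next
 case (And A B)
 then obtain c d where c: "c \<in> Ter" "\<forall>w rh th. W w --> en w rh th --> (sat w rh th A <-> nf w (sub_trm rh th c) = zw w)"
  and d: "d \<in> Ter" "\<forall>w rh th. W w --> en w rh th --> (sat w rh th B <-> nf w (sub_trm rh th d) = zw w)" by auto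
 show ?case by (rule bexI[of _ "Fn (PR pr_add) [c, d]"])
  (use c d sub_T[OF _ c(1)] sub_T[OF _ d(1)] in "auto simp: sat_And nf_Fn2 if_eq")
next
 case (Or A B)
 then obtain c d where c: "c \<in> Ter" "\<forall>w rh th. W w --> en w rh th --> (sat w rh th A <-> nf w (sub_trm rh th c) = zw w)"
  and d: "d \<in> Ter" "\<forall>w rh th. W w --> en w rh th --> (sat w rh th B <-> nf w (sub_trm rh th d) = zw w)" by auto
 show ?case by (rule bexI[of _ "Fn (PR pr_mult) [App (FC (PR pr_isz)) (App (FC (PR pr_isz)) c), d]"])
  (use c d sub_T[OF _ c(1)] sub_T[OF _ d(1)] Or.prems in "auto simp: sat_Or nf_Fn2 nf_App if_eq(2)")
next
 case (Imp A B)
 then obtain c d where c: "c \<in> Ter" "\<forall>w rh th. W w --> en w rh th --> (sat w rh th A <-> nf w (sub_trm rh th c) = zw w)"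
  and d: "d \<in> Ter" "\<forall>w rh th. W w --> en w rh th --> (sat w rh th B <-> nf w (sub_trm rh th d) = zw w)" by auto
 have AB: "A \<in> fmls Sy" "B \<in> fmls Sy" using Imp.prems by auto
 have "sat w rh th (Imp A B) <-> (sat w rh th A --> sat w rh th B)" if w: "W w" and e: "en w rh th" for w rh th
 proof (cases "sat w rh th A")
  case True
  thus ?thesis using sat_Imp[OF w e AB] sat_mono w wle_refl by blast
 next
  case False
  let ?x = "sub_trm rh th c"
  have x: "?x \<in> Tm w" by (rule sub_T[OF e c(1)])
  \<comment> \<open>A value other than zero is a successor, and a successor it remains in all later
    worlds. So where \<open>A\<close> fails it is refuted, and the implication behaves
    classically.\<close>
  obtain y where y: "y \<in> N w" "nf w ?x = Sw w y" using False c w e zero_or_suc[OF w nf_N[OF x]] by auto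
  have "\<not> sat w' rh th A" if w': "W w'" "w << w'" for w'
  proof -
   have "nf w' ?x = nf w' (Sw w y)" using nf_up[OF w w' x] y by simp
   also have "... = Sw w' (nf w' y)" using ap_up[OF w w' Succ_F y(1)] .
   finally have "nf w' ?x \<noteq> zw w'" using Sw_neq'[OF w'(1) nf_N[OF T_mono[OF w'(2) N_T[OF w y(1)]]]] by simp
   thus ?thesis using c(2) w'(1) env_mono[OF e w'(2)] by simp
  qed
  thus ?thesis using False sat_Imp[OF w e AB] by blast
 qed
 thus ?case by (intro bexI[of _ "Fn (PR pr_mult) [App (FC (PR pr_isz)) c, d]"])
  (use c d sub_T[OF _ c(1)] sub_T[OF _ d(1)] in "auto simp: nf_Fn2 nf_App if_eq")
qed simp_all

text \<open>The characteristic term, with \<open>x\<close> and \<open>y\<close> replaced by the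
  projections of one number, is abstracted to a function of \<open>J(x, y)\<close>. Unbounded search
  on its zeros gives the choice function.\<close>

lemma sat_qf_ac00:
 assumes A: "A \<in> qf_ac00 (lang Sy)" and w: "W w" and e: "en w rh th"
 shows "sat w rh th A"
proof -
 let ?s = "%n. case n of 0 => App (FVar 0) (Var 0) | Suc m => Var m"
 obtain B where B: "B \<in> fmls Sy" "quantifier_free B" and AB: "A = Imp (AllN (ExN B)) (ExF (AllN (sub_fm ?s (%k. FVar (Suc k)) B)))"
  using A by (auto simp: qf_ac00_def)
 let ?B = "sub_fm ?s (%k. FVar (Suc k)) B"
 have B': "?B \<in> fmls Sy" by (rule sub_formulas[OF B(1)]) (auto split: nat.split)
 obtain c where c: "c \<in> Ter" "\<And>w rh th. W w ==> en w rh th ==> sat w rh th B <-> nf w (sub_trm rh th c) = zw w"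
  using quantifier_free_term[OF B(2,1)] by blast
 let ?p = "%n. case n of 0 => projL (Var 0) | Suc m => (case m of 0 => projK (Var 0) | Suc k => Var (Suc k))"
 let ?c = "sub_trm ?p FVar c" and ?a = "sub_fnl rh th (Lam (sub_trm ?p FVar c))"
 have c': "?c \<in> Ter" by (rule sub_terms[OF c(1)]) (auto split: nat.split)
 have a: "?a \<in> Fu w" by (rule sub_F[OF e]) (use c' in simp)
 have val: "ap w' ?a (Jw w' x y) = zw w' <-> sat w' (y ## x ## rh) th B" if w': "W w'" "w << w'" and xy: "x \<in> N w'" "y \<in> N w'" for w' x y
 proof -
  note e' = env_mono[OF e w'(2)]
  let ?z = "Jw w' x y"
  have z: "?z \<in> N w'" using w' xy by simp
  let ?r = "projL ?z ## projK ?z ## rh"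
  have er: "en w' ?r th" "en w' (y ## x ## rh) th" using e' z xy w' by (intro env_consN; simp)+
  have "sub_trm (?z ## rh) th \<circ> ?p = ?r" "sub_fnl (?z ## rh) th \<circ> FVar = th" by (rule ext, simp split: nat.split)+
  hence s: "sub_trm (?z ## rh) th ?c = sub_trm ?r th c" by (simp only: sub_sub)
  have "nf w' (sub_trm ?r th c) = nf w' (sub_trm (y ## x ## rh) th c)"
   by (rule nf_cong[OF w'(1) er _ c(1)]) (use w' xy z in "simp add: nf_App nf_idem bim_const_eqs split: nat.split")
  thus ?thesis using ap_beta[OF w'(1) e' c' z] c(2)[OF w'(1) er(2)] unfolding s by simp
 qed
 have "sat w1 rh th (ExF (AllN ?B))" if w1: "W w1" "w << w1" and ex: "sat w1 rh th (AllN (ExN B))" for w1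
 proof -
  note e1 = env_mono[OF e w1(2)]
  have "\<exists>g\<in>Fu w1. \<forall>w'. W w' --> w1 << w' --> (\<forall>x\<in>N w'. ap w' ?a (Jw w' x (ap w' g x)) = zw w')"
  proof (rule closure_search[OF w1(1) F_mono[OF w1(2) a]])
   fix w' x assume w': "W w'" "w1 << w'" and x: "x \<in> N w'"
   have e': "en w' (x ## rh) th" by (rule env_consN[OF env_mono[OF e1 w'(2)]]) (use w' x in simp)
   have "sat w' (x ## rh) th (ExN B)" by (rule sat_AllN_D[OF ex w1(1) e1 w']) (use w' x in simp)
   thus "\<exists>y\<in>N w'. ap w' ?a (Jw w' x y) = zw w'"
    using sat_ExN'[OF w'(1) e' B(1)] val[OF w'(1) wle_trans[OF w1(2) w'(2)] x] by blast
  qed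
  then obtain g where g: "g \<in> Fu w1" "\<And>w' x. W w' ==> w1 << w' ==> x \<in> N w' ==> ap w' ?a (Jw w' x (ap w' g x)) = zw w'" by blast
  have eg: "en w1 rh (g ## th)" by (rule env_consF[OF e1 g(1)])
  have "sat w' (x ## rh) (g ## th) ?B" if w': "W w'" "w1 << w'" and x: "x \<in> N w'" for w' x
  proof -
   have F: "g \<in> Fu w'" and xT: "x \<in> Tm w'" using F_mono[OF w'(2) g(1)] w' x by simp_all
   have e': "en w' (x ## rh) th" by (intro env_consN[OF env_mono[OF e1 w'(2)]] xT)
   have "sat w' (ap w' g x ## x ## rh) th B"
    using g(2)[OF w' x] val[OF w'(1) wle_trans[OF w1(2) w'(2)] x ap_N[OF w'(1) F x]] by simp
   hence "sat w' (App g x ## x ## rh) th B" using sat_nf[OF w'(1) e', of "App g x" B] F xT by (simp add: ap_def)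
   moreover have "(%n. sub_trm (x ## rh) (g ## th) (?s n)) = App g x ## x ## rh" by (rule ext) (auto split: nat.split)
   ultimately show ?thesis by (simp add: sat_sub)
  qed
  thus ?thesis using sat_ExF[OF w1(1) e1, of "AllN ?B"] sat_AllN'[OF w1(1) eg B'] g(1) B' by auto
 qed
 thus ?thesis unfolding AB using sat_Imp[OF w e, of "AllN (ExN B)" "ExF (AllN ?B)"] B B' by simp
qed

lemma qf_ac00_derivable: "A \<in> qf_ac00 (lang Sy) ==> A \<in> fmls Sy ==> deriv Sy {} A"
 by (rule completeness) (use sat_qf_ac00 in auto)

end

section \<open>Uniqueness of the Cantor pairing\<close>

locale bimhac = bimha +
 assumes cantor: "cantor_pairing_axioms \<subseteq> axs Sy"
begin

lemma Jw_Cantor: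
 assumes w: "W w" and m: "m \<in> N w" "n \<in> N w"
 shows "Jw w (zw w) (zw w) = zw w" "Jw w (zw w) (Sw w m) = Sw w (Jw w m (zw w))" "Jw w (Sw w m) n = Sw w (Jw w m (Sw w n))"
proof -
 let ?r = "m ## n ## (%_. zero)"
 have e: "en w ?r cenv" using w m by (auto simp: env_def cenv_def split: nat.split)
 have ax: "nf w (sub_trm ?r cenv s) = nf w (sub_trm ?r cenv t)" if "Eq s t \<in> cantor_pairing_axioms" for s t
  by (rule axiom_eq[OF _ _ _ w e]) (use that cantor in "auto simp: cantor_pairing_axioms_def")
 note [simp] = w m nf_pairJ nf_App nf_idem
 show "Jw w (zw w) (zw w) = zw w" using ax[of "pairJ zero zero" zero] by (simp add: cantor_pairing_axioms_def)
 show "Jw w (zw w) (Sw w m) = Sw w (Jw w m (zw w))"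
  using ax[of "pairJ zero (suc (Var 0))" "suc (pairJ (Var 0) zero)"] by (simp add: cantor_pairing_axioms_def)
 show "Jw w (Sw w m) n = Sw w (Jw w m (Sw w n))"
  using ax[of "pairJ (suc (Var 0)) (Var 1)" "suc (pairJ (Var 0) (suc (Var 1)))"] by (simp add: cantor_pairing_axioms_def)
qed

text \<open>In the recursion equations of J no single argument always decreases, but the code does.
  The induction is therefore on the code, with the projections of the theory as its pair.\<close>

lemma J_unique: assumes w: "W w" and p: "p \<in> N w" shows "f2 w pr_J (Kw w p) (Lw w p) = p"
proof -
 let ?z = "Fn (PR pr_J) [projK (Var 0), projL (Var 0)]"
 have v: "V w ?z [a] = f2 w pr_J (Kw w a) (Lw w a)" if "W w" "a \<in> N w" for w a
  using that by (simp add: V_def lenv_def nf_Fn2 nf_App nf_idem)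
 have v0: "V w (Var 0) [a] = a" if "W w" "a \<in> N w" for w a
  using that by (simp add: V_def lenv_def nf_idem)
 have "V w ?z [p] = V w (Var 0) [p]"
 proof (rule induct1[OF _ _ _ _ w p])
  fix w assume w: "W w"
  have "Jw w (zw w) (zw w) = zw w" using Jw_Cantor(1)[OF w zw_N[OF w] zw_N[OF w]] .
  hence "Kw w (zw w) = zw w" "Lw w (zw w) = zw w" using bim_const_eqs[OF w, of "zw w" "zw w"] w by auto
  thus "V w ?z [zw w] = V w (Var 0) [zw w]"
   using v[OF w zw_N[OF w]] v0[OF w zw_N[OF w]] Cantor_eqs(1)[OF w zw_N[OF w] zw_N[OF w]] by simp
 next
  fix w a assume w: "W w" and a: "a \<in> N w" and IH: "V w ?z [a] = V w (Var 0) [a]"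
  let ?m = "Kw w a" and ?n = "Lw w a"
  have mn: "?m \<in> N w" "?n \<in> N w" using w a by simp_all
  have J: "f2 w pr_J ?m ?n = a" using IH v[OF w a] v0[OF w a] by simp
  have JJ: "Jw w ?m ?n = a" using w a by simp
  have *: "f2 w pr_J (Kw w (Sw w a)) (Lw w (Sw w a)) = Sw w a"
   if "Sw w a = Jw w x y" "Sw w a = f2 w pr_J x y" "x \<in> N w" "y \<in> N w" for x y
  proof -
   have "Kw w (Jw w x y) = x" "Lw w (Jw w x y) = y" using bim_const_eqs[OF w that(3,4)] by auto
   thus ?thesis using that by simp
  qed
  from zero_or_suc[OF w mn(2)] have "f2 w pr_J (Kw w (Sw w a)) (Lw w (Sw w a)) = Sw w a"
  proof
   assume n: "?n = zw w"
   show ?thesis by (rule *[of "zw w" "Sw w ?m"]) (use Cantor_eqs(2)[OF w mn(1) mn(1)] Jw_Cantor(2)[OF w mn(1) mn(1)] J JJ n w mn in simp_all)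
  next
   assume "\<exists>b\<in>N w. ?n = Sw w b"
   then obtain b where b: "b \<in> N w" "?n = Sw w b" ..
   show ?thesis by (rule *[of "Sw w ?m" b]) (use Cantor_eqs(3)[OF w mn(1) b(1)] Jw_Cantor(3)[OF w mn(1) b(1)] J JJ b w mn in simp_all)
  qed
  thus "V w ?z [Sw w a] = V w (Var 0) [Sw w a]" using v[OF w ap_N[OF w Succ_F a]] v0[OF w ap_N[OF w Succ_F a]] by simp
 qed simp_all
 thus ?thesis using v[OF w p] v0[OF w p] by simp
qed

lemma J_eqs:
 assumes w: "W w" and a: "a \<in> N w" "b \<in> N w"
 shows "f2 w pr_J a b = Jw w a b" "f1 w pr_K a = Kw w a" "f1 w pr_L a = Lw w a"
proof -
 have "Kw w (Jw w a b) = a" "Lw w (Jw w a b) = b" using bim_const_eqs[OF w a] by auto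
 thus "f2 w pr_J a b = Jw w a b" using J_unique[OF w Jw_N[OF w a]] by simp
 have KL: "Kw w a \<in> N w" "Lw w a \<in> N w" using w a by simp_all
 show "f1 w pr_K a = Kw w a" "f1 w pr_L a = Lw w a" using KL_J[OF w KL] J_unique[OF w a(1)] by simp_all
qed

lemma cev_el_sym:
 assumes w: "W w" and c: "has_arity c (length as)" and as: "set as \<subseteq> N w"
 shows "cev (el_sym c) w (tup w as) = cev c w (tup w as)"
proof -
 have T: "\<And>t. t \<in> set as ==> t \<in> Tm w" using w as by auto
 have id: "map (nf w) as = as" using w as nf_idem by (intro map_idI) auto
 have p: "pev d w (tup w as) = nf w (apply_const (PR d) as)" if "describes d (length as)" for d
  using pev_apply[OF that w refl T] id by simp
 have d1: "describes (Const (Suc 0) 0) (Suc 0)" "describes (Proj (Suc 0) 0) (Suc 0)" by simp_all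
 have one: "\<exists>a\<in>N w. as = [a]" if "length as = Suc 0" using that as by (auto simp: length_Suc_conv)
 have two: "\<exists>a\<in>N w. \<exists>b\<in>N w. as = [a, b]" if "length as = 2" using that as by (auto simp: length_Suc_conv numeral_2_eq_2)
 note fold = ap_def[symmetric] f2_def[symmetric]
 note s = J_eqs[OF w] bim_const_eqs[OF w] p apply_const_1 apply_const_2 fold w
 show ?thesis
 proof (cases c)
  case ZeroFn
  then obtain a where "a \<in> N w" "as = [a]" using one c by auto
  thus ?thesis using ZeroFn p[of "Const (Suc 0) 0"] ops_Const(1)[OF w, of a 0] by (simp add: apply_const_1 fold)
 next
  case Ident
  then obtain a where "a \<in> N w" "as = [a]" using one c by auto
  thus ?thesis using Ident p[of "Proj (Suc 0) 0"] w bim_const_eqs[OF w, of a "zw w"] by (simp add: apply_const_1 fold)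
 next
  case PairJ
  then obtain a b where ab: "a \<in> N w" "b \<in> N w" "as = [a, b]" using two c by auto
  thus ?thesis using PairJ p[of pr_J] w J_eqs[OF w ab(1,2)] bim_const_eqs[OF w, of a "Jw w b (zw w)"] bim_const_eqs[OF w, of b "zw w"]
   by (simp add: apply_const_2 fold)
 next
  case ProjK
  then obtain a where "a \<in> N w" "as = [a]" using one c by auto
  thus ?thesis using ProjK p[of pr_K] w J_eqs[OF w, of a a] bim_const_eqs[OF w, of a "zw w"] by (simp add: apply_const_1 fold)
 next
  case ProjL
  then obtain a where "a \<in> N w" "as = [a]" using one c by auto
  thus ?thesis using ProjL p[of pr_L] w J_eqs[OF w, of a a] bim_const_eqs[OF w, of a "zw w"] by (simp add: apply_const_1 fold)
 qed simp_all
qed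

lemma eval_el_fm:
 "t \<in> Ter ==> W w ==> en w rh th ==> eval (el_trm t) (cst rh) (fam th) w = eval t (cst rh) (fam th) w"
 "u \<in> Fun ==> W w ==> en w rh th ==> a \<in> N w ==> feval (el_fnl u) (cst rh) (fam th) w a = feval u (cst rh) (fam th) w a"
proof (induction t and u arbitrary: w rh th and w rh th a)
 case (Fn c ts)
 have ts: "has_arity c (length ts)" "\<And>t. t \<in> set ts ==> t \<in> Ter" using Fn.prems(1) by auto
 let ?as = "map (%f. f (cst rh) (fam th) w) (map eval ts)"
 have eq: "map (%f. f (cst rh) (fam th) w) (map eval (map el_trm ts)) = ?as"
  using Fn.IH[OF _ ts(2) Fn.prems(2,3)] by simp
 have "set ?as \<subseteq> N w" using eval_N[OF Fn.prems(2,3)] by auto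
 hence "cev (el_sym c) w (tup w ?as) = cev c w (tup w ?as)" by (intro cev_el_sym[OF Fn.prems(2)]) (use ts in simp_all)
 thus ?case unfolding el_trm.simps eval.simps eq .
next
 case (App u t)
 thus ?case using eval_N[OF App.prems(2,3)] by simp
next
 case (Rec t u s)
 have t: "t \<in> Ter" "u \<in> Fun" "s \<in> Ter" using Rec.prems(1) by auto
 show ?case unfolding el_trm.simps eval.simps
 proof (rule rv_cong[OF Rec.prems(2) Rec.IH(1)[OF t(1) Rec.prems(2,3)] Rec.IH(3)[OF t(3) Rec.prems(2,3)]])
  fix w' m r assume w': "W w'" "w << w'" and mr: "m \<in> N w'" "r \<in> N w'"
  have "pev pr_pair w' (Jw w' r (Jw w' m (zw w'))) \<in> N w'"
   by (rule rp_N[OF w'(1) rp_pev[OF w'(1)] w'(1) wle_refl]) (use w' mr in simp)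
  thus "feval (el_fnl u) (cst rh) (fam th) w' (pev pr_pair w' (Jw w' r (Jw w' m (zw w')))) =
    feval u (cst rh) (fam th) w' (pev pr_pair w' (Jw w' r (Jw w' m (zw w'))))"
   by (rule Rec.IH(2)[OF t(2) w'(1) env_mono[OF Rec.prems(3) w'(2)]])
 qed
next
 case (FC c)
 have "has_arity c (length [a])" using FC.prems(1) by simp
 thus ?case using cev_el_sym[OF FC.prems(2), of c "[a]"] FC.prems(4) by simp
next
 case (Lam t)
 have "en w (a ## rh) th" by (rule env_consN[OF Lam.prems(3)]) (use Lam.prems in simp)
 thus ?case using Lam.IH[of w "a ## rh" th] Lam.prems by (simp add: cst_cons)
qed simp_all

lemma sem_el_fm: "A \<in> fmls Sy ==> W w ==> en w rh th ==> sem (el_fm A) w rh th <-> sem A w rh th"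
proof (induction A arbitrary: w rh th)
 case (Eq s t) thus ?case by (simp add: eval_el_fm)
next
 case (Imp A B) thus ?case by (simp add: env_mono)
next
 case (AllN A) thus ?case by (simp add: env_mono env_consN)
next
 case (ExN A) thus ?case by (simp add: env_mono env_consN)
next
 case (AllF A) thus ?case by (simp add: env_mono env_consF)
next
 case (ExF A) thus ?case by (simp add: env_mono env_consF)
qed simp_all

lemma el_fm_Iff: "A \<in> fmls Sy ==> el_fm A \<in> fmls Sy ==> deriv Sy {} (Iff (el_fm A) A)"
 by (rule Iff_derivable) (simp_all add: sem_sat[symmetric] sem_el_fm)

end

interpretation J: bimhas "joint \<oplus>\<^sub>a C" for C
proof
 show "ha1_language \<subseteq> lang (joint \<oplus>\<^sub>a C)" using joint_sub by simp
qed (auto simp: joint_def)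

interpretation JC: bimhac "joint \<oplus>\<^sub>a cantor_pairing_axioms"
 by unfold_locales simp

lemma joint_bim_fm_Iff: "A \<in> formulas joint_language ==> deriv (joint \<oplus>\<^sub>a C) {} (Iff (bim_fm A) A)"
 using J.bim_fm_Iff[of A C] by simp

lemma joint_tm_Iff: "A \<in> formulas joint_language ==> deriv (joint \<oplus>\<^sub>a cantor_pairing_axioms) {} (Iff (el_fm A) A)"
 using JC.el_fm_Iff[of A] el_fm_formulas[of A] joint_formulas by auto

section \<open>The translations are effective\<close>

lemma computable_comp: "computable f ==> computable g ==> computable (%x. f (g x))"
 by (rule computable.intros)

lemma computable_left: "computable f ==> computable (%x. left (f x))"
 and computable_right: "computable f ==> computable (%x. right (f x))"
 by (erule computable_comp[OF computable.intros(3)], erule computable_comp[OF computable.intros(4)])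

lemma computable_const: "computable (%x. t)"
 by (induction t) (intro computable.intros(2), intro computable.intros(5))

lemma computable_recurse:
 assumes "computable f" "computable g" "computable p" "computable a"
 shows "computable (%x. recurse f g (p x) (a x))"
 using computable_comp[OF computable.intros(7)[OF assms(1,2)] computable.intros(5)[OF assms(4,3)]] by simp

text \<open>Case distinction is a recursion that discards the recursive results; both branches are
  carried along in the parameter.\<close>

lemma computable_if:
 assumes "computable a" "computable b" "computable c"
 shows "computable (%x. if a x = Leaf then b x else c x)"
proof -
 have "computable (%x. recurse left (%l. right (left (right (right (right (right l)))))) (Branch (b x) (c x)) (a x))"
  by (intro computable_recurse computable_left computable_right computable.intros(1,5) assms)
 moreover have "recurse left (%l. right (left (right (right (right (right l)))))) (Branch (b x) (c x)) (a x) = (if a x = Leaf then b x else c x)" for x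
  by (cases "a x") auto
 ultimately show ?thesis by simp
qed

lemma computable_nil: "computable (%x. list_tree [])"
 and computable_cons: "computable a ==> computable (%x. list_tree (as x)) ==> computable (%x. list_tree (a x # as x))"
 by (simp_all add: computable_const computable.intros(5))

lemma computable_node: "computable (%x. list_tree (as x)) ==> computable (%x. node k (as x))"
 unfolding node_def by (intro computable.intros(5) computable_const)

text \<open>The selector is a tag in unary notation, so a case distinction on the tag of a node can
  be written as a list of its branches.\<close>

fun select :: "tree => tree list => tree" where
 "select t [] = Leaf"
| "select t (x # xs) = (if t = Leaf then x else select (right t) xs)"

lemma select_nth [simp]: "k < length xs ==> select (num_tree k) xs = xs ! k"
proof (induction xs arbitrary: k)
 case (Cons x xs) thus ?case by (cases k) auto
qed simp

lemma select_0_1 [simp]: "select Leaf (x # xs) = x" "select (Branch Leaf Leaf) (x # y # xs) = y"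
 by simp_all

declare select.simps [simp del]

lemma computable_select_nil: "computable (%x. select (t x) [])"
 by (simp add: select.simps computable_const)

lemma computable_select_cons:
 "computable t ==> computable a ==> computable (%x. select (right (t x)) (as x)) ==> computable (%x. select (t x) (a x # as x))"
 unfolding select.simps by (rule computable_if)

lemmas computable_intros = computable.intros(1) computable_left computable_right computable.intros(5) computable_const
 computable_if computable_nil computable_cons computable_node computable_select_nil computable_select_cons computable_recurse

text \<open>Recursion along the right subtrees; on trees of the form \<open>num_tree n\<close> this
  is primitive recursion on numbers.\<close>

primrec spine :: "(tree => tree) => tree => tree => tree" where
 "spine s z Leaf = z"
| "spine s z (Branch a b) = s (Branch b (spine s z b))"

lemma computable_spine:
 assumes "computable s" "computable z" "computable a"
 shows "computable (%x. spine s (z x) (a x))"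
proof -
 have "computable (%x. recurse (%p. p) (%l. s (Branch (left (right l)) (left (right (right (right l)))))) (z x) (a x))"
  by (intro computable_recurse computable_comp[OF assms(1)] computable_intros assms)
 moreover have "recurse (%p. p) (%l. s (Branch (left (right l)) (left (right (right (right l)))))) u v = spine s u v" for u v
  by (induction v) simp_all
 ultimately show ?thesis by simp
qed

text \<open>
 The memo of a tree carries, along the shape of the tree, the values computed for all subtrees.  A
 value has two components, since a tree can be the code of an expression or of a list of expressions.
\<close>

primrec memo :: "tree => (tree => tree) => tree => tree" where
 "memo r g Leaf = Branch r Leaf"
| "memo r g (Branch a b) = Branch (g (Branch (Branch a b) (Branch (memo r g a) (memo r g b)))) (Branch (memo r g a) (memo r g b))"

lemma computable_memo:
 assumes "computable g" "computable f"
 shows "computable (%x. memo r g (f x))"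
proof -
 let ?G = "%l. Branch (g (Branch (Branch (left l) (left (right l))) (Branch (left (right (right l))) (left (right (right (right l)))))))
   (Branch (left (right (right l))) (left (right (right (right l)))))"
 have "computable (%x. recurse (%p. Branch r Leaf) ?G Leaf (f x))"
  by (intro computable_recurse computable_comp[OF assms(1)] computable_intros assms)
 moreover have "recurse (%p. Branch r Leaf) ?G Leaf v = memo r g v" for v
  by (induction v) simp_all
 ultimately show ?thesis by simp
qed

definition node_val :: "tree => tree" where "node_val m = left (left m)"
definition list_val :: "tree => tree" where "list_val m = right (left m)"

text \<open>A tree is read both as a node, with its right subtree as the list of arguments, and as a
  list cell. \<open>nd\<close> computes the value as a node from the node and the memo of that list;
  \<open>nil\<close> and \<open>cns\<close> build the value as a list.\<close>

definition translate :: "tree => (tree => tree => tree) => (tree => tree => tree) => tree => tree" where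
 "translate nil cns nd = memo (Branch Leaf nil)
  (%z. Branch (nd (left z) (right (right z))) (cns (node_val (left (right z))) (list_val (right (right z)))))"

primrec nth_memo :: "nat => tree => tree" where
 "nth_memo 0 m = left (right m)"
| "nth_memo (Suc i) m = nth_memo i (right (right m))"

primrec nth_tree :: "nat => tree => tree" where
 "nth_tree 0 t = left t"
| "nth_tree (Suc i) t = nth_tree i (right t)"

lemma nth_tree_list [simp]: "i < length as ==> nth_tree i (list_tree as) = as ! i"
proof (induction as arbitrary: i)
 case (Cons a as) thus ?case by (cases i) auto
qed simp

definition arg :: "nat => tree => tree" where "arg i x = nth_tree i (right x)"

lemma arg_node [simp]: "i < length as ==> arg i (node k as) = as ! i"
 by (simp add: arg_def node_def)

lemma tag_node [simp]: "left (node k as) = num_tree k"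
 by (simp add: node_def)

lemma translate_simps [simp]:
 "node_val (translate nil cns nd (node k as)) = nd (node k as) (translate nil cns nd (list_tree as))"
 "list_val (translate nil cns nd Leaf) = nil"
 "list_val (translate nil cns nd (Branch a b)) = cns (node_val (translate nil cns nd a)) (list_val (translate nil cns nd b))"
 by (simp_all add: translate_def node_val_def list_val_def node_def)

lemma nth_memo_translate [simp]:
 "i < length as ==> nth_memo i (translate nil cns nd (list_tree as)) = translate nil cns nd (as ! i)"
proof (induction as arbitrary: i)
 case (Cons a as)
 thus ?case by (cases i) (auto simp: translate_def)
qed simp

lemma computable_val: "computable f ==> computable (%x. node_val (f x))" "computable f ==> computable (%x. list_val (f x))"
 unfolding node_val_def list_val_def by (intro computable_intros, assumption)+

lemma computable_nth: "computable f ==> computable (%x. nth_tree i (f x))" "computable f ==> computable (%x. nth_memo i (f x))"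
 by (induction i arbitrary: f) (simp_all add: computable_intros)

lemma computable_arg: "computable f ==> computable (%x. arg i (f x))"
 unfolding arg_def by (intro computable_nth computable_intros)

definition computable2 :: "(tree => tree => tree) => bool" where
 "computable2 h <-> computable (%z. h (left z) (right z))"

lemma computable2_comp:
 assumes "computable2 h" "computable f" "computable g"
 shows "computable (%x. h (f x) (g x))"
 using computable_comp[OF assms(1)[unfolded computable2_def] computable.intros(5)[OF assms(2,3)]] by simp

lemmas computable_more = computable_intros computable_spine computable_val computable_nth computable_arg

lemma computable_translate:
 assumes "computable2 cns" "computable2 nd" "computable f"
 shows "computable (%x. translate nil cns nd (f x))"
 unfolding translate_def
 by (intro computable_memo computable2_comp[OF assms(1)] computable2_comp[OF assms(2)] computable_more assms)

subsection \<open>Codes of numerals\<close>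

definition c_numeral :: "tree => tree" where
 "c_numeral x = spine (%y. node 2 [code_fnl (FC (PR Succ)), right y]) (code_trm zero) x"

lemma c_numeral [simp]: "c_numeral (num_tree n) = code_trm (numeral_trm n)"
 by (induction n) (simp_all add: c_numeral_def)

definition c_Lpow :: "tree => tree" where
 "c_Lpow x = spine (%y. node 2 [code_fnl (FC ProjL), right y]) (code_trm (Var 0)) x"

lemma c_Lpow [simp]: "c_Lpow (num_tree n) = code_trm (Lpow n (Var 0))"
 by (induction n) (simp_all add: c_Lpow_def)

definition c_add :: "tree => tree => tree" where
 "c_add x y = spine (%y. Branch Leaf (right y)) y x"

lemma c_add [simp]: "c_add (num_tree m) (num_tree n) = num_tree (m + n)"
 by (induction m) (simp_all add: c_add_def)

definition c_tsize :: "tree => tree" where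
 "c_tsize x = recurse (%p. Leaf) (%l. Branch Leaf (c_add (left (right (right l))) (left (right (right (right l)))))) Leaf x"

lemma c_tsize [simp]: "c_tsize x = num_tree (tsize x)"
 by (induction x) (simp_all add: c_tsize_def)

text \<open>The iteration carries the remaining number \<open>M - j\<close> next to the code of
  \<open>venv M j\<close>; each round decreases it by one and uses it as the index of the next
  variable.\<close>

definition c_venv :: "tree => tree" where
 "c_venv x = left (spine (%y. Branch (node 1 [code_fsym PairJ, list_tree [node 0 [right (right (right y))], left (right y)]])
  (right (right (right y)))) (Branch (code_trm zero) x) x)"

lemma right_num [simp]: "right (num_tree n) = num_tree (n - 1)"
 by (cases n) simp_all

lemma c_venv [simp]: "c_venv (num_tree M) = code_trm (venv M M)"
proof -
 have "spine (%y. Branch (node 1 [code_fsym PairJ, list_tree [node 0 [right (right (right y))], left (right y)]])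
  (right (right (right y)))) (Branch (code_trm zero) (num_tree M)) (num_tree j) = Branch (code_trm (venv M j)) (num_tree (M - j))" for j
  by (induction j) simp_all
 thus ?thesis by (simp add: c_venv_def)
qed

text \<open>Next to the code of the formula the iteration carries that of the numeral
  \<open>n\<close>, which the next conjunct mentions.\<close>

definition c_bindF :: "tree => tree" where
 "c_bindF x = left (spine (%y. Branch
  (node 2 [left (right y), node 5 [node 0 [
    node 2 [code_fnl (FVar 0), node 1 [code_fsym PairJ, list_tree [right (right y), code_trm (Var 0)]]],
    node 2 [node 4 [Branch Leaf (left y)], code_trm (Var 0)]]]])
  (node 2 [code_fnl (FC (PR Succ)), right (right y)])) (Branch (code_fm (Eq zero zero)) (code_trm zero)) x)"

lemma c_bindF [simp]: "c_bindF (num_tree M) = code_fm (bindF M)"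
proof -
 have "spine (%y. Branch
  (node 2 [left (right y), node 5 [node 0 [
    node 2 [code_fnl (FVar 0), node 1 [code_fsym PairJ, list_tree [right (right y), code_trm (Var 0)]]],
    node 2 [node 4 [Branch Leaf (left y)], code_trm (Var 0)]]]])
  (node 2 [code_fnl (FC (PR Succ)), right (right y)])) (Branch (code_fm (Eq zero zero)) (code_trm zero)) (num_tree M)
  = Branch (code_fm (bindF M)) (code_trm (numeral_trm M))"
  by (induction M) simp_all
 thus ?thesis by (simp add: c_bindF_def)
qed

lemma computable_numerals:
 "computable f ==> computable (%x. c_numeral (f x))" "computable f ==> computable (%x. c_Lpow (f x))"
 "computable f ==> computable (%x. c_tsize (f x))" "computable f ==> computable (%x. c_venv (f x))"
 "computable f ==> computable (%x. c_bindF (f x))"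
 unfolding c_numeral_def c_Lpow_def c_tsize_def c_venv_def c_bindF_def c_add_def by (intro computable_more; assumption)+

subsection \<open>Codes of the defining formulas\<close>

definition c_basic :: "tree => tree" where "c_basic e = node 5 [node 0 [code_trm (App (FVar 0) (Var 0)), e]]"
definition c_call :: "tree => tree => tree" where
 "c_call x r = node 8 [node 8 [node 2 [code_fm (AllN (Eq (App (FVar 1) (Var 0)) (App (FVar 3) (Var 0)))), node 2 [x, r]]]]"
definition c_comp2 :: "trm => tree => tree => tree" where
 "c_comp2 E x y = c_call x (c_call y (code_fm (AllN (Eq (App (FVar 4) (Var 0)) E))))"
definition c_rec2 :: "tree => tree => tree" where
 "c_rec2 x y = c_call x (c_call y (code_fm (AllN (And
  (Eq (App (FVar 4) (pairJ zero (Var 0))) (App (FVar 2) (Var 0)))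
  (AllN (Eq (App (FVar 4) (pairJ (suc (Var 0)) (Var 1)))
       (App (FVar 0) (pairJ (Var 0) (pairJ (App (FVar 4) (pairJ (Var 0) (Var 1))) (Var 1))))))))))"

lemma code_combinators [simp]:
 "code_fm (basic E) = c_basic (code_trm E)" "code_fm (call X R) = c_call (code_fm X) (code_fm R)"
 "code_fm (comp2 X Y E) = c_comp2 E (code_fm X) (code_fm Y)" "code_fm (rec2 X Y) = c_rec2 (code_fm X) (code_fm Y)"
 unfolding c_comp2_def c_rec2_def comp2_def rec2_def basic_def call_def c_basic_def c_call_def code_fm.simps by (rule refl)+

lemma computable_combinators:
 "computable f ==> computable (%x. c_basic (f x))"
 "computable f ==> computable g ==> computable (%x. c_call (f x) (g x))"
 "computable f ==> computable g ==> computable (%x. c_comp2 E (f x) (g x))"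
 "computable f ==> computable g ==> computable (%x. c_rec2 (f x) (g x))"
 unfolding c_comp2_def c_rec2_def c_basic_def c_call_def by (intro computable_more; assumption)+

lemmas computable_fms = computable_more computable_numerals computable_combinators

text \<open>Lists are combined as in \<open>tuple_fm\<close>, so the value of a tree as a list is
  the code of a tuple formula.\<close>

abbreviation c_tuple :: "(tree => tree => tree) => tree => tree" where
 "c_tuple nd \<equiv> translate (code_fm (basic zero)) (c_comp2 E_pair) nd"

lemma c_tuple:
 "(\<And>a. a \<in> set as ==> node_val (c_tuple nd (f a)) = code_fm (h a)) ==>
 list_val (c_tuple nd (list_tree (map f as))) = code_fm (tuple_fm (map h as))"
 by (induction as) simp_all

definition prd_node :: "tree => tree => tree" where
 "prd_node x m = select (left x)
  [code_fm (prd_fm Succ), c_basic (c_numeral (arg 1 x)), c_basic (node 2 [code_fnl (FC ProjK), c_Lpow (arg 1 x)]),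
  c_comp2 E_comp (node_val (nth_memo 1 m)) (list_val (nth_memo 2 m)),
  c_rec2 (c_basic (c_numeral (arg 0 x))) (node_val (nth_memo 1 m)),
  c_rec2 (node_val (nth_memo 0 m)) (node_val (nth_memo 1 m))]"

definition c_prd :: "tree => tree" where "c_prd x = node_val (c_tuple prd_node x)"

lemma c_prd [simp]: "c_prd (code_prd d) = code_fm (prd_fm d)"
proof -
 have "node_val (c_tuple prd_node (code_prd d)) = code_fm (prd_fm d)"
 proof (induction d)
  case (Comp n g hs)
  have "list_val (c_tuple prd_node (list_tree (map code_prd hs))) = code_fm (tuple_fm (map prd_fm hs))"
   by (rule c_tuple) (rule Comp.IH(2))
  thus ?case using Comp.IH(1) by (simp add: prd_node_def[of "node k as" for k as] nth_memo_translate[of _ "[_, _, _]"] del: nth_memo.simps list_tree.simps)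
 qed (simp_all add: prd_node_def[of "node k as" for k as] del: nth_memo.simps list_tree.simps)
 thus ?thesis by (simp add: c_prd_def)
qed

lemma computable2_comp2: "computable2 (c_comp2 E)"
 unfolding computable2_def by (intro computable_fms)

lemma computable_prd: "computable f ==> computable (%x. c_prd (f x))"
proof -
 have "computable2 prd_node" unfolding computable2_def prd_node_def by (intro computable_fms)
 thus "computable f ==> computable (%x. c_prd (f x))"
  unfolding c_prd_def by (intro computable_fms computable_translate computable2_comp2)
qed

definition c_fsym :: "tree => tree" where
 "c_fsym x = select (left x)
  [code_fm (fsym_fm Zero), code_fm (fsym_fm ZeroFn), code_fm (fsym_fm Ident), code_fm (fsym_fm PairJ),
  code_fm (fsym_fm ProjK), code_fm (fsym_fm ProjL), c_prd (arg 0 x)]"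

lemma c_fsym [simp]: "c_fsym (code_fsym c) = code_fm (fsym_fm c)"
 by (cases c) (simp_all add: c_fsym_def)

definition trm_node :: "tree => tree => tree" where
 "trm_node x m = select (left x)
  [c_basic (node 2 [code_fnl (FC ProjK), c_Lpow (arg 0 x)]),
  c_comp2 E_comp (c_fsym (arg 0 x)) (list_val (nth_memo 1 m)),
  c_comp2 E_app (node_val (nth_memo 0 m)) (node_val (nth_memo 1 m)),
  c_comp2 E_app (c_rec2 (node_val (nth_memo 0 m)) (c_comp2 E_step (node_val (nth_memo 1 m)) (code_fm (prd_fm pr_pair))))
   (node_val (nth_memo 2 m)),
  c_basic (node 2 [code_fnl (FVar 1), node 1 [code_fsym PairJ, list_tree [c_numeral (arg 0 x), code_trm (projK (Var 0))]]]),
  c_comp2 E_comp (c_fsym (arg 0 x)) (code_fm (basic (pairJ (projK (Var 0)) zero))),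
  node_val (nth_memo 0 m)]"

definition c_trm :: "tree => tree" where "c_trm x = node_val (c_tuple trm_node x)"

lemma c_trm [simp]: "c_trm (code_trm t) = code_fm (trm_fm t)"
proof -
 have "node_val (c_tuple trm_node (code_trm t)) = code_fm (trm_fm t)"
  and "node_val (c_tuple trm_node (code_fnl u)) = code_fm (fnl_fm u)" for u
 proof (induction t and u)
  case (Fn c ts)
  have "list_val (c_tuple trm_node (list_tree (map code_trm ts))) = code_fm (tuple_fm (map trm_fm ts))"
   by (rule c_tuple) (rule Fn.IH)
  thus ?case by (simp add: trm_node_def[of "node k as" for k as] nth_memo_translate[of _ "[_, _]"] del: nth_memo.simps list_tree.simps)
 qed (simp_all add: trm_node_def[of "node k as" for k as] del: nth_memo.simps list_tree.simps)
 thus ?thesis by (simp add: c_trm_def)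
qed

lemma computable_fsym: "computable f ==> computable (%x. c_fsym (f x))"
 unfolding c_fsym_def by (intro computable_fms computable_prd)

lemma computable_trm: "computable f ==> computable (%x. c_trm (f x))"
proof -
 have "computable2 trm_node" unfolding computable2_def trm_node_def by (intro computable_fms computable_fsym)
 thus "computable f ==> computable (%x. c_trm (f x))"
  unfolding c_trm_def by (intro computable_fms computable_translate computable2_comp2)
qed

definition c_atom :: "tree => tree => tree => tree" where
 "c_atom s t M = node 8 [node 2 [c_bindF M, node 8 [c_call s (c_call t
  (node 0 [node 2 [code_fnl (FVar 2), c_venv M], node 2 [code_fnl (FVar 0), c_venv M]]))]]]"

lemma c_atom: "c_atom (code_fm (trm_fm s)) (code_fm (trm_fm t)) (num_tree M) = code_fm (atom_fm s t M)"
 by (simp add: c_atom_def atom_fm_def)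

subsection \<open>Recognizing the terms of BIM\<close>

text \<open>\<open>Leaf\<close> stands for yes. In the last entry the tag of the description is
  returned, which is \<open>Leaf\<close> only for \<open>Succ\<close>, the one description that
  belongs to BIM.\<close>

definition bim_sym_test :: "tree => tree" where
 "bim_sym_test x = select (left x) [Leaf, Leaf, Leaf, Leaf, Leaf, Leaf, left (arg 0 x)]"

definition both :: "tree => tree => tree" where "both x y = (if x = Leaf then y else Branch Leaf Leaf)"

lemma both_Leaf [simp]: "both x y = Leaf <-> x = Leaf \<and> y = Leaf" by (simp add: both_def)

definition bim_node :: "tree => tree => tree" where
 "bim_node x m = select (left x) [Leaf, both (bim_sym_test (arg 0 x)) (list_val (nth_memo 1 m)),
  both (node_val (nth_memo 0 m)) (node_val (nth_memo 1 m)), Branch Leaf Leaf, Leaf, bim_sym_test (arg 0 x), Branch Leaf Leaf]"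

definition bim_test :: "tree => tree" where "bim_test x = node_val (translate Leaf both bim_node x)"

lemma bim_sym_test: "bim_sym_test (code_fsym c) = Leaf <-> Sym c \<in> bim_language"
proof (cases c)
 case (PR d)
 have "left (code_prd d) = Leaf <-> d = Succ" by (cases d) (simp_all add: numeral_eq_Suc)
 thus ?thesis using PR by (auto simp: bim_sym_test_def bim_language_def)
qed (simp_all add: bim_sym_test_def bim_language_def)

text \<open>Only the symbols have to be tested: the arities are correct in every term of the joint
  language.\<close>

lemma bim_test: "t \<in> terms joint_language ==> bim_test (code_trm t) = Leaf <-> t \<in> terms bim_language"
proof -
 have l: "LamSym \<notin> bim_language" "RecSym \<notin> bim_language" by (auto simp: bim_language_def)
 have "t \<in> terms joint_language ==> node_val (translate Leaf both bim_node (code_trm t)) = Leaf <-> t \<in> terms bim_language"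
  and "u \<in> functors joint_language ==> node_val (translate Leaf both bim_node (code_fnl u)) = Leaf <-> u \<in> functors bim_language" for u
 proof (induction t and u)
  case (Fn c ts)
  have ts: "has_arity c (length ts)" "length ts \<noteq> 1" "\<And>t. t \<in> set ts ==> t \<in> terms joint_language" using Fn.prems by auto
  have "list_val (translate Leaf both bim_node (list_tree (map code_trm ss))) = Leaf <-> (\<forall>t\<in>set ss. t \<in> terms bim_language)" if "set ss \<subseteq> set ts" for ss
   using that by (induction ss) (use Fn.IH ts(3) in auto)
  thus ?case using ts by (simp add: Ball_def bim_node_def[of "node k as" for k as] bim_sym_test nth_memo_translate[of _ "[_, _]"] del: nth_memo.simps list_tree.simps)
 qed (simp_all add: bim_node_def[of "node k as" for k as] bim_sym_test l del: nth_memo.simps list_tree.simps)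
 thus "t \<in> terms joint_language ==> bim_test (code_trm t) = Leaf <-> t \<in> terms bim_language" by (simp add: bim_test_def)
qed

lemma computable_both: "computable f ==> computable g ==> computable (%x. both (f x) (g x))"
 unfolding both_def by (intro computable_fms)

lemma computable_bim_test: "computable f ==> computable (%x. bim_test (f x))"
proof -
 have "computable2 bim_node" unfolding computable2_def bim_node_def bim_sym_test_def by (intro computable_fms computable_both)
 moreover have "computable2 both" unfolding computable2_def by (intro computable_both computable_fms)
 ultimately show "computable f ==> computable (%x. bim_test (f x))"
  unfolding bim_test_def by (intro computable_fms computable_translate)
qed

subsection \<open>Translations of formulas\<close>

definition fm_node :: "(tree => tree) => tree => tree => tree" where
 "fm_node at x m = (let a = node_val (nth_memo 0 m); b = node_val (nth_memo 1 m) in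
  select (left x) [at x, x, node 2 [a, b], node 3 [a, b], node 4 [a, b], node 5 [a], node 6 [a], node 7 [a], node 8 [a]])"

definition homomorphic :: "(fm => fm) => bool" where
 "homomorphic tr <-> tr Bot = Bot \<and> (\<forall>A B. tr (And A B) = And (tr A) (tr B) \<and> tr (Or A B) = Or (tr A) (tr B) \<and> tr (Imp A B) = Imp (tr A) (tr B)) \<and>
  (\<forall>A. tr (AllN A) = AllN (tr A) \<and> tr (ExN A) = ExN (tr A) \<and> tr (AllF A) = AllF (tr A) \<and> tr (ExF A) = ExF (tr A))"

text \<open>A translation that commutes with the logical operations is determined by its values at
  equations, so computing these suffices.\<close>

lemma effective_homomorphic:
 assumes "computable at" and at: "\<And>s t. s \<in> terms L ==> t \<in> terms L ==> code_fm (tr (Eq s t)) = at (code_fm (Eq s t))"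
  and tr: "homomorphic tr"
 shows "effective_on (formulas L) tr"
 unfolding effective_on_def
proof (intro exI conjI ballI)
 let ?f = "%x. node_val (translate Leaf Branch (fm_node at) x)"
 have "computable2 (fm_node at)" unfolding computable2_def fm_node_def Let_def
  by (intro computable_comp[OF assms(1)] computable_fms)
 moreover have "computable2 Branch" unfolding computable2_def by (intro computable_fms)
 ultimately show "computable ?f" by (intro computable_fms computable_translate)
 fix A assume "A \<in> formulas L"
 thus "code_fm (tr A) = ?f (code_fm A)"
 proof induction
  case (1 s t)
  thus ?case by (simp add: at fm_node_def[of at "node k as" for k as] Let_def)
 qed (use tr in \<open>simp_all add: homomorphic_def fm_node_def[of at "node k as" for k as] Let_def del: nth_memo.simps list_tree.simps\<close>)
qed

lemma homomorphic_bim_fm: "homomorphic bim_fm" and homomorphic_el_fm: "homomorphic el_fm"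
 by (simp_all add: homomorphic_def)

lemma homomorphic_commutes: "homomorphic tr ==> commutes_with_logic X tr"
 by (auto simp: homomorphic_def commutes_with_logic_def)

lemma effective_bim_fm: "effective_on (formulas joint_language) bim_fm"
proof (rule effective_homomorphic[OF _ _ homomorphic_bim_fm])
 let ?a = "%x. c_atom (c_trm (arg 0 x)) (c_trm (arg 1 x)) (c_tsize x)"
 let ?at = "%x. if bim_test (arg 0 x) = Leaf then if bim_test (arg 1 x) = Leaf then x else ?a x else ?a x"
 show "computable ?at" unfolding c_atom_def by (intro computable_fms computable_trm computable_bim_test)
 fix s t assume st: "s \<in> terms joint_language" "t \<in> terms joint_language"
 have a: "arg 0 (code_fm (Eq s t)) = code_trm s" "arg 1 (code_fm (Eq s t)) = code_trm t" by simp_all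
 show "code_fm (bim_fm (Eq s t)) = ?at (code_fm (Eq s t))"
  unfolding a c_trm c_tsize c_atom bim_test[OF st(1)] bim_test[OF st(2)] by simp
qed

definition el_sym_code :: "tree => tree" where
 "el_sym_code x = select (left x) [x, code_fsym (el_sym ZeroFn), code_fsym (el_sym Ident), code_fsym (el_sym PairJ), code_fsym (el_sym ProjK),
  code_fsym (el_sym ProjL), x]"

lemma el_sym_code: "el_sym_code (code_fsym c) = code_fsym (el_sym c)"
 by (cases c) (simp_all add: el_sym_code_def)

definition el_trm_node :: "tree => tree => tree" where
 "el_trm_node x m = select (left x) [x, node 1 [el_sym_code (arg 0 x), list_val (nth_memo 1 m)],
  node 2 [node_val (nth_memo 0 m), node_val (nth_memo 1 m)],
  node 3 [node_val (nth_memo 0 m), node_val (nth_memo 1 m), node_val (nth_memo 2 m)],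
  x, node 5 [el_sym_code (arg 0 x)], node 6 [node_val (nth_memo 0 m)]]"

lemma el_trm_code: "node_val (translate Leaf Branch el_trm_node (code_trm t)) = code_trm (el_trm t)"
 and el_fnl_code: "node_val (translate Leaf Branch el_trm_node (code_fnl u)) = code_fnl (el_fnl u)"
proof (induction t and u)
 case (Fn c ts)
 have "list_val (translate Leaf Branch el_trm_node (list_tree (map code_trm ss))) = list_tree (map code_trm (map el_trm ss))" if "set ss \<subseteq> set ts" for ss
  using that by (induction ss) (use Fn.IH in auto)
 thus ?case by (simp add: el_trm_node_def[of "node k as" for k as] el_sym_code nth_memo_translate[of _ "[_, _]"] del: nth_memo.simps list_tree.simps)
qed (simp_all add: el_trm_node_def[of "node k as" for k as] el_sym_code del: nth_memo.simps list_tree.simps)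

lemma effective_el_fm: "effective_on (formulas joint_language) el_fm"
proof (rule effective_homomorphic[OF _ _ homomorphic_el_fm])
 let ?t = "%x. node_val (translate Leaf Branch el_trm_node x)"
 have "computable2 el_trm_node" unfolding computable2_def el_trm_node_def el_sym_code_def by (intro computable_fms)
 moreover have "computable2 Branch" unfolding computable2_def by (intro computable_fms)
 ultimately show "computable (%x. node 0 [?t (arg 0 x), ?t (arg 1 x)])" by (intro computable_fms computable_translate)
qed (simp add: el_trm_code)

section \<open>Comparison of the joint system with BIM and EL\<close>

lemma deriv_joint_BIM: "deriv (BIM \<oplus>\<^sub>a C) Ga A ==> deriv (joint \<oplus>\<^sub>a C) Ga A"
proof (erule deriv_extend)
 show "lang (BIM \<oplus>\<^sub>a C) \<subseteq> lang (joint \<oplus>\<^sub>a C)" by (simp add: joint_sub)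
 have "formulas bim_language \<subseteq> formulas joint_language" by (rule joint_formulas)
 thus "deriv (joint \<oplus>\<^sub>a C) {} B" if "B \<in> axs (BIM \<oplus>\<^sub>a C)" "B \<in> fmls (BIM \<oplus>\<^sub>a C)" for B
  using that by (intro deriv.Axiom) (auto simp: BIM_def joint_def equality_axioms_def induction_axioms_def)
qed

lemma deriv_joint_EL: "deriv EL Ga A ==> deriv (joint \<oplus>\<^sub>a C) Ga A"
proof (erule deriv_extend)
 show "lang EL \<subseteq> lang (joint \<oplus>\<^sub>a C)" by (simp add: joint_sub)
 have fm: "A \<in> formulas ha1_language ==> A \<in> formulas joint_language"
  and tr: "t \<in> terms ha1_language ==> t \<in> terms joint_language"
  and fu: "u \<in> functors ha1_language ==> u \<in> functors joint_language" for A t u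
  using joint_formulas(2) terms_mono[OF _ joint_sub(2)] functors_mono[OF _ joint_sub(2)] by blast+
 have "equality_axioms ha1_language \<subseteq> equality_axioms joint_language" "induction_axioms ha1_language \<subseteq> induction_axioms joint_language"
  "qf_ac00 ha1_language \<subseteq> qf_ac00 joint_language"
  unfolding equality_axioms_def induction_axioms_def qf_ac00_def by (auto dest: fm)
 moreover have "lambda_axioms ha1_language \<subseteq> lambda_axioms joint_language" unfolding lambda_axioms_def by (auto dest: tr)
 moreover have "recursor_axioms ha1_language \<subseteq> recursor_axioms joint_language"
  unfolding recursor_axioms_def by (rule Un_mono) (auto intro: tr fu)
 ultimately have "axs EL \<subseteq> axs (joint \<oplus>\<^sub>a C) \<union> qf_ac00 (lang (joint \<oplus>\<^sub>a C))" unfolding EL_def HA1_def joint_def by auto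
 hence ax: "B \<in> axs (joint \<oplus>\<^sub>a C) \<or> B \<in> qf_ac00 (lang (joint \<oplus>\<^sub>a C))" if "B \<in> axs EL" for B using that by blast
 show "deriv (joint \<oplus>\<^sub>a C) {} B" if "B \<in> axs EL" "B \<in> fmls EL" for B
  using ax[OF that(1)] fm that(2) by (auto intro: deriv.Axiom J.qf_ac00_derivable simp del: axs_add)
qed

lemma cantor_formulas: "cantor_pairing_axioms \<subseteq> formulas bim_language"
 by (auto simp: cantor_pairing_axioms_def)

lemma joint_over_BIM:
 assumes C: "C \<subseteq> formulas bim_language"
 shows "conservative_extension (joint \<oplus>\<^sub>a C) (BIM \<oplus>\<^sub>a C)" "definitional_extension (joint \<oplus>\<^sub>a C) (BIM \<oplus>\<^sub>a C)"
proof -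
 have cons: "deriv (BIM \<oplus>\<^sub>a C) {} E" if "E \<in> formulas bim_language" "deriv (joint \<oplus>\<^sub>a C) {} E" for E
  using bim_fm_deriv[OF C that(2)] bim_fm_id[OF that(1)] by simp
 show "conservative_extension (joint \<oplus>\<^sub>a C) (BIM \<oplus>\<^sub>a C)"
  unfolding conservative_extension_def using cons deriv_joint_BIM joint_sub by auto
 show "definitional_extension (joint \<oplus>\<^sub>a C) (BIM \<oplus>\<^sub>a C)"
  unfolding definitional_extension_def extension_def
 proof (intro conjI exI[of _ bim_fm])
  show "commutes_with_logic (fmls (joint \<oplus>\<^sub>a C)) bim_fm" by (rule homomorphic_commutes[OF homomorphic_bim_fm])
  show "\<forall>Ga E. Ga \<subseteq> fmls (joint \<oplus>\<^sub>a C) --> E \<in> fmls (joint \<oplus>\<^sub>a C) --> deriv (joint \<oplus>\<^sub>a C) Ga E --> deriv (BIM \<oplus>\<^sub>a C) (bim_fm ` Ga) (bim_fm E)"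
   using bim_fm_deriv[OF C] by blast
 qed (use deriv_joint_BIM joint_sub effective_bim_fm bim_fm_id joint_bim_fm_Iff in auto)
qed

text \<open>Conservativity holds with and without the Cantor equations, as \<open>el_fm\<close>
  fixes the formulas of EL. The definitional extension also demands that \<open>el_fm A\<close> and
  \<open>A\<close> be provably equivalent, and for this the equations are added.\<close>

lemma joint_over_EL:
 "conservative_extension (joint \<oplus>\<^sub>a cantor_pairing_axioms) EL" "definitional_extension (joint \<oplus>\<^sub>a cantor_pairing_axioms) EL"
 "conservative_extension joint EL"
proof -
 let ?C = cantor_pairing_axioms
 have cons: "deriv EL {} E" if "E \<in> formulas ha1_language" "deriv (joint \<oplus>\<^sub>a ?C) {} E" for E
  using joint_EL[OF that(2)] el_fm_id[OF that(1)] by simp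
 show c: "conservative_extension (joint \<oplus>\<^sub>a ?C) EL"
  unfolding conservative_extension_def using cons deriv_joint_EL joint_sub by auto
 show "definitional_extension (joint \<oplus>\<^sub>a ?C) EL"
  unfolding definitional_extension_def extension_def
 proof (intro conjI exI[of _ el_fm])
  show "commutes_with_logic (fmls (joint \<oplus>\<^sub>a ?C)) el_fm" by (rule homomorphic_commutes[OF homomorphic_el_fm])
  show "\<forall>Ga E. Ga \<subseteq> fmls (joint \<oplus>\<^sub>a ?C) --> E \<in> fmls (joint \<oplus>\<^sub>a ?C) --> deriv (joint \<oplus>\<^sub>a ?C) Ga E --> deriv EL (el_fm ` Ga) (el_fm E)"
   using joint_EL by blast
 qed (use deriv_joint_EL joint_sub effective_el_fm el_fm_id el_fm_formulas joint_tm_Iff in auto)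
 have "joint \<oplus>\<^sub>a {} = joint" by (simp add: add_axioms_def)
 thus "conservative_extension joint EL"
  unfolding conservative_extension_def using deriv_joint_EL[of "{}" _ "{}"] joint_EL[of "{}" "{}"] el_fm_id joint_sub
  by (metis empty_subsetI image_empty lang_axs(2,3))
qed

theorem theorem8p2:
  "\<exists>S. conservative_extension S BIM \<and> definitional_extension S BIM \<and>
       conservative_extension S EL \<and>
       conservative_extension (S \<oplus>\<^sub>a cantor_pairing_axioms) (BIM \<oplus>\<^sub>a cantor_pairing_axioms) \<and>
       definitional_extension (S \<oplus>\<^sub>a cantor_pairing_axioms) (BIM \<oplus>\<^sub>a cantor_pairing_axioms) \<and>
       conservative_extension (S \<oplus>\<^sub>a cantor_pairing_axioms) EL \<and>
       definitional_extension (S \<oplus>\<^sub>a cantor_pairing_axioms) EL"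
proof (intro exI[of _ joint] conjI joint_over_EL joint_over_BIM cantor_formulas)
 have e: "joint \<oplus>\<^sub>a {} = joint" "BIM \<oplus>\<^sub>a {} = BIM" by (simp_all add: add_axioms_def)
 show "conservative_extension joint BIM" "definitional_extension joint BIM" using joint_over_BIM[of "{}", unfolded e] by simp_all
qed

end
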